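(* The square of categories and functors $$\begin{array}{ccc}\mathsf{OpCat}&\xrightarrow{\ \mathrm{N}_{\mathrm{opd}}\ }&\mathsf{TopPs}^{\mathrm{fr+sh}}\\ {\scriptstyle\mathrm{forget}}\downarrow&&\downarrow{\scriptstyle\mathsf{u}^*}\\ \mathsf{Cat}_{\ell t}&\xrightarrow{\ \mathsf{S}\mathrm{N}_{\ell t}\ }&[(\boldsymbol\Delta^{\mathsf t})^{\mathrm{op}},\mathsf{SMGp}]\end{array}$$ is a strict pullback of categories. Explicitly, the square commutes strictly and the induced functor is an isomorphism from $\mathsf{OpCat}$ to the category whose objects are pairs $(X,\mathcal{C})$ with $X\in\mathsf{TopPs}^{\mathrm{fr+sh}}$, $\mathcal{C}\in\mathsf{Cat}_{\ell t}$ and $\mathsf{u}^*X=\mathsf{S}\mathrm{N}_{\ell t}\mathcal{C}$ (strict equality), and whose morphisms $(X,\mathcal{C})\to(X',\mathcal{C}')$ are pairs $(F,f)$ of a morphism $F:X\to X'$ and a morphism $f:\mathcal{C}\to\mathcal{C}'$ with $\mathsf{u}^*(F)=\mathsf{S}\mathrm{N}_{\ell t}(f)$.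
   Context: FINITE ORDINALS. $\mathbb{F}$ is the category with objects $\underline n=\{1<\dots<n\}$ ($n\ge 0$) and all set maps as morphisms. For $g:\underline n\to\underline k$ and $i\in\underline k$, $g^{-1}(i)$ denotes the object of $\mathbb{F}$ with the cardinality of $\{j\in\underline n: g(j)=i\}$, and $\epsilon_{g,i}:g^{-1}(i)\to\underline n$ the unique order-preserving injection with image $\{j: g(j)=i\}$. For $f:\underline m\to\underline n$, $f^g_i:(gf)^{-1}(i)\to g^{-1}(i)$ is the unique map with $\epsilon_{g,i}f^g_i=f\epsilon_{gf,i}$. $\pi_g:\underline n\to\sum_{i=1}^k g^{-1}(i)$ (ordinal sum) is the bijection whose inverse restricts to $\epsilon_{g,i}$ on the $i$-th summand. OPERADIC CATEGORY. An operadic category is a small category $\mathbb{O}$ with: (D1) a chosen terminal object in each connected component (chosen local terminals); $\tau_R:R\to U_R$ denotes the unique map to the chosen terminal of the component of $R$; (D2) a cardinality functor $|\cdot|:\mathbb{O}\to\mathbb{F}$; (D3) for each object $R$ and $i\in|R|$ a fibre functor $\varphi_{R,i}:\mathbb{O}/R\to\mathbb{O}$, written $(g:S\to R)\mapsto g^{-1}(i)$ on objects and $(f:gf\to g)\mapsto (f^g_i:(gf)^{-1}(i)\to g^{-1}(i))$ on morphisms. Axioms: (A1) if $R$ is a local terminal then $|R|=\underline 1$; (A2) $(\mathrm{id}_R)^{-1}(i)$ is a chosen local terminal for all $R$, $i\in|R|$; (A3) $|g^{-1}(i)|=|g|^{-1}(i)$ and $|f^g_i|=|f|^{|g|}_i$;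 (A4) $\tau_R^{-1}(1)=R$, and for $g:S\to R$ the fibre map of $g$ with respect to $\tau_R$ at $1$ is $g$; (A5) for $T\xrightarrow{f}S\xrightarrow{g}R$, $i\in|R|$, $j\in|g|^{-1}(i)$ and $\epsilon j:=\epsilon_{|g|,i}(j)$, one has $(f^g_i)^{-1}(j)=f^{-1}(\epsilon j)$, and for any further $h:Q\to T$, $(h^{gf}_i)^{f^g_i}_j=h^f_{\epsilon j}$. A strict operadic functor is a functor strictly commuting with cardinality functors and strictly preserving chosen local terminals, fibres and fibre maps. $\mathsf{OpCat}$ is the category of operadic categories and strict operadic functors. $\mathsf{Cat}_{\ell t}$ is the category of small categories with chosen local terminals and functors preserving them. SYMMETRIC MONOIDAL GROUPOID MONAD. For a groupoid (or set) $A$, $\mathsf{S}A$ is the free symmetric strict monoidal groupoid on $A$: objects are finite lists in $A$; a morphism $(x_i)_{i\in\underline n}\to(y_i)_{i\in\underline n}$ is a permutation $\rho$ of $\underline n$ with arrows $x_i\to y_{\rho i}$ in $A$ (so for a set $A$: a permutation with $x_i=y_{\rho i}$). The monoidal product is concatenation; elements of $A$, as one-element lists, are the monoidal generators. $\mathsf{S}$ is applied levelwise to presheaves. $\mathsf{SMGp}$ is the category of symmetric strict monoidal groupoids and symmetric strict monoidal functors. LOCAL-TERMINALS NERVE. $\boldsymbol\Delta^{\mathsf t}$ is the category of nonempty finite ordinals and top-element-preserving order-preserving maps. A presheaf $A$ on it is a top-split augmented simplicial object: objects $A_r$, $r\ge-1$, faces $d_0,\dots,d_r:A_r\to A_{r-1}$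 ($r\ge0$), degeneracies $s_0,\dots,s_{r+1}:A_r\to A_{r+1}$ ($r\ge-1$), satisfying the simplicial identities. For $\mathcal{C}\in\mathsf{Cat}_{\ell t}$, $\mathrm{N}_{\ell t}(\mathcal{C})$ is the set-valued such presheaf with $\mathrm{N}_{\ell t}(\mathcal{C})_{-1}=\pi_0(\mathcal{C})$ (connected components), underlying simplicial set the ordinary nerve, $d_0$ in degree $0$ sending an object to its component, $s_0$ in degree $-1$ sending a component to its chosen terminal object, and $s_{r+1}$ in degree $r\ge0$ appending to a chain the unique map from its last object to the chosen terminal of its component. TOP-PSEUDO-SIMPLICIAL OBJECTS. A top-pseudo-simplicial symmetric strict monoidal groupoid $X$ consists of symmetric strict monoidal groupoids $X_r$ ($r\ge0$), symmetric strict monoidal functors $d_i:X_r\to X_{r-1}$ and $s_i:X_r\to X_{r+1}$ ($0\le i\le r$) strictly satisfying all simplicial identities except those equating $d_{r+1}d_{r+1}$ with $d_{r+1}d_{r+2}:X_{r+2}\to X_r$, for which there are instead invertible monoidal transformations $\beta_r:d_{r+1}d_{r+1}\Rightarrow d_{r+1}d_{r+2}$ ($r\ge0$), subject to, for all $r\ge0$: (a) $(d_{r+1}\beta_{r+1})\circ(\beta_r d_{r+2})=(\beta_r d_{r+3})\circ(\beta_r d_{r+1})$ as $2$-cells between functors $X_{r+3}\to X_r$; (b) $d_i\beta_{r+1}=\beta_r d_i$ for $0\le i\le r$; (c) $\beta_r s_{r+1}=\mathrm{id}$; (d) $\beta_{r+1}s_i=s_i\beta_r$ for $0\le i\le r$.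 Morphisms are families of symmetric strict monoidal functors $X_r\to X'_r$ commuting strictly with all $d_i,s_i$ and strictly preserving the $\beta_r$; this gives the category $\mathsf{TopPs}$. $\mathsf{u}^*X$ is the top-split augmented simplicial symmetric monoidal groupoid with $(\mathsf{u}^*X)_r=X_{r+1}$ ($r\ge-1$), obtained by discarding all top face operators $d_r:X_r\to X_{r-1}$ (and the $\beta_r$). LEVELWISE FREE AND SHUFFLE. $X$ is levelwise free when each $X_r$ is $\mathsf{S}$ of a set. For such $X$ and a generator $\sigma\in X_{r+2}$ let $d_{r+2}(\sigma)=(p_1,\dots,p_k)$, let $n_i$ be the length of $d_{r+1}(p_i)$ and $n$ the length of $d_{r+1}d_{r+1}(\sigma)$. Then $\beta_r(\sigma)$ has an underlying bijection $\underline n\to\sum_{i=1}^k\underline{n_i}$. The shuffle condition: for all $r\ge0$ and all such $\sigma$, the inverse $\sum_i\underline{n_i}\to\underline n$ is order-preserving on each summand. $\mathsf{TopPs}^{\mathrm{fr+sh}}\subset\mathsf{TopPs}$ is the full subcategory of levelwise free objects satisfying the shuffle condition. OPERADIC NERVE. For an operadic category $\mathbb{O}$, with $\mathbb{O}_m$ the set of chains of $m$ composable morphisms: $\mathrm{N}_{\mathrm{opd}}(\mathbb{O})_0=\mathsf{S}\pi_0(\mathbb{O})$ and $\mathrm{N}_{\mathrm{opd}}(\mathbb{O})_r=\mathsf{S}\mathbb{O}_{r-1}$ for $r\ge1$; a generator in degree $r\ge 1$ is written $p=(T_r\to\cdots\to T_1)$. The operators $d_i$ ($0\le i\le r-1$)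 and $s_i$ ($0\le i\le r$) in degree $r$ are those of $\mathsf{S}\mathrm{N}_{\ell t}(\mathbb{O})$ (so $d_i$ omits and $s_i$ repeats $T_{r-i}$, and $s_r$ appends $T_1\to U_{T_1}$). The top face operator is the symmetric strict monoidal functor given on generators by: $d_1(T)$ is the list over $i\in|T|$ of the components of $(\mathrm{id}_T)^{-1}(i)$; for $r\ge2$, $d_r(p)=(p_1,\dots,p_k)$, $k=|T_1|$, where $p_i=(h_{r-1}^{-1}(i)\to\cdots\to h_1^{-1}(i))$ is the chain of fibre maps over $i$, with $h_j:T_{j+1}\to T_1$ the composite. $\beta_r$ at a generator $(T_{r+2}\to\cdots\to T_2\xrightarrow{f_1}T_1)$ has underlying bijection $\pi_{|f_1|}:|T_2|\to\sum_{i\in|T_1|}|f_1|^{-1}(i)$. On a strict operadic functor, $\mathrm{N}_{\mathrm{opd}}$ is $\mathsf{S}$ of the induced maps on components and chains. *)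

theory Defs
  imports "HOL-Library.FuncSet" "HOL-Combinatorics.Permutations"
begin

section \<open>Categories and functors\<close>

text \<open>Categories, functors and all further structures are compared by strict equality, so every
  operation is required to be \<^const>\<open>undefined\<close> outside its domain of definition.\<close>

record ('o, 'a) cat =
  Obj :: "'o set"
  Arr :: "'a set"
  Dom :: "'a \<Rightarrow> 'o"
  Cod :: "'a \<Rightarrow> 'o"
  Ident :: "'o \<Rightarrow> 'a"
  Comp :: "'a \<Rightarrow> 'a \<Rightarrow> 'a"

definition hom :: "('o, 'a) cat \<Rightarrow> 'o \<Rightarrow> 'o \<Rightarrow> 'a set" where
  "hom C x y = {f \<in> Arr C. Dom C f = x \<and> Cod C f = y}"

definition composable :: "('o, 'a) cat \<Rightarrow> 'a \<Rightarrow> 'a \<Rightarrow> bool" where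
  "composable C g f \<longleftrightarrow> g \<in> Arr C \<and> f \<in> Arr C \<and> Dom C g = Cod C f"

definition category :: "('o, 'a) cat \<Rightarrow> bool" where
  "category C \<longleftrightarrow>
     Dom C \<in> Arr C \<rightarrow>\<^sub>E Obj C \<and> Cod C \<in> Arr C \<rightarrow>\<^sub>E Obj C \<and>
     Ident C \<in> Obj C \<rightarrow>\<^sub>E Arr C \<and>
     (\<forall>x \<in> Obj C. Ident C x \<in> hom C x x) \<and>
     (\<forall>g f. if composable C g f then Comp C g f \<in> hom C (Dom C f) (Cod C g)
            else Comp C g f = undefined) \<and>
     (\<forall>f \<in> Arr C. Comp C f (Ident C (Dom C f)) = f \<and> Comp C (Ident C (Cod C f)) f = f) \<and>
     (\<forall>h g f. composable C h g \<and> composable C g f \<longrightarrow>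
        Comp C h (Comp C g f) = Comp C (Comp C h g) f)"

definition groupoid :: "('o, 'a) cat \<Rightarrow> bool" where
  "groupoid C \<longleftrightarrow> category C \<and>
     (\<forall>f \<in> Arr C. \<exists>g \<in> hom C (Cod C f) (Dom C f).
        Comp C g f = Ident C (Dom C f) \<and> Comp C f g = Ident C (Cod C f))"

definition ext_cat ::
  "'o set \<Rightarrow> 'a set \<Rightarrow> ('a \<Rightarrow> 'o) \<Rightarrow> ('a \<Rightarrow> 'o) \<Rightarrow> ('o \<Rightarrow> 'a) \<Rightarrow> ('a \<Rightarrow> 'a \<Rightarrow> 'a) \<Rightarrow> ('o, 'a) cat" where
  "ext_cat Os As d c i m =
     \<lparr>Obj = Os, Arr = As, Dom = restrict d As, Cod = restrict c As, Ident = restrict i Os,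
      Comp = (\<lambda>g f. if g \<in> As \<and> f \<in> As \<and> d g = c f then m g f else undefined)\<rparr>"

text \<open>A category of structures: an arrow is a triple (source, underlying map, target), and the
  composite of underlying maps may depend on the source (to restrict it to the source's carrier).\<close>

definition mk_cat ::
  "'x set \<Rightarrow> ('x \<Rightarrow> 'x \<Rightarrow> 'f set) \<Rightarrow> ('x \<Rightarrow> 'f) \<Rightarrow> ('x \<Rightarrow> 'f \<Rightarrow> 'f \<Rightarrow> 'f) \<Rightarrow> ('x, 'x \<times> 'f \<times> 'x) cat" where
  "mk_cat Os H i m =
     ext_cat Os {(X, f, Y). X \<in> Os \<and> Y \<in> Os \<and> f \<in> H X Y}
       fst (\<lambda>u. snd (snd u)) (\<lambda>X. (X, i X, X))
       (\<lambda>(Y, g, Z) (X, f, Y'). (X, m X g f, Z))"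

abbreviation mor :: "'x \<times> 'f \<times> 'z \<Rightarrow> 'f" where
  "mor u \<equiv> fst (snd u)"

record ('o, 'a, 'p, 'b) fctr =
  fo :: "'o \<Rightarrow> 'p"
  fa :: "'a \<Rightarrow> 'b"

definition is_fctr :: "('o, 'a) cat \<Rightarrow> ('p, 'b) cat \<Rightarrow> ('o, 'a, 'p, 'b) fctr \<Rightarrow> bool" where
  "is_fctr C D F \<longleftrightarrow>
     fo F \<in> Obj C \<rightarrow>\<^sub>E Obj D \<and> fa F \<in> Arr C \<rightarrow>\<^sub>E Arr D \<and>
     (\<forall>f \<in> Arr C. Dom D (fa F f) = fo F (Dom C f) \<and> Cod D (fa F f) = fo F (Cod C f)) \<and>
     (\<forall>x \<in> Obj C. fa F (Ident C x) = Ident D (fo F x)) \<and>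
     (\<forall>g f. composable C g f \<longrightarrow> fa F (Comp C g f) = Comp D (fa F g) (fa F f))"

definition mk_fctr :: "('o, 'a) cat \<Rightarrow> ('o \<Rightarrow> 'p) \<Rightarrow> ('a \<Rightarrow> 'b) \<Rightarrow> ('o, 'a, 'p, 'b) fctr" where
  "mk_fctr C a b = \<lparr>fo = restrict a (Obj C), fa = restrict b (Arr C)\<rparr>"

definition fid :: "('o, 'a) cat \<Rightarrow> ('o, 'a, 'o, 'a) fctr" where
  "fid C = mk_fctr C (\<lambda>x. x) (\<lambda>f. f)"

definition fcomp ::
  "('o, 'a) cat \<Rightarrow> ('p, 'b, 'q, 'c) fctr \<Rightarrow> ('o, 'a, 'p, 'b) fctr \<Rightarrow> ('o, 'a, 'q, 'c) fctr" where
  "fcomp C G F = mk_fctr C (\<lambda>x. fo G (fo F x)) (\<lambda>f. fa G (fa F f))"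

definition restr_fctr :: "('o, 'a) cat \<Rightarrow> ('o, 'a, 'p, 'b) fctr \<Rightarrow> ('o, 'a, 'p, 'b) fctr" where
  "restr_fctr C F = mk_fctr C (fo F) (fa F)"

definition cat_iso :: "('o, 'a) cat \<Rightarrow> ('p, 'b) cat \<Rightarrow> ('o, 'a, 'p, 'b) fctr \<Rightarrow> bool" where
  "cat_iso C D F \<longleftrightarrow> is_fctr C D F \<and>
     (\<exists>G. is_fctr D C G \<and> fcomp C G F = fid C \<and> fcomp D F G = fid D)"

definition full_subcat :: "('o, 'a) cat \<Rightarrow> 'o set \<Rightarrow> ('o, 'a) cat" where
  "full_subcat C S =
     ext_cat (Obj C \<inter> S) {f \<in> Arr C. Dom C f \<in> S \<and> Cod C f \<in> S} (Dom C) (Cod C) (Ident C) (Comp C)"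

definition prod_cat :: "('o, 'a) cat \<Rightarrow> ('p, 'b) cat \<Rightarrow> ('o \<times> 'p, 'a \<times> 'b) cat" where
  "prod_cat C D =
     ext_cat (Obj C \<times> Obj D) (Arr C \<times> Arr D)
       (map_prod (Dom C) (Dom D)) (map_prod (Cod C) (Cod D)) (map_prod (Ident C) (Ident D))
       (\<lambda>(g, g') (f, f'). (Comp C g f, Comp D g' f'))"

text \<open>The slice over \<open>R\<close>: the pair \<open>(f, g)\<close> is the arrow \<open>f : g f \<rightarrow> g\<close>.\<close>

definition slice :: "('o, 'a) cat \<Rightarrow> 'o \<Rightarrow> ('a, 'a \<times> 'a) cat" where
  "slice C R =
     ext_cat {g \<in> Arr C. Cod C g = R} {(f, g). composable C g f \<and> Cod C g = R}
       (\<lambda>(f, g). Comp C g f) snd (\<lambda>g. (Ident C (Dom C g), g))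
       (\<lambda>(f', g') (f, g). (Comp C f' f, g'))"

definition pullback_cat ::
  "('o, 'a) cat \<Rightarrow> ('p, 'b) cat \<Rightarrow> ('o, 'a, 'q, 'c) fctr \<Rightarrow> ('p, 'b, 'q, 'c) fctr
   \<Rightarrow> ('o \<times> 'p, 'a \<times> 'b) cat" where
  "pullback_cat A B F G =
     ext_cat {(x, y). x \<in> Obj A \<and> y \<in> Obj B \<and> fo F x = fo G y}
       {(f, g). f \<in> Arr A \<and> g \<in> Arr B \<and> fa F f = fa G g}
       (map_prod (Dom A) (Dom B)) (map_prod (Cod A) (Cod B)) (map_prod (Ident A) (Ident B))
       (\<lambda>(g, g') (f, f'). (Comp A g f, Comp B g' f'))"

definition pairing ::
  "('s, 't) cat \<Rightarrow> ('s, 't, 'o, 'a) fctr \<Rightarrow> ('s, 't, 'p, 'b) fctr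
   \<Rightarrow> ('s, 't, 'o \<times> 'p, 'a \<times> 'b) fctr" where
  "pairing P p q = mk_fctr P (\<lambda>x. (fo p x, fo q x)) (\<lambda>f. (fa p f, fa q f))"

text \<open>Strict pullback of the cospan \<open>A \<rightarrow> D \<leftarrow> B\<close> (functors \<open>F\<close>, \<open>G\<close>) with projections
  \<open>p : P \<rightarrow> A\<close> and \<open>q : P \<rightarrow> B\<close>.\<close>

definition strict_pullback ::
  "('s, 't) cat \<Rightarrow> ('o, 'a) cat \<Rightarrow> ('p, 'b) cat \<Rightarrow> ('q, 'c) cat
   \<Rightarrow> ('s, 't, 'o, 'a) fctr \<Rightarrow> ('s, 't, 'p, 'b) fctr
   \<Rightarrow> ('o, 'a, 'q, 'c) fctr \<Rightarrow> ('p, 'b, 'q, 'c) fctr \<Rightarrow> bool" where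
  "strict_pullback P A B D p q F G \<longleftrightarrow>
     category P \<and> category A \<and> category B \<and> category D \<and>
     is_fctr P A p \<and> is_fctr P B q \<and> is_fctr A D F \<and> is_fctr B D G \<and>
     fcomp P F p = fcomp P G q \<and>
     cat_iso P (pullback_cat A B F G) (pairing P p q)"


section \<open>Finite ordinals\<close>

text \<open>The ordinal with \<open>n\<close> elements is represented as \<open>{0, \<dots>, n - 1}\<close>; all indices of fibres and of
  positions in lists start at 0.\<close>

type_synonym fmap = "nat \<times> (nat \<Rightarrow> nat) \<times> nat"

definition FinOrd :: "(nat, fmap) cat" where
  "FinOrd = mk_cat UNIV (\<lambda>m n. {..<m} \<rightarrow>\<^sub>E {..<n}) (\<lambda>n. \<lambda>j\<in>{..<n}. j) (\<lambda>m g f. compose {..<m} g f)"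

definition fin_preimage :: "fmap \<Rightarrow> nat \<Rightarrow> nat set" where
  "fin_preimage g i = {j. j < Dom FinOrd g \<and> mor g j = i}"

definition fin_fib :: "fmap \<Rightarrow> nat \<Rightarrow> nat" where
  "fin_fib g i = card (fin_preimage g i)"

definition fin_eps :: "fmap \<Rightarrow> nat \<Rightarrow> nat \<Rightarrow> nat" where
  "fin_eps g i a = sorted_list_of_set (fin_preimage g i) ! a"

definition fin_fibmap :: "fmap \<Rightarrow> fmap \<Rightarrow> nat \<Rightarrow> fmap" where
  "fin_fibmap f g i =
     (fin_fib (Comp FinOrd g f) i,
      (\<lambda>a\<in>{..<fin_fib (Comp FinOrd g f) i}.
         THE b. b < fin_fib g i \<and> fin_eps g i b = mor f (fin_eps (Comp FinOrd g f) i a)),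
      fin_fib g i)"

text \<open>The bijection \<open>\<pi>\<^sub>g\<close>, as a permutation of the positions \<open>0, \<dots>, n - 1\<close>.\<close>

definition fin_pi :: "fmap \<Rightarrow> nat \<Rightarrow> nat" where
  "fin_pi g =
     (THE p. p permutes {..<Dom FinOrd g} \<and>
        (\<forall>i < Cod FinOrd g. \<forall>a < fin_fib g i. inv p ((\<Sum>i'<i. fin_fib g i') + a) = fin_eps g i a))"


section \<open>Categories with chosen local terminals\<close>

definition cpt :: "('o, 'm) cat \<Rightarrow> 'o \<Rightarrow> 'o set" where
  "cpt C x = {y. equivclp (\<lambda>a b. hom C a b \<noteq> {}) x y}"

definition pi0 :: "('o, 'm) cat \<Rightarrow> 'o set set" where
  "pi0 C = cpt C ` Obj C"

definition pi0_map :: "('p, 'n) cat \<Rightarrow> ('o, 'm, 'p, 'n) fctr \<Rightarrow> 'o set \<Rightarrow> 'p set" where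
  "pi0_map D F c = (THE d. d \<in> pi0 D \<and> fo F ` c \<subseteq> d)"

definition local_terminal :: "('o, 'm) cat \<Rightarrow> 'o \<Rightarrow> bool" where
  "local_terminal C u \<longleftrightarrow> u \<in> Obj C \<and> (\<forall>x \<in> cpt C u. \<exists>!f. f \<in> hom C x u)"

record ('o, 'm) ltcat =
  Base :: "('o, 'm) cat"
  Lt :: "'o set \<Rightarrow> 'o"

definition is_ltcat :: "('o, 'm) ltcat \<Rightarrow> bool" where
  "is_ltcat C \<longleftrightarrow> category (Base C) \<and> Lt C \<in> extensional (pi0 (Base C)) \<and>
     (\<forall>c \<in> pi0 (Base C). Lt C c \<in> c \<and> local_terminal (Base C) (Lt C c))"

definition chosen :: "('o, 'm) ltcat \<Rightarrow> 'o set" where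
  "chosen C = Lt C ` pi0 (Base C)"

definition tau :: "('o, 'm) ltcat \<Rightarrow> 'o \<Rightarrow> 'm" where
  "tau C x = (THE f. f \<in> hom (Base C) x (Lt C (cpt (Base C) x)))"

definition lt_fctr :: "('o, 'm) ltcat \<Rightarrow> ('p, 'n) ltcat \<Rightarrow> ('o, 'm, 'p, 'n) fctr \<Rightarrow> bool" where
  "lt_fctr C D F \<longleftrightarrow> is_fctr (Base C) (Base D) F \<and> fo F ` chosen C \<subseteq> chosen D"

definition CatLt ::
  "(('o, 'm) ltcat, ('o, 'm) ltcat \<times> ('o, 'm, 'o, 'm) fctr \<times> ('o, 'm) ltcat) cat" where
  "CatLt = mk_cat {C. is_ltcat C} (\<lambda>C D. {F. lt_fctr C D F})
             (\<lambda>C. fid (Base C)) (\<lambda>C G F. fcomp (Base C) G F)"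


section \<open>Operadic categories\<close>

record ('o, 'm) opcat =
  Und :: "('o, 'm) ltcat"
  Crd :: "('o, 'm, nat, fmap) fctr"
  Fib :: "'o \<Rightarrow> nat \<Rightarrow> ('m, 'm \<times> 'm, 'o, 'm) fctr"

abbreviation OBase :: "('o, 'm) opcat \<Rightarrow> ('o, 'm) cat" where
  "OBase P \<equiv> Base (Und P)"

definition fib_obj :: "('o, 'm) opcat \<Rightarrow> 'm \<Rightarrow> nat \<Rightarrow> 'o" where
  "fib_obj P g i = fo (Fib P (Cod (OBase P) g) i) g"

definition fib_map :: "('o, 'm) opcat \<Rightarrow> 'm \<Rightarrow> 'm \<Rightarrow> nat \<Rightarrow> 'm" where
  "fib_map P f g i = fa (Fib P (Cod (OBase P) g) i) (f, g)"

definition is_opcat :: "('o, 'm) opcat \<Rightarrow> bool" where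
  "is_opcat P \<longleftrightarrow>
     is_ltcat (Und P) \<and>
     is_fctr (OBase P) FinOrd (Crd P) \<and>
     (\<forall>R i. if R \<in> Obj (OBase P) \<and> i < fo (Crd P) R
            then is_fctr (slice (OBase P) R) (OBase P) (Fib P R i)
            else Fib P R i = undefined) \<and>
     (\<forall>R. local_terminal (OBase P) R \<longrightarrow> fo (Crd P) R = 1) \<and>
     (\<forall>R \<in> Obj (OBase P). \<forall>i < fo (Crd P) R. fib_obj P (Ident (OBase P) R) i \<in> chosen (Und P)) \<and>
     (\<forall>g \<in> Arr (OBase P). \<forall>i < fo (Crd P) (Cod (OBase P) g).
        fo (Crd P) (fib_obj P g i) = fin_fib (fa (Crd P) g) i) \<and>
     (\<forall>g f. composable (OBase P) g f \<longrightarrow> (\<forall>i < fo (Crd P) (Cod (OBase P) g).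
        fa (Crd P) (fib_map P f g i) = fin_fibmap (fa (Crd P) f) (fa (Crd P) g) i)) \<and>
     (\<forall>R \<in> Obj (OBase P). fib_obj P (tau (Und P) R) 0 = R) \<and>
     (\<forall>g \<in> Arr (OBase P). fib_map P g (tau (Und P) (Cod (OBase P) g)) 0 = g) \<and>
     (\<forall>g f. composable (OBase P) g f \<longrightarrow>
        (\<forall>i < fo (Crd P) (Cod (OBase P) g). \<forall>j < fin_fib (fa (Crd P) g) i.
           fib_obj P (fib_map P f g i) j = fib_obj P f (fin_eps (fa (Crd P) g) i j) \<and>
           (\<forall>h. composable (OBase P) f h \<longrightarrow>
              fib_map P (fib_map P h (Comp (OBase P) g f) i) (fib_map P f g i) j
              = fib_map P h f (fin_eps (fa (Crd P) g) i j))))"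

definition op_fctr :: "('o, 'm) opcat \<Rightarrow> ('p, 'n) opcat \<Rightarrow> ('o, 'm, 'p, 'n) fctr \<Rightarrow> bool" where
  "op_fctr P Q F \<longleftrightarrow>
     lt_fctr (Und P) (Und Q) F \<and>
     fcomp (OBase P) (Crd Q) F = Crd P \<and>
     (\<forall>g \<in> Arr (OBase P). \<forall>i < fo (Crd P) (Cod (OBase P) g).
        fo F (fib_obj P g i) = fib_obj Q (fa F g) i) \<and>
     (\<forall>g f. composable (OBase P) g f \<longrightarrow> (\<forall>i < fo (Crd P) (Cod (OBase P) g).
        fa F (fib_map P f g i) = fib_map Q (fa F f) (fa F g) i))"

definition OpCat ::
  "(('o, 'm) opcat, ('o, 'm) opcat \<times> ('o, 'm, 'o, 'm) fctr \<times> ('o, 'm) opcat) cat" where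
  "OpCat = mk_cat {P. is_opcat P} (\<lambda>P Q. {F. op_fctr P Q F})
             (\<lambda>P. fid (OBase P)) (\<lambda>P G F. fcomp (OBase P) G F)"

definition Forget ::
  "(('o, 'm) opcat, ('o, 'm) opcat \<times> ('o, 'm, 'o, 'm) fctr \<times> ('o, 'm) opcat,
    ('o, 'm) ltcat, ('o, 'm) ltcat \<times> ('o, 'm, 'o, 'm) fctr \<times> ('o, 'm) ltcat) fctr" where
  "Forget = mk_fctr OpCat Und (\<lambda>(P, F, Q). (Und P, F, Und Q))"


section \<open>Symmetric strict monoidal groupoids\<close>

record ('x, 'y) smg =
  Gpd :: "('x, 'y) cat"
  Unit :: 'x
  Tens :: "('x \<times> 'x, 'y \<times> 'y, 'x, 'y) fctr"
  Sym :: "'x \<times> 'x \<Rightarrow> 'y"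

abbreviation tob :: "('x, 'y) smg \<Rightarrow> 'x \<Rightarrow> 'x \<Rightarrow> 'x" where
  "tob M x y \<equiv> fo (Tens M) (x, y)"

abbreviation tar :: "('x, 'y) smg \<Rightarrow> 'y \<Rightarrow> 'y \<Rightarrow> 'y" where
  "tar M f g \<equiv> fa (Tens M) (f, g)"

definition is_smg :: "('x, 'y) smg \<Rightarrow> bool" where
  "is_smg M \<longleftrightarrow>
     groupoid (Gpd M) \<and>
     is_fctr (prod_cat (Gpd M) (Gpd M)) (Gpd M) (Tens M) \<and>
     Unit M \<in> Obj (Gpd M) \<and>
     (\<forall>x \<in> Obj (Gpd M). tob M (Unit M) x = x \<and> tob M x (Unit M) = x) \<and>
     (\<forall>x \<in> Obj (Gpd M). \<forall>y \<in> Obj (Gpd M). \<forall>z \<in> Obj (Gpd M).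
        tob M (tob M x y) z = tob M x (tob M y z)) \<and>
     (\<forall>f \<in> Arr (Gpd M). tar M (Ident (Gpd M) (Unit M)) f = f \<and> tar M f (Ident (Gpd M) (Unit M)) = f) \<and>
     (\<forall>f \<in> Arr (Gpd M). \<forall>g \<in> Arr (Gpd M). \<forall>h \<in> Arr (Gpd M).
        tar M (tar M f g) h = tar M f (tar M g h)) \<and>
     Sym M \<in> Obj (Gpd M) \<times> Obj (Gpd M) \<rightarrow>\<^sub>E Arr (Gpd M) \<and>
     (\<forall>x \<in> Obj (Gpd M). \<forall>y \<in> Obj (Gpd M). Sym M (x, y) \<in> hom (Gpd M) (tob M x y) (tob M y x)) \<and>
     (\<forall>f \<in> Arr (Gpd M). \<forall>g \<in> Arr (Gpd M).
        Comp (Gpd M) (Sym M (Cod (Gpd M) f, Cod (Gpd M) g)) (tar M f g)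
        = Comp (Gpd M) (tar M g f) (Sym M (Dom (Gpd M) f, Dom (Gpd M) g))) \<and>
     (\<forall>x \<in> Obj (Gpd M). \<forall>y \<in> Obj (Gpd M).
        Comp (Gpd M) (Sym M (y, x)) (Sym M (x, y)) = Ident (Gpd M) (tob M x y)) \<and>
     (\<forall>x \<in> Obj (Gpd M). \<forall>y \<in> Obj (Gpd M). \<forall>z \<in> Obj (Gpd M).
        Sym M (x, tob M y z)
        = Comp (Gpd M) (tar M (Ident (Gpd M) y) (Sym M (x, z)))
            (tar M (Sym M (x, y)) (Ident (Gpd M) z)))"

definition mon_fctr :: "('x, 'y) smg \<Rightarrow> ('u, 'v) smg \<Rightarrow> ('x, 'y, 'u, 'v) fctr \<Rightarrow> bool" where
  "mon_fctr M N F \<longleftrightarrow>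
     is_fctr (Gpd M) (Gpd N) F \<and>
     fo F (Unit M) = Unit N \<and>
     (\<forall>x \<in> Obj (Gpd M). \<forall>y \<in> Obj (Gpd M). fo F (tob M x y) = tob N (fo F x) (fo F y)) \<and>
     (\<forall>f \<in> Arr (Gpd M). \<forall>g \<in> Arr (Gpd M). fa F (tar M f g) = tar N (fa F f) (fa F g)) \<and>
     (\<forall>x \<in> Obj (Gpd M). \<forall>y \<in> Obj (Gpd M). fa F (Sym M (x, y)) = Sym N (fo F x, fo F y))"

text \<open>Monoidal transformations; they are automatically invertible because the target is a groupoid.\<close>

definition mon_trans ::
  "('x, 'y) smg \<Rightarrow> ('u, 'v) smg \<Rightarrow> ('x, 'y, 'u, 'v) fctr \<Rightarrow> ('x, 'y, 'u, 'v) fctr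
   \<Rightarrow> ('x \<Rightarrow> 'v) \<Rightarrow> bool" where
  "mon_trans M N F G b \<longleftrightarrow>
     b \<in> Obj (Gpd M) \<rightarrow>\<^sub>E Arr (Gpd N) \<and>
     (\<forall>x \<in> Obj (Gpd M). b x \<in> hom (Gpd N) (fo F x) (fo G x)) \<and>
     (\<forall>f \<in> Arr (Gpd M). Comp (Gpd N) (b (Cod (Gpd M) f)) (fa F f)
        = Comp (Gpd N) (fa G f) (b (Dom (Gpd M) f))) \<and>
     b (Unit M) = Ident (Gpd N) (Unit N) \<and>
     (\<forall>x \<in> Obj (Gpd M). \<forall>y \<in> Obj (Gpd M). b (tob M x y) = tar N (b x) (b y))"

type_synonym ('x, 'y) smg_arr = "('x, 'y) smg \<times> ('x, 'y, 'x, 'y) fctr \<times> ('x, 'y) smg"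

definition SMGp :: "(('x, 'y) smg, ('x, 'y) smg_arr) cat" where
  "SMGp = mk_cat {M. is_smg M} (\<lambda>M N. {F. mon_fctr M N F})
            (\<lambda>M. fid (Gpd M)) (\<lambda>M G F. fcomp (Gpd M) G F)"


section \<open>The free symmetric strict monoidal groupoid on a set\<close>

definition SetCat :: "('g set, 'g set \<times> ('g \<Rightarrow> 'g) \<times> 'g set) cat" where
  "SetCat = mk_cat UNIV (\<lambda>A B. A \<rightarrow>\<^sub>E B) (\<lambda>A. \<lambda>x\<in>A. x) (\<lambda>A g f. compose A g f)"

text \<open>An arrow of the free groupoid is a triple \<open>(xs, \<rho>, ys)\<close>; the permutation \<open>\<rho>\<close> of the positions
  of \<open>xs\<close> is the identity outside them, as for \<^const>\<open>permutes\<close>.\<close>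

type_synonym 'g sarr = "'g list \<times> (nat \<Rightarrow> nat) \<times> 'g list"

definition perm_cat :: "'g set \<Rightarrow> ('g list, 'g sarr) cat" where
  "perm_cat A = mk_cat (lists A)
     (\<lambda>xs ys. {\<rho>. length xs = length ys \<and> \<rho> permutes {..<length xs} \<and>
                  (\<forall>i < length xs. xs ! i = ys ! \<rho> i)})
     (\<lambda>xs i. i) (\<lambda>xs \<tau> \<rho>. \<tau> \<circ> \<rho>)"

definition perm_sum :: "nat \<Rightarrow> (nat \<Rightarrow> nat) \<Rightarrow> (nat \<Rightarrow> nat) \<Rightarrow> nat \<Rightarrow> nat" where
  "perm_sum n \<rho> \<tau> i = (if i < n then \<rho> i else n + \<tau> (i - n))"

definition block_swap :: "nat \<Rightarrow> nat \<Rightarrow> nat \<Rightarrow> nat" where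
  "block_swap m n i = (if i < m then n + i else if i < m + n then i - m else i)"

definition SS :: "'g set \<Rightarrow> ('g list, 'g sarr) smg" where
  "SS A =
     \<lparr>Gpd = perm_cat A,
      Unit = [],
      Tens = mk_fctr (prod_cat (perm_cat A) (perm_cat A))
        (\<lambda>(xs, xs'). xs @ xs')
        (\<lambda>((xs, \<rho>, ys), (xs', \<rho>', ys')). (xs @ xs', perm_sum (length xs) \<rho> \<rho>', ys @ ys')),
      Sym = (\<lambda>(xs, ys)\<in>lists A \<times> lists A.
        (xs @ ys, block_swap (length xs) (length ys), ys @ xs))\<rparr>"

definition SS_map :: "'g set \<Rightarrow> ('g \<Rightarrow> 'h) \<Rightarrow> ('g list, 'g sarr, 'h list, 'h sarr) fctr" where
  "SS_map A f = mk_fctr (perm_cat A) (map f) (\<lambda>(xs, \<rho>, ys). (map f xs, \<rho>, map f ys))"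

definition SFctr ::
  "('g set, 'g set \<times> ('g \<Rightarrow> 'g) \<times> 'g set,
    ('g list, 'g sarr) smg, ('g list, 'g sarr) smg_arr) fctr" where
  "SFctr = mk_fctr SetCat SS (\<lambda>(A, f, B). (SS A, SS_map A f, SS B))"

text \<open>The symmetric strict monoidal functor out of a free groupoid with prescribed values on the
  monoidal generators.\<close>

definition free_ext ::
  "'g set \<Rightarrow> ('x, 'y) smg \<Rightarrow> ('g \<Rightarrow> 'x) \<Rightarrow> ('g list, 'g sarr, 'x, 'y) fctr" where
  "free_ext A M \<phi> = (THE F. mon_fctr (SS A) M F \<and> (\<forall>a \<in> A. fo F [a] = \<phi> a))"


section \<open>Top-split augmented simplicial objects\<close>

text \<open>The level called \<open>n\<close> here has simplicial degree \<open>r = n - 1 \<ge> -1\<close>: the faces \<open>d\<^sub>0, \<dots>, d\<^sub>r\<close> out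
  of it are \<open>TD A n i\<close> for \<open>i < n\<close>, and the degeneracies \<open>s\<^sub>0, \<dots>, s\<^sub>r\<^sub>+\<^sub>1\<close> are \<open>TS A n i\<close> for \<open>i \<le> n\<close>.\<close>

record ('o, 'a) tsplit =
  TLev :: "nat \<Rightarrow> 'o"
  TD :: "nat \<Rightarrow> nat \<Rightarrow> 'a"
  TS :: "nat \<Rightarrow> nat \<Rightarrow> 'a"

definition is_tsplit :: "('o, 'a) cat \<Rightarrow> ('o, 'a) tsplit \<Rightarrow> bool" where
  "is_tsplit E A \<longleftrightarrow>
     (\<forall>n. TLev A n \<in> Obj E) \<and>
     (\<forall>n i. if i < n then TD A n i \<in> hom E (TLev A n) (TLev A (n - 1)) else TD A n i = undefined) \<and>
     (\<forall>n i. if i \<le> n then TS A n i \<in> hom E (TLev A n) (TLev A (n + 1)) else TS A n i = undefined) \<and>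
     (\<forall>n i j. i < j \<and> j < n \<longrightarrow>
        Comp E (TD A (n - 1) i) (TD A n j) = Comp E (TD A (n - 1) (j - 1)) (TD A n i)) \<and>
     (\<forall>n i j. i \<le> j \<and> j \<le> n \<longrightarrow>
        Comp E (TS A (n + 1) i) (TS A n j) = Comp E (TS A (n + 1) (j + 1)) (TS A n i)) \<and>
     (\<forall>n i j. i < j \<and> j \<le> n \<longrightarrow>
        Comp E (TD A (n + 1) i) (TS A n j) = Comp E (TS A (n - 1) (j - 1)) (TD A n i)) \<and>
     (\<forall>n i j. (i = j \<or> i = j + 1) \<and> i < n + 1 \<longrightarrow>
        Comp E (TD A (n + 1) i) (TS A n j) = Ident E (TLev A n)) \<and>
     (\<forall>n i j. j + 1 < i \<and> i < n + 1 \<longrightarrow>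
        Comp E (TD A (n + 1) i) (TS A n j) = Comp E (TS A (n - 1) j) (TD A n (i - 1)))"

definition tsplit_map ::
  "('o, 'a) cat \<Rightarrow> ('o, 'a) tsplit \<Rightarrow> ('o, 'a) tsplit \<Rightarrow> (nat \<Rightarrow> 'a) \<Rightarrow> bool" where
  "tsplit_map E A B h \<longleftrightarrow>
     (\<forall>n. h n \<in> hom E (TLev A n) (TLev B n)) \<and>
     (\<forall>n i. i < n \<longrightarrow> Comp E (h (n - 1)) (TD A n i) = Comp E (TD B n i) (h n)) \<and>
     (\<forall>n i. i \<le> n \<longrightarrow> Comp E (h (n + 1)) (TS A n i) = Comp E (TS B n i) (h n))"

type_synonym ('o, 'a) tsplit_arr = "('o, 'a) tsplit \<times> (nat \<Rightarrow> 'a) \<times> ('o, 'a) tsplit"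

definition TSplit :: "('o, 'a) cat \<Rightarrow> (('o, 'a) tsplit, ('o, 'a) tsplit_arr) cat" where
  "TSplit E = mk_cat {A. is_tsplit E A} (\<lambda>A B. {h. tsplit_map E A B h})
                (\<lambda>A n. Ident E (TLev A n)) (\<lambda>A g f n. Comp E (g n) (f n))"

definition tsplit_app :: "('o, 'a, 'p, 'b) fctr \<Rightarrow> ('o, 'a) tsplit \<Rightarrow> ('p, 'b) tsplit" where
  "tsplit_app F A =
     \<lparr>TLev = (\<lambda>n. fo F (TLev A n)),
      TD = (\<lambda>n i. if i < n then fa F (TD A n i) else undefined),
      TS = (\<lambda>n i. if i \<le> n then fa F (TS A n i) else undefined)\<rparr>"

definition levelwise ::
  "('o, 'a) cat \<Rightarrow> ('o, 'a, 'p, 'b) fctr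
   \<Rightarrow> (('o, 'a) tsplit, ('o, 'a) tsplit_arr, ('p, 'b) tsplit, ('p, 'b) tsplit_arr) fctr" where
  "levelwise E F = mk_fctr (TSplit E) (tsplit_app F)
     (\<lambda>(A, h, B). (tsplit_app F A, (\<lambda>n. fa F (h n)), tsplit_app F B))"


section \<open>The local-terminals nerve\<close>

text \<open>\<open>Chain x [f\<^sub>1, \<dots>, f\<^sub>m]\<close> is the chain of \<open>m\<close> composable morphisms with first object \<open>x = dom f\<^sub>1\<close>,
  so that \<open>Chain x []\<close> is the object \<open>x\<close>. In the notation \<open>T\<^sub>r \<rightarrow> \<dots> \<rightarrow> T\<^sub>1\<close>, \<open>x = T\<^sub>r\<close> and \<open>m = r - 1\<close>.\<close>

datatype ('o, 'm) cell = Cpt "'o set" | Chain 'o "'m list"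

primrec is_path :: "('o, 'm) cat \<Rightarrow> 'o \<Rightarrow> 'm list \<Rightarrow> bool" where
  "is_path C x [] \<longleftrightarrow> x \<in> Obj C"
| "is_path C x (f # fs) \<longleftrightarrow> f \<in> Arr C \<and> Dom C f = x \<and> is_path C (Cod C f) fs"

definition vertex :: "('o, 'm) cat \<Rightarrow> 'o \<Rightarrow> 'm list \<Rightarrow> nat \<Rightarrow> 'o" where
  "vertex C x fs i = (if i = 0 then x else Cod C (fs ! (i - 1)))"

definition cells :: "('o, 'm) cat \<Rightarrow> nat \<Rightarrow> ('o, 'm) cell set" where
  "cells C n = (if n = 0 then Cpt ` pi0 C else {Chain x fs | x fs. is_path C x fs \<and> length fs = n - 1})"

primrec cell_face :: "('o, 'm) ltcat \<Rightarrow> nat \<Rightarrow> ('o, 'm) cell \<Rightarrow> ('o, 'm) cell" where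
  "cell_face C i (Cpt c) = undefined"
| "cell_face C i (Chain x fs) =
     (if fs = [] then Cpt (cpt (Base C) x)
      else if i = 0 then Chain (Cod (Base C) (hd fs)) (tl fs)
      else if i = length fs then Chain x (butlast fs)
      else Chain x (take (i - 1) fs @ Comp (Base C) (fs ! i) (fs ! (i - 1)) # drop (i + 1) fs))"

primrec cell_degen :: "('o, 'm) ltcat \<Rightarrow> nat \<Rightarrow> ('o, 'm) cell \<Rightarrow> ('o, 'm) cell" where
  "cell_degen C i (Cpt c) = Chain (Lt C c) []"
| "cell_degen C i (Chain x fs) =
     (if i \<le> length fs
      then Chain x (take i fs @ Ident (Base C) (vertex (Base C) x fs i) # drop i fs)
      else Chain x (fs @ [tau C (vertex (Base C) x fs (length fs))]))"

primrec cell_map :: "('p, 'n) cat \<Rightarrow> ('o, 'm, 'p, 'n) fctr \<Rightarrow> ('o, 'm) cell \<Rightarrow> ('p, 'n) cell" where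
  "cell_map D F (Cpt c) = Cpt (pi0_map D F c)"
| "cell_map D F (Chain x fs) = Chain (fo F x) (map (fa F) fs)"

type_synonym ('o, 'm) cell_fun =
  "('o, 'm) cell set \<times> (('o, 'm) cell \<Rightarrow> ('o, 'm) cell) \<times> ('o, 'm) cell set"

definition nlt_obj :: "('o, 'm) ltcat \<Rightarrow> (('o, 'm) cell set, ('o, 'm) cell_fun) tsplit" where
  "nlt_obj C =
     \<lparr>TLev = cells (Base C),
      TD = (\<lambda>n i. if i < n
              then (cells (Base C) n, restrict (cell_face C i) (cells (Base C) n), cells (Base C) (n - 1))
              else undefined),
      TS = (\<lambda>n i. if i \<le> n
              then (cells (Base C) n, restrict (cell_degen C i) (cells (Base C) n), cells (Base C) (n + 1))
              else undefined)\<rparr>"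

definition nlt_map ::
  "('o, 'm) ltcat \<Rightarrow> ('o, 'm) ltcat \<Rightarrow> ('o, 'm, 'o, 'm) fctr \<Rightarrow> nat \<Rightarrow> ('o, 'm) cell_fun" where
  "nlt_map C D F n =
     (cells (Base C) n, restrict (cell_map (Base D) F) (cells (Base C) n), cells (Base D) n)"

definition Nlt ::
  "(('o, 'm) ltcat, ('o, 'm) ltcat \<times> ('o, 'm, 'o, 'm) fctr \<times> ('o, 'm) ltcat,
    (('o, 'm) cell set, ('o, 'm) cell_fun) tsplit,
    (('o, 'm) cell set, ('o, 'm) cell_fun) tsplit_arr) fctr" where
  "Nlt = mk_fctr CatLt nlt_obj (\<lambda>(C, F, D). (nlt_obj C, nlt_map C D F, nlt_obj D))"

type_synonym ('o, 'm) cell_smg = "(('o, 'm) cell list, ('o, 'm) cell sarr) smg"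
type_synonym ('o, 'm) cell_smg_arr = "(('o, 'm) cell list, ('o, 'm) cell sarr) smg_arr"

definition SNlt ::
  "(('o, 'm) ltcat, ('o, 'm) ltcat \<times> ('o, 'm, 'o, 'm) fctr \<times> ('o, 'm) ltcat,
    (('o, 'm) cell_smg, ('o, 'm) cell_smg_arr) tsplit,
    (('o, 'm) cell_smg, ('o, 'm) cell_smg_arr) tsplit_arr) fctr" where
  "SNlt = fcomp CatLt (levelwise SetCat SFctr) Nlt"


section \<open>Top-pseudo-simplicial symmetric strict monoidal groupoids\<close>

text \<open>Here level \<open>n\<close> is simplicial degree \<open>n\<close>. \<open>PB X r\<close> gives the components of \<open>\<beta>\<^sub>r\<close>.\<close>

record ('x, 'y) topps =
  PLev :: "nat \<Rightarrow> ('x, 'y) smg"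
  PD :: "nat \<Rightarrow> nat \<Rightarrow> ('x, 'y) smg_arr"
  PS :: "nat \<Rightarrow> nat \<Rightarrow> ('x, 'y) smg_arr"
  PB :: "nat \<Rightarrow> 'x \<Rightarrow> 'y"

abbreviation PObj :: "('x, 'y) topps \<Rightarrow> nat \<Rightarrow> 'x set" where
  "PObj X n \<equiv> Obj (Gpd (PLev X n))"

definition is_topps :: "('x, 'y) topps \<Rightarrow> bool" where
  "is_topps X \<longleftrightarrow>
     (\<forall>n. PLev X n \<in> Obj SMGp) \<and>
     (\<forall>n i. if 1 \<le> n \<and> i \<le> n then PD X n i \<in> hom SMGp (PLev X n) (PLev X (n - 1))
            else PD X n i = undefined) \<and>
     (\<forall>n i. if i \<le> n then PS X n i \<in> hom SMGp (PLev X n) (PLev X (n + 1))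
            else PS X n i = undefined) \<and>
     (\<forall>r i j. i < j \<and> j \<le> r + 2 \<and> \<not> (i = r + 1 \<and> j = r + 2) \<longrightarrow>
        Comp SMGp (PD X (r + 1) i) (PD X (r + 2) j) = Comp SMGp (PD X (r + 1) (j - 1)) (PD X (r + 2) i)) \<and>
     (\<forall>n i j. i \<le> j \<and> j \<le> n \<longrightarrow>
        Comp SMGp (PS X (n + 1) i) (PS X n j) = Comp SMGp (PS X (n + 1) (j + 1)) (PS X n i)) \<and>
     (\<forall>n i j. i < j \<and> j \<le> n \<longrightarrow>
        Comp SMGp (PD X (n + 1) i) (PS X n j) = Comp SMGp (PS X (n - 1) (j - 1)) (PD X n i)) \<and>
     (\<forall>n i j. (i = j \<or> i = j + 1) \<and> j \<le> n \<longrightarrow>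
        Comp SMGp (PD X (n + 1) i) (PS X n j) = Ident SMGp (PLev X n)) \<and>
     (\<forall>n i j. j + 1 < i \<and> i \<le> n + 1 \<longrightarrow>
        Comp SMGp (PD X (n + 1) i) (PS X n j) = Comp SMGp (PS X (n - 1) j) (PD X n (i - 1))) \<and>
     (\<forall>r. mon_trans (PLev X (r + 2)) (PLev X r)
        (mor (Comp SMGp (PD X (r + 1) (r + 1)) (PD X (r + 2) (r + 1))))
        (mor (Comp SMGp (PD X (r + 1) (r + 1)) (PD X (r + 2) (r + 2))))
        (PB X r)) \<and>
     (\<forall>r. \<forall>x \<in> PObj X (r + 3).
        Comp (Gpd (PLev X r))
          (fa (mor (PD X (r + 1) (r + 1))) (PB X (r + 1) x))
          (PB X r (fo (mor (PD X (r + 3) (r + 2))) x))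
        = Comp (Gpd (PLev X r))
          (PB X r (fo (mor (PD X (r + 3) (r + 3))) x))
          (PB X r (fo (mor (PD X (r + 3) (r + 1))) x))) \<and>
     (\<forall>r. \<forall>i \<le> r. \<forall>x \<in> PObj X (r + 3).
        fa (mor (PD X (r + 1) i)) (PB X (r + 1) x) = PB X r (fo (mor (PD X (r + 3) i)) x)) \<and>
     (\<forall>r. \<forall>x \<in> PObj X (r + 1).
        PB X r (fo (mor (PS X (r + 1) (r + 1))) x)
        = Ident (Gpd (PLev X r)) (fo (mor (PD X (r + 1) (r + 1))) x)) \<and>
     (\<forall>r. \<forall>i \<le> r. \<forall>x \<in> PObj X (r + 2).
        PB X (r + 1) (fo (mor (PS X (r + 2) i)) x) = fa (mor (PS X r i)) (PB X r x))"

definition topps_map ::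
  "('x, 'y) topps \<Rightarrow> ('x, 'y) topps \<Rightarrow> (nat \<Rightarrow> ('x, 'y) smg_arr) \<Rightarrow> bool" where
  "topps_map X Y h \<longleftrightarrow>
     (\<forall>n. h n \<in> hom SMGp (PLev X n) (PLev Y n)) \<and>
     (\<forall>n i. 1 \<le> n \<and> i \<le> n \<longrightarrow> Comp SMGp (h (n - 1)) (PD X n i) = Comp SMGp (PD Y n i) (h n)) \<and>
     (\<forall>n i. i \<le> n \<longrightarrow> Comp SMGp (h (n + 1)) (PS X n i) = Comp SMGp (PS Y n i) (h n)) \<and>
     (\<forall>r. \<forall>x \<in> PObj X (r + 2). fa (mor (h r)) (PB X r x) = PB Y r (fo (mor (h (r + 2))) x))"

type_synonym ('x, 'y) topps_arr =
  "('x, 'y) topps \<times> (nat \<Rightarrow> ('x, 'y) smg_arr) \<times> ('x, 'y) topps"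

definition TopPs :: "(('x, 'y) topps, ('x, 'y) topps_arr) cat" where
  "TopPs = mk_cat {X. is_topps X} (\<lambda>X Y. {h. topps_map X Y h})
             (\<lambda>X n. Ident SMGp (PLev X n)) (\<lambda>X g f n. Comp SMGp (g n) (f n))"

definition u_star :: "('x, 'y) topps \<Rightarrow> (('x, 'y) smg, ('x, 'y) smg_arr) tsplit" where
  "u_star X =
     \<lparr>TLev = PLev X, TD = (\<lambda>n i. if i < n then PD X n i else undefined), TS = PS X\<rparr>"

definition UStar ::
  "(('x, 'y) topps, ('x, 'y) topps_arr,
    (('x, 'y) smg, ('x, 'y) smg_arr) tsplit, (('x, 'y) smg, ('x, 'y) smg_arr) tsplit_arr) fctr" where
  "UStar = mk_fctr TopPs u_star (\<lambda>(X, h, Y). (u_star X, h, u_star Y))"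

definition levelwise_free :: "('g list, 'g sarr) topps \<Rightarrow> bool" where
  "levelwise_free X \<longleftrightarrow> (\<forall>n. \<exists>A. PLev X n = SS A)"

definition shuffle :: "('g list, 'g sarr) topps \<Rightarrow> bool" where
  "shuffle X \<longleftrightarrow>
     (\<forall>r \<sigma>. [\<sigma>] \<in> PObj X (r + 2) \<longrightarrow>
        (let ps = fo (mor (PD X (r + 2) (r + 2))) [\<sigma>];
             ns = map (\<lambda>p. length (fo (mor (PD X (r + 1) (r + 1))) [p])) ps
         in \<forall>i < length ps.
              mono_on {sum_list (take i ns) ..< sum_list (take (i + 1) ns)} (inv (mor (PB X r [\<sigma>])))))"

definition TopPsFrSh :: "(('g list, 'g sarr) topps, ('g list, 'g sarr) topps_arr) cat" where
  "TopPsFrSh = full_subcat TopPs {X. levelwise_free X \<and> shuffle X}"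


section \<open>The operadic nerve\<close>

fun path_comp :: "('o, 'm) cat \<Rightarrow> 'm list \<Rightarrow> 'm" where
  "path_comp C [] = undefined"
| "path_comp C [f] = f"
| "path_comp C (f # fs) = Comp C (path_comp C fs) f"

text \<open>The chain of fibre maps over \<open>i\<close>; \<open>path_comp (drop a gs)\<close> is the composite from the \<open>a\<close>-th
  object (counted from 0 at the source) to the last object.\<close>

definition fib_chain :: "('o, 'm) opcat \<Rightarrow> 'm list \<Rightarrow> nat \<Rightarrow> ('o, 'm) cell" where
  "fib_chain P gs i =
     Chain (fib_obj P (path_comp (OBase P) gs) i)
       (map (\<lambda>a. fib_map P (gs ! a) (path_comp (OBase P) (drop (a + 1) gs)) i) [0..<length gs - 1])"

primrec top_face :: "('o, 'm) opcat \<Rightarrow> ('o, 'm) cell \<Rightarrow> ('o, 'm) cell list" where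
  "top_face P (Cpt c) = undefined"
| "top_face P (Chain x gs) =
     (if gs = []
      then map (\<lambda>i. Cpt (cpt (OBase P) (fib_obj P (Ident (OBase P) x) i))) [0..<fo (Crd P) x]
      else map (fib_chain P gs) [0..<fo (Crd P) (Cod (OBase P) (last gs))])"

primrec last_arrow :: "('o, 'm) cell \<Rightarrow> 'm" where
  "last_arrow (Cpt c) = undefined"
| "last_arrow (Chain x gs) = last gs"

definition nopd_lev :: "('o, 'm) opcat \<Rightarrow> nat \<Rightarrow> ('o, 'm) cell_smg" where
  "nopd_lev P n = SS (cells (OBase P) n)"

definition nopd_d :: "('o, 'm) opcat \<Rightarrow> nat \<Rightarrow> nat \<Rightarrow> ('o, 'm) cell_smg_arr" where
  "nopd_d P n i =
     (if i < n then TD (fo SNlt (Und P)) n i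
      else if 1 \<le> n \<and> i = n
      then (nopd_lev P n, free_ext (cells (OBase P) n) (nopd_lev P (n - 1)) (top_face P), nopd_lev P (n - 1))
      else undefined)"

definition nopd_beta :: "('o, 'm) opcat \<Rightarrow> nat \<Rightarrow> ('o, 'm) cell list \<Rightarrow> ('o, 'm) cell sarr" where
  "nopd_beta P r =
     (THE b. mon_trans (nopd_lev P (r + 2)) (nopd_lev P r)
           (mor (Comp SMGp (nopd_d P (r + 1) (r + 1)) (nopd_d P (r + 2) (r + 1))))
           (mor (Comp SMGp (nopd_d P (r + 1) (r + 1)) (nopd_d P (r + 2) (r + 2)))) b \<and>
        (\<forall>\<sigma> \<in> cells (OBase P) (r + 2). mor (b [\<sigma>]) = fin_pi (fa (Crd P) (last_arrow \<sigma>))))"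

definition nopd_obj :: "('o, 'm) opcat \<Rightarrow> (('o, 'm) cell list, ('o, 'm) cell sarr) topps" where
  "nopd_obj P =
     \<lparr>PLev = nopd_lev P, PD = nopd_d P, PS = TS (fo SNlt (Und P)), PB = nopd_beta P\<rparr>"

definition nopd_map ::
  "('o, 'm) opcat \<Rightarrow> ('o, 'm) opcat \<Rightarrow> ('o, 'm, 'o, 'm) fctr \<Rightarrow> nat \<Rightarrow> ('o, 'm) cell_smg_arr" where
  "nopd_map P Q F n =
     (nopd_lev P n, SS_map (cells (OBase P) n) (cell_map (OBase Q) F), nopd_lev Q n)"

definition Nopd ::
  "(('o, 'm) opcat, ('o, 'm) opcat \<times> ('o, 'm, 'o, 'm) fctr \<times> ('o, 'm) opcat,
    (('o, 'm) cell list, ('o, 'm) cell sarr) topps,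
    (('o, 'm) cell list, ('o, 'm) cell sarr) topps_arr) fctr" where
  "Nopd = mk_fctr OpCat nopd_obj (\<lambda>(P, F, Q). (nopd_obj P, nopd_map P Q F, nopd_obj Q))"

end

theory Submission
  imports Defs
begin

text \<open>
  Strict monoidal functors out of \<open>\<S>A\<close>, and monoidal transformations between them, are determined
  freely by their values on generators. Hence an object \<open>X\<close> with
  \<open>u\<^sup>*X = \<S>N\<^sub>l\<^sub>t C\<close> amounts to generator data: a list \<open>t \<sigma>\<close> of cells for every chain \<open>\<sigma>\<close> of
  \<open>C\<close> (the top face) and a permutation \<open>\<beta> r \<sigma>\<close> (the coherence cell), subject to equations
  between cells and between block permutations.

  For the data of an operadic category these equations are the functoriality of the fibres, (A4),
  (A5), and the identity relating \<open>\<pi>\<^sub>f\<close>, \<open>\<pi>\<^sub>g\<close>, \<open>\<pi>\<^sub>g\<^sub>f\<close> and the \<open>\<pi>\<close> of the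
  fibre maps of \<open>f\<close> over \<open>g\<close>.

  Conversely, compatibility with the faces \<open>d\<^sub>0\<close> gives \<open>\<beta> r \<sigma> = \<beta> 0 f\<close> for the last arrow \<open>f\<close> of
  \<open>\<sigma>\<close>, and that \<open>t \<sigma>\<close> has as many entries as \<open>t\<close> of the last object. A shuffle
  with given block sizes is \<open>\<pi>\<^sub>g\<close> for exactly one map \<open>g\<close> of finite ordinals, so \<open>\<beta> 0 f\<close> defines
  \<open>|f|\<close>; fibres and fibre maps are read off \<open>t\<close> on chains of one and two arrows. The cocycle
  condition then says that \<open>|f|\<close> is functorial and that \<open>|\<cdot>|\<close> of a fibre map is the fibre map of
  cardinalities, and the fact that \<open>\<beta>\<close> is a morphism between the two iterated top faces is (A5).
\<close>

section \<open>Categories and functors\<close>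

text \<open>A coherence law for \<beta> is an equation between arrows of a free groupoid at every
  object. It is brought to generators only after both sides are recognised as monoidal
  transformations, and their end points match only because \<open>t\<close> commutes with the lower
  faces and the degeneracies. Hence \<open>top_simplicial\<close> is a hypothesis of every reduction
  that leads to \<open>top_coherent\<close>. No new data sits on long chains: a chain with two or
  more arrows is determined by its first and last faces, and top faces commute with these. So the
  values of \<open>t\<close> on at most two arrows rebuild all of it. The axioms on terminals and
  identities come from degeneracies. As \<open>s_0\<close> of a component is its chosen terminal,
  and the top face retracts the top degeneracy, one gets (A4), the one-element cardinality of chosen
  terminals and, by a retract argument, (A1). Repeating an object gives (A2) and the identities of
  fibres. That cardinality preserves identities is not visible in the data; it holds because
  \<open>|id|\<close> is idempotent with one-element fibres.\<close>

lemma ext_cat_simps [simp]: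
  "Obj (ext_cat Os As d c i m) = Os"
  "Arr (ext_cat Os As d c i m) = As"
  "f \<in> As \<Longrightarrow> Dom (ext_cat Os As d c i m) f = d f"
  "f \<in> As \<Longrightarrow> Cod (ext_cat Os As d c i m) f = c f"
  "x \<in> Os \<Longrightarrow> Ident (ext_cat Os As d c i m) x = i x"
  "g \<in> As \<Longrightarrow> f \<in> As \<Longrightarrow> d g = c f \<Longrightarrow> Comp (ext_cat Os As d c i m) g f = m g f"
  by (simp_all add: ext_cat_def)

lemma category_ext_cat:
  assumes d: "\<And>f. f \<in> As \<Longrightarrow> d f \<in> Os \<and> c f \<in> Os"
    and i: "\<And>x. x \<in> Os \<Longrightarrow> i x \<in> As \<and> d (i x) = x \<and> c (i x) = x"
    and m: "\<And>g f. g \<in> As \<Longrightarrow> f \<in> As \<Longrightarrow> d g = c f \<Longrightarrow> m g f \<in> As \<and> d (m g f) = d f \<and> c (m g f) = c g"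
    and u: "\<And>f. f \<in> As \<Longrightarrow> m f (i (d f)) = f \<and> m (i (c f)) f = f"
    and a: "\<And>h g f. h \<in> As \<Longrightarrow> g \<in> As \<Longrightarrow> f \<in> As \<Longrightarrow> d h = c g \<Longrightarrow> d g = c f \<Longrightarrow>
              m h (m g f) = m (m h g) f"
  shows "category (ext_cat Os As d c i m)"
  unfolding category_def
proof (intro conjI allI ballI impI)
  show "Dom (ext_cat Os As d c i m) \<in> Arr (ext_cat Os As d c i m) \<rightarrow>\<^sub>E Obj (ext_cat Os As d c i m)"
    "Cod (ext_cat Os As d c i m) \<in> Arr (ext_cat Os As d c i m) \<rightarrow>\<^sub>E Obj (ext_cat Os As d c i m)"
    "Ident (ext_cat Os As d c i m) \<in> Obj (ext_cat Os As d c i m) \<rightarrow>\<^sub>E Arr (ext_cat Os As d c i m)"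
    using d i by (auto simp: ext_cat_def)
next
  fix g f
  show "if composable (ext_cat Os As d c i m) g f
        then Comp (ext_cat Os As d c i m) g f
             \<in> hom (ext_cat Os As d c i m) (Dom (ext_cat Os As d c i m) f) (Cod (ext_cat Os As d c i m) g)
        else Comp (ext_cat Os As d c i m) g f = undefined"
    using m by (auto simp: composable_def hom_def) (auto simp: ext_cat_def)
next
  fix h g f
  assume "composable (ext_cat Os As d c i m) h g \<and> composable (ext_cat Os As d c i m) g f"
  then have "h \<in> As" "g \<in> As" "f \<in> As" "d h = c g" "d g = c f"
    by (auto simp: composable_def)
  then show "Comp (ext_cat Os As d c i m) h (Comp (ext_cat Os As d c i m) g f)
      = Comp (ext_cat Os As d c i m) (Comp (ext_cat Os As d c i m) h g) f"
    using m a by simp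
qed (use d i m u in \<open>auto simp: hom_def\<close>)

lemma mk_cat_Obj [simp]: "Obj (mk_cat Os H i m) = Os"
  by (simp add: mk_cat_def)

lemma mk_cat_Arr [simp]:
  "(X, f, Y) \<in> Arr (mk_cat Os H i m) \<longleftrightarrow> X \<in> Os \<and> Y \<in> Os \<and> f \<in> H X Y"
  by (simp add: mk_cat_def)

lemma mk_cat_ArrE:
  assumes "u \<in> Arr (mk_cat Os H i m)"
  obtains X f Y where "u = (X, f, Y)" "X \<in> Os" "Y \<in> Os" "f \<in> H X Y"
  using assms by (cases u) auto

lemma mk_cat_ops [simp]:
  "(X, f, Y) \<in> Arr (mk_cat Os H i m) \<Longrightarrow> Dom (mk_cat Os H i m) (X, f, Y) = X"
  "(X, f, Y) \<in> Arr (mk_cat Os H i m) \<Longrightarrow> Cod (mk_cat Os H i m) (X, f, Y) = Y"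
  "X \<in> Os \<Longrightarrow> Ident (mk_cat Os H i m) X = (X, i X, X)"
  "(X, f, Y) \<in> Arr (mk_cat Os H i m) \<Longrightarrow> (Y, g, Z) \<in> Arr (mk_cat Os H i m) \<Longrightarrow>
     Comp (mk_cat Os H i m) (Y, g, Z) (X, f, Y) = (X, m X g f, Z)"
  by (simp_all add: mk_cat_def)

lemma mk_cat_hom:
  "u \<in> hom (mk_cat Os H i m) X Y \<longleftrightarrow> (\<exists>f. u = (X, f, Y) \<and> X \<in> Os \<and> Y \<in> Os \<and> f \<in> H X Y)"
  by (cases u) (auto simp: hom_def)

lemma category_mk_cat:
  assumes "\<And>X. X \<in> Os \<Longrightarrow> i X \<in> H X X"
    and "\<And>X Y Z f g. X \<in> Os \<Longrightarrow> Y \<in> Os \<Longrightarrow> Z \<in> Os \<Longrightarrow> f \<in> H X Y \<Longrightarrow> g \<in> H Y Z \<Longrightarrow> m X g f \<in> H X Z"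
    and "\<And>X Y f. X \<in> Os \<Longrightarrow> Y \<in> Os \<Longrightarrow> f \<in> H X Y \<Longrightarrow> m X f (i X) = f \<and> m X (i Y) f = f"
    and "\<And>X Y Z W f g h. X \<in> Os \<Longrightarrow> Y \<in> Os \<Longrightarrow> Z \<in> Os \<Longrightarrow> W \<in> Os \<Longrightarrow>
           f \<in> H X Y \<Longrightarrow> g \<in> H Y Z \<Longrightarrow> h \<in> H Z W \<Longrightarrow> m X h (m X g f) = m X (m Y h g) f"
  shows "category (mk_cat Os H i m)"
  unfolding mk_cat_def
  by (rule category_ext_cat) (use assms in \<open>auto simp: split_beta\<close>)

lemma category_ops:
  assumes "category C"
  shows "f \<in> Arr C \<Longrightarrow> Dom C f \<in> Obj C" "f \<in> Arr C \<Longrightarrow> Cod C f \<in> Obj C"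
    "x \<in> Obj C \<Longrightarrow> Ident C x \<in> Arr C"
    "x \<in> Obj C \<Longrightarrow> Dom C (Ident C x) = x" "x \<in> Obj C \<Longrightarrow> Cod C (Ident C x) = x"
    "g \<in> Arr C \<Longrightarrow> f \<in> Arr C \<Longrightarrow> Dom C g = Cod C f \<Longrightarrow> Comp C g f \<in> Arr C"
    "g \<in> Arr C \<Longrightarrow> f \<in> Arr C \<Longrightarrow> Dom C g = Cod C f \<Longrightarrow> Dom C (Comp C g f) = Dom C f"
    "g \<in> Arr C \<Longrightarrow> f \<in> Arr C \<Longrightarrow> Dom C g = Cod C f \<Longrightarrow> Cod C (Comp C g f) = Cod C g"
    "f \<in> Arr C \<Longrightarrow> Dom C f = x \<Longrightarrow> Comp C f (Ident C x) = f"
    "f \<in> Arr C \<Longrightarrow> Cod C f = y \<Longrightarrow> Comp C (Ident C y) f = f"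
proof -
  have D: "Dom C \<in> Arr C \<rightarrow> Obj C" "Cod C \<in> Arr C \<rightarrow> Obj C" "Ident C \<in> Obj C \<rightarrow> Arr C"
    and I: "\<And>x. x \<in> Obj C \<Longrightarrow> Ident C x \<in> hom C x x"
    and M: "\<And>g f. composable C g f \<Longrightarrow> Comp C g f \<in> hom C (Dom C f) (Cod C g)"
    and U: "\<And>f. f \<in> Arr C \<Longrightarrow> Comp C f (Ident C (Dom C f)) = f \<and> Comp C (Ident C (Cod C f)) f = f"
    using assms unfolding category_def by (auto simp: PiE_def)
  show "f \<in> Arr C \<Longrightarrow> Dom C f \<in> Obj C" "f \<in> Arr C \<Longrightarrow> Cod C f \<in> Obj C"
    "x \<in> Obj C \<Longrightarrow> Ident C x \<in> Arr C"
    using D by auto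
  show "x \<in> Obj C \<Longrightarrow> Dom C (Ident C x) = x" "x \<in> Obj C \<Longrightarrow> Cod C (Ident C x) = x"
    using I by (auto simp: hom_def)
  show "g \<in> Arr C \<Longrightarrow> f \<in> Arr C \<Longrightarrow> Dom C g = Cod C f \<Longrightarrow> Comp C g f \<in> Arr C"
    "g \<in> Arr C \<Longrightarrow> f \<in> Arr C \<Longrightarrow> Dom C g = Cod C f \<Longrightarrow> Dom C (Comp C g f) = Dom C f"
    "g \<in> Arr C \<Longrightarrow> f \<in> Arr C \<Longrightarrow> Dom C g = Cod C f \<Longrightarrow> Cod C (Comp C g f) = Cod C g"
    using M[of g f] by (auto simp: hom_def composable_def)
  show "f \<in> Arr C \<Longrightarrow> Dom C f = x \<Longrightarrow> Comp C f (Ident C x) = f"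
    "f \<in> Arr C \<Longrightarrow> Cod C f = y \<Longrightarrow> Comp C (Ident C y) f = f"
    using U[of f] by auto
qed

lemma category_assoc:
  assumes "category C" "h \<in> Arr C" "g \<in> Arr C" "f \<in> Arr C" "Dom C h = Cod C g" "Dom C g = Cod C f"
  shows "Comp C (Comp C h g) f = Comp C h (Comp C g f)"
  using assms unfolding category_def composable_def by auto

lemma hom_comp:
  assumes "category C" "f \<in> hom C x y" "g \<in> hom C y z"
  shows "Comp C g f \<in> hom C x z"
  using assms by (auto simp: hom_def category_ops)

lemma hom_ident: "category C \<Longrightarrow> x \<in> Obj C \<Longrightarrow> Ident C x \<in> hom C x x"
  by (auto simp: hom_def category_ops)

lemma hom_assoc:
  assumes "category C" "f \<in> hom C x y" "g \<in> hom C y z" "h \<in> hom C z w"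
  shows "Comp C h (Comp C g f) = Comp C (Comp C h g) f"
  using assms by (auto simp: hom_def category_assoc)

text \<open>Pasting of two commuting squares; it serves each face and each degeneracy when maps of
  top-pseudo-simplicial objects are composed.\<close>

lemma square_comp:
  assumes E: "category E" and f: "f \<in> hom E a b" "f' \<in> hom E a' b'" and g: "g \<in> hom E b c" "g' \<in> hom E b' c'"
    and d: "d \<in> hom E a a'" "e \<in> hom E b b'" "k \<in> hom E c c'"
    and eq: "Comp E f' d = Comp E e f" "Comp E g' e = Comp E k g"
  shows "Comp E (Comp E g' f') d = Comp E k (Comp E g f)"
proof -
  have "Comp E (Comp E g' f') d = Comp E g' (Comp E e f)"
    using hom_assoc[OF E d(1) f(2) g(2)] eq by simp
  also have "\<dots> = Comp E k (Comp E g f)"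
    using hom_assoc[OF E f(1) d(2) g(2)] hom_assoc[OF E f(1) g(1) d(3)] eq by simp
  finally show ?thesis .
qed

section \<open>Functors and isomorphisms of categories\<close>

lemma is_fctrI:
  assumes "\<And>x. x \<in> Obj C \<Longrightarrow> a x \<in> Obj D"
    and "\<And>f. f \<in> Arr C \<Longrightarrow> b f \<in> Arr D \<and> Dom D (b f) = a (Dom C f) \<and> Cod D (b f) = a (Cod C f)"
    and "\<And>x. x \<in> Obj C \<Longrightarrow> b (Ident C x) = Ident D (a x)"
    and "\<And>g f. g \<in> Arr C \<Longrightarrow> f \<in> Arr C \<Longrightarrow> Dom C g = Cod C f \<Longrightarrow> b (Comp C g f) = Comp D (b g) (b f)"
    and "category C"
  shows "is_fctr C D (mk_fctr C a b)"
  using assms by (auto simp: is_fctr_def mk_fctr_def composable_def category_ops)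

lemma is_fctr_ops:
  assumes "is_fctr C D F"
  shows "x \<in> Obj C \<Longrightarrow> fo F x \<in> Obj D" "f \<in> Arr C \<Longrightarrow> fa F f \<in> Arr D"
    "f \<in> Arr C \<Longrightarrow> Dom D (fa F f) = fo F (Dom C f)"
    "f \<in> Arr C \<Longrightarrow> Cod D (fa F f) = fo F (Cod C f)"
    "x \<in> Obj C \<Longrightarrow> fa F (Ident C x) = Ident D (fo F x)"
    "g \<in> Arr C \<Longrightarrow> f \<in> Arr C \<Longrightarrow> Dom C g = Cod C f \<Longrightarrow> fa F (Comp C g f) = Comp D (fa F g) (fa F f)"
  using assms by (auto simp: is_fctr_def composable_def)

lemma is_fctr_hom: "is_fctr C D F \<Longrightarrow> f \<in> hom C x y \<Longrightarrow> fa F f \<in> hom D (fo F x) (fo F y)"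
  by (auto simp: hom_def is_fctr_ops)

lemma is_fctr_hom_comp:
  "is_fctr C D F \<Longrightarrow> f \<in> hom C x y \<Longrightarrow> g \<in> hom C y z \<Longrightarrow> fa F (Comp C g f) = Comp D (fa F g) (fa F f)"
  by (auto simp: hom_def is_fctr_ops)

text \<open>\<open>is_fctr\<close> forces both components to be \<open>undefined\<close> outside the
  source, so agreement on objects and arrows is equality of records. The targets \<open>D\<close>
  and \<open>D'\<close> may differ because a functor record does not carry its target.\<close>

lemma fctr_eqI:
  fixes F G :: "('o, 'a, 'p, 'b) fctr"
  assumes "is_fctr C D F" "is_fctr C D' G"
    and "\<And>x. x \<in> Obj C \<Longrightarrow> fo F x = fo G x" "\<And>f. f \<in> Arr C \<Longrightarrow> fa F f = fa G f"
  shows "F = G"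
proof -
  have "fo F = fo G" "fa F = fa G"
    by (rule extensionalityI[of _ "Obj C"], use assms in \<open>auto simp: is_fctr_def PiE_def\<close>)
      (rule extensionalityI[of _ "Arr C"], use assms in \<open>auto simp: is_fctr_def PiE_def\<close>)
  then show ?thesis by simp
qed

lemma mk_fctr_simps [simp]:
  "x \<in> Obj C \<Longrightarrow> fo (mk_fctr C a b) x = a x"
  "f \<in> Arr C \<Longrightarrow> fa (mk_fctr C a b) f = b f"
  by (simp_all add: mk_fctr_def)

lemma mk_fctr_cong:
  assumes "\<And>x. x \<in> Obj C \<Longrightarrow> a x = a' x" "\<And>f. f \<in> Arr C \<Longrightarrow> b f = b' f"
  shows "mk_fctr C a b = mk_fctr C a' b'"
  using assms by (auto simp: mk_fctr_def restrict_def)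

lemma is_fctr_fid: "category C \<Longrightarrow> is_fctr C C (fid C)"
  unfolding fid_def by (rule is_fctrI) (auto simp: category_ops)

lemma is_fctr_fcomp:
  "category C \<Longrightarrow> is_fctr C D F \<Longrightarrow> is_fctr D E G \<Longrightarrow> is_fctr C E (fcomp C G F)"
  unfolding fcomp_def by (rule is_fctrI) (auto simp: is_fctr_ops)

lemma fcomp_simps [simp]:
  "x \<in> Obj C \<Longrightarrow> fo (fcomp C G F) x = fo G (fo F x)"
  "f \<in> Arr C \<Longrightarrow> fa (fcomp C G F) f = fa G (fa F f)"
  by (simp_all add: fcomp_def)

lemma fid_simps [simp]:
  "x \<in> Obj C \<Longrightarrow> fo (fid C) x = x" "f \<in> Arr C \<Longrightarrow> fa (fid C) f = f"
  by (simp_all add: fid_def)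

lemma fcomp_fid: "category C \<Longrightarrow> is_fctr C D F \<Longrightarrow> fcomp C F (fid C) = F"
  by (rule fctr_eqI[of C D _ D]) (auto intro: is_fctr_fcomp is_fctr_fid)

lemma fid_fcomp: "category C \<Longrightarrow> category D \<Longrightarrow> is_fctr C D F \<Longrightarrow> fcomp C (fid D) F = F"
  by (rule fctr_eqI[of C D _ D]) (auto intro: is_fctr_fcomp is_fctr_fid simp: is_fctr_ops)

lemma fcomp_assoc:
  "is_fctr C D F \<Longrightarrow> fcomp C H (fcomp C G F) = fcomp C (fcomp D H G) F"
  by (simp add: fcomp_def mk_fctr_def restrict_def fun_eq_iff is_fctr_ops)

text \<open>The inverse is assembled from \<open>inv_into\<close> on objects and arrows; each
  functor law for it follows by applying \<open>F\<close> and cancelling by injectivity.\<close>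

lemma cat_isoI:
  assumes F: "is_fctr C D F" and C: "category C" and D: "category D"
    and o: "bij_betw (fo F) (Obj C) (Obj D)" and a: "bij_betw (fa F) (Arr C) (Arr D)"
  shows "cat_iso C D F"
proof -
  define p where "p = inv_into (Obj C) (fo F)"
  define q where "q = inv_into (Arr C) (fa F)"
  have p: "p y \<in> Obj C" "fo F (p y) = y" if "y \<in> Obj D" for y
    using o that unfolding p_def by (auto simp: bij_betw_def f_inv_into_f inv_into_into)
  have q: "q g \<in> Arr C" "fa F (q g) = g" if "g \<in> Arr D" for g
    using a that unfolding q_def by (auto simp: bij_betw_def f_inv_into_f inv_into_into)
  have io: "x = x'" if "fo F x = fo F x'" "x \<in> Obj C" "x' \<in> Obj C" for x x'
    using o that by (auto simp: bij_betw_def inj_on_def)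
  have ia: "f = f'" if "fa F f = fa F f'" "f \<in> Arr C" "f' \<in> Arr C" for f f'
    using a that by (auto simp: bij_betw_def inj_on_def)
  have dq: "Dom C (q f) = p (Dom D f)" "Cod C (q f) = p (Cod D f)" if "f \<in> Arr D" for f
    using that F C D p q by (auto intro!: io simp: category_ops is_fctr_ops(3,4)[OF F, symmetric])
  have G: "is_fctr D C (mk_fctr D p q)"
  proof (rule is_fctrI)
    show "q (Ident D x) = Ident C (p x)" if "x \<in> Obj D" for x
      using that F C D p q by (auto intro!: ia simp: category_ops is_fctr_ops(5)[OF F])
    show "q (Comp D g f) = Comp C (q g) (q f)" if "g \<in> Arr D" "f \<in> Arr D" "Dom D g = Cod D f" for g f
      using that F C D p q dq by (auto intro!: ia simp: category_ops is_fctr_ops(6)[OF F])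
  qed (use p q dq D in auto)
  have "fcomp C (mk_fctr D p q) F = fid C"
    by (rule fctr_eqI[OF is_fctr_fcomp[OF C F G] is_fctr_fid[OF C]])
      (use F p q io ia in \<open>auto simp: is_fctr_ops\<close>)
  moreover have "fcomp D F (mk_fctr D p q) = fid D"
    by (rule fctr_eqI[OF is_fctr_fcomp[OF D G F] is_fctr_fid[OF D]]) (use p q in auto)
  ultimately show ?thesis using F G unfolding cat_iso_def by blast
qed

section \<open>Full subcategories, products, slices and strict pullbacks\<close>

lemma category_full_subcat: "category C \<Longrightarrow> category (full_subcat C S)"
  unfolding full_subcat_def
  by (rule category_ext_cat) (auto simp: category_ops category_assoc)

lemma is_fctr_full_subcat:
  "category C \<Longrightarrow> is_fctr C D F \<Longrightarrow> is_fctr (full_subcat C S) D (restr_fctr (full_subcat C S) F)"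
  unfolding restr_fctr_def
  by (rule is_fctrI) (auto simp: is_fctr_ops category_full_subcat, auto simp: full_subcat_def is_fctr_ops)

text \<open>By fullness only the objects have to land in \<open>S\<close>; the functor record itself
  stays the same, so the nerve can be used unchanged with either target.\<close>

lemma is_fctr_into_full_subcat:
  "is_fctr C D F \<Longrightarrow> fo F ` Obj C \<subseteq> S \<Longrightarrow> category C \<Longrightarrow> is_fctr C (full_subcat D S) F"
  unfolding is_fctr_def full_subcat_def
  by (auto simp: PiE_def Pi_def composable_def image_subset_iff category_ops)

lemma category_prod_cat: "category C \<Longrightarrow> category D \<Longrightarrow> category (prod_cat C D)"
  unfolding prod_cat_def
  by (rule category_ext_cat) (auto simp: category_ops category_assoc)

lemma category_slice: "category C \<Longrightarrow> category (slice C R)"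
  unfolding slice_def composable_def
  by (rule category_ext_cat) (auto simp: category_ops category_assoc)

lemma category_pullback_cat:
  assumes "category A" "category B" "is_fctr A D F" "is_fctr B D G"
  shows "category (pullback_cat A B F G)"
proof -
  have "fo F (Dom A f) = fo G (Dom B g)" "fo F (Cod A f) = fo G (Cod B g)"
    if "f \<in> Arr A" "g \<in> Arr B" "fa F f = fa G g" for f g
    using that assms(3,4) by (metis is_fctr_ops(3), metis is_fctr_ops(4))
  then show ?thesis
    unfolding pullback_cat_def
    by (intro category_ext_cat) (use assms in \<open>auto simp: category_ops category_assoc is_fctr_ops\<close>)
qed

lemma is_fctr_pairing:
  assumes "category P" "is_fctr P A p" "is_fctr P B q" "fcomp P F p = fcomp P G q"
  shows "is_fctr P (pullback_cat A B F G) (pairing P p q)"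
proof -
  have o: "fo F (fo p x) = fo G (fo q x)" if "x \<in> Obj P" for x
    using that fcomp_simps(1)[of x P F p] fcomp_simps(1)[of x P G q] assms(4) by simp
  have a: "fa F (fa p x) = fa G (fa q x)" if "x \<in> Arr P" for x
    using that fcomp_simps(2)[of x P F p] fcomp_simps(2)[of x P G q] assms(4) by simp
  show ?thesis
    unfolding pairing_def
    by (rule is_fctrI) (use assms o a in \<open>auto simp: pullback_cat_def is_fctr_ops\<close>)
qed

text \<open>Splits the isomorphism with the pullback category into four elementary conditions: the
  two projections are jointly injective and jointly surjective, on objects and on arrows.\<close>

lemma strict_pullbackI:
  assumes "category P" "category A" "category B" "category D"
    and "is_fctr P A p" "is_fctr P B q" "is_fctr A D F" "is_fctr B D G"
    and "fcomp P F p = fcomp P G q"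
    and "\<And>x y. x \<in> Obj P \<Longrightarrow> y \<in> Obj P \<Longrightarrow> fo p x = fo p y \<Longrightarrow> fo q x = fo q y \<Longrightarrow> x = y"
    and "\<And>x y. x \<in> Arr P \<Longrightarrow> y \<in> Arr P \<Longrightarrow> fa p x = fa p y \<Longrightarrow> fa q x = fa q y \<Longrightarrow> x = y"
    and "\<And>x y. x \<in> Obj A \<Longrightarrow> y \<in> Obj B \<Longrightarrow> fo F x = fo G y \<Longrightarrow> \<exists>z \<in> Obj P. fo p z = x \<and> fo q z = y"
    and "\<And>x y. x \<in> Arr A \<Longrightarrow> y \<in> Arr B \<Longrightarrow> fa F x = fa G y \<Longrightarrow> \<exists>z \<in> Arr P. fa p z = x \<and> fa q z = y"
  shows "strict_pullback P A B D p q F G"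
proof -
  have pair: "is_fctr P (pullback_cat A B F G) (pairing P p q)"
    using assms(1,5,6,9) by (rule is_fctr_pairing)
  have "fo (pairing P p q) ` Obj P = Obj (pullback_cat A B F G)"
  proof
    show "Obj (pullback_cat A B F G) \<subseteq> fo (pairing P p q) ` Obj P"
      using assms(12) by (fastforce simp: pullback_cat_def pairing_def image_iff)
  qed (use pair in \<open>auto simp: is_fctr_ops\<close>)
  moreover have "fa (pairing P p q) ` Arr P = Arr (pullback_cat A B F G)"
  proof
    show "Arr (pullback_cat A B F G) \<subseteq> fa (pairing P p q) ` Arr P"
      using assms(13) by (fastforce simp: pullback_cat_def pairing_def image_iff)
  qed (use pair in \<open>auto simp: is_fctr_ops\<close>)
  ultimately have "cat_iso P (pullback_cat A B F G) (pairing P p q)"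
    using assms pair
    by (intro cat_isoI category_pullback_cat) (auto simp: bij_betw_def inj_on_def pairing_def)
  then show ?thesis using assms unfolding strict_pullback_def by blast
qed

section \<open>Finite ordinals, sets, and categories with chosen local terminals\<close>

lemma category_FinOrd: "category FinOrd"
  unfolding FinOrd_def
  by (rule category_mk_cat) (auto simp: compose_def fun_eq_iff PiE_def extensional_def Pi_def)

lemma category_SetCat: "category SetCat"
  unfolding SetCat_def
  by (rule category_mk_cat) (auto simp: compose_def fun_eq_iff PiE_def extensional_def Pi_def)

lemma is_ltcat_category [dest]: "is_ltcat C \<Longrightarrow> category (Base C)"
  by (simp add: is_ltcat_def)

lemma category_CatLt: "category CatLt"
  unfolding CatLt_def
proof (rule category_mk_cat)
  show "\<And>X. X \<in> {C. is_ltcat C} \<Longrightarrow> fid (Base X) \<in> {F. lt_fctr X X F}"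
    by (auto simp: lt_fctr_def is_fctr_fid chosen_def is_ltcat_def pi0_def local_terminal_def)
  show "fcomp (Base X) g f \<in> {F. lt_fctr X Z F}"
    if "X \<in> {C. is_ltcat C}" "f \<in> {F. lt_fctr X Y F}" "g \<in> {F. lt_fctr Y Z F}" for X Y Z f g
  proof -
    \<comment> \<open>\<open>fcomp\<close> has its intended value on objects only, so the images of
      the chosen terminals can be computed once these are known to be objects.\<close>
    have "chosen X \<subseteq> Obj (Base X)"
      using that(1) by (auto simp: chosen_def is_ltcat_def local_terminal_def)
    then show ?thesis
      using that by (auto simp: lt_fctr_def is_fctr_fcomp is_ltcat_category image_subset_iff subset_iff)
  qed
qed (auto simp: lt_fctr_def fcomp_fid fid_fcomp is_ltcat_category fcomp_assoc)

section \<open>Top-split objects\<close>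

lemma tsplit_ops:
  assumes "is_tsplit E A"
  shows "TLev A n \<in> Obj E" "i < n \<Longrightarrow> TD A n i \<in> hom E (TLev A n) (TLev A (n - 1))"
    "i \<le> n \<Longrightarrow> TS A n i \<in> hom E (TLev A n) (TLev A (n + 1))"
proof -
  have "\<forall>n. TLev A n \<in> Obj E"
    "\<forall>n i. if i < n then TD A n i \<in> hom E (TLev A n) (TLev A (n - 1)) else TD A n i = undefined"
    "\<forall>n i. if i \<le> n then TS A n i \<in> hom E (TLev A n) (TLev A (n + 1)) else TS A n i = undefined"
    using assms unfolding is_tsplit_def by - (elim conjE, assumption)+
  then show "TLev A n \<in> Obj E" "i < n \<Longrightarrow> TD A n i \<in> hom E (TLev A n) (TLev A (n - 1))"
    "i \<le> n \<Longrightarrow> TS A n i \<in> hom E (TLev A n) (TLev A (n + 1))"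
    by presburger+
qed

lemma category_TSplit:
  assumes E: "category E"
  shows "category (TSplit E)"
  unfolding TSplit_def
proof (rule category_mk_cat)
  fix A assume "A \<in> {A. is_tsplit E A}"
  then show "(\<lambda>n. Ident E (TLev A n)) \<in> {h. tsplit_map E A A h}"
    using E tsplit_ops[of E A] by (auto simp: tsplit_map_def hom_def category_ops)
next
  fix A B C f g
  assume *: "A \<in> {A. is_tsplit E A}" "B \<in> {A. is_tsplit E A}" "C \<in> {A. is_tsplit E A}"
    and "f \<in> {h. tsplit_map E A B h}" "g \<in> {h. tsplit_map E B C h}"
  then have f: "tsplit_map E A B f" and g: "tsplit_map E B C g" by auto
  have A: "TLev X n \<in> Obj E" "i < n \<Longrightarrow> TD X n i \<in> hom E (TLev X n) (TLev X (n - 1))"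
    "i \<le> n \<Longrightarrow> TS X n i \<in> hom E (TLev X n) (TLev X (n + 1))" if "X = A \<or> X = B \<or> X = C" for n i X
    using * that tsplit_ops[of E X] by auto
  have h: "f n \<in> hom E (TLev A n) (TLev B n)" "g n \<in> hom E (TLev B n) (TLev C n)" for n
    using f g by (auto simp: tsplit_map_def)
  have "tsplit_map E A C (\<lambda>n. Comp E (g n) (f n))"
    unfolding tsplit_map_def
  proof (intro conjI allI impI)
    show "Comp E (g n) (f n) \<in> hom E (TLev A n) (TLev C n)" for n
      using hom_comp[OF E h] .
    show "Comp E (Comp E (g (n - 1)) (f (n - 1))) (TD A n i) = Comp E (TD C n i) (Comp E (g n) (f n))"
      if i: "i < n" for n i
    proof -
      have "Comp E (Comp E (g (n - 1)) (f (n - 1))) (TD A n i) = Comp E (g (n - 1)) (Comp E (TD B n i) (f n))"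
        using i f hom_assoc[OF E A(2) h(1) h(2)] by (simp add: tsplit_map_def)
      also have "\<dots> = Comp E (Comp E (g (n - 1)) (TD B n i)) (f n)"
        using i by (intro hom_assoc[OF E h(1) A(2) h(2)]) auto
      also have "\<dots> = Comp E (TD C n i) (Comp E (g n) (f n))"
        using i g hom_assoc[OF E h(1) h(2) A(2)] by (simp add: tsplit_map_def)
      finally show ?thesis .
    qed
    show "Comp E (Comp E (g (n + 1)) (f (n + 1))) (TS A n i) = Comp E (TS C n i) (Comp E (g n) (f n))"
      if i: "i \<le> n" for n i
    proof -
      have "Comp E (Comp E (g (n + 1)) (f (n + 1))) (TS A n i) = Comp E (g (n + 1)) (Comp E (TS B n i) (f n))"
        using i f hom_assoc[OF E A(3) h(1) h(2)] by (simp add: tsplit_map_def)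
      also have "\<dots> = Comp E (Comp E (g (n + 1)) (TS B n i)) (f n)"
        using i by (intro hom_assoc[OF E h(1) A(3) h(2)]) auto
      also have "\<dots> = Comp E (TS C n i) (Comp E (g n) (f n))"
        using i g hom_assoc[OF E h(1) h(2) A(3)] by (simp add: tsplit_map_def)
      finally show ?thesis .
    qed
  qed
  then show "(\<lambda>n. Comp E (g n) (f n)) \<in> {h. tsplit_map E A C h}" by simp
next
  fix A B f assume "f \<in> {h. tsplit_map E A B h}"
  then have "f n \<in> hom E (TLev A n) (TLev B n)" for n by (auto simp: tsplit_map_def)
  then show "(\<lambda>n. Comp E (f n) (Ident E (TLev A n))) = f \<and> (\<lambda>n. Comp E (Ident E (TLev B n)) (f n)) = f"
    using E by (auto simp: hom_def category_ops)
next
  fix A B C D f g h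
  assume "f \<in> {h. tsplit_map E A B h}" "g \<in> {h. tsplit_map E B C h}" "h \<in> {h. tsplit_map E C D h}"
  then show "(\<lambda>n. Comp E (h n) (Comp E (g n) (f n))) = (\<lambda>n. Comp E (Comp E (h n) (g n)) (f n))"
    using E by (auto simp: tsplit_map_def fun_eq_iff intro!: hom_assoc)
qed

lemma tsplit_eqs:
  assumes "is_tsplit E A"
  shows "i < j \<Longrightarrow> j < n \<Longrightarrow> Comp E (TD A (n - 1) i) (TD A n j) = Comp E (TD A (n - 1) (j - 1)) (TD A n i)"
    "i \<le> j \<Longrightarrow> j \<le> n \<Longrightarrow> Comp E (TS A (n + 1) i) (TS A n j) = Comp E (TS A (n + 1) (j + 1)) (TS A n i)"
    "i < j \<Longrightarrow> j \<le> n \<Longrightarrow> Comp E (TD A (n + 1) i) (TS A n j) = Comp E (TS A (n - 1) (j - 1)) (TD A n i)"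
    "i = j \<or> i = j + 1 \<Longrightarrow> i < n + 1 \<Longrightarrow> Comp E (TD A (n + 1) i) (TS A n j) = Ident E (TLev A n)"
    "j + 1 < i \<Longrightarrow> i < n + 1 \<Longrightarrow> Comp E (TD A (n + 1) i) (TS A n j) = Comp E (TS A (n - 1) j) (TD A n (i - 1))"
    "\<not> i < n \<Longrightarrow> TD A n i = undefined" "\<not> i \<le> n \<Longrightarrow> TS A n i = undefined"
proof -
  have *:
   "\<forall>n i j. i < j \<and> j < n \<longrightarrow>
        Comp E (TD A (n - 1) i) (TD A n j) = Comp E (TD A (n - 1) (j - 1)) (TD A n i)"
   "\<forall>n i j. i \<le> j \<and> j \<le> n \<longrightarrow>
        Comp E (TS A (n + 1) i) (TS A n j) = Comp E (TS A (n + 1) (j + 1)) (TS A n i)"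
   "\<forall>n i j. i < j \<and> j \<le> n \<longrightarrow>
        Comp E (TD A (n + 1) i) (TS A n j) = Comp E (TS A (n - 1) (j - 1)) (TD A n i)"
   "\<forall>n i j. (i = j \<or> i = j + 1) \<and> i < n + 1 \<longrightarrow>
        Comp E (TD A (n + 1) i) (TS A n j) = Ident E (TLev A n)"
   "\<forall>n i j. j + 1 < i \<and> i < n + 1 \<longrightarrow>
        Comp E (TD A (n + 1) i) (TS A n j) = Comp E (TS A (n - 1) j) (TD A n (i - 1))"
    "\<forall>n i. if i < n then TD A n i \<in> hom E (TLev A n) (TLev A (n - 1)) else TD A n i = undefined"
    "\<forall>n i. if i \<le> n then TS A n i \<in> hom E (TLev A n) (TLev A (n + 1)) else TS A n i = undefined"
    using assms unfolding is_tsplit_def by - (elim conjE, assumption)+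
  show "i < j \<Longrightarrow> j < n \<Longrightarrow> Comp E (TD A (n - 1) i) (TD A n j) = Comp E (TD A (n - 1) (j - 1)) (TD A n i)"
    using *(1) by blast
  show "i \<le> j \<Longrightarrow> j \<le> n \<Longrightarrow> Comp E (TS A (n + 1) i) (TS A n j) = Comp E (TS A (n + 1) (j + 1)) (TS A n i)"
    using *(2) by blast
  show "i < j \<Longrightarrow> j \<le> n \<Longrightarrow> Comp E (TD A (n + 1) i) (TS A n j) = Comp E (TS A (n - 1) (j - 1)) (TD A n i)"
    using *(3) by blast
  show "i = j \<or> i = j + 1 \<Longrightarrow> i < n + 1 \<Longrightarrow> Comp E (TD A (n + 1) i) (TS A n j) = Ident E (TLev A n)"
    using *(4) by blast
  show "j + 1 < i \<Longrightarrow> i < n + 1 \<Longrightarrow> Comp E (TD A (n + 1) i) (TS A n j) = Comp E (TS A (n - 1) j) (TD A n (i - 1))"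
    using *(5) by blast
  show "\<not> i < n \<Longrightarrow> TD A n i = undefined" "\<not> i \<le> n \<Longrightarrow> TS A n i = undefined"
    using *(6,7) by presburger+
qed

lemma is_tsplitI:
  assumes "\<And>n. TLev A n \<in> Obj E"
    and "\<And>n i. i < n \<Longrightarrow> TD A n i \<in> hom E (TLev A n) (TLev A (n - 1))"
    and "\<And>n i. \<not> i < n \<Longrightarrow> TD A n i = undefined"
    and "\<And>n i. i \<le> n \<Longrightarrow> TS A n i \<in> hom E (TLev A n) (TLev A (n + 1))"
    and "\<And>n i. \<not> i \<le> n \<Longrightarrow> TS A n i = undefined"
    and "\<And>n i j. i < j \<Longrightarrow> j < n \<Longrightarrow>
           Comp E (TD A (n - 1) i) (TD A n j) = Comp E (TD A (n - 1) (j - 1)) (TD A n i)"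
    and "\<And>n i j. i \<le> j \<Longrightarrow> j \<le> n \<Longrightarrow>
           Comp E (TS A (n + 1) i) (TS A n j) = Comp E (TS A (n + 1) (j + 1)) (TS A n i)"
    and "\<And>n i j. i < j \<Longrightarrow> j \<le> n \<Longrightarrow>
           Comp E (TD A (n + 1) i) (TS A n j) = Comp E (TS A (n - 1) (j - 1)) (TD A n i)"
    and "\<And>n i j. i = j \<or> i = j + 1 \<Longrightarrow> i < n + 1 \<Longrightarrow>
           Comp E (TD A (n + 1) i) (TS A n j) = Ident E (TLev A n)"
    and "\<And>n i j. j + 1 < i \<Longrightarrow> i < n + 1 \<Longrightarrow>
           Comp E (TD A (n + 1) i) (TS A n j) = Comp E (TS A (n - 1) j) (TD A n (i - 1))"
  shows "is_tsplit E A"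
  unfolding is_tsplit_def using assms(1-5)
  by (intro conjI allI impI; (elim conjE)?) (presburger | (rule assms(6-10); assumption))+

lemma is_tsplit_app:
  assumes F: "is_fctr E E' F" and A: "is_tsplit E A"
  shows "is_tsplit E' (tsplit_app F A)"
proof -
  note L = tsplit_ops[OF A]
  \<comment> \<open>Forms indexed by \<open>Suc n\<close>: after a case split on \<open>n\<close>
    they match the composites that mention \<open>n - 1\<close>.\<close>
  have LS: "i \<le> n \<Longrightarrow> TS A n i \<in> hom E (TLev A n) (TLev A (Suc n))" for n i
    using L(3)[of i n] by simp
  have LD: "i \<le> n \<Longrightarrow> TD A (Suc n) i \<in> hom E (TLev A (Suc n)) (TLev A n)" for n i
    using L(2)[of i "Suc n"] by simp
  note c = is_fctr_hom_comp[OF F, symmetric]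
  show ?thesis
    unfolding tsplit_app_def
  proof (rule is_tsplitI, goal_cases)
    case (1 n) show ?case by (simp add: is_fctr_ops(1)[OF F] L)
  next
    case (2 n i) then show ?case using is_fctr_hom[OF F L(2)] by simp
  next
    case (4 n i) then show ?case using is_fctr_hom[OF F L(3)] by simp
  next
    case (6 n i j) then have "i < n - 1" "j - 1 < n - 1" "i < n" by auto
    with 6 show ?case using c[OF L(2) L(2), of j n i] c[OF L(2) L(2), of i n "j - 1"] tsplit_eqs(1)[OF A, of i j n]
      by simp
  next
    case (7 n i j) then have "i \<le> n + 1" "i \<le> n" by auto
    with 7 show ?case using c[OF L(3) L(3), of j n i] c[OF L(3) L(3), of i n "j + 1"] tsplit_eqs(2)[OF A, of i j n]
      by simp
  next
    case (8 n i j) then have "j - 1 \<le> n - 1" "i \<le> n - 1" "0 < n" by auto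
    with 8 show ?case using tsplit_eqs(3)[OF A, of i j n]
      by (cases n) (simp_all add: c[OF LS LD] c[OF LD LS])
  next
    case (9 n i j) then have "j \<le> n" "i \<le> n" by auto
    with 9 show ?case using tsplit_eqs(4)[OF A, of i j n]
      by (simp add: c[OF LS LD] is_fctr_ops(5)[OF F] L)
  next
    case (10 n i j) then have "j \<le> n - 1" "i - 1 \<le> n - 1" "0 < n" "i - 1 < n" "i \<le> n" "j \<le> n" by auto
    with 10 show ?case using tsplit_eqs(5)[OF A, of j i n]
      by (cases n) (simp_all add: c[OF LS LD] c[OF LD LS])
  qed simp_all
qed

lemma tsplit_map_app:
  assumes F: "is_fctr E E' F" and A: "is_tsplit E A" and B: "is_tsplit E B" and h: "tsplit_map E A B h"
  shows "tsplit_map E' (tsplit_app F A) (tsplit_app F B) (\<lambda>n. fa F (h n))"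
proof -
  have hn: "h n \<in> hom E (TLev A n) (TLev B n)" for n using h by (simp add: tsplit_map_def)
  note c = is_fctr_hom_comp[OF F, symmetric]
  have d: "Comp E (h (n - 1)) (TD A n i) = Comp E (TD B n i) (h n)" if "i < n" for n i
    using h that unfolding tsplit_map_def by blast
  have s: "Comp E (h (n + 1)) (TS A n i) = Comp E (TS B n i) (h n)" if "i \<le> n" for n i
    using h that unfolding tsplit_map_def by blast
  show ?thesis
    unfolding tsplit_map_def tsplit_app_def
  proof (intro conjI allI impI, goal_cases)
    case (1 n) show ?case using is_fctr_hom[OF F hn[of n]] by simp
  next
    case (2 n i) then show ?case
      using c[OF tsplit_ops(2)[OF A] hn, of i n] c[OF hn tsplit_ops(2)[OF B], of i n] d[of i n] by simp
  next
    case (3 n i) then show ?case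
      using c[OF tsplit_ops(3)[OF A] hn, of i n] c[OF hn tsplit_ops(3)[OF B], of i n] s[of i n] by simp
  qed
qed

lemma is_fctr_levelwise:
  assumes E: "category E" and F: "is_fctr E E' F"
  shows "is_fctr (TSplit E) (TSplit E') (levelwise E F)"
  unfolding levelwise_def
proof (rule is_fctrI)
  show "\<And>x. x \<in> Obj (TSplit E) \<Longrightarrow> tsplit_app F x \<in> Obj (TSplit E')"
    using is_tsplit_app[OF F] by (auto simp: TSplit_def)
  fix f assume "f \<in> Arr (TSplit E)"
  then show "(case f of (A, h, B) \<Rightarrow> (tsplit_app F A, \<lambda>n. fa F (h n), tsplit_app F B)) \<in> Arr (TSplit E') \<and>
    Dom (TSplit E') (case f of (A, h, B) \<Rightarrow> (tsplit_app F A, \<lambda>n. fa F (h n), tsplit_app F B))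
      = tsplit_app F (Dom (TSplit E) f) \<and>
    Cod (TSplit E') (case f of (A, h, B) \<Rightarrow> (tsplit_app F A, \<lambda>n. fa F (h n), tsplit_app F B))
      = tsplit_app F (Cod (TSplit E) f)"
    using is_tsplit_app[OF F] tsplit_map_app[OF F] unfolding TSplit_def by (auto elim!: mk_cat_ArrE)
next
  fix A assume "A \<in> Obj (TSplit E)"
  then have "is_tsplit E A" by (simp add: TSplit_def)
  then have "TLev A n \<in> Obj E" for n by (simp add: is_tsplit_def)
  then show "(case Ident (TSplit E) A of (A, h, B) \<Rightarrow> (tsplit_app F A, \<lambda>n. fa F (h n), tsplit_app F B))
    = Ident (TSplit E') (tsplit_app F A)"
    using \<open>is_tsplit E A\<close> is_tsplit_app[OF F] F
    by (simp add: TSplit_def is_fctr_ops) (simp add: tsplit_app_def)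
next
  fix g f assume g: "g \<in> Arr (TSplit E)" and f: "f \<in> Arr (TSplit E)" and "Dom (TSplit E) g = Cod (TSplit E) f"
  then obtain A B C g' f' where *: "f = (A, f', B)" "g = (B, g', C)"
    unfolding TSplit_def by (auto elim!: mk_cat_ArrE)
  have L: "is_tsplit E A" "is_tsplit E B" "is_tsplit E C" "tsplit_map E A B f'" "tsplit_map E B C g'"
    using f g unfolding * TSplit_def by auto
  have m: "(tsplit_app F A, \<lambda>n. fa F (f' n), tsplit_app F B) \<in> Arr (TSplit E')"
    "(tsplit_app F B, \<lambda>n. fa F (g' n), tsplit_app F C) \<in> Arr (TSplit E')"
    using L tsplit_map_app[OF F] is_tsplit_app[OF F] by (auto simp: TSplit_def)
  have "f' n \<in> hom E (TLev A n) (TLev B n)" "g' n \<in> hom E (TLev B n) (TLev C n)" for n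
    using L by (auto simp: tsplit_map_def)
  then have "fa F (Comp E (g' n) (f' n)) = Comp E' (fa F (g' n)) (fa F (f' n))" for n
    using is_fctr_hom_comp[OF F] by blast
  then show "(case Comp (TSplit E) g f of (A, h, B) \<Rightarrow> (tsplit_app F A, \<lambda>n. fa F (h n), tsplit_app F B))
    = Comp (TSplit E') (case g of (A, h, B) \<Rightarrow> (tsplit_app F A, \<lambda>n. fa F (h n), tsplit_app F B))
        (case f of (A, h, B) \<Rightarrow> (tsplit_app F A, \<lambda>n. fa F (h n), tsplit_app F B))"
    using f g m unfolding * TSplit_def by simp
qed (rule category_TSplit[OF E])

section \<open>The free symmetric strict monoidal groupoid\<close>

text \<open>An injective self-map of a finite set is onto, so surjectivity never has to be checked
  for the block permutations below.\<close>

lemma permutes_lessThanI: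
  fixes p :: "nat \<Rightarrow> nat"
  assumes "\<And>k. k < n \<Longrightarrow> p k < n" "\<And>k l. k < n \<Longrightarrow> l < n \<Longrightarrow> p k = p l \<Longrightarrow> k = l"
    and "\<And>k. \<not> k < n \<Longrightarrow> p k = k"
  shows "p permutes {..<n}"
proof (rule bij_imp_permutes)
  have "inj_on p {..<n}" by (rule inj_onI, rule assms(2)) simp_all
  moreover have "p ` {..<n} \<subseteq> {..<n}" using assms(1) by auto
  ultimately show "bij_betw p {..<n} {..<n}" using endo_inj_surj[of "{..<n}" p] by (simp add: bij_betw_def)
  show "p x = x" if "x \<notin> {..<n}" for x using assms(3) that by simp
qed

lemma permutes_lessThanD:
  fixes p :: "nat \<Rightarrow> nat"
  assumes "p permutes {..<n}"
  shows "p k < n \<longleftrightarrow> k < n" "p k = p l \<longleftrightarrow> k = l" "\<not> k < n \<Longrightarrow> p k = k"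
  using assms permutes_in_image[OF assms, of k] permutes_inj[OF assms]
  by (auto simp: inj_eq permutes_def)

lemma perm_cat_Obj [simp]: "Obj (perm_cat A) = lists A"
  by (simp add: perm_cat_def)

lemma perm_cat_Arr:
  "(xs, \<rho>, ys) \<in> Arr (perm_cat A) \<longleftrightarrow> xs \<in> lists A \<and> ys \<in> lists A \<and> length ys = length xs \<and>
     \<rho> permutes {..<length xs} \<and> (\<forall>i < length xs. xs ! i = ys ! \<rho> i)"
  by (auto simp: perm_cat_def)

lemma perm_cat_ops [simp]:
  "(xs, \<rho>, ys) \<in> Arr (perm_cat A) \<Longrightarrow> Dom (perm_cat A) (xs, \<rho>, ys) = xs"
  "(xs, \<rho>, ys) \<in> Arr (perm_cat A) \<Longrightarrow> Cod (perm_cat A) (xs, \<rho>, ys) = ys"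
  "xs \<in> lists A \<Longrightarrow> Ident (perm_cat A) xs = (xs, \<lambda>i. i, xs)"
  "(xs, \<rho>, ys) \<in> Arr (perm_cat A) \<Longrightarrow> (ys, \<tau>, zs) \<in> Arr (perm_cat A) \<Longrightarrow>
     Comp (perm_cat A) (ys, \<tau>, zs) (xs, \<rho>, ys) = (xs, \<tau> \<circ> \<rho>, zs)"
  unfolding perm_cat_def by (simp_all only: mk_cat_ops)

lemma permutes_ident: "(\<lambda>i. i) permutes S"
  by (simp add: permutes_def)

lemma category_perm_cat: "category (perm_cat A)"
  unfolding perm_cat_def
proof (rule category_mk_cat, goal_cases)
  case (2 X Y Z f g)
  then show ?case
    by (auto simp: permutes_compose permutes_lessThanD)
qed (auto simp: permutes_ident)

lemma perm_cat_ident: "xs \<in> lists A \<Longrightarrow> (xs, \<lambda>i. i, xs) \<in> Arr (perm_cat A)"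
  by (simp add: perm_cat_Arr permutes_ident)

lemma perm_cat_inv:
  assumes "(xs, \<rho>, ys) \<in> Arr (perm_cat A)"
  shows "(ys, inv \<rho>, xs) \<in> Arr (perm_cat A)"
proof -
  have p: "\<rho> permutes {..<length ys}" using assms by (auto simp: perm_cat_Arr)
  then show ?thesis
    using assms permutes_inv[OF p] permutes_lessThanD(1)[OF permutes_inv[OF p]]
    by (auto simp: perm_cat_Arr permutes_inverses[OF p])
qed

lemma groupoid_perm_cat: "groupoid (perm_cat A)"
  unfolding groupoid_def
proof (intro conjI ballI category_perm_cat)
  fix f assume f: "f \<in> Arr (perm_cat A)"
  obtain xs \<rho> ys where f_def: "f = (xs, \<rho>, ys)" by (cases f)
  note * = f[unfolded f_def]
  have p: "\<rho> permutes {..<length ys}" using * by (auto simp: perm_cat_Arr)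
  have "(ys, inv \<rho>, xs) \<in> hom (perm_cat A) (Cod (perm_cat A) f) (Dom (perm_cat A) f)"
    using * perm_cat_inv[OF *] by (simp add: f_def hom_def)
  moreover have "xs \<in> lists A" "ys \<in> lists A" using * by (simp_all add: perm_cat_Arr)
  ultimately show "\<exists>g\<in>hom (perm_cat A) (Cod (perm_cat A) f) (Dom (perm_cat A) f).
      Comp (perm_cat A) g f = Ident (perm_cat A) (Dom (perm_cat A) f) \<and>
      Comp (perm_cat A) f g = Ident (perm_cat A) (Cod (perm_cat A) f)"
    using * perm_cat_inv[OF *] permutes_inv_o[OF p]
    by (intro bexI[of _ "(ys, inv \<rho>, xs)"]) (simp_all add: f_def id_def)
qed

lemma perm_sum_permutes:
  assumes "\<rho> permutes {..<m}" "\<tau> permutes {..<n}"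
  shows "perm_sum m \<rho> \<tau> permutes {..<m + n}"
proof (rule permutes_lessThanI)
  have r: "\<And>k. \<rho> k < m \<longleftrightarrow> k < m" "\<And>k l. \<rho> k = \<rho> l \<longleftrightarrow> k = l"
    and t: "\<And>k. \<tau> k < n \<longleftrightarrow> k < n" "\<And>k l. \<tau> k = \<tau> l \<longleftrightarrow> k = l" "\<And>k. \<not> k < n \<Longrightarrow> \<tau> k = k"
    using permutes_lessThanD[OF assms(1)] permutes_lessThanD[OF assms(2)] by auto
  show "perm_sum m \<rho> \<tau> k < m + n" if "k < m + n" for k
    using that r(1)[of k] t(1)[of "k - m"] by (auto simp: perm_sum_def)
  show "k = l" if "k < m + n" "l < m + n" "perm_sum m \<rho> \<tau> k = perm_sum m \<rho> \<tau> l" for k l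
    using that r(1)[of k] r(1)[of l] r(2)[of k l] t(2)[of "k - m" "l - m"]
    by (auto simp: perm_sum_def split: if_splits)
  show "perm_sum m \<rho> \<tau> k = k" if "\<not> k < m + n" for k
    using that t(3)[of "k - m"] by (auto simp: perm_sum_def)
qed

lemma perm_sum_Arr:
  assumes "(xs, \<rho>, ys) \<in> Arr (perm_cat A)" "(xs', \<rho>', ys') \<in> Arr (perm_cat A)"
  shows "(xs @ xs', perm_sum (length xs) \<rho> \<rho>', ys @ ys') \<in> Arr (perm_cat A)"
proof -
  have p: "\<rho> permutes {..<length ys}" "\<rho>' permutes {..<length ys'}" using assms by (auto simp: perm_cat_Arr)
  show ?thesis
    using assms perm_sum_permutes[OF p] permutes_lessThanD(1)[OF p(1)]
    by (auto simp: perm_cat_Arr nth_append perm_sum_def)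
qed

lemma perm_sum_comp:
  assumes "\<rho> permutes {..<m}"
  shows "perm_sum m \<sigma> \<sigma>' \<circ> perm_sum m \<rho> \<rho>' = perm_sum m (\<sigma> \<circ> \<rho>) (\<sigma>' \<circ> \<rho>')"
  using permutes_lessThanD(1)[OF assms] by (auto simp: perm_sum_def fun_eq_iff)

lemma perm_sum_ident: "perm_sum m (\<lambda>i. i) (\<lambda>i. i) = (\<lambda>i. i)"
  by (auto simp: perm_sum_def fun_eq_iff)

lemma block_swap_Arr:
  "xs \<in> lists A \<Longrightarrow> ys \<in> lists A \<Longrightarrow>
     (xs @ ys, block_swap (length xs) (length ys), ys @ xs) \<in> Arr (perm_cat A)"
  by (auto simp: perm_cat_Arr nth_append block_swap_def intro!: permutes_lessThanI split: if_splits)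

lemma SS_simps [simp]:
  "Gpd (SS A) = perm_cat A" "Unit (SS A) = []"
  "xs \<in> lists A \<Longrightarrow> ys \<in> lists A \<Longrightarrow> tob (SS A) xs ys = xs @ ys"
  "(xs, \<rho>, ys) \<in> Arr (perm_cat A) \<Longrightarrow> (xs', \<rho>', ys') \<in> Arr (perm_cat A) \<Longrightarrow>
     tar (SS A) (xs, \<rho>, ys) (xs', \<rho>', ys') = (xs @ xs', perm_sum (length xs) \<rho> \<rho>', ys @ ys')"
  "xs \<in> lists A \<Longrightarrow> ys \<in> lists A \<Longrightarrow>
     Sym (SS A) (xs, ys) = (xs @ ys, block_swap (length xs) (length ys), ys @ xs)"
  by (simp_all add: SS_def prod_cat_def)

lemma is_fctr_Tens_SS: "is_fctr (prod_cat (perm_cat A) (perm_cat A)) (perm_cat A) (Tens (SS A))"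
  unfolding SS_def smg.simps
proof (rule is_fctrI)
  let ?b = "\<lambda>((xs, \<rho>, ys), (xs', \<rho>', ys')). (xs @ xs', perm_sum (length xs) \<rho> \<rho>', ys @ ys')"
  show "category (prod_cat (perm_cat A) (perm_cat A))"
    by (simp add: category_perm_cat category_prod_cat)
  show "(case x of (xs, xs') \<Rightarrow> xs @ xs') \<in> Obj (perm_cat A)"
    if "x \<in> Obj (prod_cat (perm_cat A) (perm_cat A))" for x
    using that by (auto simp: prod_cat_def)
  show "?b (Ident (prod_cat (perm_cat A) (perm_cat A)) x)
      = Ident (perm_cat A) (case x of (xs, xs') \<Rightarrow> xs @ xs')"
    if "x \<in> Obj (prod_cat (perm_cat A) (perm_cat A))" for x
    using that by (cases x) (simp add: prod_cat_def perm_sum_ident)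
next
  let ?b = "\<lambda>((xs, \<rho>, ys), (xs', \<rho>', ys')). (xs @ xs', perm_sum (length xs) \<rho> \<rho>', ys @ ys')"
  fix f assume "f \<in> Arr (prod_cat (perm_cat A) (perm_cat A))"
  then show "?b f \<in> Arr (perm_cat A) \<and>
    Dom (perm_cat A) (?b f)
      = (case Dom (prod_cat (perm_cat A) (perm_cat A)) f of (xs, xs') \<Rightarrow> xs @ xs') \<and>
    Cod (perm_cat A) (?b f)
      = (case Cod (prod_cat (perm_cat A) (perm_cat A)) f of (xs, xs') \<Rightarrow> xs @ xs')"
    by (auto simp: prod_cat_def perm_sum_Arr)
next
  let ?b = "\<lambda>((xs, \<rho>, ys), (xs', \<rho>', ys')). (xs @ xs', perm_sum (length xs) \<rho> \<rho>', ys @ ys')"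
  fix g f
  assume "g \<in> Arr (prod_cat (perm_cat A) (perm_cat A))" "f \<in> Arr (prod_cat (perm_cat A) (perm_cat A))"
    "Dom (prod_cat (perm_cat A) (perm_cat A)) g = Cod (prod_cat (perm_cat A) (perm_cat A)) f"
  then obtain xs \<rho> ys \<sigma> zs xs' \<rho>' ys' \<sigma>' zs' where
    *: "f = ((xs, \<rho>, ys), (xs', \<rho>', ys'))" "g = ((ys, \<sigma>, zs), (ys', \<sigma>', zs'))"
      "(xs, \<rho>, ys) \<in> Arr (perm_cat A)" "(xs', \<rho>', ys') \<in> Arr (perm_cat A)"
      "(ys, \<sigma>, zs) \<in> Arr (perm_cat A)" "(ys', \<sigma>', zs') \<in> Arr (perm_cat A)"
    by (auto simp: prod_cat_def)
  have "\<rho> permutes {..<length xs}" "length xs = length ys" using *(3) by (auto simp: perm_cat_Arr)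
  then show "?b (Comp (prod_cat (perm_cat A) (perm_cat A)) g f)
      = Comp (perm_cat A) (?b g) (?b f)"
    using perm_sum_Arr[OF *(3,4)] perm_sum_Arr[OF *(5,6)] *(3-6)
    by (simp add: * prod_cat_def perm_sum_comp)
qed

text \<open>With concatenation as tensor product, each axiom on arrows becomes an identity between
  block permutations, verified position by position.\<close>

lemma is_smg_SS: "is_smg (SS A)"
  unfolding is_smg_def SS_simps(1,2)
proof (intro conjI ballI)
  fix f g assume "f \<in> Arr (perm_cat A)" "g \<in> Arr (perm_cat A)"
  moreover obtain xs \<rho> ys xs' \<rho>' ys' where fg: "f = (xs, \<rho>, ys)" "g = (xs', \<rho>', ys')" by (cases f, cases g)
  ultimately have *: "(xs, \<rho>, ys) \<in> Arr (perm_cat A)" "(xs', \<rho>', ys') \<in> Arr (perm_cat A)"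
    and l: "xs \<in> lists A" "ys \<in> lists A" "xs' \<in> lists A" "ys' \<in> lists A" "length xs = length ys"
      "length xs' = length ys'"
    and p: "\<rho> permutes {..<length xs}" "\<rho>' permutes {..<length xs'}"
    by (auto simp: perm_cat_Arr)
  have "block_swap (length ys) (length ys') \<circ> perm_sum (length xs) \<rho> \<rho>'
      = perm_sum (length xs') \<rho>' \<rho> \<circ> block_swap (length xs) (length xs')"
    using permutes_lessThanD[OF p(1)] permutes_lessThanD[OF p(2)] l
    by (auto simp: fun_eq_iff perm_sum_def block_swap_def)
  then show "Comp (perm_cat A) (Sym (SS A) (Cod (perm_cat A) f, Cod (perm_cat A) g)) (tar (SS A) f g)
      = Comp (perm_cat A) (tar (SS A) g f) (Sym (SS A) (Dom (perm_cat A) f, Dom (perm_cat A) g))"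
    using * l perm_sum_Arr[OF *] perm_sum_Arr[OF *(2,1)] block_swap_Arr[OF l(1,3)] block_swap_Arr[OF l(2,4)]
    unfolding fg by simp
  fix h assume "h \<in> Arr (perm_cat A)"
  moreover obtain xs'' \<rho>'' ys'' where h: "h = (xs'', \<rho>'', ys'')" by (cases h)
  ultimately have **: "(xs'', \<rho>'', ys'') \<in> Arr (perm_cat A)" by simp
  have "perm_sum (length xs + length xs') (perm_sum (length xs) \<rho> \<rho>') \<rho>''
      = perm_sum (length xs) \<rho> (perm_sum (length xs') \<rho>' \<rho>'')"
    by (auto simp: fun_eq_iff perm_sum_def)
  then show "tar (SS A) (tar (SS A) f g) h = tar (SS A) f (tar (SS A) g h)"
    using * ** perm_sum_Arr[OF *] perm_sum_Arr[OF *(2) **] unfolding fg h by simp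
next
  fix f assume "f \<in> Arr (perm_cat A)"
  moreover obtain xs \<rho> ys where f: "f = (xs, \<rho>, ys)" by (cases f)
  ultimately have *: "(xs, \<rho>, ys) \<in> Arr (perm_cat A)" by simp
  have "perm_sum 0 (\<lambda>i. i) \<rho> = \<rho>" "perm_sum (length xs) \<rho> (\<lambda>i. i) = \<rho>"
    using * permutes_lessThanD(3)[of \<rho> "length xs"] by (auto simp: fun_eq_iff perm_sum_def perm_cat_Arr)
  then show "tar (SS A) (Ident (perm_cat A) []) f = f" "tar (SS A) f (Ident (perm_cat A) []) = f"
    using * perm_cat_ident[of "[]" A] unfolding f by simp_all
next
  fix xs ys assume *: "xs \<in> Obj (perm_cat A)" "ys \<in> Obj (perm_cat A)"
  have "block_swap (length ys) (length xs) \<circ> block_swap (length xs) (length ys) = (\<lambda>i. i)"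
    by (auto simp: fun_eq_iff block_swap_def)
  then show "Comp (perm_cat A) (Sym (SS A) (ys, xs)) (Sym (SS A) (xs, ys)) = Ident (perm_cat A) (tob (SS A) xs ys)"
    using * block_swap_Arr[of xs A ys] block_swap_Arr[of ys A xs] by simp
  fix zs assume **: "zs \<in> Obj (perm_cat A)"
  have "perm_sum (length ys) (\<lambda>i. i) (block_swap (length xs) (length zs))
      \<circ> perm_sum (length xs + length ys) (block_swap (length xs) (length ys)) (\<lambda>i. i)
      = block_swap (length xs) (length ys + length zs)"
    by (auto simp: fun_eq_iff block_swap_def perm_sum_def)
  then show "Sym (SS A) (xs, tob (SS A) ys zs)
      = Comp (perm_cat A) (tar (SS A) (Ident (perm_cat A) ys) (Sym (SS A) (xs, zs)))
          (tar (SS A) (Sym (SS A) (xs, ys)) (Ident (perm_cat A) zs))"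
    using * ** block_swap_Arr[of xs A ys] block_swap_Arr[of xs A zs] perm_cat_ident[of ys A] perm_cat_ident[of zs A]
      perm_sum_Arr[OF perm_cat_ident[of ys A] block_swap_Arr[of xs A zs]]
      perm_sum_Arr[OF block_swap_Arr[of xs A ys] perm_cat_ident[of zs A]]
    by simp
next
  show "Sym (SS A) \<in> Obj (perm_cat A) \<times> Obj (perm_cat A) \<rightarrow>\<^sub>E Arr (perm_cat A)"
    using block_swap_Arr[of _ A] by (auto simp: SS_def)
qed (auto simp: groupoid_perm_cat is_fctr_Tens_SS block_swap_Arr hom_def)

section \<open>Symmetric strict monoidal functors and their category\<close>

lemma mon_fctr_ops:
  assumes "mon_fctr M N F"
  shows "is_fctr (Gpd M) (Gpd N) F" "fo F (Unit M) = Unit N"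
    "x \<in> Obj (Gpd M) \<Longrightarrow> y \<in> Obj (Gpd M) \<Longrightarrow> fo F (tob M x y) = tob N (fo F x) (fo F y)"
    "f \<in> Arr (Gpd M) \<Longrightarrow> g \<in> Arr (Gpd M) \<Longrightarrow> fa F (tar M f g) = tar N (fa F f) (fa F g)"
    "x \<in> Obj (Gpd M) \<Longrightarrow> y \<in> Obj (Gpd M) \<Longrightarrow> fa F (Sym M (x, y)) = Sym N (fo F x, fo F y)"
  using assms by (auto simp: mon_fctr_def)

lemma is_smg_ops:
  assumes "is_smg M"
  shows "category (Gpd M)" "is_fctr (prod_cat (Gpd M) (Gpd M)) (Gpd M) (Tens M)" "Unit M \<in> Obj (Gpd M)"
    "x \<in> Obj (Gpd M) \<Longrightarrow> y \<in> Obj (Gpd M) \<Longrightarrow> Sym M (x, y) \<in> Arr (Gpd M)"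
proof -
  have "groupoid (Gpd M)" and t: "is_fctr (prod_cat (Gpd M) (Gpd M)) (Gpd M) (Tens M)"
    and u: "Unit M \<in> Obj (Gpd M)" and s: "Sym M \<in> Obj (Gpd M) \<times> Obj (Gpd M) \<rightarrow>\<^sub>E Arr (Gpd M)"
    using assms unfolding is_smg_def by - (elim conjE, assumption)+
  then show "category (Gpd M)" by (simp add: groupoid_def)
  show "is_fctr (prod_cat (Gpd M) (Gpd M)) (Gpd M) (Tens M)" by (rule t)
  show "Unit M \<in> Obj (Gpd M)" by (rule u)
  show "x \<in> Obj (Gpd M) \<Longrightarrow> y \<in> Obj (Gpd M) \<Longrightarrow> Sym M (x, y) \<in> Arr (Gpd M)" using s by auto
qed

lemma smg_tensor:
  assumes "is_smg M"
  shows "x \<in> Obj (Gpd M) \<Longrightarrow> y \<in> Obj (Gpd M) \<Longrightarrow> tob M x y \<in> Obj (Gpd M)"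
    "f \<in> hom (Gpd M) x y \<Longrightarrow> f' \<in> hom (Gpd M) x' y' \<Longrightarrow> tar M f f' \<in> hom (Gpd M) (tob M x x') (tob M y y')"
    "f \<in> hom (Gpd M) x y \<Longrightarrow> g \<in> hom (Gpd M) y z \<Longrightarrow> f' \<in> hom (Gpd M) x' y' \<Longrightarrow> g' \<in> hom (Gpd M) y' z' \<Longrightarrow>
       tar M (Comp (Gpd M) g f) (Comp (Gpd M) g' f') = Comp (Gpd M) (tar M g g') (tar M f f')"
proof -
  note T = is_smg_ops(2)[OF assms]
  show "x \<in> Obj (Gpd M) \<Longrightarrow> y \<in> Obj (Gpd M) \<Longrightarrow> tob M x y \<in> Obj (Gpd M)"
    using is_fctr_ops(1)[OF T, of "(x, y)"] by (simp add: prod_cat_def)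
  have h: "(f, f') \<in> hom (prod_cat (Gpd M) (Gpd M)) (x, x') (y, y')"
    if "f \<in> hom (Gpd M) x y" "f' \<in> hom (Gpd M) x' y'" for f f' x x' y y'
    using that by (auto simp: hom_def prod_cat_def)
  show "f \<in> hom (Gpd M) x y \<Longrightarrow> f' \<in> hom (Gpd M) x' y' \<Longrightarrow> tar M f f' \<in> hom (Gpd M) (tob M x x') (tob M y y')"
    using is_fctr_hom[OF T h] .
  show "f \<in> hom (Gpd M) x y \<Longrightarrow> g \<in> hom (Gpd M) y z \<Longrightarrow> f' \<in> hom (Gpd M) x' y' \<Longrightarrow> g' \<in> hom (Gpd M) y' z' \<Longrightarrow>
       tar M (Comp (Gpd M) g f) (Comp (Gpd M) g' f') = Comp (Gpd M) (tar M g g') (tar M f f')"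
    using is_fctr_hom_comp[OF T h h, of f x y f' x' y' g z g' z']
    by (auto simp: prod_cat_def hom_def)
qed

lemma mon_fctr_fid:
  assumes "is_smg M"
  shows "mon_fctr M M (fid (Gpd M))"
proof -
  note c = is_smg_ops[OF assms]
  have "tar M f g \<in> Arr (Gpd M)" if "f \<in> Arr (Gpd M)" "g \<in> Arr (Gpd M)" for f g
    using smg_tensor(2)[OF assms, of f _ _ g] that by (auto simp: hom_def)
  then show ?thesis
    using c smg_tensor(1)[OF assms] by (auto simp: mon_fctr_def is_fctr_fid)
qed

lemma mon_fctr_fcomp:
  assumes M: "is_smg M" and F: "mon_fctr M N F" and G: "mon_fctr N K G"
  shows "mon_fctr M K (fcomp (Gpd M) G F)"
proof -
  note c = is_smg_ops[OF M]
  have "tar M f g \<in> Arr (Gpd M)" if "f \<in> Arr (Gpd M)" "g \<in> Arr (Gpd M)" for f g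
    using smg_tensor(2)[OF M, of f _ _ g] that by (auto simp: hom_def)
  then show ?thesis
    using c smg_tensor(1)[OF M] mon_fctr_ops[OF F] mon_fctr_ops[OF G] is_fctr_ops[OF mon_fctr_ops(1)[OF F]]
    by (auto simp: mon_fctr_def is_fctr_fcomp)
qed

lemma category_SMGp: "category SMGp"
  unfolding SMGp_def
  by (rule category_mk_cat)
    (auto simp: mon_fctr_fid mon_fctr_fcomp is_smg_ops fcomp_fid fid_fcomp mon_fctr_ops(1)
      intro!: fcomp_assoc dest: mon_fctr_ops(1))

lemma SMGp_Obj [simp]: "Obj SMGp = {M. is_smg M}"
  by (simp add: SMGp_def)

lemma SMGp_hom: "u \<in> hom SMGp M N \<longleftrightarrow> (\<exists>F. u = (M, F, N) \<and> is_smg M \<and> is_smg N \<and> mon_fctr M N F)"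
  by (auto simp: SMGp_def mk_cat_hom)

lemma SMGp_ops [simp]:
  "is_smg M \<Longrightarrow> Ident SMGp M = (M, fid (Gpd M), M)"
  "(M, F, N) \<in> hom SMGp M N \<Longrightarrow> (N, G, K) \<in> hom SMGp N K \<Longrightarrow>
     Comp SMGp (N, G, K) (M, F, N) = (M, fcomp (Gpd M) G F, K)"
  unfolding SMGp_def by (auto simp: hom_def)

section \<open>Block permutations and the free extension\<close>

text \<open>The flattened index of entry \<open>a\<close> of block \<open>b\<close>, for consecutive
  blocks of sizes \<open>ns\<close>. Nothing asks \<open>a\<close> to lie inside the block, so
  \<open>pos ns b 0\<close> is the start of block \<open>b\<close> and
  \<open>pos ns (Suc b) 0\<close> its end.\<close>

definition pos :: "nat list \<Rightarrow> nat \<Rightarrow> nat \<Rightarrow> nat" where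
  "pos ns b a = sum_list (take b ns) + a"

text \<open>Inverse to \<open>pos\<close> on positions that lie in some block. Beyond the blocks its
  value is a mere default, which is why \<open>blk_perm\<close> tests the range first.\<close>

fun unpos :: "nat list \<Rightarrow> nat \<Rightarrow> nat \<times> nat" where
  "unpos [] k = (0, k)"
| "unpos (n # ns) k = (if k < n then (0, k) else map_prod Suc id (unpos ns (k - n)))"

lemma pos_Cons: "pos (n # ns) b a = (case b of 0 \<Rightarrow> a | Suc b' \<Rightarrow> n + pos ns b' a)"
  by (simp add: pos_def split: nat.split)

lemma unpos_pos: "b < length ns \<Longrightarrow> a < ns ! b \<Longrightarrow> unpos ns (pos ns b a) = (b, a)"
  by (induction ns arbitrary: b) (auto simp: pos_Cons split: nat.split)

lemma pos_less: "b < length ns \<Longrightarrow> a < ns ! b \<Longrightarrow> pos ns b a < sum_list ns"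
  by (induction ns arbitrary: b) (fastforce simp: pos_Cons split: nat.split)+

lemma pos_exhaust: "k < sum_list ns \<Longrightarrow> \<exists>b a. k = pos ns b a \<and> b < length ns \<and> a < ns ! b"
proof (induction ns arbitrary: k)
  case (Cons n ns)
  show ?case
  proof (cases "k < n")
    case True
    then show ?thesis by (intro exI[of _ 0] exI[of _ k]) (simp add: pos_Cons)
  next
    case False
    then have "k - n < sum_list ns" using Cons.prems by auto
    from Cons.IH[OF this] obtain b a where "k - n = pos ns b a" "b < length ns" "a < ns ! b"
      by (elim exE conjE)
    then show ?thesis using False by (intro exI[of _ "Suc b"] exI[of _ a]) (simp add: pos_Cons)
  qed
qed simp

lemma pos_cases:
  assumes "k < sum_list ns"
  obtains b a where "k = pos ns b a" "b < length ns" "a < ns ! b"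
  using pos_exhaust[OF assms] by (elim exE conjE)

lemma pos_inject:
  assumes "pos ns b a = pos ns b' a'" "b < length ns" "a < ns ! b" "b' < length ns" "a' < ns ! b'"
  shows "b = b' \<and> a = a'"
  using unpos_pos[OF assms(2,3), unfolded assms(1)] unpos_pos[OF assms(4,5)] by simp

lemma pos_append:
  "pos (ns @ ns') b a = (if b < length ns then pos ns b a else sum_list ns + pos ns' (b - length ns) a)"
  by (auto simp: pos_def)

lemma pos_ones: "b < length xs \<Longrightarrow> pos (map (\<lambda>_. Suc 0) xs) b 0 = b"
  by (simp add: pos_def take_map sum_list_triv)

text \<open>Associativity of flattening: in a list of lists of blocks, the two outer indices or the
  two inner indices may be merged first. This is the arithmetic content of the cocycle condition on
  \<beta>.\<close>

lemma pos_concat: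
  assumes "i < length nss" "b < length (nss ! i)"
  shows "pos (concat nss) (pos (map length nss) i b) a = pos (map sum_list nss) i (pos (nss ! i) b a)"
  using assms
proof (induction nss arbitrary: i)
  case (Cons ns nss)
  then show ?case
    by (cases i) (auto simp: pos_Cons pos_append)
qed simp

lemma nth_concat_pos:
  "b < length xss \<Longrightarrow> a < length (xss ! b) \<Longrightarrow> concat xss ! pos (map length xss) b a = xss ! b ! a"
  by (induction xss arbitrary: b) (auto simp: pos_Cons nth_append split: nat.split)

text \<open>The permutation sending the \<open>a\<close>-th position of the \<open>b\<close>-th block (of sizes \<open>ns\<close>) to the
  \<open>R b a\<close>-th position of the \<open>\<rho> b\<close>-th block (of sizes \<open>ms\<close>).\<close>

definition blk_perm :: "nat list \<Rightarrow> nat list \<Rightarrow> (nat \<Rightarrow> nat) \<Rightarrow> (nat \<Rightarrow> nat \<Rightarrow> nat) \<Rightarrow> nat \<Rightarrow> nat" where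
  "blk_perm ns ms \<rho> R k =
     (if k < sum_list ns then case unpos ns k of (b, a) \<Rightarrow> pos ms (\<rho> b) (R b a) else k)"

lemma blk_perm_pos [simp]:
  "b < length ns \<Longrightarrow> a < ns ! b \<Longrightarrow> blk_perm ns ms \<rho> R (pos ns b a) = pos ms (\<rho> b) (R b a)"
  by (simp add: blk_perm_def pos_less unpos_pos)

lemma blk_perm_outside: "\<not> k < sum_list ns \<Longrightarrow> blk_perm ns ms \<rho> R k = k"
  by (simp add: blk_perm_def)

lemma blk_eqI:
  assumes "\<And>b a. b < length ns \<Longrightarrow> a < ns ! b \<Longrightarrow> f (pos ns b a) = g (pos ns b a)"
    and "\<And>k. \<not> k < sum_list ns \<Longrightarrow> f k = g k"
  shows "f = g"
  using assms by (metis pos_cases ext)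

text \<open>The situation in which \<open>blk_perm ns ms \<rho> R\<close> really is a permutation:
  block \<open>b\<close> moves to an equally long block \<open>\<rho> b\<close> after being permuted
  internally by \<open>R b\<close>.\<close>

locale blk =
  fixes ns ms :: "nat list" and \<rho> :: "nat \<Rightarrow> nat" and R :: "nat \<Rightarrow> nat \<Rightarrow> nat"
  assumes len: "length ms = length ns" and perm: "\<rho> permutes {..<length ns}"
    and nth: "\<And>b. b < length ns \<Longrightarrow> ms ! \<rho> b = ns ! b"
    and R: "\<And>b. b < length ns \<Longrightarrow> R b permutes {..<ns ! b}"
begin

lemma sum: "sum_list ms = sum_list ns"
proof -
  have "sum_list ms = (\<Sum>b<length ns. ms ! b)"
    by (simp add: sum_list_sum_nth len lessThan_atLeast0)
  also have "\<dots> = (\<Sum>b<length ns. ms ! \<rho> b)" by (rule sum.permute[OF perm, unfolded comp_def])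
  also have "\<dots> = sum_list ns" by (simp add: nth sum_list_sum_nth lessThan_atLeast0)
  finally show ?thesis .
qed

lemma in_range:
  assumes "b < length ns" "a < ns ! b"
  shows "\<rho> b < length ms" "R b a < ms ! \<rho> b"
  using assms permutes_lessThanD(1)[OF perm] permutes_lessThanD(1)[OF R] by (auto simp: len nth)

lemma permutes: "blk_perm ns ms \<rho> R permutes {..<sum_list ns}"
proof (rule permutes_lessThanI)
  show "blk_perm ns ms \<rho> R k < sum_list ns" if "k < sum_list ns" for k
    using that by (rule pos_cases) (auto simp: in_range pos_less simp flip: sum)
  show "k = l" if kl: "k < sum_list ns" "l < sum_list ns" "blk_perm ns ms \<rho> R k = blk_perm ns ms \<rho> R l" for k l
  proof -
    obtain b a b' a' where *: "k = pos ns b a" "b < length ns" "a < ns ! b"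
      "l = pos ns b' a'" "b' < length ns" "a' < ns ! b'"
      using pos_exhaust[OF kl(1)] pos_exhaust[OF kl(2)] by (elim exE conjE)
    then have "\<rho> b = \<rho> b' \<and> R b a = R b' a'"
      using kl(3) in_range[of b a] in_range[of b' a'] by (auto dest: pos_inject)
    then have "b = b'" "R b a = R b a'" using permutes_lessThanD(2)[OF perm] by auto
    then show ?thesis using * permutes_lessThanD(2)[OF R] by auto
  qed
qed (simp add: blk_perm_outside)

end

text \<open>The first factor keeps every position inside a block of \<open>ms\<close>, where the
  second factor can be evaluated by \<open>blk_perm_pos\<close>; hence the block hypotheses on the
  first factor suffice.\<close>

lemma blk_perm_comp:
  assumes "blk ns ms \<rho> R"
  shows "blk_perm ms ls \<tau> S \<circ> blk_perm ns ms \<rho> R = blk_perm ns ls (\<tau> \<circ> \<rho>) (\<lambda>b. S (\<rho> b) \<circ> R b)"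
proof -
  interpret blk ns ms \<rho> R by fact
  show ?thesis
    by (rule blk_eqI[of ns]) (auto simp: in_range blk_perm_outside sum)
qed

lemma blk_perm_cong:
  assumes "\<And>b. b < length ns \<Longrightarrow> \<rho> b = \<rho>' b" "\<And>b a. b < length ns \<Longrightarrow> a < ns ! b \<Longrightarrow> R b a = R' b a"
  shows "blk_perm ns ms \<rho> R = blk_perm ns ms \<rho>' R'"
  by (rule blk_eqI[of ns]) (simp_all add: assms blk_perm_outside)

lemma blk_perm_ident: "blk_perm ns ns (\<lambda>i. i) (\<lambda>_ i. i) = (\<lambda>i. i)"
  by (rule blk_eqI[of ns]) (simp_all add: blk_perm_outside)

lemma blk_perm_ones:
  assumes "\<rho> permutes {..<length xs}" "length ys = length xs"
  shows "blk_perm (map (\<lambda>_. Suc 0) xs) (map (\<lambda>_. Suc 0) ys) \<rho> (\<lambda>_ i. i) = \<rho>"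
proof (rule blk_eqI[of "map (\<lambda>_. Suc 0) xs"])
  fix b a assume "b < length (map (\<lambda>_. Suc 0) xs)" "a < map (\<lambda>_. Suc 0) xs ! b"
  then have b: "b < length xs" "a = 0" by auto
  then have "blk_perm (map (\<lambda>_. Suc 0) xs) (map (\<lambda>_. Suc 0) ys) \<rho> (\<lambda>_ i. i) (pos (map (\<lambda>_. Suc 0) xs) b a)
      = pos (map (\<lambda>_. Suc 0) ys) (\<rho> b) a" by (subst blk_perm_pos) auto
  then show "blk_perm (map (\<lambda>_. Suc 0) xs) (map (\<lambda>_. Suc 0) ys) \<rho> (\<lambda>_ i. i) (pos (map (\<lambda>_. Suc 0) xs) b a)
      = \<rho> (pos (map (\<lambda>_. Suc 0) xs) b a)"
    using b assms permutes_lessThanD(1)[OF assms(1), of b] by (simp add: pos_ones)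
qed (use permutes_lessThanD(3)[OF assms(1)] in \<open>auto simp: blk_perm_outside sum_list_triv\<close>)

text \<open>The identity behind compatibility with the tensor product, both for extended functors
  and for extended transformations.\<close>

lemma blk_perm_append:
  assumes "blk ns ms \<rho> R" "blk ns' ms' \<rho>' R'"
  shows "blk_perm (ns @ ns') (ms @ ms') (perm_sum (length ns) \<rho> \<rho>')
           (\<lambda>b. if b < length ns then R b else R' (b - length ns))
         = perm_sum (sum_list ns) (blk_perm ns ms \<rho> R) (blk_perm ns' ms' \<rho>' R')"
proof -
  interpret a: blk ns ms \<rho> R by fact
  interpret b: blk ns' ms' \<rho>' R' by fact
  show ?thesis
  proof (rule blk_eqI[of "ns @ ns'"], goal_cases)
    case (1 b a)
    then show ?case
      using a.in_range[of b a] b.in_range[of "b - length ns" a] pos_less[of b ns a]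
      by (simp, simp add: pos_append perm_sum_def nth_append a.len a.sum split: if_splits)
  next
    case (2 k)
    then show ?case by (auto simp: blk_perm_outside perm_sum_def)
  qed
qed

text \<open>The identity behind preservation of the symmetry: exchanging two groups of whole blocks
  only sees their total lengths.\<close>

lemma blk_perm_swap:
  "blk_perm (ns @ ns') (ns' @ ns) (block_swap (length ns) (length ns')) (\<lambda>_ i. i)
   = block_swap (sum_list ns) (sum_list ns')"
proof (rule blk_eqI[of "ns @ ns'"], goal_cases)
  case (1 b a)
  then have "b - length ns < length ns'" if "\<not> b < length ns" using that by auto
  with 1 show ?case
    using pos_less[of b ns a] pos_less[of "b - length ns" ns' a]
    by (cases "b < length ns") (simp_all, simp_all add: pos_append block_swap_def nth_append)
next
  case (2 k)
  then show ?case by (auto simp: blk_perm_outside block_swap_def)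
qed

section \<open>Strict monoidal functors out of a free groupoid\<close>

abbreviation lens :: "('g \<Rightarrow> 'h list) \<Rightarrow> 'g list \<Rightarrow> nat list" where
  "lens \<phi> xs \<equiv> map (\<lambda>x. length (\<phi> x)) xs"

lemma blk_Arr:
  assumes xy: "(xs, \<rho>, ys) \<in> Arr (perm_cat A)"
    and R: "\<And>b. b < length xs \<Longrightarrow> (\<phi> (xs ! b), R b, \<psi> (xs ! b)) \<in> Arr (perm_cat B)"
  shows "blk (lens \<phi> xs) (lens \<psi> ys) \<rho> R"
proof
  have l: "length ys = length xs" "\<rho> permutes {..<length xs}" "\<And>i. i < length xs \<Longrightarrow> ys ! \<rho> i = xs ! i"
    using xy by (auto simp: perm_cat_Arr)
  show "length (lens \<psi> ys) = length (lens \<phi> xs)" "\<rho> permutes {..<length (lens \<phi> xs)}" using l by simp_all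
  fix b assume b: "b < length (lens \<phi> xs)"
  then show "R b permutes {..<lens \<phi> xs ! b}" "lens \<psi> ys ! \<rho> b = lens \<phi> xs ! b"
    using R[of b] l permutes_lessThanD(1)[OF l(2), of b] by (simp_all add: perm_cat_Arr)
qed

lemma blk_perm_Arr:
  assumes xy: "(xs, \<rho>, ys) \<in> Arr (perm_cat A)"
    and Rx: "\<And>b. b < length xs \<Longrightarrow> (\<phi> (xs ! b), R b, \<psi> (xs ! b)) \<in> Arr (perm_cat B)"
  shows "(concat (map \<phi> xs), blk_perm (lens \<phi> xs) (lens \<psi> ys) \<rho> R, concat (map \<psi> ys)) \<in> Arr (perm_cat B)"
proof -
  interpret blk "lens \<phi> xs" "lens \<psi> ys" \<rho> R using assms by (rule blk_Arr)
  have l: "length xs = length ys" and nth: "\<And>i. i < length xs \<Longrightarrow> xs ! i = ys ! \<rho> i"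
    using xy by (auto simp: perm_cat_Arr)
  have "set (\<phi> (xs ! b)) \<subseteq> B \<and> set (\<psi> (xs ! b)) \<subseteq> B" if "b < length xs" for b
    using Rx[OF that] by (auto simp: perm_cat_Arr)
  then have "\<forall>x \<in> set xs. set (\<phi> x) \<subseteq> B \<and> set (\<psi> x) \<subseteq> B" by (metis in_set_conv_nth)
  \<comment> \<open>The hypothesis speaks of entries of \<open>xs\<close>, whereas
    \<open>concat (map \<psi> ys)\<close> needs those of \<open>ys\<close>; the two lists differ by
    the permutation \<open>\<rho>\<close>.\<close>
  moreover have "set ys = set xs"
    using xy permutes_lessThanD(1)[of \<rho> "length xs"] permutes_image[of \<rho> "{..<length xs}"]
    by (auto simp: perm_cat_Arr set_conv_nth) (metis imageE lessThan_iff)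
  ultimately have "concat (map \<phi> xs) \<in> lists B" "concat (map \<psi> ys) \<in> lists B"
    unfolding in_lists_conv_set set_concat set_map by blast+
  moreover have "concat (map \<phi> xs) ! i = concat (map \<psi> ys) ! blk_perm (lens \<phi> xs) (lens \<psi> ys) \<rho> R i"
    if i: "i < sum_list (lens \<phi> xs)" for i
  proof -
    obtain b a where *: "i = pos (lens \<phi> xs) b a" "b < length xs" "a < length (\<phi> (xs ! b))"
      using i by (rule pos_cases) auto
    then have "concat (map \<phi> xs) ! i = \<phi> (xs ! b) ! a"
      using nth_concat_pos[of b "map \<phi> xs" a] by (simp add: comp_def)
    also have "\<dots> = \<psi> (xs ! b) ! R b a" using Rx[OF *(2)] * by (simp add: perm_cat_Arr)
    also have "\<dots> = map \<psi> ys ! \<rho> b ! R b a" using in_range[of b a] * nth l by simp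
    also have "\<dots> = concat (map \<psi> ys) ! pos (lens \<psi> ys) (\<rho> b) (R b a)"
      using in_range[of b a] * nth_concat_pos[of "\<rho> b" "map \<psi> ys" "R b a"] by (simp add: comp_def)
    finally show ?thesis using * by simp
  qed
  ultimately show ?thesis using permutes sum by (simp add: perm_cat_Arr length_concat comp_def)
qed

text \<open>The explicit form of \<open>free_ext\<close> between free groupoids: a permutation of
  the generators moves whole blocks and permutes nothing inside them.\<close>

definition ext_fctr :: "'g set \<Rightarrow> ('g \<Rightarrow> 'h list) \<Rightarrow> ('g list, 'g sarr, 'h list, 'h sarr) fctr" where
  "ext_fctr A \<phi> = mk_fctr (perm_cat A) (\<lambda>xs. concat (map \<phi> xs))
     (\<lambda>(xs, \<rho>, ys). (concat (map \<phi> xs), blk_perm (lens \<phi> xs) (lens \<phi> ys) \<rho> (\<lambda>_ i. i), concat (map \<phi> ys)))"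

lemma ext_fctr_simps [simp]:
  "xs \<in> lists A \<Longrightarrow> fo (ext_fctr A \<phi>) xs = concat (map \<phi> xs)"
  "(xs, \<rho>, ys) \<in> Arr (perm_cat A) \<Longrightarrow> fa (ext_fctr A \<phi>) (xs, \<rho>, ys) =
     (concat (map \<phi> xs), blk_perm (lens \<phi> xs) (lens \<phi> ys) \<rho> (\<lambda>_ i. i), concat (map \<phi> ys))"
  by (simp_all add: ext_fctr_def)

lemma ext_Arr:
  assumes "\<phi> \<in> A \<rightarrow> lists B" "(xs, \<rho>, ys) \<in> Arr (perm_cat A)"
  shows "(concat (map \<phi> xs), blk_perm (lens \<phi> xs) (lens \<phi> ys) \<rho> (\<lambda>_ i. i), concat (map \<phi> ys)) \<in> Arr (perm_cat B)"
    "blk (lens \<phi> xs) (lens \<phi> ys) \<rho> (\<lambda>_ i. i)"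
proof -
  have "(\<phi> (xs ! b), \<lambda>i. i, \<phi> (xs ! b)) \<in> Arr (perm_cat B)" if "b < length xs" for b
  proof (rule perm_cat_ident)
    have "xs \<in> lists A" using assms(2) by (simp add: perm_cat_Arr)
    then have "xs ! b \<in> A" using nth_mem[OF that] by blast
    then show "\<phi> (xs ! b) \<in> lists B" using assms(1) by blast
  qed
  then show "(concat (map \<phi> xs), blk_perm (lens \<phi> xs) (lens \<phi> ys) \<rho> (\<lambda>_ i. i), concat (map \<phi> ys)) \<in> Arr (perm_cat B)"
    "blk (lens \<phi> xs) (lens \<phi> ys) \<rho> (\<lambda>_ i. i)"
    using assms(2) by (auto intro: blk_perm_Arr blk_Arr)
qed

lemma concat_map_lists: "\<phi> \<in> A \<rightarrow> lists B \<Longrightarrow> xs \<in> lists A \<Longrightarrow> concat (map \<phi> xs) \<in> lists B"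
  by (fastforce simp: in_lists_conv_set)

lemma is_fctr_ext:
  assumes \<phi>: "\<phi> \<in> A \<rightarrow> lists B"
  shows "is_fctr (perm_cat A) (perm_cat B) (ext_fctr A \<phi>)"
  unfolding ext_fctr_def
proof (rule is_fctrI)
  show "concat (map \<phi> xs) \<in> Obj (perm_cat B)" if "xs \<in> Obj (perm_cat A)" for xs
    using concat_map_lists[OF \<phi>] that by simp
  then show "(case Ident (perm_cat A) xs of (xs, \<rho>, ys) \<Rightarrow>
        (concat (map \<phi> xs), blk_perm (lens \<phi> xs) (lens \<phi> ys) \<rho> (\<lambda>_ i. i), concat (map \<phi> ys)))
      = Ident (perm_cat B) (concat (map \<phi> xs))" if "xs \<in> Obj (perm_cat A)" for xs
    using that by (simp add: blk_perm_ident)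
  fix f assume f: "f \<in> Arr (perm_cat A)"
  moreover obtain xs \<rho> ys where f_def: "f = (xs, \<rho>, ys)" by (cases f)
  ultimately show "(case f of (xs, \<rho>, ys) \<Rightarrow>
         (concat (map \<phi> xs), blk_perm (lens \<phi> xs) (lens \<phi> ys) \<rho> (\<lambda>_ i. i), concat (map \<phi> ys))) \<in> Arr (perm_cat B) \<and>
      Dom (perm_cat B) (case f of (xs, \<rho>, ys) \<Rightarrow>
         (concat (map \<phi> xs), blk_perm (lens \<phi> xs) (lens \<phi> ys) \<rho> (\<lambda>_ i. i), concat (map \<phi> ys)))
        = concat (map \<phi> (Dom (perm_cat A) f)) \<and>
      Cod (perm_cat B) (case f of (xs, \<rho>, ys) \<Rightarrow>
         (concat (map \<phi> xs), blk_perm (lens \<phi> xs) (lens \<phi> ys) \<rho> (\<lambda>_ i. i), concat (map \<phi> ys)))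
        = concat (map \<phi> (Cod (perm_cat A) f))"
    using ext_Arr(1)[OF \<phi>, of xs \<rho> ys] by simp
  fix g assume g: "g \<in> Arr (perm_cat A)" and d: "Dom (perm_cat A) g = Cod (perm_cat A) f"
  obtain \<tau> zs where g_def: "g = (ys, \<tau>, zs)" using f g d unfolding f_def by (cases g) simp
  note * = f[unfolded f_def] g[unfolded g_def]
  show "(case Comp (perm_cat A) g f of (xs, \<rho>, ys) \<Rightarrow>
         (concat (map \<phi> xs), blk_perm (lens \<phi> xs) (lens \<phi> ys) \<rho> (\<lambda>_ i. i), concat (map \<phi> ys)))
      = Comp (perm_cat B)
         (case g of (xs, \<rho>, ys) \<Rightarrow>
           (concat (map \<phi> xs), blk_perm (lens \<phi> xs) (lens \<phi> ys) \<rho> (\<lambda>_ i. i), concat (map \<phi> ys)))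
         (case f of (xs, \<rho>, ys) \<Rightarrow>
           (concat (map \<phi> xs), blk_perm (lens \<phi> xs) (lens \<phi> ys) \<rho> (\<lambda>_ i. i), concat (map \<phi> ys)))"
    using * ext_Arr(1)[OF \<phi> *(1)] ext_Arr(1)[OF \<phi> *(2)] blk_perm_comp[OF ext_Arr(2)[OF \<phi> *(1)]]
    unfolding f_def g_def by (simp add: comp_def)
qed (rule category_perm_cat)

lemma mon_fctr_ext:
  assumes \<phi>: "\<phi> \<in> A \<rightarrow> lists B"
  shows "mon_fctr (SS A) (SS B) (ext_fctr A \<phi>)"
  unfolding mon_fctr_def SS_simps(1,2)
proof (intro conjI ballI is_fctr_ext[OF \<phi>])
  fix f g assume "f \<in> Arr (perm_cat A)" "g \<in> Arr (perm_cat A)"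
  moreover obtain xs \<rho> ys xs' \<rho>' ys' where fg: "f = (xs, \<rho>, ys)" "g = (xs', \<rho>', ys')" by (cases f, cases g)
  ultimately have *: "(xs, \<rho>, ys) \<in> Arr (perm_cat A)" "(xs', \<rho>', ys') \<in> Arr (perm_cat A)" by auto
  show "fa (ext_fctr A \<phi>) (tar (SS A) f g) = tar (SS B) (fa (ext_fctr A \<phi>) f) (fa (ext_fctr A \<phi>) g)"
    using * perm_sum_Arr[OF *] ext_Arr(1)[OF \<phi> *(1)] ext_Arr(1)[OF \<phi> *(2)]
      blk_perm_append[OF ext_Arr(2)[OF \<phi> *(1)] ext_Arr(2)[OF \<phi> *(2)]]
    unfolding fg by (simp add: length_concat comp_def)
next
  fix xs ys assume *: "xs \<in> Obj (perm_cat A)" "ys \<in> Obj (perm_cat A)"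
  then show "fo (ext_fctr A \<phi>) (tob (SS A) xs ys) = tob (SS B) (fo (ext_fctr A \<phi>) xs) (fo (ext_fctr A \<phi>) ys)"
    using concat_map_lists[OF \<phi>] by simp
  show "fa (ext_fctr A \<phi>) (Sym (SS A) (xs, ys)) = Sym (SS B) (fo (ext_fctr A \<phi>) xs, fo (ext_fctr A \<phi>) ys)"
    using * block_swap_Arr[of xs A ys] concat_map_lists[OF \<phi>] blk_perm_swap[of "lens \<phi> xs" "lens \<phi> ys"]
    by (simp add: length_concat comp_def)
qed simp

text \<open>The four cases are exactly what a symmetric strict monoidal functor preserves. They
  generate all arrows because a permutation can be split, by induction on the source list, into a
  permutation of the tail followed by a block swap that carries the first letter to its target
  position.\<close>

lemma perm_cat_induct [consumes 1, case_names ident swap sum comp]: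
  assumes "(xs, \<rho>, ys) \<in> Arr (perm_cat A)"
    and ident: "\<And>xs. xs \<in> lists A \<Longrightarrow> P (xs, \<lambda>i. i, xs)"
    and swap: "\<And>xs ys. xs \<in> lists A \<Longrightarrow> ys \<in> lists A \<Longrightarrow> P (xs @ ys, block_swap (length xs) (length ys), ys @ xs)"
    and sum: "\<And>xs \<rho> ys xs' \<rho>' ys'. (xs, \<rho>, ys) \<in> Arr (perm_cat A) \<Longrightarrow> (xs', \<rho>', ys') \<in> Arr (perm_cat A) \<Longrightarrow>
      P (xs, \<rho>, ys) \<Longrightarrow> P (xs', \<rho>', ys') \<Longrightarrow> P (xs @ xs', perm_sum (length xs) \<rho> \<rho>', ys @ ys')"
    and comp: "\<And>xs \<rho> ys \<tau> zs. (xs, \<rho>, ys) \<in> Arr (perm_cat A) \<Longrightarrow> (ys, \<tau>, zs) \<in> Arr (perm_cat A) \<Longrightarrow>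
      P (xs, \<rho>, ys) \<Longrightarrow> P (ys, \<tau>, zs) \<Longrightarrow> P (xs, \<tau> \<circ> \<rho>, zs)"
  shows "P (xs, \<rho>, ys)"
  using assms(1)
proof (induction xs arbitrary: \<rho> ys)
  case Nil
  then have "ys = []" "\<rho> = (\<lambda>i. i)" using permutes_lessThanD(3)[of \<rho> 0] by (auto simp: perm_cat_Arr)
  then show ?case using ident[of "[]"] by simp
next
  case (Cons x xs)
  have l: "length ys = Suc (length xs)" and p: "\<rho> permutes {..<Suc (length xs)}"
    and A: "x \<in> A" "xs \<in> lists A" "ys \<in> lists A" and xy: "\<And>i. i < Suc (length xs) \<Longrightarrow> (x # xs) ! i = ys ! \<rho> i"
    using Cons.prems by (auto simp: perm_cat_Arr)
  \<comment> \<open>The target position of the first letter; \<open>us\<close> and \<open>vs\<close>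
    are the parts of \<open>ys\<close> before and after it.\<close>
  define k where "k = \<rho> 0"
  have k: "k < length ys" using permutes_lessThanD(1)[OF p, of 0] by (simp add: k_def l)
  define us vs where "us = take k ys" and "vs = drop (Suc k) ys"
  have ys: "ys = us @ [x] @ vs" and lu: "length us = k" "length us + length vs = length xs"
    using id_take_nth_drop[OF k] xy[of 0] k l by (simp_all add: us_def vs_def k_def)
  have uv: "us \<in> lists A" "vs \<in> lists A" using A(3) unfolding ys by auto
  \<comment> \<open>Carries \<open>x\<close> from the front past \<open>us\<close> and leaves
    \<open>vs\<close> alone, so it is a sum of a block swap and an identity.\<close>
  define \<mu> where "\<mu> = perm_sum (length ([x] @ us)) (block_swap 1 (length us)) (\<lambda>i. i)"
  note sw = block_swap_Arr[of "[x]" A us] and iv = perm_cat_ident[OF uv(2)] and ix = perm_cat_ident[of "[x]" A]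
  have \<mu>: "([x] @ us @ vs, \<mu>, ys) \<in> Arr (perm_cat A)"
    using perm_sum_Arr[OF sw iv] A uv unfolding \<mu>_def ys by simp
  then have \<mu>p: "\<mu> permutes {..<Suc (length xs)}" and \<mu>n: "\<And>i. i < Suc (length xs) \<Longrightarrow> (x # us @ vs) ! i = ys ! \<mu> i"
    using lu by (auto simp: perm_cat_Arr)
  have P\<mu>: "P ([x] @ us @ vs, \<mu>, ys)"
    using sum[OF sw iv swap ident[OF uv(2)]] A uv unfolding \<mu>_def ys by simp
  \<comment> \<open>What remains of \<open>\<rho>\<close> once \<open>\<mu>\<close> is split off. It
    fixes position 0, so shifting by one gives the permutation \<open>\<sigma>'\<close> of the
    tail.\<close>
  define \<sigma> where "\<sigma> = inv \<mu> \<circ> \<rho>"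
  have \<mu>\<sigma>: "\<mu> (\<sigma> i) = \<rho> i" for i using permutes_inverses(1)[OF \<mu>p] by (simp add: \<sigma>_def)
  have \<sigma>p: "\<sigma> permutes {..<Suc (length xs)}"
    unfolding \<sigma>_def using p \<mu>p by (intro permutes_compose permutes_inv)
  have "\<mu> 0 = k" by (simp add: \<mu>_def perm_sum_def block_swap_def lu)
  then have \<sigma>0: "\<sigma> 0 = 0" using permutes_inverses(2)[OF \<mu>p, of 0] by (simp add: \<sigma>_def k_def)
  have \<sigma>S: "\<sigma> (Suc i) \<noteq> 0" for i using permutes_lessThanD(2)[OF \<sigma>p, of "Suc i" 0] \<sigma>0 by simp
  define \<sigma>' where "\<sigma>' i = \<sigma> (Suc i) - 1" for i
  have S\<sigma>': "Suc (\<sigma>' i) = \<sigma> (Suc i)" for i using \<sigma>S[of i] by (simp add: \<sigma>'_def)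
  have "\<sigma>' permutes {..<length xs}"
  proof (rule permutes_lessThanI)
    show "\<sigma>' i < length xs" if "i < length xs" for i
      using permutes_lessThanD(1)[OF \<sigma>p, of "Suc i"] that S\<sigma>'[of i] by simp
    show "i = j" if "\<sigma>' i = \<sigma>' j" for i j
      using permutes_lessThanD(2)[OF \<sigma>p, of "Suc i" "Suc j"] that S\<sigma>'[of i] S\<sigma>'[of j] by simp
    show "\<sigma>' i = i" if "\<not> i < length xs" for i
      using permutes_lessThanD(3)[OF \<sigma>p, of "Suc i"] that S\<sigma>'[of i] by simp
  qed
  moreover have "xs ! i = (us @ vs) ! \<sigma>' i" if i: "i < length xs" for i
  proof -
    have "xs ! i = ys ! \<mu> (\<sigma> (Suc i))" using xy[of "Suc i"] i by (simp add: \<mu>\<sigma>)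
    also have "\<dots> = (x # us @ vs) ! \<sigma> (Suc i)"
      using \<mu>n permutes_lessThanD(1)[OF \<sigma>p, of "Suc i"] i by simp
    finally show ?thesis by (simp flip: S\<sigma>')
  qed
  ultimately have \<sigma>': "(xs, \<sigma>', us @ vs) \<in> Arr (perm_cat A)"
    using A uv lu by (simp add: perm_cat_Arr)
  have "perm_sum (length [x]) (\<lambda>i. i) \<sigma>' i = \<sigma> i" for i
    using S\<sigma>'[of "i - 1"] \<sigma>0 by (cases i) (auto simp: perm_sum_def)
  then have "perm_sum (length [x]) (\<lambda>i. i) \<sigma>' = \<sigma>" by blast
  then have *: "([x] @ xs, \<sigma>, [x] @ us @ vs) \<in> Arr (perm_cat A)" "P ([x] @ xs, \<sigma>, [x] @ us @ vs)"
    using perm_sum_Arr[OF ix \<sigma>'] sum[OF ix \<sigma>' ident Cons.IH[OF \<sigma>']] A by simp_all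
  have "\<mu> \<circ> \<sigma> = \<rho>" by (auto simp: \<mu>\<sigma>)
  then show ?case using comp[OF *(1) \<mu> *(2) P\<mu>] by simp
qed

text \<open>The uniqueness half of freeness: induction on the list for objects,
  \<open>perm_cat_induct\<close> for arrows.\<close>

lemma mon_fctr_eq_on_generators:
  fixes F G :: "('g list, 'g sarr, 'x, 'y) fctr"
  assumes F: "mon_fctr (SS A) N F" and G: "mon_fctr (SS A) N G"
    and gen: "\<And>a. a \<in> A \<Longrightarrow> fo F [a] = fo G [a]"
  shows "F = G"
proof -
  note f = mon_fctr_ops[OF F] is_fctr_ops[OF mon_fctr_ops(1)[OF F]]
    and g = mon_fctr_ops[OF G] is_fctr_ops[OF mon_fctr_ops(1)[OF G]]
  have o: "fo F xs = fo G xs" if "xs \<in> lists A" for xs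
    using that
  proof (induction xs)
    case Nil
    then show ?case using f(2) g(2) by simp
  next
    case (Cons x xs)
    then show ?case using f(3)[of "[x]" xs] g(3)[of "[x]" xs] gen by simp
  qed
  have a: "fa F u = fa G u" if u: "u \<in> Arr (perm_cat A)" for u
  proof -
    obtain xs \<rho> ys where u_def: "u = (xs, \<rho>, ys)" by (cases u)
    show ?thesis
      using u unfolding u_def
    proof (induction rule: perm_cat_induct)
      case (ident xs)
      then show ?case using f(10)[of xs] g(10)[of xs] o by simp
    next
      case (swap xs ys)
      then show ?case using f(5)[of xs ys] g(5)[of xs ys] o by simp
    next
      case (sum xs \<rho> ys xs' \<rho>' ys')
      then show ?case using f(4)[of "(xs, \<rho>, ys)" "(xs', \<rho>', ys')"] g(4)[of "(xs, \<rho>, ys)" "(xs', \<rho>', ys')"] by simp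
    next
      case (comp xs \<rho> ys \<tau> zs)
      then show ?case using f(11)[of "(ys, \<tau>, zs)" "(xs, \<rho>, ys)"] g(11)[of "(ys, \<tau>, zs)" "(xs, \<rho>, ys)"] by simp
    qed
  qed
  show ?thesis
    by (rule fctr_eqI[OF f(1) g(1)]) (simp_all add: o a)
qed

lemma ext_fctr_eq_iff:
  assumes "\<phi> \<in> A \<rightarrow> lists B" "\<psi> \<in> A \<rightarrow> lists B"
  shows "ext_fctr A \<phi> = ext_fctr A \<psi> \<longleftrightarrow> (\<forall>a\<in>A. \<phi> a = \<psi> a)"
proof
  assume eq: "ext_fctr A \<phi> = ext_fctr A \<psi>"
  show "\<forall>a\<in>A. \<phi> a = \<psi> a"
  proof
    fix a assume "a \<in> A"
    moreover have "fo (ext_fctr A \<phi>) [a] = fo (ext_fctr A \<psi>) [a]" by (simp only: eq)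
    ultimately show "\<phi> a = \<psi> a" by simp
  qed
next
  assume "\<forall>a\<in>A. \<phi> a = \<psi> a"
  then show "ext_fctr A \<phi> = ext_fctr A \<psi>"
    by (intro mon_fctr_eq_on_generators[OF mon_fctr_ext[OF assms(1)] mon_fctr_ext[OF assms(2)]]) simp
qed

text \<open>There is no typing hypothesis on the values here, so that this can serve as a congruence
  rule.\<close>

lemma ext_fctr_cong: "(\<And>a. a \<in> A \<Longrightarrow> \<phi> a = \<psi> a) \<Longrightarrow> ext_fctr A \<phi> = ext_fctr A \<psi>"
  unfolding ext_fctr_def
proof (rule mk_fctr_cong)
  assume *: "\<And>a. a \<in> A \<Longrightarrow> \<phi> a = \<psi> a"
  show "concat (map \<phi> xs) = concat (map \<psi> xs)" if "xs \<in> Obj (perm_cat A)" for xs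
    using that * by (auto simp: in_lists_conv_set cong: map_cong)
  fix f assume "f \<in> Arr (perm_cat A)"
  then show "(case f of (xs, \<rho>, ys) \<Rightarrow>
        (concat (map \<phi> xs), blk_perm (lens \<phi> xs) (lens \<phi> ys) \<rho> (\<lambda>_ i. i), concat (map \<phi> ys)))
      = (case f of (xs, \<rho>, ys) \<Rightarrow>
        (concat (map \<psi> xs), blk_perm (lens \<psi> xs) (lens \<psi> ys) \<rho> (\<lambda>_ i. i), concat (map \<psi> ys)))"
    using * by (cases f) (auto simp: perm_cat_Arr in_lists_conv_set cong: map_cong)
qed

lemma mon_fctr_SS:
  assumes F: "mon_fctr (SS A) (SS B) F"
  shows "F = ext_fctr A (\<lambda>a. fo F [a])" "(\<lambda>a. fo F [a]) \<in> A \<rightarrow> lists B"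
proof -
  show *: "(\<lambda>a. fo F [a]) \<in> A \<rightarrow> lists B"
    using is_fctr_ops(1)[OF mon_fctr_ops(1)[OF F]] by simp
  show "F = ext_fctr A (\<lambda>a. fo F [a])"
    by (rule mon_fctr_eq_on_generators[OF F mon_fctr_ext[OF *]]) simp
qed

text \<open>Both sides are strict monoidal, so uniqueness reduces the claim to one-letter lists and
  the block permutations of the two sides need not be compared.\<close>

lemma fcomp_ext:
  assumes "\<phi> \<in> A \<rightarrow> lists B" "\<psi> \<in> B \<rightarrow> lists K"
  shows "fcomp (perm_cat A) (ext_fctr B \<psi>) (ext_fctr A \<phi>) = ext_fctr A (\<lambda>a. concat (map \<psi> (\<phi> a)))"
proof (rule mon_fctr_eq_on_generators)
  show "mon_fctr (SS A) (SS K) (fcomp (perm_cat A) (ext_fctr B \<psi>) (ext_fctr A \<phi>))"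
    using mon_fctr_fcomp[OF is_smg_SS mon_fctr_ext[OF assms(1)] mon_fctr_ext[OF assms(2)]] by simp
  show "mon_fctr (SS A) (SS K) (ext_fctr A (\<lambda>a. concat (map \<psi> (\<phi> a))))"
    by (intro mon_fctr_ext Pi_I concat_map_lists[OF assms(2)]) (rule funcset_mem[OF assms(1)])
  show "fo (fcomp (perm_cat A) (ext_fctr B \<psi>) (ext_fctr A \<phi>)) [a] = fo (ext_fctr A (\<lambda>a. concat (map \<psi> (\<phi> a)))) [a]"
    if "a \<in> A" for a
    using that funcset_mem[OF assms(1) that] by simp
qed

lemma fid_ext: "fid (perm_cat A) = ext_fctr A (\<lambda>a. [a])"
proof (rule mon_fctr_eq_on_generators)
  show "mon_fctr (SS A) (SS A) (fid (perm_cat A))"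
    using mon_fctr_fid[OF is_smg_SS, of A] by simp
  show "mon_fctr (SS A) (SS A) (ext_fctr A (\<lambda>a. [a]))" by (rule mon_fctr_ext) auto
qed simp

lemma SS_map_ext: "SS_map A f = ext_fctr A (\<lambda>a. [f a])"
  unfolding SS_map_def ext_fctr_def
  by (rule mk_fctr_cong) (auto simp: perm_cat_Arr blk_perm_ones)

lemma free_ext_SS:
  assumes "\<phi> \<in> A \<rightarrow> lists B"
  shows "free_ext A (SS B) \<phi> = ext_fctr A \<phi>"
  unfolding free_ext_def
proof (rule the_equality)
  show "mon_fctr (SS A) (SS B) (ext_fctr A \<phi>) \<and> (\<forall>a\<in>A. fo (ext_fctr A \<phi>) [a] = \<phi> a)"
    using mon_fctr_ext[OF assms] by simp
  show "F = ext_fctr A \<phi>" if "mon_fctr (SS A) (SS B) F \<and> (\<forall>a\<in>A. fo F [a] = \<phi> a)" for F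
    using that mon_fctr_ext[OF assms] by (intro mon_fctr_eq_on_generators) auto
qed

section \<open>Monoidal transformations\<close>

lemma mon_transI:
  assumes "b \<in> extensional (Obj (Gpd M))"
    and "\<And>x. x \<in> Obj (Gpd M) \<Longrightarrow> b x \<in> hom (Gpd N) (fo F x) (fo G x)"
    and "\<And>f x y. f \<in> hom (Gpd M) x y \<Longrightarrow> Comp (Gpd N) (b y) (fa F f) = Comp (Gpd N) (fa G f) (b x)"
    and "b (Unit M) = Ident (Gpd N) (Unit N)"
    and "\<And>x y. x \<in> Obj (Gpd M) \<Longrightarrow> y \<in> Obj (Gpd M) \<Longrightarrow> b (tob M x y) = tar N (b x) (b y)"
  shows "mon_trans M N F G b"
  using assms unfolding mon_trans_def by (auto simp: PiE_iff hom_def)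

lemma mon_trans_ops:
  assumes "mon_trans M N F G b"
  shows "b \<in> extensional (Obj (Gpd M))"
    "x \<in> Obj (Gpd M) \<Longrightarrow> b x \<in> hom (Gpd N) (fo F x) (fo G x)"
    "f \<in> hom (Gpd M) x y \<Longrightarrow> Comp (Gpd N) (b y) (fa F f) = Comp (Gpd N) (fa G f) (b x)"
    "b (Unit M) = Ident (Gpd N) (Unit N)"
    "x \<in> Obj (Gpd M) \<Longrightarrow> y \<in> Obj (Gpd M) \<Longrightarrow> b (tob M x y) = tar N (b x) (b y)"
  using assms unfolding mon_trans_def by (auto simp: PiE_iff hom_def)

text \<open>Whiskerings, vertical composites and identities cover every 2-cell in the coherence laws
  (a) to (d). Each result is restricted to the objects, since transformations are
  extensional.\<close>

lemma mon_trans_whisker_left: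
  assumes M: "is_smg M" and H: "mon_fctr N K H" and F: "mon_fctr M N F" and G: "mon_fctr M N G"
    and b: "mon_trans M N F G b"
  shows "mon_trans M K (fcomp (Gpd M) H F) (fcomp (Gpd M) H G) (\<lambda>x\<in>Obj (Gpd M). fa H (b x))"
proof (rule mon_transI, goal_cases)
  case 1 show ?case by simp
next
  case (2 x) then show ?case
    using is_fctr_hom[OF mon_fctr_ops(1)[OF H] mon_trans_ops(2)[OF b]] by simp
next
  case (3 f x y)
  then have "x \<in> Obj (Gpd M)" "y \<in> Obj (Gpd M)" "f \<in> Arr (Gpd M)"
    using category_ops(1,2)[OF is_smg_ops(1)[OF M]] by (auto simp: hom_def)
  then show ?case
    using is_fctr_hom_comp[OF mon_fctr_ops(1)[OF H] is_fctr_hom[OF mon_fctr_ops(1)[OF F] 3] mon_trans_ops(2)[OF b, of y]]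
      is_fctr_hom_comp[OF mon_fctr_ops(1)[OF H] mon_trans_ops(2)[OF b, of x] is_fctr_hom[OF mon_fctr_ops(1)[OF G] 3]]
      mon_trans_ops(3)[OF b 3]
    by simp
next
  case 4 show ?case
    using is_smg_ops(3)[OF M] mon_trans_ops(4)[OF b] mon_fctr_ops(2)[OF H]
      is_fctr_ops(1)[OF mon_fctr_ops(1)[OF F], of "Unit M"] mon_fctr_ops(2)[OF F]
      is_fctr_ops(5)[OF mon_fctr_ops(1)[OF H], of "Unit N"] by simp
next
  case (5 x y) then show ?case
    using mon_trans_ops(5)[OF b 5] mon_trans_ops(2)[OF b, of x] mon_trans_ops(2)[OF b, of y]
      mon_fctr_ops(4)[OF H, of "b x" "b y"] smg_tensor(1)[OF M 5]
    by (simp add: hom_def)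
qed

lemma mon_trans_whisker_right:
  assumes L: "is_smg L" and E: "mon_fctr L M E" and b: "mon_trans M N F G b"
  shows "mon_trans L N (fcomp (Gpd L) F E) (fcomp (Gpd L) G E) (\<lambda>x\<in>Obj (Gpd L). b (fo E x))"
proof (rule mon_transI, goal_cases)
  case 1 show ?case by simp
next
  case (2 x) then show ?case
    using mon_trans_ops(2)[OF b] is_fctr_ops(1)[OF mon_fctr_ops(1)[OF E]] by simp
next
  case (3 f x y)
  then have "x \<in> Obj (Gpd L)" "y \<in> Obj (Gpd L)" "f \<in> Arr (Gpd L)"
    using category_ops(1,2)[OF is_smg_ops(1)[OF L]] by (auto simp: hom_def)
  then show ?case
    using mon_trans_ops(3)[OF b is_fctr_hom[OF mon_fctr_ops(1)[OF E] 3]] by simp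
next
  case 4 show ?case
    using is_smg_ops(3)[OF L] mon_trans_ops(4)[OF b] mon_fctr_ops(2)[OF E] by simp
next
  case (5 x y) then show ?case
    using mon_trans_ops(5)[OF b, of "fo E x" "fo E y"] mon_fctr_ops(3)[OF E 5] smg_tensor(1)[OF L 5]
      is_fctr_ops(1)[OF mon_fctr_ops(1)[OF E]]
    by simp
qed

lemma mon_trans_vcomp:
  assumes M: "is_smg M" and N: "is_smg N"
    and F: "mon_fctr M N F" and G: "mon_fctr M N G" and H: "mon_fctr M N H"
    and b: "mon_trans M N F G b" and c: "mon_trans M N G H c"
  shows "mon_trans M N F H (\<lambda>x\<in>Obj (Gpd M). Comp (Gpd N) (c x) (b x))"
proof (rule mon_transI, goal_cases)
  case 1 show ?case by simp
next
  case (2 x) then show ?case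
    using hom_comp[OF is_smg_ops(1)[OF N] mon_trans_ops(2)[OF b] mon_trans_ops(2)[OF c]] by simp
next
  case (3 f x y)
  then have x: "x \<in> Obj (Gpd M)" and y: "y \<in> Obj (Gpd M)" and f: "f \<in> Arr (Gpd M)"
    using category_ops(1,2)[OF is_smg_ops(1)[OF M]] by (auto simp: hom_def)
  note N' = is_smg_ops(1)[OF N] and bx = mon_trans_ops(2)[OF b] and cx = mon_trans_ops(2)[OF c]
    and Ff = is_fctr_hom[OF mon_fctr_ops(1)[OF F] 3] and Gf = is_fctr_hom[OF mon_fctr_ops(1)[OF G] 3]
    and Hf = is_fctr_hom[OF mon_fctr_ops(1)[OF H] 3]
  have "Comp (Gpd N) (Comp (Gpd N) (c y) (b y)) (fa F f) = Comp (Gpd N) (c y) (Comp (Gpd N) (fa G f) (b x))"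
    using hom_assoc[OF N' Ff bx[OF y] cx[OF y]] mon_trans_ops(3)[OF b 3] by simp
  also have "\<dots> = Comp (Gpd N) (Comp (Gpd N) (fa H f) (c x)) (b x)"
    using hom_assoc[OF N' bx[OF x] Gf cx[OF y]] mon_trans_ops(3)[OF c 3] by simp
  also have "\<dots> = Comp (Gpd N) (fa H f) (Comp (Gpd N) (c x) (b x))"
    using hom_assoc[OF N' bx[OF x] cx[OF x] Hf] by simp
  finally show ?case using x y by simp
next
  case 4 show ?case
    using is_smg_ops(3)[OF M] is_smg_ops(3)[OF N] mon_trans_ops(4)[OF b] mon_trans_ops(4)[OF c]
      category_ops[OF is_smg_ops(1)[OF N]] by simp
next
  case (5 x y) then show ?case
    using mon_trans_ops(5)[OF b 5] mon_trans_ops(5)[OF c 5] smg_tensor(1)[OF M 5]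
      smg_tensor(3)[OF N mon_trans_ops(2)[OF b 5(1)] mon_trans_ops(2)[OF c 5(1)]
        mon_trans_ops(2)[OF b 5(2)] mon_trans_ops(2)[OF c 5(2)]]
    by simp
qed

lemma mon_trans_ident:
  assumes M: "is_smg M" and N: "is_smg N" and F: "mon_fctr M N F"
  shows "mon_trans M N F F (\<lambda>x\<in>Obj (Gpd M). Ident (Gpd N) (fo F x))"
proof (rule mon_transI, goal_cases)
  case (5 x y)
  have "Ident (prod_cat (Gpd N) (Gpd N)) (fo F x, fo F y) = (Ident (Gpd N) (fo F x), Ident (Gpd N) (fo F y))"
    using is_fctr_ops(1)[OF mon_fctr_ops(1)[OF F]] 5 by (simp add: prod_cat_def)
  then show ?case
    using is_fctr_ops(5)[OF is_smg_ops(2)[OF N], of "(fo F x, fo F y)"] 5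
      is_fctr_ops(1)[OF mon_fctr_ops(1)[OF F]] smg_tensor(1)[OF M 5] mon_fctr_ops(3)[OF F 5]
    by (simp add: prod_cat_def)
qed (use is_smg_ops[OF M] is_smg_ops(1)[OF N] is_fctr_ops[OF mon_fctr_ops(1)[OF F]] mon_fctr_ops(2)[OF F]
    category_ops[OF is_smg_ops(1)[OF N]] category_ops(1,2)[OF is_smg_ops(1)[OF M]] in \<open>auto simp: hom_def\<close>)

text \<open>Every object is a tensor product of letters, so monoidality fixes all values. Source and
  target functors may be written differently for \<open>b\<close> and \<open>c\<close>, as happens
  for the two sides of a coherence law.\<close>

lemma mon_trans_eq_on_generators:
  assumes b: "mon_trans (SS A) N F G b" and c: "mon_trans (SS A) N F' G' c"
    and gen: "\<And>a. a \<in> A \<Longrightarrow> b [a] = c [a]"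
  shows "b = c"
proof (rule extensionalityI[of _ "lists A"])
  show "b xs = c xs" if "xs \<in> lists A" for xs
    using that
  proof (induction xs)
    case Nil
    then show ?case using mon_trans_ops(4)[OF b] mon_trans_ops(4)[OF c] by simp
  next
    case (Cons x xs)
    then show ?case
      using mon_trans_ops(5)[OF b, of "[x]" xs] mon_trans_ops(5)[OF c, of "[x]" xs] gen[of x] by simp
  qed
qed (use mon_trans_ops(1)[OF b] mon_trans_ops(1)[OF c] in simp_all)

text \<open>Turns a coherence law quantified over all objects of a free level into one over
  generators. The restrictions make arbitrary terms \<open>L\<close> and \<open>R\<close>
  extensional, so that equality of functions is available.\<close>

lemma mon_trans_ball_generators:
  assumes "mon_trans (SS A) N F G (restrict L (lists A))" "mon_trans (SS A) N F' G' (restrict R (lists A))"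
  shows "(\<forall>xs\<in>lists A. L xs = R xs) \<longleftrightarrow> (\<forall>a\<in>A. L [a] = R [a])"
proof
  assume "\<forall>a\<in>A. L [a] = R [a]"
  then have "restrict L (lists A) = restrict R (lists A)"
    by (intro mon_trans_eq_on_generators[OF assms]) simp
  then show "\<forall>xs\<in>lists A. L xs = R xs" by (metis restrict_apply')
qed auto

section \<open>Transformations prescribed on generators\<close>

definition ext_trans ::
  "'g set \<Rightarrow> ('g \<Rightarrow> 'h list) \<Rightarrow> ('g \<Rightarrow> 'h list) \<Rightarrow> ('g \<Rightarrow> nat \<Rightarrow> nat) \<Rightarrow> 'g list \<Rightarrow> 'h sarr" where
  "ext_trans A \<phi> \<psi> \<beta> = (\<lambda>xs\<in>lists A.
     (concat (map \<phi> xs), blk_perm (lens \<phi> xs) (lens \<psi> xs) (\<lambda>i. i) (\<lambda>b. \<beta> (xs ! b)), concat (map \<psi> xs)))"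

lemma ext_trans_generator:
  assumes "a \<in> A" "(\<phi> a, \<beta> a, \<psi> a) \<in> Arr (perm_cat B)"
  shows "ext_trans A \<phi> \<psi> \<beta> [a] = (\<phi> a, \<beta> a, \<psi> a)"
proof -
  have "\<beta> a permutes {..<length (\<phi> a)}" using assms(2) by (simp add: perm_cat_Arr)
  then have "blk_perm [length (\<phi> a)] [length (\<psi> a)] (\<lambda>i. i) (\<lambda>b. \<beta> ([a] ! b)) = \<beta> a"
    using permutes_lessThanD(3)[of "\<beta> a"]
    by (auto simp: blk_perm_def fun_eq_iff pos_def)
  then show ?thesis using assms(1) by (simp add: ext_trans_def)
qed

lemma ext_trans_cong:
  "(\<And>a. a \<in> A \<Longrightarrow> \<phi> a = \<phi>' a \<and> \<psi> a = \<psi>' a \<and> \<beta> a = \<beta>' a) \<Longrightarrow> ext_trans A \<phi> \<psi> \<beta> = ext_trans A \<phi>' \<psi>' \<beta>'"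
  unfolding ext_trans_def
proof (rule restrict_ext)
  assume *: "\<And>a. a \<in> A \<Longrightarrow> \<phi> a = \<phi>' a \<and> \<psi> a = \<psi>' a \<and> \<beta> a = \<beta>' a"
  fix xs assume xs: "xs \<in> lists A"
  have "blk_perm (lens \<phi> xs) (lens \<psi> xs) (\<lambda>i. i) (\<lambda>b. \<beta> (xs ! b))
      = blk_perm (lens \<phi> xs) (lens \<psi> xs) (\<lambda>i. i) (\<lambda>b. \<beta>' (xs ! b))"
    using xs * nth_mem[of _ xs] by (intro blk_perm_cong) (auto simp: in_lists_conv_set)
  moreover have "map \<phi> xs = map \<phi>' xs" "map \<psi> xs = map \<psi>' xs" "lens \<phi> xs = lens \<phi>' xs" "lens \<psi> xs = lens \<psi>' xs"
    using xs * by (auto simp: in_lists_conv_set)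
  ultimately show "(concat (map \<phi> xs), blk_perm (lens \<phi> xs) (lens \<psi> xs) (\<lambda>i. i) (\<lambda>b. \<beta> (xs ! b)), concat (map \<psi> xs))
      = (concat (map \<phi>' xs), blk_perm (lens \<phi>' xs) (lens \<psi>' xs) (\<lambda>i. i) (\<lambda>b. \<beta>' (xs ! b)), concat (map \<psi>' xs))"
    by (simp only:)
qed

text \<open>The existence half of freeness for 2-cells: in \<open>ext_trans\<close> the blocks stay
  in place and each is permuted by the value of \<beta> at its letter.\<close>

lemma mon_trans_ext:
  assumes \<phi>: "\<phi> \<in> A \<rightarrow> lists B" and \<psi>: "\<psi> \<in> A \<rightarrow> lists B"
    and \<beta>: "\<And>a. a \<in> A \<Longrightarrow> (\<phi> a, \<beta> a, \<psi> a) \<in> Arr (perm_cat B)"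
  shows "mon_trans (SS A) (SS B) (ext_fctr A \<phi>) (ext_fctr A \<psi>) (ext_trans A \<phi> \<psi> \<beta>)"
proof (rule mon_transI, unfold SS_simps(1,2))
  have R: "(\<phi> (xs ! b), \<beta> (xs ! b), \<psi> (xs ! b)) \<in> Arr (perm_cat B)" if "xs \<in> lists A" "b < length xs" for xs b
    using \<beta> that nth_mem[of b xs] by blast
  have a: "(concat (map \<phi> xs), blk_perm (lens \<phi> xs) (lens \<psi> xs) (\<lambda>i. i) (\<lambda>b. \<beta> (xs ! b)), concat (map \<psi> xs))
      \<in> Arr (perm_cat B)"
    and k: "blk (lens \<phi> xs) (lens \<psi> xs) (\<lambda>i. i) (\<lambda>b. \<beta> (xs ! b))" if "xs \<in> lists A" for xs
    by (rule blk_perm_Arr[OF perm_cat_ident[OF that]], rule R[OF that], assumption)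
      (rule blk_Arr[OF perm_cat_ident[OF that]], rule R[OF that], assumption)
  show "ext_trans A \<phi> \<psi> \<beta> \<in> extensional (Obj (perm_cat A))" by (simp add: ext_trans_def)
  show "ext_trans A \<phi> \<psi> \<beta> xs \<in> hom (perm_cat B) (fo (ext_fctr A \<phi>) xs) (fo (ext_fctr A \<psi>) xs)"
    if "xs \<in> Obj (perm_cat A)" for xs
    using that a by (simp add: ext_trans_def hom_def)
  show "ext_trans A \<phi> \<psi> \<beta> [] = Ident (perm_cat B) []"
    by (simp add: ext_trans_def blk_perm_def fun_eq_iff)
  show "ext_trans A \<phi> \<psi> \<beta> (tob (SS A) xs ys) = tar (SS B) (ext_trans A \<phi> \<psi> \<beta> xs) (ext_trans A \<phi> \<psi> \<beta> ys)"
    if "xs \<in> Obj (perm_cat A)" "ys \<in> Obj (perm_cat A)" for xs ys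
  proof -
    have x: "xs \<in> lists A" "ys \<in> lists A" using that by simp_all
    have "blk_perm (lens \<phi> (xs @ ys)) (lens \<psi> (xs @ ys)) (\<lambda>i. i) (\<lambda>b. \<beta> ((xs @ ys) ! b))
        = blk_perm (lens \<phi> xs @ lens \<phi> ys) (lens \<psi> xs @ lens \<psi> ys)
           (perm_sum (length (lens \<phi> xs)) (\<lambda>i. i) (\<lambda>i. i))
           (\<lambda>b. if b < length (lens \<phi> xs) then \<beta> (xs ! b) else \<beta> (ys ! (b - length (lens \<phi> xs))))"
      unfolding map_append by (rule blk_perm_cong) (simp_all add: perm_sum_ident nth_append)
    then show ?thesis
      using x a[OF x(1)] a[OF x(2)] blk_perm_append[OF k[OF x(1)] k[OF x(2)]]
      by (simp add: ext_trans_def length_concat comp_def)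
  qed
  show "Comp (perm_cat B) (ext_trans A \<phi> \<psi> \<beta> ys) (fa (ext_fctr A \<phi>) f)
      = Comp (perm_cat B) (fa (ext_fctr A \<psi>) f) (ext_trans A \<phi> \<psi> \<beta> xs)"
    if f: "f \<in> hom (perm_cat A) xs ys" for f xs ys
  proof -
    obtain \<rho> where f_def: "f = (xs, \<rho>, ys)" and fA: "(xs, \<rho>, ys) \<in> Arr (perm_cat A)"
      using f by (cases f) (auto simp: hom_def)
    have x: "xs \<in> lists A" "ys \<in> lists A" and n: "\<And>b. b < length xs \<Longrightarrow> xs ! b = ys ! \<rho> b"
      using fA by (auto simp: perm_cat_Arr)
    \<comment> \<open>Naturality is interchange: moving blocks commutes with permuting inside them,
      because a letter of \<open>xs\<close> and its image in \<open>ys\<close> have the same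
      \<beta>.\<close>
    have "blk_perm (lens \<phi> ys) (lens \<psi> ys) (\<lambda>i. i) (\<lambda>b. \<beta> (ys ! b)) \<circ> blk_perm (lens \<phi> xs) (lens \<phi> ys) \<rho> (\<lambda>_ i. i)
        = blk_perm (lens \<psi> xs) (lens \<psi> ys) \<rho> (\<lambda>_ i. i) \<circ> blk_perm (lens \<phi> xs) (lens \<psi> xs) (\<lambda>i. i) (\<lambda>b. \<beta> (xs ! b))"
      unfolding blk_perm_comp[OF ext_Arr(2)[OF \<phi> fA]] blk_perm_comp[OF k[OF x(1)]]
      by (rule blk_perm_cong) (simp_all add: n)
    then show ?thesis
      using x fA a[OF x(1)] a[OF x(2)] ext_Arr(1)[OF \<phi> fA] ext_Arr(1)[OF \<psi> fA]
      by (simp add: f_def ext_trans_def)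
  qed
qed

lemma mon_trans_SS:
  assumes b: "mon_trans (SS A) (SS B) (ext_fctr A \<phi>) (ext_fctr A \<psi>) b"
    and \<phi>: "\<phi> \<in> A \<rightarrow> lists B" and \<psi>: "\<psi> \<in> A \<rightarrow> lists B"
  shows "a \<in> A \<Longrightarrow> (\<phi> a, mor (b [a]), \<psi> a) \<in> Arr (perm_cat B)"
    "b = ext_trans A \<phi> \<psi> (\<lambda>a. mor (b [a]))"
proof -
  have *: "(\<phi> a, mor (b [a]), \<psi> a) \<in> Arr (perm_cat B) \<and> b [a] = (\<phi> a, mor (b [a]), \<psi> a)" if "a \<in> A" for a
    using mon_trans_ops(2)[OF b, of "[a]"] that by (cases "b [a]") (auto simp: hom_def)
  then show "a \<in> A \<Longrightarrow> (\<phi> a, mor (b [a]), \<psi> a) \<in> Arr (perm_cat B)" by blast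
  show "b = ext_trans A \<phi> \<psi> (\<lambda>a. mor (b [a]))"
  proof (rule mon_trans_eq_on_generators[OF b mon_trans_ext[OF \<phi> \<psi>]])
    show "(\<phi> a, mor (b [a]), \<psi> a) \<in> Arr (perm_cat B)" if "a \<in> A" for a using * that by blast
    then show "b [a] = ext_trans A \<phi> \<psi> (\<lambda>a. mor (b [a])) [a]" if "a \<in> A" for a
      using that by (intro trans[OF conjunct2[OF *[OF that]]
          ext_trans_generator[of a A \<phi> "\<lambda>a. mor (b [a])" \<psi> B, symmetric]])
  qed
qed

section \<open>Paths\<close>

lemma vertex_simps [simp]:
  "vertex C x fs 0 = x" "vertex C x fs (Suc i) = Cod C (fs ! i)"
  by (simp_all add: vertex_def)

lemma vertex_Cons: "vertex C x (f # fs) (Suc i) = vertex C (Cod C f) fs i"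
  by (cases i) simp_all

lemma is_path_iff:
  "category C \<Longrightarrow> is_path C x fs \<longleftrightarrow>
     x \<in> Obj C \<and> (\<forall>k < length fs. fs ! k \<in> Arr C \<and> Dom C (fs ! k) = vertex C x fs k)"
proof (induction fs arbitrary: x)
  case (Cons f fs)
  then have "is_path C x (f # fs) \<longleftrightarrow> x \<in> Obj C \<and> f \<in> Arr C \<and> Dom C f = x \<and>
      (\<forall>k < length fs. fs ! k \<in> Arr C \<and> Dom C (fs ! k) = vertex C (Cod C f) fs k)"
    by (auto simp: category_ops)
  also have "\<dots> \<longleftrightarrow> x \<in> Obj C \<and>
      (\<forall>k < length (f # fs). (f # fs) ! k \<in> Arr C \<and> Dom C ((f # fs) ! k) = vertex C x (f # fs) k)"
    unfolding length_Cons All_less_Suc2 by (auto simp: vertex_Cons simp del: vertex_simps(2))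
  finally show ?case .
qed simp

text \<open>\<open>seg C x fs p q\<close> is the composite from the \<open>p\<close>-th to the \<open>q\<close>-th vertex, for \<open>p \<le> q\<close>.\<close>

primrec seg :: "('o, 'm) cat \<Rightarrow> 'o \<Rightarrow> 'm list \<Rightarrow> nat \<Rightarrow> nat \<Rightarrow> 'm" where
  "seg C x fs p 0 = Ident C (vertex C x fs p)"
| "seg C x fs p (Suc q) = (if Suc q \<le> p then Ident C (vertex C x fs p) else Comp C (fs ! q) (seg C x fs p q))"

text \<open>The simplicial operator of a monotone map \<open>\<theta> : {0, \<dots>, k} \<rightarrow> {0, \<dots>, m}\<close> on chains with
  \<open>m + 1\<close> vertices.\<close>

definition pull :: "('o, 'm) cat \<Rightarrow> 'o \<Rightarrow> 'm list \<Rightarrow> nat \<Rightarrow> (nat \<Rightarrow> nat) \<Rightarrow> ('o, 'm) cell" where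
  "pull C x fs k \<theta> =
     Chain (vertex C x fs (\<theta> 0)) (map (\<lambda>j. seg C x fs (\<theta> j) (\<theta> (Suc j))) [0..<k])"

text \<open>The coface omitting \<open>i\<close>, and below it the codegeneracy taking the value
  \<open>i\<close> twice. Both are total on the naturals, so a single function serves all degrees
  and the simplicial identities become equations of functions on numbers.\<close>

definition face_map :: "nat \<Rightarrow> nat \<Rightarrow> nat" where
  "face_map i k = (if k < i then k else Suc k)"

definition degen_map :: "nat \<Rightarrow> nat \<Rightarrow> nat" where
  "degen_map i k = (if k \<le> i then k else k - 1)"

lemma mono_face_map: "mono (face_map i)" and mono_degen_map: "mono (degen_map i)"
  by (auto simp: mono_def face_map_def degen_map_def)

lemma pull_cong:
  assumes "\<And>j. j \<le> k \<Longrightarrow> \<theta> j = \<theta>' j"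
  shows "pull C x fs k \<theta> = pull C x fs k \<theta>'"
  unfolding pull_def using assms by (auto intro!: map_cong)

lemma seg_append: "q \<le> length fs \<Longrightarrow> p \<le> q \<Longrightarrow> seg C x (fs @ gs) p q = seg C x fs p q"
proof (induction q)
  case 0
  then show ?case by simp
next
  case (Suc q)
  then show ?case by (cases p) (auto simp: nth_append le_Suc_eq)
qed

lemma seg_snoc:
  "a \<le> length gs \<Longrightarrow> seg C x (gs @ [g]) a (Suc (length gs)) = Comp C g (seg C x gs a (length gs))"
  using seg_append[of "length gs" gs a C x "[g]"] by simp

lemma vertex_append: "q \<le> length fs \<Longrightarrow> vertex C x (fs @ gs) q = vertex C x fs q"
  by (cases q) (simp_all add: nth_append)

context
  fixes C :: "('o, 'm) cat" and x :: 'o and fs :: "'m list"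
  assumes C: "category C" and path: "is_path C x fs"
begin

lemma path_nth:
  "k < length fs \<Longrightarrow> fs ! k \<in> hom C (vertex C x fs k) (vertex C x fs (Suc k))"
  using path unfolding is_path_iff[OF C] by (simp add: hom_def)

lemma vertex_Obj: "k \<le> length fs \<Longrightarrow> vertex C x fs k \<in> Obj C"
  using path unfolding is_path_iff[OF C] by (cases k) (auto simp: category_ops[OF C])

lemma seg_self: "seg C x fs p p = Ident C (vertex C x fs p)"
  by (cases p) simp_all

lemma seg_hom: "p \<le> q \<Longrightarrow> q \<le> length fs \<Longrightarrow> seg C x fs p q \<in> hom C (vertex C x fs p) (vertex C x fs q)"
proof (induction q)
  case 0
  then show ?case using hom_ident[OF C vertex_Obj[of 0]] by simp
next
  case (Suc q)
  show ?case
  proof (cases "p = Suc q")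
    case True
    then show ?thesis using hom_ident[OF C vertex_Obj[of p]] Suc.prems by (simp add: seg_self del: seg.simps vertex_simps)
  next
    case False
    then show ?thesis using Suc hom_comp[OF C Suc.IH path_nth[of q]] by simp
  qed
qed

lemma seg_Suc: "p < length fs \<Longrightarrow> seg C x fs p (Suc p) = fs ! p"
  using path_nth[of p] by (simp add: seg_self hom_def category_ops[OF C])

lemma seg_Comp:
  assumes "p \<le> q" "q \<le> r" "r \<le> length fs"
  shows "Comp C (seg C x fs q r) (seg C x fs p q) = seg C x fs p r"
  using assms(2,3)
proof (induction r rule: dec_induct)
  case base
  then show ?case using seg_hom[OF assms(1)] by (simp add: seg_self hom_def category_ops[OF C])
next
  case (step r)
  then have "Comp C (Comp C (fs ! r) (seg C x fs q r)) (seg C x fs p q)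
      = Comp C (fs ! r) (Comp C (seg C x fs q r) (seg C x fs p q))"
    using hom_assoc[OF C seg_hom[OF assms(1)] seg_hom[of q r] path_nth[of r]] by simp
  then show ?case using step assms(1) by simp
qed

lemma pull_ident: "pull C x fs (length fs) (\<lambda>k. k) = Chain x fs"
  unfolding pull_def by (auto intro!: nth_equalityI simp del: seg.simps simp: seg_Suc)

context
  fixes k :: nat and \<theta> :: "nat \<Rightarrow> nat"
  assumes mono: "mono \<theta>" and top: "\<theta> k \<le> length fs"
begin

lemma pull_bound: "j \<le> k \<Longrightarrow> \<theta> j \<le> length fs"
  using monoD[OF mono, of j k] top by simp

lemma vertex_pull:
  assumes "j \<le> k"
  shows "vertex C (vertex C x fs (\<theta> 0)) (map (\<lambda>j. seg C x fs (\<theta> j) (\<theta> (Suc j))) [0..<k]) j = vertex C x fs (\<theta> j)"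
proof (cases j)
  case (Suc i)
  then show ?thesis
    using assms seg_hom[OF monoD[OF mono, of i j] pull_bound[OF assms]] by (simp add: hom_def)
qed simp

lemma is_path_pull:
  "is_path C (vertex C x fs (\<theta> 0)) (map (\<lambda>j. seg C x fs (\<theta> j) (\<theta> (Suc j))) [0..<k])"
  unfolding is_path_iff[OF C]
proof (intro conjI allI impI)
  show "vertex C x fs (\<theta> 0) \<in> Obj C" by (rule vertex_Obj[OF pull_bound]) simp
  fix j assume "j < length (map (\<lambda>j. seg C x fs (\<theta> j) (\<theta> (Suc j))) [0..<k])"
  then have j: "j < k" by simp
  have "seg C x fs (\<theta> j) (\<theta> (Suc j)) \<in> hom C (vertex C x fs (\<theta> j)) (vertex C x fs (\<theta> (Suc j)))"
    using j by (intro seg_hom monoD[OF mono] pull_bound) simp_all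
  then show "map (\<lambda>j. seg C x fs (\<theta> j) (\<theta> (Suc j))) [0..<k] ! j \<in> Arr C"
    "Dom C (map (\<lambda>j. seg C x fs (\<theta> j) (\<theta> (Suc j))) [0..<k] ! j)
      = vertex C (vertex C x fs (\<theta> 0)) (map (\<lambda>j. seg C x fs (\<theta> j) (\<theta> (Suc j))) [0..<k]) j"
    using j by (simp_all add: vertex_pull hom_def)
qed

lemma seg_pull:
  assumes "p \<le> q" "q \<le> k"
  shows "seg C (vertex C x fs (\<theta> 0)) (map (\<lambda>j. seg C x fs (\<theta> j) (\<theta> (Suc j))) [0..<k]) p q
         = seg C x fs (\<theta> p) (\<theta> q)"
  using assms
proof (induction q rule: dec_induct)
  case base
  have "seg C (vertex C x fs (\<theta> 0)) (map (\<lambda>j. seg C x fs (\<theta> j) (\<theta> (Suc j))) [0..<k]) p p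
      = Ident C (vertex C (vertex C x fs (\<theta> 0)) (map (\<lambda>j. seg C x fs (\<theta> j) (\<theta> (Suc j))) [0..<k]) p)"
    by (cases p) simp_all
  then show ?case using base by (simp add: vertex_pull seg_self)
next
  case (step q)
  then show ?case
    using seg_Comp[OF monoD[OF mono, of p q] monoD[OF mono, of q "Suc q"] pull_bound[of "Suc q"]] by simp
qed

text \<open>Contravariant functoriality in the monotone map. It replaces manipulations of lists of
  arrows by composition of maps of ordinals.\<close>

lemma pull_pull:
  assumes "mono \<eta>" "\<eta> l \<le> k"
  shows "pull C (vertex C x fs (\<theta> 0)) (map (\<lambda>j. seg C x fs (\<theta> j) (\<theta> (Suc j))) [0..<k]) l \<eta>
         = pull C x fs l (\<lambda>j. \<theta> (\<eta> j))"
proof -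
  have "\<eta> j \<le> k" if "j \<le> l" for j using monoD[OF assms(1) that] assms(2) by simp
  then show ?thesis
    using monoD[OF assms(1)] unfolding pull_def
    by (simp del: seg.simps vertex_simps add: vertex_pull seg_pull)
qed

end

text \<open>Replaces the list surgery in \<open>cell_face\<close> by the operator of a monotone map.
  The list has to be nonempty because the face of a lone object is a component, not a chain.\<close>

lemma cell_face_Chain:
  assumes B: "Base D = C" and ne: "fs \<noteq> []" and i: "i \<le> length fs"
  shows "cell_face D i (Chain x fs) = pull C x fs (length fs - 1) (face_map i)"
proof -
  have two: "seg C x fs k (Suc (Suc k)) = Comp C (fs ! Suc k) (fs ! k)" if "Suc k < length fs" for k
    using that seg_Suc[of k] by (simp del: seg.simps(2) add: seg.simps(2)[of C x fs k "Suc k"])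
  consider "i = 0" | "i = length fs" "i \<noteq> 0" | "i \<noteq> 0" "i < length fs" using i by linarith
  then show ?thesis
  proof cases
    case 1
    then show ?thesis
      using ne unfolding pull_def
      by (auto simp: B hd_conv_nth nth_tl face_map_def seg_Suc simp del: seg.simps intro!: nth_equalityI)
  next
    case 2
    then show ?thesis
      using ne unfolding pull_def
      by (auto simp: nth_butlast face_map_def seg_Suc simp del: seg.simps intro!: nth_equalityI)
  next
    case 3
    have "take (i - 1) fs @ Comp C (fs ! i) (fs ! (i - 1)) # drop (i + 1) fs
        = map (\<lambda>j. seg C x fs (face_map i j) (face_map i (Suc j))) [0..<length fs - 1]"
    proof (rule nth_equalityI)
      show "length (take (i - 1) fs @ Comp C (fs ! i) (fs ! (i - 1)) # drop (i + 1) fs)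
          = length (map (\<lambda>j. seg C x fs (face_map i j) (face_map i (Suc j))) [0..<length fs - 1])"
        using 3 by auto
      fix k assume "k < length (take (i - 1) fs @ Comp C (fs ! i) (fs ! (i - 1)) # drop (i + 1) fs)"
      then have k: "Suc k < length fs" using 3 by auto
      consider "Suc k < i" | "Suc k = i" | "i \<le> k" by linarith
      then show "(take (i - 1) fs @ Comp C (fs ! i) (fs ! (i - 1)) # drop (i + 1) fs) ! k
          = map (\<lambda>j. seg C x fs (face_map i j) (face_map i (Suc j))) [0..<length fs - 1] ! k"
      proof cases
        case 1
        then have "k < i - 1" by simp
        then show ?thesis using k 3 1
          by (simp add: nth_append face_map_def seg_Suc del: seg.simps)
      next
        case 2
        then show ?thesis using k two[of k]
          by (auto simp: nth_append face_map_def simp del: seg.simps)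
      next
        case i: 3
        then have "k - (i - 1) = Suc (k - i)" "\<not> k < i - 1" "min (length fs) (i - 1) = i - 1"
          using 3 by linarith+
        then show ?thesis using k 3 i
          by (simp add: nth_append face_map_def seg_Suc del: seg.simps)
      qed
    qed
    then show ?thesis using 3 ne unfolding pull_def by (simp add: B face_map_def)
  qed
qed

text \<open>The bound on \<open>i\<close> leaves out the top degeneracy, which appends an arrow to a
  chosen terminal and is treated by \<open>cell_degen_top_pull\<close>.\<close>

lemma cell_degen_Chain:
  assumes B: "Base D = C" and i: "i \<le> length fs"
  shows "cell_degen D i (Chain x fs) = pull C x fs (Suc (length fs)) (degen_map i)"
proof -
  have "take i fs @ Ident C (vertex C x fs i) # drop i fs
      = map (\<lambda>j. seg C x fs (degen_map i j) (degen_map i (Suc j))) [0..<Suc (length fs)]"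
  proof (rule nth_equalityI)
    fix k assume "k < length (take i fs @ Ident C (vertex C x fs i) # drop i fs)"
    then have k: "k < Suc (length fs)" using i by auto
    then have r: "map (\<lambda>j. seg C x fs (degen_map i j) (degen_map i (Suc j))) [0..<Suc (length fs)] ! k
        = seg C x fs (degen_map i k) (degen_map i (Suc k))" by (simp del: upt_Suc)
    consider "k < i" | "k = i" | "i < k" by linarith
    then show "(take i fs @ Ident C (vertex C x fs i) # drop i fs) ! k
        = map (\<lambda>j. seg C x fs (degen_map i j) (degen_map i (Suc j))) [0..<Suc (length fs)] ! k"
    proof cases
      case 1
      then show ?thesis using k i r
        by (simp add: nth_append degen_map_def seg_Suc del: seg.simps)
    next
      case 2
      then show ?thesis using k i r
        by (simp add: nth_append degen_map_def seg_self min_def del: seg.simps)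
    next
      case 3
      then obtain k' where "k = Suc k'" by (cases k) auto
      then show ?thesis using k 3 i r
        by (simp add: nth_append degen_map_def seg_Suc min_def Suc_diff_le del: seg.simps)
    qed
  qed (use i in simp)
  then show ?thesis using i unfolding pull_def by (simp add: B degen_map_def del: upt_Suc)
qed

end

lemma cell_face_pull:
  assumes "is_ltcat D" "is_path (Base D) x fs" "mono \<theta>" "\<theta> (Suc k) \<le> length fs" "i \<le> Suc k"
  shows "cell_face D i (pull (Base D) x fs (Suc k) \<theta>) = pull (Base D) x fs k (\<lambda>j. \<theta> (face_map i j))"
proof -
  have C: "category (Base D)" using assms(1) by blast
  have "face_map i k \<le> Suc k" by (simp add: face_map_def)
  then show ?thesis
    using cell_face_Chain[OF C is_path_pull[OF C assms(2-4)] refl, of i]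
      pull_pull[OF C assms(2-4) mono_face_map, of i k] assms(5)
    by (simp add: pull_def[of _ _ _ "Suc k" \<theta>] del: upt_Suc)
qed

lemma cell_degen_pull:
  assumes "is_ltcat D" "is_path (Base D) x fs" "mono \<theta>" "\<theta> k \<le> length fs" "i \<le> k"
  shows "cell_degen D i (pull (Base D) x fs k \<theta>) = pull (Base D) x fs (Suc k) (\<lambda>j. \<theta> (degen_map i j))"
proof -
  have C: "category (Base D)" using assms(1) by blast
  have "degen_map i (Suc k) \<le> k" using assms(5) by (simp add: degen_map_def)
  then show ?thesis
    using cell_degen_Chain[OF C is_path_pull[OF C assms(2-4)] refl, of i]
      pull_pull[OF C assms(2-4) mono_degen_map, of i "Suc k"] assms(5)
    by (simp add: pull_def[of _ _ _ k \<theta>] del: upt_Suc)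
qed

section \<open>Components and local terminals\<close>

lemma cpt_self [simp]: "x \<in> cpt C x"
  using reflpD[OF reflp_equivclp] by (simp add: cpt_def)

lemma cpt_eqI: "y \<in> cpt C x \<Longrightarrow> cpt C y = cpt C x"
proof -
  let ?R = "\<lambda>a b. hom C a b \<noteq> {}"
  assume "y \<in> cpt C x"
  then have xy: "equivclp ?R x y" by (simp add: cpt_def)
  then have yx: "equivclp ?R y x" by (rule equivclp_sym)
  have "equivclp ?R y z \<longleftrightarrow> equivclp ?R x z" for z
    using transpD[OF transp_equivclp xy, of z] transpD[OF transp_equivclp yx, of z] by blast
  then show ?thesis by (simp add: cpt_def)
qed

lemma cpt_hom:
  assumes "f \<in> hom C x y"
  shows "cpt C x = cpt C y"
proof -
  have "y \<in> cpt C x"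
  proof -
    have "symclp (\<lambda>a b. hom C a b \<noteq> {}) x y" using assms unfolding symclp_def by blast
    then show ?thesis by (simp add: cpt_def equivclp_def r_into_rtranclp)
  qed
  then show ?thesis by (rule cpt_eqI[symmetric])
qed

lemma cpt_Obj:
  assumes "category C" "x \<in> Obj C" "y \<in> cpt C x"
  shows "y \<in> Obj C"
proof -
  have "equivclp (\<lambda>a b. hom C a b \<noteq> {}) x y" using assms(3) by (simp add: cpt_def)
  then show ?thesis
    by (induction rule: equivclp_induct) (use assms in \<open>auto simp: hom_def category_ops\<close>)
qed

lemma pi0_mem:
  assumes "category C" "c \<in> pi0 C" "x \<in> c"
  shows "x \<in> Obj C" "cpt C x = c"
  using assms by (auto simp: pi0_def cpt_eqI intro: cpt_Obj)

lemma is_ltcat_Lt: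
  assumes "is_ltcat C" "c \<in> pi0 (Base C)"
  shows "Lt C c \<in> Obj (Base C)" "cpt (Base C) (Lt C c) = c" "local_terminal (Base C) (Lt C c)"
    "Lt C c \<in> chosen C"
  using assms pi0_mem[of "Base C" c "Lt C c"] by (auto simp: is_ltcat_def chosen_def)

lemma cpt_pi0: "x \<in> Obj C \<Longrightarrow> cpt C x \<in> pi0 C"
  by (simp add: pi0_def)

lemma chosen_iff:
  assumes "is_ltcat C"
  shows "u \<in> chosen C \<longleftrightarrow> u \<in> Obj (Base C) \<and> Lt C (cpt (Base C) u) = u"
proof
  assume "u \<in> chosen C"
  then obtain c where "c \<in> pi0 (Base C)" "u = Lt C c" by (auto simp: chosen_def)
  then show "u \<in> Obj (Base C) \<and> Lt C (cpt (Base C) u) = u" using is_ltcat_Lt[OF assms] by simp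
next
  assume "u \<in> Obj (Base C) \<and> Lt C (cpt (Base C) u) = u"
  then show "u \<in> chosen C" using is_ltcat_Lt(4)[OF assms cpt_pi0, of u] by simp
qed

lemma local_terminal_unique:
  assumes "local_terminal C u" "f \<in> hom C x u" "g \<in> hom C x u"
  shows "f = g"
proof -
  have "x \<in> cpt C u" using cpt_hom[OF assms(2)] cpt_self[of x C] by simp
  then have "\<exists>!f. f \<in> hom C x u" using assms(1) by (simp add: local_terminal_def)
  then show ?thesis using assms(2,3) by blast
qed

lemma tau_hom:
  assumes "is_ltcat C" "x \<in> Obj (Base C)"
  shows "tau C x \<in> hom (Base C) x (Lt C (cpt (Base C) x))"
proof -
  note L = is_ltcat_Lt[OF assms(1) cpt_pi0[OF assms(2)]]
  have "\<exists>!f. f \<in> hom (Base C) x (Lt C (cpt (Base C) x))"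
    using L(3) unfolding local_terminal_def L(2) by simp
  then show ?thesis unfolding tau_def by (rule theI')
qed

text \<open>The usual way to recognise a \<open>tau\<close>: any arrow into a chosen object is one,
  in particular any composite ending there.\<close>

lemma tau_unique:
  assumes "is_ltcat C" "f \<in> hom (Base C) x u" "u \<in> chosen C"
  shows "tau C x = f"
proof -
  have u: "u \<in> Obj (Base C)" "Lt C (cpt (Base C) u) = u" using assms by (auto simp: chosen_iff)
  have c: "cpt (Base C) x = cpt (Base C) u" by (rule cpt_hom[OF assms(2)])
  have "x \<in> Obj (Base C)" using assms by (auto simp: hom_def category_ops is_ltcat_category)
  then have "tau C x \<in> hom (Base C) x u" using tau_hom[OF assms(1)] u c by metis
  then show ?thesis
    using is_ltcat_Lt(3)[OF assms(1) cpt_pi0[OF u(1)]] u assms(2) by (metis local_terminal_unique)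
qed

lemma is_path_tau:
  assumes "is_ltcat C" "is_path (Base C) x fs"
  shows "is_path (Base C) x (fs @ [tau C (vertex (Base C) x fs (length fs))])"
proof -
  note C = is_ltcat_category[OF assms(1)]
  have "tau C (vertex (Base C) x fs (length fs)) \<in> Arr (Base C) \<and>
      Dom (Base C) (tau C (vertex (Base C) x fs (length fs))) = vertex (Base C) x fs (length fs)"
    using tau_hom[OF assms(1) vertex_Obj[OF C assms(2), of "length fs"]] by (simp add: hom_def)
  then show ?thesis
    using assms(2) unfolding is_path_iff[OF C] by (auto simp: nth_append vertex_append less_Suc_eq)
qed

text \<open>The top degeneracy also becomes the operator of a monotone map, on the path lengthened
  by \<open>tau\<close> of its last vertex. The new arrow starts at vertex
  \<open>\<theta> k\<close>, not necessarily the last one; it is the composite to the end of the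
  longer path, by uniqueness of arrows into a chosen terminal.\<close>

lemma cell_degen_top_pull:
  assumes D: "is_ltcat D" and p: "is_path (Base D) x fs" and m: "mono \<theta>" and t: "\<theta> k \<le> length fs"
  shows "cell_degen D (Suc k) (pull (Base D) x fs k \<theta>)
    = pull (Base D) x (fs @ [tau D (vertex (Base D) x fs (length fs))]) (Suc k)
        (\<lambda>j. if j \<le> k then \<theta> j else Suc (length fs))"
proof -
  note C = is_ltcat_category[OF D]
  define T where "T = tau D (vertex (Base D) x fs (length fs))"
  note p' = is_path_tau[OF D p, folded T_def]
  have v: "vertex (Base D) x fs (length fs) \<in> Obj (Base D)" by (rule vertex_Obj[OF C p]) simp
  have ch: "Lt D (cpt (Base D) (vertex (Base D) x fs (length fs))) \<in> chosen D"
    by (rule is_ltcat_Lt(4)[OF D cpt_pi0[OF v]])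
  have "seg (Base D) x (fs @ [T]) (\<theta> k) (Suc (length fs))
      \<in> hom (Base D) (vertex (Base D) x (fs @ [T]) (\<theta> k)) (vertex (Base D) x (fs @ [T]) (Suc (length fs)))"
    using t by (intro seg_hom[OF C p']) simp_all
  moreover have "Cod (Base D) T = Lt D (cpt (Base D) (vertex (Base D) x fs (length fs)))"
    using tau_hom[OF D v] by (simp add: T_def hom_def)
  ultimately have "tau D (vertex (Base D) x fs (\<theta> k)) = seg (Base D) x (fs @ [T]) (\<theta> k) (Suc (length fs))"
    using t ch by (intro tau_unique[OF D]) (auto simp: vertex_append simp del: seg.simps)
  moreover have "\<theta> j \<le> length fs" if "j \<le> k" for j using monoD[OF m that] t by simp
  ultimately show ?thesis
    using monoD[OF m] vertex_pull[OF C p m t, of k] unfolding T_def[symmetric]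
    by (simp add: pull_def seg_append vertex_append del: seg.simps vertex_simps cong: map_cong)
qed

section \<open>The local-terminals nerve\<close>

lemma cells_iff [simp]:
  "Cpt c \<in> cells C n \<longleftrightarrow> n = 0 \<and> c \<in> pi0 C"
  "Chain x fs \<in> cells C n \<longleftrightarrow> n = Suc (length fs) \<and> is_path C x fs"
  by (auto simp: cells_def)

lemma cellsE:
  assumes "\<sigma> \<in> cells C n"
  obtains (Cpt) c where "\<sigma> = Cpt c" "n = 0" "c \<in> pi0 C"
    | (Chain) x fs where "\<sigma> = Chain x fs" "n = Suc (length fs)" "is_path C x fs"
  using assms by (cases \<sigma>) auto

lemma pull_cells:
  "category C \<Longrightarrow> is_path C x fs \<Longrightarrow> mono \<theta> \<Longrightarrow> \<theta> k \<le> length fs \<Longrightarrow> pull C x fs k \<theta> \<in> cells C (Suc k)"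
  using is_path_pull unfolding pull_def by simp

lemma mono_ops:
  "mono (\<lambda>k :: nat. k)" "mono \<theta> \<Longrightarrow> mono (\<lambda>k. \<theta> (face_map i k))" "mono \<theta> \<Longrightarrow> mono (\<lambda>k. \<theta> (degen_map i k))"
  using mono_face_map[of i] mono_degen_map[of i] by (simp_all add: mono_def)

lemma tau_chosen:
  assumes "is_ltcat C" "u \<in> chosen C"
  shows "tau C u = Ident (Base C) u"
  using assms by (intro tau_unique) (auto simp: hom_ident is_ltcat_category chosen_iff)

context
  fixes D :: "('o, 'm) ltcat"
  assumes D: "is_ltcat D"
begin

lemma catK: "category (Base D)" using D by blast

lemma face_pull:
  assumes "is_path (Base D) x fs" "mono \<theta>" "\<theta> (Suc k) \<le> length fs" "i \<le> Suc k"
  shows "cell_face D i (pull (Base D) x fs (Suc k) \<theta>) = pull (Base D) x fs k (\<lambda>j. \<theta> (face_map i j))"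
  using assms cell_face_pull[OF D] by blast

lemma degen_pull:
  assumes "is_path (Base D) x fs" "mono \<theta>" "\<theta> k \<le> length fs" "i \<le> k"
  shows "cell_degen D i (pull (Base D) x fs k \<theta>) = pull (Base D) x fs (Suc k) (\<lambda>j. \<theta> (degen_map i j))"
  using assms cell_degen_pull[OF D] by blast

lemma Chain_pull: "is_path (Base D) x fs \<Longrightarrow> length fs = k \<Longrightarrow> Chain x fs = pull (Base D) x fs k (\<lambda>k. k)"
  using pull_ident[OF catK] by metis

lemma cell_face_cells:
  assumes "\<sigma> \<in> cells (Base D) n" "i < n"
  shows "cell_face D i \<sigma> \<in> cells (Base D) (n - 1)"
  using assms(1)
proof (cases rule: cellsE)
  case (Chain x fs)
  show ?thesis
  proof (cases "length fs")
    case 0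
    then show ?thesis using Chain cpt_pi0[of x "Base D"] by (simp add: is_path_iff[OF catK])
  next
    case (Suc k)
    have "cell_face D i \<sigma> = pull (Base D) x fs k (face_map i)"
      using Chain assms(2) face_pull[OF Chain(3) mono_ops(1), of k i] Suc by (simp add: Chain_pull)
    then show ?thesis
      using Chain Suc pull_cells[OF catK Chain(3) mono_face_map, of i k] by (simp add: face_map_def)
  qed
qed (use assms in simp)

lemma cell_degen_cells:
  assumes "\<sigma> \<in> cells (Base D) n" "i \<le> n"
  shows "cell_degen D i \<sigma> \<in> cells (Base D) (Suc n)"
  using assms(1)
proof (cases rule: cellsE)
  case (Cpt c)
  then show ?thesis using is_ltcat_Lt(1)[OF D Cpt(3)] by simp
next
  case (Chain x fs)
  show ?thesis
  proof (cases "i \<le> length fs")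
    case True
    have "cell_degen D i \<sigma> = pull (Base D) x fs (Suc (length fs)) (degen_map i)"
      using Chain True degen_pull[OF Chain(3) mono_ops(1), of "length fs" i] by (simp add: Chain_pull)
    then show ?thesis
      using Chain True pull_cells[OF catK Chain(3) mono_degen_map, of i "Suc (length fs)"] by (simp add: degen_map_def)
  next
    case False
    then show ?thesis using Chain is_path_tau[OF D Chain(3)] by simp
  qed
qed

section \<open>Simplicial identities in the local-terminals nerve\<close>

lemma cell_face_face:
  assumes "\<sigma> \<in> cells (Base D) n" "i < j" "j < n"
  shows "cell_face D i (cell_face D j \<sigma>) = cell_face D (j - 1) (cell_face D i \<sigma>)"
  using assms(1)
proof (cases rule: cellsE)
  case (Chain x fs)
  consider "length fs = 0" | "length fs = 1" | k where "length fs = Suc (Suc k)"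
    by (metis One_nat_def old.nat.exhaust)
  then show ?thesis
  proof cases
    case 1
    then show ?thesis using assms Chain by simp
  next
    case 2
    then obtain f where fs: "fs = [f]" by (auto simp: length_Suc_conv)
    \<comment> \<open>Both double faces of a single arrow are components, and its end points are
      connected.\<close>
    then have "cpt (Base D) x = cpt (Base D) (Cod (Base D) f)" using Chain(3) by (intro cpt_hom[of f]) (simp add: hom_def)
    then show ?thesis using assms Chain fs by (auto simp: less_Suc_eq)
  next
    case 3
    have b: "face_map j (Suc k) \<le> length fs" "face_map i (Suc k) \<le> length fs"
      using 3 by (auto simp: face_map_def)
    have "cell_face D i (cell_face D j \<sigma>) = pull (Base D) x fs k (\<lambda>l. face_map j (face_map i l))"
      using Chain assms 3 b face_pull[OF Chain(3) mono_ops(1), of "Suc k" j]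
        face_pull[OF Chain(3) mono_face_map, of j k i] by (simp add: Chain_pull)
    moreover have "cell_face D (j - 1) (cell_face D i \<sigma>) = pull (Base D) x fs k (\<lambda>l. face_map i (face_map (j - 1) l))"
      using Chain assms 3 b face_pull[OF Chain(3) mono_ops(1), of "Suc k" i]
        face_pull[OF Chain(3) mono_face_map, of i k "j - 1"] by (simp add: Chain_pull)
    ultimately show ?thesis using assms(2) by (auto simp: face_map_def intro!: pull_cong)
  qed
qed (use assms in simp)

lemma cell_degen_degen:
  assumes "\<sigma> \<in> cells (Base D) n" "i \<le> j" "j \<le> n"
  shows "cell_degen D i (cell_degen D j \<sigma>) = cell_degen D (Suc j) (cell_degen D i \<sigma>)"
  using assms(1)
proof (cases rule: cellsE)
  case (Cpt c)
  then show ?thesis using assms tau_chosen[OF D is_ltcat_Lt(4)[OF D Cpt(3)]] by simp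
next
  case (Chain x fs)
  define m where "m = length fs"
  \<comment> \<open>If the top degeneracy takes part, both sides are compared as operators on this
    lengthened path.\<close>
  define T where "T = fs @ [tau D (vertex (Base D) x fs m)]"
  have pT: "is_path (Base D) x T" and lT: "length T = Suc m"
    using is_path_tau[OF D Chain(3)] by (simp_all add: T_def m_def)
  consider "j \<le> m" | "j = Suc m" "i \<le> m" | "j = Suc m" "i = Suc m"
    using assms(2,3) Chain(2) unfolding m_def by linarith
  then show ?thesis
  proof cases
    case 1
    have b: "degen_map j (Suc m) \<le> length fs" "degen_map i (Suc m) \<le> length fs"
      using 1 assms(2) by (auto simp: degen_map_def m_def)
    have "cell_degen D i (cell_degen D j \<sigma>) = pull (Base D) x fs (Suc (Suc m)) (\<lambda>l. degen_map j (degen_map i l))"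
      using Chain(1) 1 assms b degen_pull[OF Chain(3) mono_ops(1), of m j]
        degen_pull[OF Chain(3) mono_degen_map, of j "Suc m" i] Chain_pull[OF Chain(3) m_def[symmetric]]
      by (simp add: m_def)
    moreover have "cell_degen D (Suc j) (cell_degen D i \<sigma>) = pull (Base D) x fs (Suc (Suc m)) (\<lambda>l. degen_map i (degen_map (Suc j) l))"
      using Chain(1) 1 assms b degen_pull[OF Chain(3) mono_ops(1), of m i]
        degen_pull[OF Chain(3) mono_degen_map, of i "Suc m" "Suc j"] Chain_pull[OF Chain(3) m_def[symmetric]]
      by (simp add: m_def)
    ultimately show ?thesis using assms(2) by (auto simp: degen_map_def intro!: pull_cong)
  next
    case 2
    have b: "degen_map i (Suc m) \<le> length fs" using 2 by (auto simp: degen_map_def m_def)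
    have "cell_degen D j \<sigma> = pull (Base D) x T (Suc m) (\<lambda>k. k)"
      using 2 Chain(1) Chain_pull[OF pT lT] by (simp add: T_def m_def)
    then have "cell_degen D i (cell_degen D j \<sigma>) = pull (Base D) x T (Suc (Suc m)) (degen_map i)"
      using degen_pull[OF pT mono_ops(1), of "Suc m" i] 2 lT by simp
    moreover have "cell_degen D i \<sigma> = pull (Base D) x fs (Suc m) (degen_map i)"
      using Chain(1) 2 degen_pull[OF Chain(3) mono_ops(1), of m i] Chain_pull[OF Chain(3) m_def[symmetric]]
      by (simp add: m_def)
    then have "cell_degen D (Suc j) (cell_degen D i \<sigma>)
        = pull (Base D) x T (Suc (Suc m)) (\<lambda>k. if k \<le> Suc m then degen_map i k else Suc m)"
      using cell_degen_top_pull[OF D Chain(3) mono_degen_map b] 2 unfolding T_def m_def by simp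
    ultimately show ?thesis using 2 by (auto simp: degen_map_def intro!: pull_cong)
  next
    case 3
    have v: "vertex (Base D) x fs m \<in> Obj (Base D)" using vertex_Obj[OF catK Chain(3), of m] by (simp add: m_def)
    then have "Cod (Base D) (tau D (vertex (Base D) x fs m)) = Lt D (cpt (Base D) (vertex (Base D) x fs m))"
      using tau_hom[OF D] by (simp add: hom_def)
    \<comment> \<open>The last vertex of \<open>T\<close> is chosen, so its \<open>tau\<close> is an
      identity: on \<open>T\<close>, appending \<open>tau\<close> and repeating the last vertex
      coincide.\<close>
    then have "tau D (vertex (Base D) x T (Suc m)) = Ident (Base D) (vertex (Base D) x T (Suc m))"
      using tau_chosen[OF D is_ltcat_Lt(4)[OF D cpt_pi0[OF v]]] by (simp add: T_def m_def)
    then have "cell_degen D (Suc m) (Chain x T) = cell_degen D (Suc (Suc m)) (Chain x T)"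
      using lT by (simp del: vertex_simps)
    moreover have "cell_degen D (Suc m) \<sigma> = Chain x T" using Chain(1) by (simp add: T_def m_def)
    ultimately show ?thesis using 3 by simp
  qed
qed

lemma cell_face_degen_less:
  assumes "\<sigma> \<in> cells (Base D) n" "i < j" "j \<le> n"
  shows "cell_face D i (cell_degen D j \<sigma>) = cell_degen D (j - 1) (cell_face D i \<sigma>)"
  using assms(1)
proof (cases rule: cellsE)
  case (Chain x fs)
  define T where "T = fs @ [tau D (vertex (Base D) x fs (length fs))]"
  have pT: "is_path (Base D) x T" and lT: "length T = Suc (length fs)"
    using is_path_tau[OF D Chain(3)] by (simp_all add: T_def)
  show ?thesis
  proof (cases "length fs")
    case 0
    then have "j = 1" "i = 0" "x \<in> Obj (Base D)" using assms Chain by (auto simp: is_path_iff[OF catK])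
    then show ?thesis using 0 Chain(1) tau_hom[OF D, of x] by (simp add: hom_def)
  next
    case (Suc m)
    have b: "face_map i m \<le> length fs" using Suc by (auto simp: face_map_def)
    have f: "cell_face D i \<sigma> = pull (Base D) x fs m (face_map i)"
      using Chain assms Suc face_pull[OF Chain(3) mono_ops(1), of m i] by (simp add: Chain_pull)
    show ?thesis
    proof (cases "j \<le> length fs")
      case True
      then have d: "degen_map j (Suc (Suc m)) \<le> length fs" using Suc by (auto simp: degen_map_def)
      have "cell_face D i (cell_degen D j \<sigma>) = pull (Base D) x fs (Suc m) (\<lambda>l. degen_map j (face_map i l))"
        using Chain True assms d Suc degen_pull[OF Chain(3) mono_ops(1), of "Suc m" j]
          face_pull[OF Chain(3) mono_degen_map, of j "Suc m" i] by (simp add: Chain_pull)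
      moreover have "cell_degen D (j - 1) (cell_face D i \<sigma>) = pull (Base D) x fs (Suc m) (\<lambda>l. face_map i (degen_map (j - 1) l))"
        using degen_pull[OF Chain(3) mono_face_map b, of "j - 1"] True Suc f by simp
      ultimately show ?thesis using assms(2) by (auto simp: degen_map_def face_map_def intro!: pull_cong)
    next
      case False
      then have j: "j = Suc (Suc m)" using assms Chain Suc by simp
      have "cell_degen D j \<sigma> = pull (Base D) x T (Suc (Suc m)) (\<lambda>k. k)"
        using j Suc Chain(1) Chain_pull[OF pT lT] by (simp add: T_def)
      then have "cell_face D i (cell_degen D j \<sigma>) = pull (Base D) x T (Suc m) (face_map i)"
        using face_pull[OF pT mono_ops(1), of "Suc m" i] lT Suc assms(2) j by simp
      moreover have "cell_degen D (j - 1) (cell_face D i \<sigma>)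
          = pull (Base D) x T (Suc m) (\<lambda>k. if k \<le> m then face_map i k else Suc (length fs))"
        using cell_degen_top_pull[OF D Chain(3) mono_face_map b] f j by (simp add: T_def)
      ultimately show ?thesis using assms(2) j Suc by (auto simp: face_map_def intro!: pull_cong)
    qed
  qed
qed (use assms in simp)

lemma cell_face_degen_same:
  assumes "\<sigma> \<in> cells (Base D) n" "i = j \<or> i = Suc j" "i \<le> n"
  shows "cell_face D i (cell_degen D j \<sigma>) = \<sigma>"
  using assms(1)
proof (cases rule: cellsE)
  case (Cpt c)
  then show ?thesis using assms is_ltcat_Lt(2)[OF D Cpt(3)] by simp
next
  case (Chain x fs)
  define m where "m = length fs"
  show ?thesis
  proof (cases "j \<le> m")
    case True
    then have d: "degen_map j (Suc m) \<le> length fs" by (auto simp: degen_map_def m_def)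
    have "cell_face D i (cell_degen D j \<sigma>) = pull (Base D) x fs m (\<lambda>l. degen_map j (face_map i l))"
      using Chain True assms d degen_pull[OF Chain(3) mono_ops(1), of m j]
        face_pull[OF Chain(3) mono_degen_map, of j m i] by (simp add: Chain_pull m_def)
    also have "\<dots> = pull (Base D) x fs m (\<lambda>k. k)"
      using assms(2) by (auto simp: degen_map_def face_map_def intro!: pull_cong)
    finally show ?thesis using Chain Chain_pull[OF Chain(3)] by (simp add: m_def)
  next
    case False
    then have "i = Suc m" "j = Suc m" using assms Chain by (auto simp: m_def)
    then show ?thesis using Chain(1) by (simp add: m_def)
  qed
qed

lemma cell_face_degen_greater:
  assumes "\<sigma> \<in> cells (Base D) n" "Suc j < i" "i \<le> n"
  shows "cell_face D i (cell_degen D j \<sigma>) = cell_degen D j (cell_face D (i - 1) \<sigma>)"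
  using assms(1)
proof (cases rule: cellsE)
  case (Chain x fs)
  then obtain m where m: "length fs = Suc m" using assms by (cases "length fs") auto
  have b: "face_map (i - 1) m \<le> length fs" "degen_map j (Suc (Suc m)) \<le> length fs"
    using m assms Chain by (auto simp: face_map_def degen_map_def)
  have "cell_face D i (cell_degen D j \<sigma>) = pull (Base D) x fs (Suc m) (\<lambda>l. degen_map j (face_map i l))"
    using Chain m assms b degen_pull[OF Chain(3) mono_ops(1), of "Suc m" j]
      face_pull[OF Chain(3) mono_degen_map, of j "Suc m" i] by (simp add: Chain_pull)
  moreover have "cell_degen D j (cell_face D (i - 1) \<sigma>) = pull (Base D) x fs (Suc m) (\<lambda>l. face_map (i - 1) (degen_map j l))"
    using Chain m assms b face_pull[OF Chain(3) mono_ops(1), of m "i - 1"]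
      degen_pull[OF Chain(3) mono_face_map, of "i - 1" m j] by (simp add: Chain_pull)
  ultimately show ?thesis using assms(2) by (auto simp: degen_map_def face_map_def intro!: pull_cong)
qed (use assms in simp)

end

lemma SetCat_Arr: "(A, f, B) \<in> Arr SetCat \<longleftrightarrow> f \<in> A \<rightarrow>\<^sub>E B"
  by (simp add: SetCat_def)

lemma SetCat_restrict:
  assumes "f \<in> A \<rightarrow> B" "g \<in> B \<rightarrow> E"
  shows "Comp SetCat (B, restrict g B, E) (A, restrict f A, B) = (A, \<lambda>x\<in>A. g (f x), E)"
proof -
  have "compose A (restrict g B) (restrict f A) = (\<lambda>x\<in>A. g (f x))"
    using assms(1) by (auto simp: compose_def intro!: restrict_ext)
  then show ?thesis using assms by (simp add: SetCat_def restrict_PiE_iff Pi_iff)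
qed

lemma is_tsplit_nlt:
  assumes D: "is_ltcat D"
  shows "is_tsplit SetCat (nlt_obj D)"
proof -
  let ?C = "cells (Base D)"
  have f: "cell_face D i \<in> ?C n \<rightarrow> ?C (n - 1)" if "i < n" for i n
    using cell_face_cells[OF D] that by auto
  have d: "cell_degen D i \<in> ?C n \<rightarrow> ?C (n + 1)" if "i \<le> n" for i n
    using cell_degen_cells[OF D] that by auto
  have d': "cell_degen D i \<in> ?C n \<rightarrow> ?C m" if "i \<le> n" "m = Suc n" for i n m
    using cell_degen_cells[OF D] that by auto
  have f': "cell_face D i \<in> ?C m \<rightarrow> ?C n" if "i \<le> n" "m = Suc n" for i n m
    using cell_face_cells[OF D, of _ "Suc n"] that by auto
  have ff: "Comp SetCat (?C n, restrict g (?C n), ?C m) (?C l, restrict f (?C l), ?C n) = (?C l, \<lambda>x\<in>?C l. g (f x), ?C m)"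
    if "f \<in> ?C l \<rightarrow> ?C n" "g \<in> ?C n \<rightarrow> ?C m" for f g l n m
    using SetCat_restrict[OF that] .
  have Id: "Ident SetCat (?C n) = (?C n, \<lambda>x\<in>?C n. x, ?C n)" for n by (simp add: SetCat_def)
  show ?thesis
    unfolding nlt_obj_def
  proof (rule is_tsplitI, goal_cases)
    case (1 n) show ?case by (simp add: SetCat_def)
  next
    case (2 n i) then show ?case using f[of i n] by (simp add: SetCat_def mk_cat_hom restrict_PiE_iff Pi_iff)
  next
    case (4 n i) then show ?case using d[of i n] by (simp add: SetCat_def mk_cat_hom restrict_PiE_iff Pi_iff)
  next
    case (6 n i j)
    then have "i < n - 1" "j - 1 < n - 1" "i < n" by auto
    with 6 show ?case
      using cell_face_face[OF D, of _ n i j]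
      by (simp add: ff[OF f f, of j n i, simplified] ff[OF f f, of i n "j - 1", simplified] cong: restrict_cong)
  next
    case (7 n i j)
    then show ?case
      using cell_degen_degen[OF D, of _ n i j]
      by (simp add: ff[OF d' d'] cong: restrict_cong)
  next
    case (8 n i j)
    then show ?case
      using cell_face_degen_less[OF D, of _ n i j]
      by (cases n) (auto simp: ff[OF d' f'] ff[OF f' d'] cong: restrict_cong)
  next
    case (9 n i j)
    then show ?case
      using cell_face_degen_same[OF D, of _ n i j]
      by (auto simp: ff[OF d' f'] Id cong: restrict_cong)
  next
    case (10 n i j)
    then have "j \<le> n - 1" "i - 1 \<le> n - 1" "0 < n" "i - 1 < n" "i \<le> n" "j \<le> n" by auto
    with 10 show ?case
      using cell_face_degen_greater[OF D, of _ n j i]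
      by (cases n) (auto simp: ff[OF d' f'] ff[OF f' d'] cong: restrict_cong)
  qed simp_all
qed

section \<open>Functoriality of the local-terminals nerve\<close>

lemma vertex_map:
  assumes "is_fctr C D F" "category C" "is_path C x fs" "k \<le> length fs"
  shows "vertex D (fo F x) (map (fa F) fs) k = fo F (vertex C x fs k)"
proof (cases k)
  case (Suc i)
  then show ?thesis
    using path_nth[OF assms(2,3), of i] assms(4) is_fctr_ops(4)[OF assms(1), of "fs ! i"] by (simp add: hom_def)
qed simp

lemma is_path_map:
  assumes "is_fctr C D F" "category C" "category D" "is_path C x fs"
  shows "is_path D (fo F x) (map (fa F) fs)"
  unfolding is_path_iff[OF assms(3)]
proof (intro conjI allI impI)
  show "fo F x \<in> Obj D" using assms is_path_iff[OF assms(2), of x fs] by (simp add: is_fctr_ops)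
  fix k assume k: "k < length (map (fa F) fs)"
  then have "fs ! k \<in> Arr C" "Dom C (fs ! k) = vertex C x fs k"
    using path_nth[OF assms(2,4), of k] by (simp_all add: hom_def)
  then show "map (fa F) fs ! k \<in> Arr D"
    "Dom D (map (fa F) fs ! k) = vertex D (fo F x) (map (fa F) fs) k"
    using k vertex_map[OF assms(1,2,4), of k] by (simp_all add: is_fctr_ops[OF assms(1)])
qed

lemma seg_map:
  assumes F: "is_fctr C D F" and C: "category C" and p: "is_path C x fs" and "i \<le> j" "j \<le> length fs"
  shows "seg D (fo F x) (map (fa F) fs) i j = fa F (seg C x fs i j)"
  using assms(4,5)
proof (induction j rule: dec_induct)
  case base
  then show ?case
    using vertex_map[OF F C p, of i] is_fctr_ops(5)[OF F vertex_Obj[OF C p, of i]]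
    by (cases i) (simp_all del: vertex_simps)
next
  case (step j)
  then show ?case
    using is_fctr_hom_comp[OF F seg_hom[OF C p, of i j] path_nth[OF C p, of j]] by simp
qed

lemma cell_map_pull:
  assumes F: "is_fctr C D F" and C: "category C" and p: "is_path C x fs" and t: "mono \<theta>" "\<theta> k \<le> length fs"
  shows "cell_map D F (pull C x fs k \<theta>) = pull D (fo F x) (map (fa F) fs) k \<theta>"
proof -
  have "\<theta> j \<le> length fs" if "j \<le> k" for j using monoD[OF t(1) that] t(2) by simp
  then show ?thesis
    using monoD[OF t(1)] unfolding pull_def
    by (simp add: vertex_map[OF F C p] seg_map[OF F C p] del: seg.simps)
qed

text \<open>A functor maps zigzags to zigzags and components are disjoint, so the defining
  description of \<open>pi0_map\<close> has exactly one solution.\<close>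

lemma pi0_map_cpt:
  assumes F: "is_fctr C D F" and C: "category C" and D: "category D" and x: "x \<in> Obj C"
  shows "pi0_map D F (cpt C x) = cpt D (fo F x)"
proof -
  have "fo F y \<in> cpt D (fo F x)" if "y \<in> cpt C x" for y
  proof -
    have "equivclp (\<lambda>a b. hom C a b \<noteq> {}) x y" using that by (simp add: cpt_def)
    then show ?thesis
    proof (induction rule: equivclp_induct)
      case (step y z)
      then obtain f where "f \<in> hom C y z \<or> f \<in> hom C z y" by blast
      then have "cpt D (fo F y) = cpt D (fo F z)"
        using cpt_hom[OF is_fctr_hom[OF F, of f y z]] cpt_hom[OF is_fctr_hom[OF F, of f z y]] by auto
      then show ?case using step cpt_eqI[of "fo F y" D "fo F x"] cpt_self[of "fo F z" D] by simp
    qed simp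
  qed
  moreover have "cpt D (fo F x) \<in> pi0 D" using is_fctr_ops(1)[OF F x] by (rule cpt_pi0)
  moreover have "d = cpt D (fo F x)" if "d \<in> pi0 D" "fo F ` cpt C x \<subseteq> d" for d
    using pi0_mem(2)[OF D that(1), of "fo F x"] that(2) cpt_self[of x C] by blast
  ultimately show ?thesis unfolding pi0_map_def by (intro the_equality) auto
qed

context
  fixes C D :: "('o, 'm) ltcat" and F
  assumes C: "is_ltcat C" and D: "is_ltcat D" and F: "lt_fctr C D F"
begin

lemma ltF: "is_fctr (Base C) (Base D) F"
  using F by (simp add: lt_fctr_def)

text \<open>A component has only one chosen object, so preserving chosenness already amounts to
  commuting with the choice \<open>Lt\<close>.\<close>

lemma lt_fctr_Lt:
  assumes "c \<in> pi0 (Base C)"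
  shows "fo F (Lt C c) = Lt D (pi0_map (Base D) F c)" "pi0_map (Base D) F c \<in> pi0 (Base D)"
proof -
  have L: "Lt C c \<in> Obj (Base C)" "cpt (Base C) (Lt C c) = c" using is_ltcat_Lt[OF C assms] by auto
  have p: "pi0_map (Base D) F c = cpt (Base D) (fo F (Lt C c))"
    using pi0_map_cpt[OF ltF is_ltcat_category[OF C] is_ltcat_category[OF D] L(1)] L(2) by simp
  have "fo F (Lt C c) \<in> chosen D" using F is_ltcat_Lt(4)[OF C assms] by (auto simp: lt_fctr_def)
  then show "fo F (Lt C c) = Lt D (pi0_map (Base D) F c)" "pi0_map (Base D) F c \<in> pi0 (Base D)"
    using p L is_fctr_ops(1)[OF ltF] by (simp_all add: chosen_iff[OF D] cpt_pi0)
qed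

lemma lt_fctr_tau:
  assumes "x \<in> Obj (Base C)"
  shows "tau D (fo F x) = fa F (tau C x)"
proof (rule tau_unique[OF D is_fctr_hom[OF ltF tau_hom[OF C assms]]])
  show "fo F (Lt C (cpt (Base C) x)) \<in> chosen D"
    using F is_ltcat_Lt(4)[OF C cpt_pi0[OF assms]] by (auto simp: lt_fctr_def)
qed

lemma cell_map_cells:
  assumes "\<sigma> \<in> cells (Base C) n"
  shows "cell_map (Base D) F \<sigma> \<in> cells (Base D) n"
  using assms
  by (cases rule: cellsE)
    (simp_all add: lt_fctr_Lt is_path_map[OF ltF is_ltcat_category[OF C] is_ltcat_category[OF D]])

lemma cell_map_face:
  assumes "\<sigma> \<in> cells (Base C) n" "i < n"
  shows "cell_map (Base D) F (cell_face C i \<sigma>) = cell_face D i (cell_map (Base D) F \<sigma>)"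
  using assms(1)
proof (cases rule: cellsE)
  case (Chain x fs)
  note c = is_ltcat_category[OF C] and d = is_ltcat_category[OF D]
  show ?thesis
  proof (cases "fs = []")
    case True
    then show ?thesis using Chain by (simp add: pi0_map_cpt[OF ltF c d])
  next
    case False
    then have "face_map i (length fs - 1) \<le> length fs" by (cases fs) (auto simp: face_map_def)
    then show ?thesis
      using Chain False assms(2) cell_face_Chain[OF c Chain(3) refl False, of i]
        cell_face_Chain[OF d is_path_map[OF ltF c d Chain(3)] refl, of i]
        cell_map_pull[OF ltF c Chain(3) mono_face_map, of i "length fs - 1"]
      by simp
  qed
qed (use assms in simp)

lemma cell_map_degen:
  assumes "\<sigma> \<in> cells (Base C) n" "i \<le> n"
  shows "cell_map (Base D) F (cell_degen C i \<sigma>) = cell_degen D i (cell_map (Base D) F \<sigma>)"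
  using assms(1)
proof (cases rule: cellsE)
  case (Cpt c)
  then show ?thesis by (simp add: lt_fctr_Lt)
next
  case (Chain x fs)
  note c = is_ltcat_category[OF C] and d = is_ltcat_category[OF D]
  show ?thesis
  proof (cases "i \<le> length fs")
    case True
    then have "degen_map i (Suc (length fs)) \<le> length fs" by (auto simp: degen_map_def)
    then show ?thesis
      using Chain True assms(2) cell_degen_Chain[OF c Chain(3) refl True]
        cell_degen_Chain[OF d is_path_map[OF ltF c d Chain(3)] refl, of i]
        cell_map_pull[OF ltF c Chain(3) mono_degen_map, of i "Suc (length fs)"]
      by (simp del: cell_degen.simps(2))
  next
    case False
    then show ?thesis
      using Chain vertex_map[OF ltF c Chain(3), of "length fs"] lt_fctr_tau[OF vertex_Obj[OF c Chain(3), of "length fs"]]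
      by simp
  qed
qed

lemma tsplit_map_nlt: "tsplit_map SetCat (nlt_obj C) (nlt_obj D) (nlt_map C D F)"
proof -
  let ?C = "cells (Base C)" and ?D = "cells (Base D)" and ?F = "cell_map (Base D) F"
  have m: "?F \<in> ?C n \<rightarrow> ?D n" for n using cell_map_cells by auto
  have fC: "cell_face C i \<in> ?C n \<rightarrow> ?C (n - 1)" and fD: "cell_face D i \<in> ?D n \<rightarrow> ?D (n - 1)" if "i < n" for i n
    using cell_face_cells[OF C] cell_face_cells[OF D] that by auto
  have dC: "cell_degen C i \<in> ?C n \<rightarrow> ?C (n + 1)" and dD: "cell_degen D i \<in> ?D n \<rightarrow> ?D (n + 1)" if "i \<le> n" for i n
    using cell_degen_cells[OF C] cell_degen_cells[OF D] that by auto
  show ?thesis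
    unfolding tsplit_map_def nlt_obj_def nlt_map_def
  proof (intro conjI allI impI, goal_cases)
    case (1 n) show ?case using m[of n] by (simp add: SetCat_def mk_cat_hom restrict_PiE_iff Pi_iff)
  next
    case (2 n i)
    then show ?case
      using cell_map_face[of _ n i] SetCat_restrict[OF fC m, of i n] SetCat_restrict[OF m fD, of i n]
      by (simp cong: restrict_cong)
  next
    case (3 n i)
    then show ?case
      using cell_map_degen[of _ n i] SetCat_restrict[OF dC m, of i n] SetCat_restrict[OF m dD, of i n]
      by (simp cong: restrict_cong)
  qed
qed

end

lemma CatLt_Obj [simp]: "Obj CatLt = {C. is_ltcat C}"
  by (simp add: CatLt_def)

lemma CatLt_Arr: "(C, F, D) \<in> Arr CatLt \<longleftrightarrow> is_ltcat C \<and> is_ltcat D \<and> lt_fctr C D F"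
  by (simp add: CatLt_def)

lemma CatLt_ops [simp]:
  "(C, F, D) \<in> Arr CatLt \<Longrightarrow> Dom CatLt (C, F, D) = C"
  "(C, F, D) \<in> Arr CatLt \<Longrightarrow> Cod CatLt (C, F, D) = D"
  "is_ltcat C \<Longrightarrow> Ident CatLt C = (C, fid (Base C), C)"
  "(C, F, D) \<in> Arr CatLt \<Longrightarrow> (D, G, E) \<in> Arr CatLt \<Longrightarrow>
     Comp CatLt (D, G, E) (C, F, D) = (C, fcomp (Base C) G F, E)"
  unfolding CatLt_def by (simp_all only: mk_cat_ops mem_Collect_eq)

lemma CatLt_ArrE:
  assumes "u \<in> Arr CatLt"
  obtains C F D where "u = (C, F, D)" "is_ltcat C" "is_ltcat D" "lt_fctr C D F"
  using assms unfolding CatLt_def by (auto elim: mk_cat_ArrE)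

lemma TSplit_Obj [simp]: "Obj (TSplit E) = {A. is_tsplit E A}"
  by (simp add: TSplit_def)

lemma TSplit_Arr: "(A, h, B) \<in> Arr (TSplit E) \<longleftrightarrow> is_tsplit E A \<and> is_tsplit E B \<and> tsplit_map E A B h"
  by (simp add: TSplit_def)

lemma TSplit_ops [simp]:
  "(A, h, B) \<in> Arr (TSplit E) \<Longrightarrow> Dom (TSplit E) (A, h, B) = A"
  "(A, h, B) \<in> Arr (TSplit E) \<Longrightarrow> Cod (TSplit E) (A, h, B) = B"
  "is_tsplit E A \<Longrightarrow> Ident (TSplit E) A = (A, \<lambda>n. Ident E (TLev A n), A)"
  "(A, h, B) \<in> Arr (TSplit E) \<Longrightarrow> (B, k, B') \<in> Arr (TSplit E) \<Longrightarrow>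
     Comp (TSplit E) (B, k, B') (A, h, B) = (A, \<lambda>n. Comp E (k n) (h n), B')"
  unfolding TSplit_def by (simp_all only: mk_cat_ops mem_Collect_eq)

lemma cell_map_fid:
  assumes C: "category C" and \<sigma>: "\<sigma> \<in> cells C n"
  shows "cell_map C (fid C) \<sigma> = \<sigma>"
  using \<sigma>
proof (cases rule: cellsE)
  case (Cpt c)
  then obtain x where "c = cpt C x" "x \<in> Obj C" by (auto simp: pi0_def)
  then show ?thesis using Cpt pi0_map_cpt[OF is_fctr_fid[OF C] C C] by simp
next
  case (Chain x fs)
  have "map (fa (fid C)) fs = fs"
    using path_nth[OF C Chain(3)] by (intro nth_equalityI) (simp_all add: hom_def)
  then show ?thesis using Chain by (simp add: is_path_iff[OF C])
qed

lemma cell_map_fcomp: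
  assumes C: "category C" "category D" "category E" and F: "is_fctr C D F" and G: "is_fctr D E G"
    and \<sigma>: "\<sigma> \<in> cells C n"
  shows "cell_map E (fcomp C G F) \<sigma> = cell_map E G (cell_map D F \<sigma>)"
  using \<sigma>
proof (cases rule: cellsE)
  case (Cpt c)
  then obtain x where "c = cpt C x" "x \<in> Obj C" by (auto simp: pi0_def)
  then show ?thesis
    using Cpt pi0_map_cpt[OF is_fctr_fcomp[OF C(1) F G] C(1,3)] pi0_map_cpt[OF F C(1,2)] pi0_map_cpt[OF G C(2,3)]
      is_fctr_ops(1)[OF F] by simp
next
  case (Chain x fs)
  have "map (fa (fcomp C G F)) fs = map (fa G) (map (fa F) fs)"
    using path_nth[OF C(1) Chain(3)] by (intro nth_equalityI) (simp_all add: hom_def)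
  then show ?thesis using Chain by (simp add: is_path_iff[OF C(1)])
qed

lemma is_fctr_Nlt: "is_fctr CatLt (TSplit SetCat) Nlt"
  unfolding Nlt_def
proof (rule is_fctrI)
  show "nlt_obj C \<in> Obj (TSplit SetCat)" if "C \<in> Obj CatLt" for C :: "('a, 'b) ltcat"
    using that is_tsplit_nlt by simp
  have arr: "(nlt_obj C, nlt_map C D F, nlt_obj D) \<in> Arr (TSplit SetCat)"
    if "is_ltcat C" "is_ltcat D" "lt_fctr C D F" for C D :: "('a, 'b) ltcat" and F
    using that by (simp add: TSplit_Arr is_tsplit_nlt tsplit_map_nlt)
  fix u :: "('a, 'b) ltcat \<times> ('a, 'b, 'a, 'b) fctr \<times> ('a, 'b) ltcat"
  assume "u \<in> Arr CatLt"
  then obtain C F D where u: "u = (C, F, D)" and *: "is_ltcat C" "is_ltcat D" "lt_fctr C D F"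
    by (rule CatLt_ArrE)
  show "(case u of (C, F, D) \<Rightarrow> (nlt_obj C, nlt_map C D F, nlt_obj D)) \<in> Arr (TSplit SetCat) \<and>
    Dom (TSplit SetCat) (case u of (C, F, D) \<Rightarrow> (nlt_obj C, nlt_map C D F, nlt_obj D)) = nlt_obj (Dom CatLt u) \<and>
    Cod (TSplit SetCat) (case u of (C, F, D) \<Rightarrow> (nlt_obj C, nlt_map C D F, nlt_obj D)) = nlt_obj (Cod CatLt u)"
    using arr[OF *] * unfolding u by (simp add: CatLt_Arr)
  fix v :: "('a, 'b) ltcat \<times> ('a, 'b, 'a, 'b) fctr \<times> ('a, 'b) ltcat"
  assume v: "v \<in> Arr CatLt" and d: "Dom CatLt v = Cod CatLt u"
  then obtain G E where v: "v = (D, G, E)" and **: "is_ltcat E" "lt_fctr D E G"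
    using * by (auto elim!: CatLt_ArrE simp: u CatLt_Arr)
  have "nlt_map C E (fcomp (Base C) G F) n = Comp SetCat (nlt_map D E G n) (nlt_map C D F n)" for n
  proof -
    have m: "cell_map (Base D) F \<in> cells (Base C) n \<rightarrow> cells (Base D) n"
      "cell_map (Base E) G \<in> cells (Base D) n \<rightarrow> cells (Base E) n"
      using cell_map_cells[OF *] cell_map_cells[OF *(2) **] by auto
    then show ?thesis
      using SetCat_restrict[OF m] cell_map_fcomp[OF is_ltcat_category[OF *(1)] is_ltcat_category[OF *(2)]
          is_ltcat_category[OF **(1)] ltF[OF *] ltF[OF *(2) **], of _ n]
      unfolding nlt_map_def by (simp cong: restrict_cong)
  qed
  then show "(case Comp CatLt v u of (C, F, D) \<Rightarrow> (nlt_obj C, nlt_map C D F, nlt_obj D))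
    = Comp (TSplit SetCat) (case v of (C, F, D) \<Rightarrow> (nlt_obj C, nlt_map C D F, nlt_obj D))
        (case u of (C, F, D) \<Rightarrow> (nlt_obj C, nlt_map C D F, nlt_obj D))"
    using arr[OF *] arr[OF *(2) **] * ** unfolding u v by (simp add: CatLt_Arr fun_eq_iff)
next
  fix C :: "('a, 'b) ltcat" assume C: "C \<in> Obj CatLt"
  have "nlt_map C C (fid (Base C)) n = Ident SetCat (TLev (nlt_obj C) n)" for n
    using C cell_map_fid[of "Base C" _ n] by (simp add: nlt_map_def nlt_obj_def SetCat_def is_ltcat_category cong: restrict_cong)
  then show "(case Ident CatLt C of (C, F, D) \<Rightarrow> (nlt_obj C, nlt_map C D F, nlt_obj D))
      = Ident (TSplit SetCat) (nlt_obj C)"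
    using C by (simp add: is_tsplit_nlt fun_eq_iff)
qed (rule category_CatLt)

lemma is_fctr_SFctr: "is_fctr SetCat SMGp SFctr"
  unfolding SFctr_def
proof (rule is_fctrI)
  have arr: "(SS A, SS_map A f, SS B) \<in> hom SMGp (SS A) (SS B)" if "f \<in> A \<rightarrow>\<^sub>E B" for A B :: "'a set" and f
    using that by (simp add: SMGp_hom is_smg_SS SS_map_ext) (auto intro!: mon_fctr_ext)
  show "SS A \<in> Obj SMGp" for A :: "'a set" by (simp add: is_smg_SS)
  fix u :: "'a set \<times> ('a \<Rightarrow> 'a) \<times> 'a set" assume "u \<in> Arr SetCat"
  then obtain A f B where u: "u = (A, f, B)" "f \<in> A \<rightarrow>\<^sub>E B" by (cases u) (simp add: SetCat_Arr)
  then have *: "u \<in> Arr SetCat" "Dom SetCat u = A" "Cod SetCat u = B" by (simp_all add: SetCat_def)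
  show "(case u of (A, f, B) \<Rightarrow> (SS A, SS_map A f, SS B)) \<in> Arr SMGp \<and>
      Dom SMGp (case u of (A, f, B) \<Rightarrow> (SS A, SS_map A f, SS B)) = SS (Dom SetCat u) \<and>
      Cod SMGp (case u of (A, f, B) \<Rightarrow> (SS A, SS_map A f, SS B)) = SS (Cod SetCat u)"
    unfolding * using arr[OF u(2)] by (simp add: u hom_def)
  fix v :: "'a set \<times> ('a \<Rightarrow> 'a) \<times> 'a set" assume "v \<in> Arr SetCat" and d: "Dom SetCat v = Cod SetCat u"
  then obtain g E where v: "v = (B, g, E)" "g \<in> B \<rightarrow>\<^sub>E E" unfolding * by (cases v) (simp add: SetCat_def)
  have "Comp SetCat v u = (A, compose A g f, E)" using u v by (simp add: SetCat_def)
  moreover have "fcomp (perm_cat A) (SS_map B g) (SS_map A f) = SS_map A (compose A g f)"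
    unfolding SS_map_ext using u(2) v(2)
    by (subst fcomp_ext[of _ A B _ E]) (auto intro!: ext_fctr_cong simp: compose_def)
  ultimately show "(case Comp SetCat v u of (A, f, B) \<Rightarrow> (SS A, SS_map A f, SS B))
      = Comp SMGp (case v of (A, f, B) \<Rightarrow> (SS A, SS_map A f, SS B)) (case u of (A, f, B) \<Rightarrow> (SS A, SS_map A f, SS B))"
    using arr[OF u(2)] arr[OF v(2)] by (simp add: u v)
next
  fix A :: "'a set"
  show "(case Ident SetCat A of (A, f, B) \<Rightarrow> (SS A, SS_map A f, SS B)) = Ident SMGp (SS A)"
    by (simp add: SetCat_def is_smg_SS SS_map_ext fid_ext cong: ext_fctr_cong)
qed (rule category_SetCat)

lemma is_fctr_SNlt: "is_fctr CatLt (TSplit SMGp) SNlt"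
  unfolding SNlt_def
  by (rule is_fctr_fcomp[OF category_CatLt is_fctr_Nlt is_fctr_levelwise[OF category_SetCat is_fctr_SFctr]])

section \<open>The local-terminals nerve in terms of generators\<close>

definition ext_arr :: "'g set \<Rightarrow> ('g \<Rightarrow> 'g list) \<Rightarrow> 'g set \<Rightarrow> ('g list, 'g sarr) smg_arr" where
  "ext_arr A \<phi> B = (SS A, ext_fctr A \<phi>, SS B)"

lemma SFctr_restrict:
  assumes "f \<in> A \<rightarrow> B"
  shows "fa SFctr (A, restrict f A, B) = ext_arr A (\<lambda>a. [f a]) B"
  using assms by (simp add: SFctr_def SetCat_Arr restrict_PiE_iff Pi_iff SS_map_ext ext_arr_def cong: ext_fctr_cong)

lemma SNlt_obj:
  assumes D: "is_ltcat D"
  shows "fo SNlt D =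
    \<lparr>TLev = (\<lambda>n. SS (cells (Base D) n)),
     TD = (\<lambda>n i. if i < n
             then ext_arr (cells (Base D) n) (\<lambda>\<sigma>. [cell_face D i \<sigma>]) (cells (Base D) (n - 1)) else undefined),
     TS = (\<lambda>n i. if i \<le> n
             then ext_arr (cells (Base D) n) (\<lambda>\<sigma>. [cell_degen D i \<sigma>]) (cells (Base D) (n + 1)) else undefined)\<rparr>"
proof -
  have "fo SNlt D = tsplit_app SFctr (nlt_obj D)"
    using D is_tsplit_nlt[OF D] by (simp add: SNlt_def levelwise_def Nlt_def)
  also have "fa SFctr (cells (Base D) n, restrict (cell_face D i) (cells (Base D) n), cells (Base D) (n - 1))
      = ext_arr (cells (Base D) n) (\<lambda>\<sigma>. [cell_face D i \<sigma>]) (cells (Base D) (n - 1))" if "i < n" for n i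
    by (rule SFctr_restrict) (use cell_face_cells[OF D] that in auto)
  moreover have "fa SFctr (cells (Base D) n, restrict (cell_degen D i) (cells (Base D) n), cells (Base D) (n + 1))
      = ext_arr (cells (Base D) n) (\<lambda>\<sigma>. [cell_degen D i \<sigma>]) (cells (Base D) (n + 1))" if "i \<le> n" for n i
    by (rule SFctr_restrict) (use cell_degen_cells[OF D] that in auto)
  ultimately show ?thesis
    by (simp add: tsplit_app_def nlt_obj_def fun_eq_iff) (simp add: SFctr_def SetCat_def)
qed

lemma SNlt_map:
  assumes *: "is_ltcat C" "is_ltcat D" "lt_fctr C D F"
  shows "fa SNlt (C, F, D) = (fo SNlt C,
    (\<lambda>n. ext_arr (cells (Base C) n) (\<lambda>\<sigma>. [cell_map (Base D) F \<sigma>]) (cells (Base D) n)), fo SNlt D)"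
proof -
  have "fa SNlt (C, F, D) = (tsplit_app SFctr (nlt_obj C), \<lambda>n. fa SFctr (nlt_map C D F n), tsplit_app SFctr (nlt_obj D))"
    using * tsplit_map_nlt[OF *] by (simp add: SNlt_def levelwise_def Nlt_def CatLt_Arr TSplit_Arr is_tsplit_nlt)
  moreover have "fa SFctr (nlt_map C D F n) = ext_arr (cells (Base C) n) (\<lambda>\<sigma>. [cell_map (Base D) F \<sigma>]) (cells (Base D) n)" for n
    unfolding nlt_map_def by (rule SFctr_restrict) (use cell_map_cells[OF *] in auto)
  moreover have "fo SNlt X = tsplit_app SFctr (nlt_obj X)" if "is_ltcat X" for X :: "('a, 'b) ltcat"
    using that by (simp add: SNlt_def levelwise_def Nlt_def is_tsplit_nlt)
  ultimately show ?thesis using * by simp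
qed

section \<open>Top-pseudo-simplicial objects over a local-terminals nerve\<close>

lemma concat_map_concat: "concat (map f (concat xss)) = concat (map (\<lambda>xs. concat (map f xs)) xss)"
  by (induction xss) simp_all

lemma ext_arr_hom: "\<phi> \<in> A \<rightarrow> lists B \<Longrightarrow> ext_arr A \<phi> B \<in> hom SMGp (SS A) (SS B)"
  by (simp add: ext_arr_def SMGp_hom is_smg_SS mon_fctr_ext)

lemma ext_arr_comp:
  assumes "\<phi> \<in> A \<rightarrow> lists B" "\<psi> \<in> B \<rightarrow> lists E"
  shows "Comp SMGp (ext_arr B \<psi> E) (ext_arr A \<phi> B) = ext_arr A (\<lambda>a. concat (map \<psi> (\<phi> a))) E"
  using ext_arr_hom[OF assms(1)] ext_arr_hom[OF assms(2)] fcomp_ext[OF assms] by (simp add: ext_arr_def)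

lemma ext_arr_ident: "Ident SMGp (SS A) = ext_arr A (\<lambda>a. [a]) A"
  by (simp add: ext_arr_def is_smg_SS fid_ext)

lemma ext_arr_eq_iff:
  "\<phi> \<in> A \<rightarrow> lists B \<Longrightarrow> \<psi> \<in> A \<rightarrow> lists B \<Longrightarrow> ext_arr A \<phi> B = ext_arr A \<psi> B \<longleftrightarrow> (\<forall>a\<in>A. \<phi> a = \<psi> a)"
  by (simp add: ext_arr_def ext_fctr_eq_iff)

lemma ext_arr_cong: "(\<And>a. a \<in> A \<Longrightarrow> \<phi> a = \<psi> a) \<Longrightarrow> ext_arr A \<phi> B = ext_arr A \<psi> B"
  by (auto simp: ext_arr_def intro: ext_fctr_cong)

lemma mor_ext_arr [simp]: "mor (ext_arr A \<phi> B) = ext_fctr A \<phi>"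
  by (simp add: ext_arr_def)

lemma concat_map_funcset:
  assumes "\<phi> \<in> A \<rightarrow> lists B" "\<psi> \<in> B \<rightarrow> lists E"
  shows "(\<lambda>a. concat (map \<psi> (\<phi> a))) \<in> A \<rightarrow> lists E"
  using funcset_mem[OF assms(1)] concat_map_lists[OF assms(2)] by blast

lemma whisker_right_ext:
  assumes "\<epsilon> \<in> A \<rightarrow> lists B" "\<phi> \<in> B \<rightarrow> lists E" "\<psi> \<in> B \<rightarrow> lists E"
    and "mon_trans (SS B) (SS E) (ext_fctr B \<phi>) (ext_fctr B \<psi>) b"
  shows "mon_trans (SS A) (SS E) (ext_fctr A (\<lambda>a. concat (map \<phi> (\<epsilon> a)))) (ext_fctr A (\<lambda>a. concat (map \<psi> (\<epsilon> a))))
           (\<lambda>x\<in>lists A. b (fo (ext_fctr A \<epsilon>) x))"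
  using mon_trans_whisker_right[OF is_smg_SS mon_fctr_ext[OF assms(1)] assms(4)]
  by (simp add: fcomp_ext[OF assms(1,2)] fcomp_ext[OF assms(1,3)])

lemma whisker_left_ext:
  assumes "\<eta> \<in> B \<rightarrow> lists E" "\<phi> \<in> A \<rightarrow> lists B" "\<psi> \<in> A \<rightarrow> lists B"
    and "mon_trans (SS A) (SS B) (ext_fctr A \<phi>) (ext_fctr A \<psi>) b"
  shows "mon_trans (SS A) (SS E) (ext_fctr A (\<lambda>a. concat (map \<eta> (\<phi> a)))) (ext_fctr A (\<lambda>a. concat (map \<eta> (\<psi> a))))
           (\<lambda>x\<in>lists A. fa (ext_fctr B \<eta>) (b x))"
  using mon_trans_whisker_left[OF is_smg_SS mon_fctr_ext[OF assms(1)] mon_fctr_ext[OF assms(2)] mon_fctr_ext[OF assms(3)] assms(4)]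
  by (simp add: fcomp_ext[OF assms(2,1)] fcomp_ext[OF assms(3,1)])

text \<open>The two 2-cells may meet in functors written with different formulas
  \<open>\<psi>\<close> and \<open>\<psi>'\<close>; agreement on generators makes these functors
  equal.\<close>

lemma vcomp_ext:
  assumes "\<phi> \<in> A \<rightarrow> lists B" "\<psi> \<in> A \<rightarrow> lists B" "\<chi> \<in> A \<rightarrow> lists B" "\<And>a. a \<in> A \<Longrightarrow> \<psi> a = \<psi>' a"
    and "mon_trans (SS A) (SS B) (ext_fctr A \<phi>) (ext_fctr A \<psi>) (restrict b (lists A))"
    and "mon_trans (SS A) (SS B) (ext_fctr A \<psi>') (ext_fctr A \<chi>) (restrict c (lists A))"
  shows "mon_trans (SS A) (SS B) (ext_fctr A \<phi>) (ext_fctr A \<chi>) (\<lambda>x\<in>lists A. Comp (perm_cat B) (c x) (b x))"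
proof -
  have "ext_fctr A \<psi>' = ext_fctr A \<psi>" using assms(4) by (intro ext_fctr_cong) simp
  then have c: "mon_trans (SS A) (SS B) (ext_fctr A \<psi>) (ext_fctr A \<chi>) (restrict c (lists A))"
    using assms(6) by simp
  show ?thesis
    using mon_trans_vcomp[OF is_smg_SS is_smg_SS mon_fctr_ext[OF assms(1)] mon_fctr_ext[OF assms(2)]
        mon_fctr_ext[OF assms(3)] assms(5) c]
    by (simp cong: restrict_cong)
qed

text \<open>Over a fixed \<open>C\<close>, the top face \<open>t\<close> and the permutations
  \<open>\<beta> r \<sigma>\<close> are the only unknowns: levels, lower faces and degeneracies are
  those of the nerve. One function \<open>t\<close> covers all levels at once.\<close>

definition top_ps ::
  "('o, 'm) ltcat \<Rightarrow> (('o, 'm) cell \<Rightarrow> ('o, 'm) cell list) \<Rightarrow> (nat \<Rightarrow> ('o, 'm) cell \<Rightarrow> nat \<Rightarrow> nat)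
   \<Rightarrow> (('o, 'm) cell list, ('o, 'm) cell sarr) topps" where
  "top_ps C t \<beta> =
     \<lparr>PLev = (\<lambda>n. SS (cells (Base C) n)),
      PD = (\<lambda>n i. if i < n then TD (fo SNlt C) n i
              else if 1 \<le> n \<and> i = n then ext_arr (cells (Base C) n) t (cells (Base C) (n - 1)) else undefined),
      PS = TS (fo SNlt C),
      PB = (\<lambda>r. ext_trans (cells (Base C) (r + 2)) (\<lambda>\<sigma>. t (cell_face C (r + 1) \<sigma>)) (\<lambda>\<sigma>. concat (map t (t \<sigma>))) (\<beta> r))\<rparr>"

text \<open>The second clause is more than bookkeeping. An arrow of the free groupoid over a set
  matches equal letters, so the clause equates entries of the two iterated top faces along \<beta>;
  this is the form taken by (A5).\<close>

definition top_typed ::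
  "('o, 'm) ltcat \<Rightarrow> (('o, 'm) cell \<Rightarrow> ('o, 'm) cell list) \<Rightarrow> (nat \<Rightarrow> ('o, 'm) cell \<Rightarrow> nat \<Rightarrow> nat) \<Rightarrow> bool" where
  "top_typed C t \<beta> \<longleftrightarrow>
     (\<forall>n. \<forall>\<sigma>\<in>cells (Base C) (Suc n). t \<sigma> \<in> lists (cells (Base C) n)) \<and>
     (\<forall>r. \<forall>\<sigma>\<in>cells (Base C) (r + 2).
        (t (cell_face C (r + 1) \<sigma>), \<beta> r \<sigma>, concat (map t (t \<sigma>))) \<in> Arr (perm_cat (cells (Base C) r)))"

definition top_simplicial :: "('o, 'm) ltcat \<Rightarrow> (('o, 'm) cell \<Rightarrow> ('o, 'm) cell list) \<Rightarrow> bool" where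
  "top_simplicial C t \<longleftrightarrow>
     (\<forall>r. \<forall>i\<le>r. \<forall>\<sigma>\<in>cells (Base C) (r + 2). map (cell_face C i) (t \<sigma>) = t (cell_face C i \<sigma>)) \<and>
     (\<forall>n. \<forall>j<n. \<forall>\<sigma>\<in>cells (Base C) n. t (cell_degen C j \<sigma>) = map (cell_degen C j) (t \<sigma>)) \<and>
     (\<forall>n. \<forall>\<sigma>\<in>cells (Base C) n. t (cell_degen C n \<sigma>) = [\<sigma>])"

text \<open>The laws (a) to (d) on generators. In (a), the block permutation along
  \<open>\<beta> (r + 1) \<sigma>\<close> is the top face applied to that 2-cell, and the one with
  inner parts \<open>\<beta> r (t \<sigma> ! b)\<close> is the component of the 2-cell at the list
  \<open>t \<sigma>\<close>.\<close>

definition top_coherent ::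
  "('o, 'm) ltcat \<Rightarrow> (('o, 'm) cell \<Rightarrow> ('o, 'm) cell list) \<Rightarrow> (nat \<Rightarrow> ('o, 'm) cell \<Rightarrow> nat \<Rightarrow> nat) \<Rightarrow> bool" where
  "top_coherent C t \<beta> \<longleftrightarrow>
     (\<forall>r. \<forall>\<sigma>\<in>cells (Base C) (r + 3).
        blk_perm (lens t (t (cell_face C (r + 2) \<sigma>))) (lens t (concat (map t (t \<sigma>)))) (\<beta> (r + 1) \<sigma>) (\<lambda>_ i. i)
          \<circ> \<beta> r (cell_face C (r + 2) \<sigma>)
        = blk_perm (lens (\<lambda>p. t (cell_face C (r + 1) p)) (t \<sigma>)) (lens (\<lambda>p. concat (map t (t p))) (t \<sigma>))
            (\<lambda>i. i) (\<lambda>b. \<beta> r (t \<sigma> ! b))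
          \<circ> \<beta> r (cell_face C (r + 1) \<sigma>)) \<and>
     (\<forall>r. \<forall>i\<le>r. \<forall>\<sigma>\<in>cells (Base C) (r + 3). \<beta> (r + 1) \<sigma> = \<beta> r (cell_face C i \<sigma>)) \<and>
     (\<forall>r. \<forall>\<sigma>\<in>cells (Base C) (r + 1). \<beta> r (cell_degen C (r + 1) \<sigma>) = (\<lambda>i. i)) \<and>
     (\<forall>r. \<forall>i\<le>r. \<forall>\<sigma>\<in>cells (Base C) (r + 2). \<beta> (r + 1) (cell_degen C i \<sigma>) = \<beta> r \<sigma>)"

section \<open>Simplicial identities of the top face, on generators\<close>

context
  fixes C :: "('o, 'm) ltcat" and t \<beta>
  assumes C: "is_ltcat C" and typed: "top_typed C t \<beta>"
begin

lemma t_mem: "t \<in> cells (Base C) (Suc n) \<rightarrow> lists (cells (Base C) n)"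
  using typed unfolding top_typed_def by blast

lemma beta_Arr:
  "\<sigma> \<in> cells (Base C) (r + 2) \<Longrightarrow> (t (cell_face C (r + 1) \<sigma>), \<beta> r \<sigma>, concat (map t (t \<sigma>))) \<in> Arr (perm_cat (cells (Base C) r))"
  using typed unfolding top_typed_def by blast

lemma f_mem: "i \<le> n \<Longrightarrow> (\<lambda>\<sigma>. [cell_face C i \<sigma>]) \<in> cells (Base C) (Suc n) \<rightarrow> lists (cells (Base C) n)"
  using cell_face_cells[OF C, of _ "Suc n" i] by auto

lemma d_mem: "i \<le> n \<Longrightarrow> (\<lambda>\<sigma>. [cell_degen C i \<sigma>]) \<in> cells (Base C) n \<rightarrow> lists (cells (Base C) (Suc n))"
  using cell_degen_cells[OF C, of _ n i] by auto

lemma tf_mem: "i \<le> Suc n \<Longrightarrow> (\<lambda>\<sigma>. t (cell_face C i \<sigma>)) \<in> cells (Base C) (Suc (Suc n)) \<rightarrow> lists (cells (Base C) n)"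
  using t_mem cell_face_cells[OF C, of _ "Suc (Suc n)" i] by fastforce

lemma tt_mem: "(\<lambda>\<sigma>. concat (map t (t \<sigma>))) \<in> cells (Base C) (Suc (Suc n)) \<rightarrow> lists (cells (Base C) n)"
  by (rule concat_map_funcset[OF t_mem t_mem])

lemma TX_PLev: "PLev (top_ps C t \<beta>) n = SS (cells (Base C) n)"
  by (simp add: top_ps_def)

lemma TX_PD:
  "i \<le> n \<Longrightarrow> PD (top_ps C t \<beta>) (Suc n) i = ext_arr (cells (Base C) (Suc n)) (\<lambda>\<sigma>. [cell_face C i \<sigma>]) (cells (Base C) n)"
  "PD (top_ps C t \<beta>) (Suc n) (Suc n) = ext_arr (cells (Base C) (Suc n)) t (cells (Base C) n)"
  by (simp_all add: top_ps_def SNlt_obj[OF C])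

lemma TX_PS: "i \<le> n \<Longrightarrow> PS (top_ps C t \<beta>) n i = ext_arr (cells (Base C) n) (\<lambda>\<sigma>. [cell_degen C i \<sigma>]) (cells (Base C) (Suc n))"
  by (simp add: top_ps_def SNlt_obj[OF C])

lemma TX_PB: "PB (top_ps C t \<beta>) r = ext_trans (cells (Base C) (Suc (Suc r))) (\<lambda>\<sigma>. t (cell_face C (Suc r) \<sigma>)) (\<lambda>\<sigma>. concat (map t (t \<sigma>))) (\<beta> r)"
  by (simp add: top_ps_def)

lemma TX_PB_trans:
  "mon_trans (SS (cells (Base C) (Suc (Suc r)))) (SS (cells (Base C) r)) (ext_fctr (cells (Base C) (Suc (Suc r))) (\<lambda>\<sigma>. t (cell_face C (Suc r) \<sigma>)))
     (ext_fctr (cells (Base C) (Suc (Suc r))) (\<lambda>\<sigma>. concat (map t (t \<sigma>)))) (PB (top_ps C t \<beta>) r)"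
  unfolding TX_PB using beta_Arr[of _ r]
  by (intro mon_trans_ext tf_mem tt_mem) simp_all

lemma TX_PB_generator:
  "\<sigma> \<in> cells (Base C) (Suc (Suc r)) \<Longrightarrow> PB (top_ps C t \<beta>) r [\<sigma>] = (t (cell_face C (Suc r) \<sigma>), \<beta> r \<sigma>, concat (map t (t \<sigma>)))"
  unfolding TX_PB using beta_Arr[of _ r] by (intro ext_trans_generator) simp_all

lemmas TX_comp =
  ext_arr_comp[OF f_mem f_mem] ext_arr_comp[OF f_mem t_mem] ext_arr_comp[OF t_mem f_mem]
  ext_arr_comp[OF t_mem t_mem] ext_arr_comp[OF d_mem d_mem] ext_arr_comp[OF f_mem d_mem]
  ext_arr_comp[OF d_mem f_mem] ext_arr_comp[OF d_mem t_mem] ext_arr_comp[OF t_mem d_mem]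

text \<open>Identities among lower faces hold already in the nerve, so only the instances with the
  top face constrain \<open>t\<close>. The same division between old and new instances is made in
  the next two lemmas.\<close>

lemma TX_face_face:
  "(\<forall>r i j. i < j \<and> j \<le> r + 2 \<and> \<not> (i = r + 1 \<and> j = r + 2) \<longrightarrow>
      Comp SMGp (PD (top_ps C t \<beta>) (r + 1) i) (PD (top_ps C t \<beta>) (r + 2) j) = Comp SMGp (PD (top_ps C t \<beta>) (r + 1) (j - 1)) (PD (top_ps C t \<beta>) (r + 2) i))
   \<longleftrightarrow> (\<forall>r. \<forall>i\<le>r. \<forall>\<sigma>\<in>cells (Base C) (r + 2). map (cell_face C i) (t \<sigma>) = t (cell_face C i \<sigma>))"
  (is "?L \<longleftrightarrow> ?R")
proof -
  have top: "Comp SMGp (PD (top_ps C t \<beta>) (Suc r) i) (PD (top_ps C t \<beta>) (Suc (Suc r)) (Suc (Suc r)))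
        = Comp SMGp (PD (top_ps C t \<beta>) (Suc r) (Suc r)) (PD (top_ps C t \<beta>) (Suc (Suc r)) i)
      \<longleftrightarrow> (\<forall>\<sigma>\<in>cells (Base C) (Suc (Suc r)). map (cell_face C i) (t \<sigma>) = t (cell_face C i \<sigma>))" if "i \<le> r" for i r
    using that concat_map_funcset[OF t_mem f_mem, of i r] tf_mem[of i r]
    by (simp add: TX_PD TX_comp ext_arr_eq_iff)
  have low: "Comp SMGp (PD (top_ps C t \<beta>) (Suc r) i) (PD (top_ps C t \<beta>) (Suc (Suc r)) j) = Comp SMGp (PD (top_ps C t \<beta>) (Suc r) (j - 1)) (PD (top_ps C t \<beta>) (Suc (Suc r)) i)"
    if "i < j" "j \<le> Suc r" for i j r
    using that cell_face_face[OF C, of _ "Suc (Suc r)" i j]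
    by (auto simp: TX_PD TX_comp intro!: ext_arr_cong)
  show ?thesis
  proof
    assume ?L
    then have "Comp SMGp (PD (top_ps C t \<beta>) (Suc r) i) (PD (top_ps C t \<beta>) (Suc (Suc r)) (Suc (Suc r)))
        = Comp SMGp (PD (top_ps C t \<beta>) (Suc r) (Suc r)) (PD (top_ps C t \<beta>) (Suc (Suc r)) i)" if "i \<le> r" for i r
      using that by (auto dest!: spec[of _ r] spec[of _ i] spec[of _ "Suc (Suc r)"])
    then show ?R using top by simp
  next
    assume R: ?R
    show ?L
    proof (intro allI impI)
      fix r i j :: nat assume *: "i < j \<and> j \<le> r + 2 \<and> \<not> (i = r + 1 \<and> j = r + 2)"
      show "Comp SMGp (PD (top_ps C t \<beta>) (r + 1) i) (PD (top_ps C t \<beta>) (r + 2) j) = Comp SMGp (PD (top_ps C t \<beta>) (r + 1) (j - 1)) (PD (top_ps C t \<beta>) (r + 2) i)"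
      proof (cases "j = Suc (Suc r)")
        case True
        then show ?thesis using top[of i r] R * by simp
      next
        case False
        then show ?thesis using low[of i j r] * by simp
      qed
    qed
  qed
qed

lemma TX_face_degen_same:
  "(\<forall>n i j. (i = j \<or> i = j + 1) \<and> j \<le> n \<longrightarrow>
      Comp SMGp (PD (top_ps C t \<beta>) (n + 1) i) (PS (top_ps C t \<beta>) n j) = Ident SMGp (PLev (top_ps C t \<beta>) n))
   \<longleftrightarrow> (\<forall>n. \<forall>\<sigma>\<in>cells (Base C) n. t (cell_degen C n \<sigma>) = [\<sigma>])"
  (is "?L \<longleftrightarrow> ?R")
proof -
  have m: "(\<lambda>a. [a]) \<in> cells (Base C) n \<rightarrow> lists (cells (Base C) n)" for n by auto
  have top: "Comp SMGp (PD (top_ps C t \<beta>) (Suc n) (Suc n)) (PS (top_ps C t \<beta>) n n) = Ident SMGp (PLev (top_ps C t \<beta>) n)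
      \<longleftrightarrow> (\<forall>\<sigma>\<in>cells (Base C) n. t (cell_degen C n \<sigma>) = [\<sigma>])" for n
    using concat_map_funcset[OF d_mem[of n n] t_mem]
    by (simp add: TX_PD TX_PS TX_PLev TX_comp ext_arr_ident ext_arr_eq_iff m)
  have low: "Comp SMGp (PD (top_ps C t \<beta>) (Suc n) i) (PS (top_ps C t \<beta>) n j) = Ident SMGp (PLev (top_ps C t \<beta>) n)"
    if "i = j \<or> i = Suc j" "i \<le> n" for n i j
    using that cell_face_degen_same[OF C, of _ n i j]
    by (auto simp: TX_PD TX_PS TX_PLev TX_comp ext_arr_ident intro!: ext_arr_cong)
  show ?thesis
  proof
    assume ?L
    then have "Comp SMGp (PD (top_ps C t \<beta>) (Suc n) (Suc n)) (PS (top_ps C t \<beta>) n n) = Ident SMGp (PLev (top_ps C t \<beta>) n)" for n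
      by (auto dest!: spec[of _ n] spec[of _ "Suc n"])
    then show ?R using top by simp
  next
    assume R: ?R
    show ?L
    proof (intro allI impI)
      fix n i j :: nat assume *: "(i = j \<or> i = j + 1) \<and> j \<le> n"
      show "Comp SMGp (PD (top_ps C t \<beta>) (n + 1) i) (PS (top_ps C t \<beta>) n j) = Ident SMGp (PLev (top_ps C t \<beta>) n)"
      proof (cases "i = Suc n")
        case True
        then show ?thesis using top[of n] R * by auto
      next
        case False
        then have "i \<le> n" using * by linarith
        then show ?thesis using low[of i j n] * by auto
      qed
    qed
  qed
qed

lemma TX_face_degen_greater:
  "(\<forall>n i j. j + 1 < i \<and> i \<le> n + 1 \<longrightarrow>
      Comp SMGp (PD (top_ps C t \<beta>) (n + 1) i) (PS (top_ps C t \<beta>) n j) = Comp SMGp (PS (top_ps C t \<beta>) (n - 1) j) (PD (top_ps C t \<beta>) n (i - 1)))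
   \<longleftrightarrow> (\<forall>n. \<forall>j<n. \<forall>\<sigma>\<in>cells (Base C) n. t (cell_degen C j \<sigma>) = map (cell_degen C j) (t \<sigma>))"
  (is "?L \<longleftrightarrow> ?R")
proof -
  have top: "Comp SMGp (PD (top_ps C t \<beta>) (Suc (Suc n)) (Suc (Suc n))) (PS (top_ps C t \<beta>) (Suc n) j) = Comp SMGp (PS (top_ps C t \<beta>) n j) (PD (top_ps C t \<beta>) (Suc n) (Suc n))
      \<longleftrightarrow> (\<forall>\<sigma>\<in>cells (Base C) (Suc n). t (cell_degen C j \<sigma>) = map (cell_degen C j) (t \<sigma>))" if "j \<le> n" for n j
    using that concat_map_funcset[OF d_mem[of j "Suc n"] t_mem] concat_map_funcset[OF t_mem d_mem[of j n]]
    by (simp add: TX_PD TX_PS TX_comp ext_arr_eq_iff)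
  have low: "Comp SMGp (PD (top_ps C t \<beta>) (Suc (Suc n)) i) (PS (top_ps C t \<beta>) (Suc n) j) = Comp SMGp (PS (top_ps C t \<beta>) n j) (PD (top_ps C t \<beta>) (Suc n) (i - 1))"
    if "Suc j < i" "i \<le> Suc n" for n i j
    using that cell_face_degen_greater[OF C, of _ "Suc n" j i]
    by (auto simp: TX_PD TX_PS TX_comp intro!: ext_arr_cong)
  show ?thesis
  proof
    assume L: ?L
    show ?R
    proof (intro allI impI)
      fix n j :: nat assume "j < n"
      then obtain n' where n: "n = Suc n'" "j \<le> n'" by (cases n) auto
      have "Comp SMGp (PD (top_ps C t \<beta>) (Suc (Suc n')) (Suc (Suc n'))) (PS (top_ps C t \<beta>) (Suc n') j) = Comp SMGp (PS (top_ps C t \<beta>) n' j) (PD (top_ps C t \<beta>) (Suc n') (Suc n'))"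
        using L[rule_format, of j "Suc (Suc n')" "Suc n'"] n by simp
      then show "\<forall>\<sigma>\<in>cells (Base C) n. t (cell_degen C j \<sigma>) = map (cell_degen C j) (t \<sigma>)" using top n by simp
    qed
  next
    assume R: ?R
    show ?L
    proof (intro allI impI)
      fix n i j :: nat assume *: "j + 1 < i \<and> i \<le> n + 1"
      then obtain n' where n: "n = Suc n'" by (cases n) auto
      show "Comp SMGp (PD (top_ps C t \<beta>) (n + 1) i) (PS (top_ps C t \<beta>) n j) = Comp SMGp (PS (top_ps C t \<beta>) (n - 1) j) (PD (top_ps C t \<beta>) n (i - 1))"
      proof (cases "i = Suc n")
        case True
        then show ?thesis using top[of j n'] R * n by simp
      next
        case False
        then show ?thesis using low[of j i n'] * n by simp
      qed
    qed
  qed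
qed

lemma TX_degen_degen:
  "i \<le> j \<Longrightarrow> j \<le> n \<Longrightarrow> Comp SMGp (PS (top_ps C t \<beta>) (n + 1) i) (PS (top_ps C t \<beta>) n j) = Comp SMGp (PS (top_ps C t \<beta>) (n + 1) (j + 1)) (PS (top_ps C t \<beta>) n i)"
  using cell_degen_degen[OF C, of _ n i j] by (auto simp: TX_PS TX_comp intro!: ext_arr_cong)

lemma TX_face_degen_less:
  assumes "i < j" "j \<le> n"
  shows "Comp SMGp (PD (top_ps C t \<beta>) (n + 1) i) (PS (top_ps C t \<beta>) n j) = Comp SMGp (PS (top_ps C t \<beta>) (n - 1) (j - 1)) (PD (top_ps C t \<beta>) n i)"
proof -
  obtain n' where "n = Suc n'" using assms by (cases n) auto
  then show ?thesis
    using assms cell_face_degen_less[OF C, of _ n i j] by (auto simp: TX_PD TX_PS TX_comp intro!: ext_arr_cong)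
qed

lemma TX_hom:
  "PLev (top_ps C t \<beta>) n \<in> Obj SMGp"
  "if 1 \<le> n \<and> i \<le> n then PD (top_ps C t \<beta>) n i \<in> hom SMGp (PLev (top_ps C t \<beta>) n) (PLev (top_ps C t \<beta>) (n - 1)) else PD (top_ps C t \<beta>) n i = undefined"
  "if i \<le> n then PS (top_ps C t \<beta>) n i \<in> hom SMGp (PLev (top_ps C t \<beta>) n) (PLev (top_ps C t \<beta>) (n + 1)) else PS (top_ps C t \<beta>) n i = undefined"
proof -
  show "PLev (top_ps C t \<beta>) n \<in> Obj SMGp" by (simp add: TX_PLev is_smg_SS)
  show "if 1 \<le> n \<and> i \<le> n then PD (top_ps C t \<beta>) n i \<in> hom SMGp (PLev (top_ps C t \<beta>) n) (PLev (top_ps C t \<beta>) (n - 1)) else PD (top_ps C t \<beta>) n i = undefined"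
  proof (cases "1 \<le> n \<and> i \<le> n")
    case True
    then obtain k where k: "n = Suc k" by (cases n) auto
    show ?thesis
    proof (cases "i = Suc k")
      case True
      then show ?thesis using ext_arr_hom[OF t_mem, of k] by (simp add: k TX_PD TX_PLev)
    next
      case False
      then show ?thesis using True ext_arr_hom[OF f_mem, of i k] by (simp add: k TX_PD TX_PLev)
    qed
  qed (auto simp: top_ps_def SNlt_obj[OF C])
  show "if i \<le> n then PS (top_ps C t \<beta>) n i \<in> hom SMGp (PLev (top_ps C t \<beta>) n) (PLev (top_ps C t \<beta>) (n + 1)) else PS (top_ps C t \<beta>) n i = undefined"
    using ext_arr_hom[OF d_mem, of i n] by (auto simp: TX_PS TX_PLev) (simp add: top_ps_def SNlt_obj[OF C])
qed

lemma TX_mon_trans: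
  "mon_trans (PLev (top_ps C t \<beta>) (r + 2)) (PLev (top_ps C t \<beta>) r)
     (mor (Comp SMGp (PD (top_ps C t \<beta>) (r + 1) (r + 1)) (PD (top_ps C t \<beta>) (r + 2) (r + 1))))
     (mor (Comp SMGp (PD (top_ps C t \<beta>) (r + 1) (r + 1)) (PD (top_ps C t \<beta>) (r + 2) (r + 2)))) (PB (top_ps C t \<beta>) r)"
  using TX_PB_trans[of r] by (simp add: TX_PLev TX_PD TX_comp)

end

lemma blk_perm_singletons:
  assumes "\<rho> permutes {..<length xs}" "length ys = length xs"
  shows "blk_perm (lens (\<lambda>x. [f x]) xs) (lens (\<lambda>x. [g x]) ys) \<rho> (\<lambda>_ i. i) = \<rho>"
  using blk_perm_ones[OF assms] by simp

section \<open>Coherence laws for \<beta>, on generators\<close>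

context
  fixes C :: "('o, 'm) ltcat" and t \<beta>
  assumes C: "is_ltcat C" and typed: "top_typed C t \<beta>" and simplicial: "top_simplicial C t"
begin

lemmas c_simps = TX_PLev[OF C typed] TX_PD[OF C typed] TX_PS[OF C typed] TX_PB_generator[OF C typed]
lemmas c_t_mem = t_mem[OF C typed] and c_f_mem = f_mem[OF C typed] and c_d_mem = d_mem[OF C typed]
  and c_tf_mem = tf_mem[OF C typed] and c_tt_mem = tt_mem[OF C typed]
  and c_PB = TX_PB_trans[OF C typed]

lemma t_face: "\<sigma> \<in> cells (Base C) (Suc (Suc r)) \<Longrightarrow> i \<le> r \<Longrightarrow> t (cell_face C i \<sigma>) = map (cell_face C i) (t \<sigma>)"
  using simplicial unfolding top_simplicial_def by simp

lemma t_degen: "\<sigma> \<in> cells (Base C) n \<Longrightarrow> j < n \<Longrightarrow> t (cell_degen C j \<sigma>) = map (cell_degen C j) (t \<sigma>)"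
  using simplicial unfolding top_simplicial_def by simp

lemma t_degen_top: "\<sigma> \<in> cells (Base C) n \<Longrightarrow> t (cell_degen C n \<sigma>) = [\<sigma>]"
  using simplicial unfolding top_simplicial_def by simp

lemma t_cells: "\<sigma> \<in> cells (Base C) (Suc n) \<Longrightarrow> p \<in> set (t \<sigma>) \<Longrightarrow> p \<in> cells (Base C) n"
  using c_t_mem[of n] by blast

lemma f_cells: "\<sigma> \<in> cells (Base C) (Suc n) \<Longrightarrow> i \<le> n \<Longrightarrow> cell_face C i \<sigma> \<in> cells (Base C) n"
  using cell_face_cells[OF C, of \<sigma> "Suc n" i] by simp

lemma d_cells: "\<sigma> \<in> cells (Base C) n \<Longrightarrow> i \<le> n \<Longrightarrow> cell_degen C i \<sigma> \<in> cells (Base C) (Suc n)"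
  using cell_degen_cells[OF C] by simp

lemma beta_arr: "\<sigma> \<in> cells (Base C) (Suc (Suc r)) \<Longrightarrow>
    (t (cell_face C (Suc r) \<sigma>), \<beta> r \<sigma>, concat (map t (t \<sigma>))) \<in> Arr (perm_cat (cells (Base C) r))"
  using beta_Arr[OF C typed, of \<sigma> r] by simp

text \<open>Each side is a vertical composite of whiskered transformations and hence monoidal, so
  comparing one-letter lists is enough. There the end points agree and only the permutations are
  left.\<close>

lemma coherence_cocycle:
  "(\<forall>x\<in>PObj (top_ps C t \<beta>) (r + 3).
        Comp (Gpd (PLev (top_ps C t \<beta>) r))
          (fa (mor (PD (top_ps C t \<beta>) (r + 1) (r + 1))) (PB (top_ps C t \<beta>) (r + 1) x))
          (PB (top_ps C t \<beta>) r (fo (mor (PD (top_ps C t \<beta>) (r + 3) (r + 2))) x))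
        = Comp (Gpd (PLev (top_ps C t \<beta>) r))
          (PB (top_ps C t \<beta>) r (fo (mor (PD (top_ps C t \<beta>) (r + 3) (r + 3))) x))
          (PB (top_ps C t \<beta>) r (fo (mor (PD (top_ps C t \<beta>) (r + 3) (r + 1))) x)))
   \<longleftrightarrow> (\<forall>\<sigma>\<in>cells (Base C) (r + 3).
        blk_perm (lens t (t (cell_face C (r + 2) \<sigma>))) (lens t (concat (map t (t \<sigma>)))) (\<beta> (r + 1) \<sigma>) (\<lambda>_ i. i)
          \<circ> \<beta> r (cell_face C (r + 2) \<sigma>)
        = blk_perm (lens (\<lambda>p. t (cell_face C (r + 1) p)) (t \<sigma>)) (lens (\<lambda>p. concat (map t (t p))) (t \<sigma>))
            (\<lambda>i. i) (\<lambda>b. \<beta> r (t \<sigma> ! b))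
          \<circ> \<beta> r (cell_face C (r + 1) \<sigma>))"
proof -
  let ?A = "cells (Base C) (Suc (Suc (Suc r)))" and ?E = "cells (Base C) r"
  let ?X = "top_ps C t \<beta>"
  let ?f = "\<lambda>i. ext_fctr ?A (\<lambda>\<sigma>. [cell_face C i \<sigma>])"
  let ?L = "\<lambda>x. Comp (perm_cat ?E) (fa (ext_fctr (cells (Base C) (Suc r)) t) (PB ?X (Suc r) x))
              (PB ?X r (fo (?f (Suc (Suc r))) x))"
  let ?R = "\<lambda>x. Comp (perm_cat ?E) (PB ?X r (fo (ext_fctr ?A t) x)) (PB ?X r (fo (?f (Suc r)) x))"
  note w = whisker_right_ext[OF c_f_mem c_tf_mem c_tt_mem c_PB]
  have L: "mon_trans (SS ?A) (SS ?E) (ext_fctr ?A (\<lambda>a. concat (map (\<lambda>\<sigma>. t (cell_face C (Suc r) \<sigma>)) [cell_face C (Suc (Suc r)) a])))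
      (ext_fctr ?A (\<lambda>a. concat (map t (concat (map t (t a)))))) (restrict ?L (lists ?A))"
    by (rule vcomp_ext[OF _ _ _ _ w whisker_left_ext[OF c_t_mem c_tf_mem c_tt_mem c_PB]])
      (rule concat_map_funcset[OF c_f_mem c_tf_mem] concat_map_funcset[OF c_f_mem c_tt_mem]
        concat_map_funcset[OF c_tt_mem c_t_mem] | simp)+
  \<comment> \<open>The functors at which the two halves of the right-hand side meet. They agree
    because the top face commutes with \<open>d_{r+1}\<close>.\<close>
  have eq: "concat (map (\<lambda>\<sigma>. concat (map t (t \<sigma>))) [cell_face C (Suc r) a]) = concat (map (\<lambda>\<sigma>. t (cell_face C (Suc r) \<sigma>)) (t a))"
    if "a \<in> ?A" for a
    using t_face[of a "Suc r" "Suc r"] that by (simp add: comp_def)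
  have R: "mon_trans (SS ?A) (SS ?E) (ext_fctr ?A (\<lambda>a. concat (map (\<lambda>\<sigma>. t (cell_face C (Suc r) \<sigma>)) [cell_face C (Suc r) a])))
      (ext_fctr ?A (\<lambda>a. concat (map (\<lambda>\<sigma>. concat (map t (t \<sigma>))) (t a)))) (restrict ?R (lists ?A))"
    by (rule vcomp_ext[OF _ _ _ _ w whisker_right_ext[OF c_t_mem c_tf_mem c_tt_mem c_PB]])
      (rule concat_map_funcset[OF c_f_mem c_tf_mem] concat_map_funcset[OF c_f_mem c_tt_mem]
        concat_map_funcset[OF c_t_mem c_tt_mem] eq | simp)+
  have gen: "?L [\<sigma>] = ?R [\<sigma>] \<longleftrightarrow>
        blk_perm (lens t (t (cell_face C (r + 2) \<sigma>))) (lens t (concat (map t (t \<sigma>)))) (\<beta> (r + 1) \<sigma>) (\<lambda>_ i. i)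
          \<circ> \<beta> r (cell_face C (r + 2) \<sigma>)
        = blk_perm (lens (\<lambda>p. t (cell_face C (r + 1) p)) (t \<sigma>)) (lens (\<lambda>p. concat (map t (t p))) (t \<sigma>))
            (\<lambda>i. i) (\<lambda>b. \<beta> r (t \<sigma> ! b))
          \<circ> \<beta> r (cell_face C (r + 1) \<sigma>)" if s: "\<sigma> \<in> ?A" for \<sigma>
  proof -
    have f: "cell_face C (Suc (Suc r)) \<sigma> \<in> cells (Base C) (Suc (Suc r))" "cell_face C (Suc r) \<sigma> \<in> cells (Base C) (Suc (Suc r))"
      using f_cells[OF s] by simp_all
    have ff: "cell_face C (Suc r) (cell_face C (Suc (Suc r)) \<sigma>) = cell_face C (Suc r) (cell_face C (Suc r) \<sigma>)"
      using cell_face_face[OF C s, of "Suc r" "Suc (Suc r)"] by simp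
    have l: "?L [\<sigma>] = (t (cell_face C (Suc r) (cell_face C (Suc r) \<sigma>)),
        blk_perm (lens t (t (cell_face C (r + 2) \<sigma>))) (lens t (concat (map t (t \<sigma>)))) (\<beta> (r + 1) \<sigma>) (\<lambda>_ i. i)
          \<circ> \<beta> r (cell_face C (r + 2) \<sigma>), concat (map t (concat (map t (t \<sigma>)))))"
      using s f ff beta_arr[OF s] beta_arr[OF f(1)] ext_Arr(1)[OF c_t_mem beta_arr[OF s]]
      by (simp add: c_simps del: concat_map_concat)
    have ts: "t \<sigma> \<in> lists (cells (Base C) (Suc (Suc r)))" using c_t_mem s by blast
    have tr: "PB ?X r (t \<sigma>) = (concat (map (\<lambda>p. t (cell_face C (Suc r) p)) (t \<sigma>)),
        blk_perm (lens (\<lambda>p. t (cell_face C (r + 1) p)) (t \<sigma>)) (lens (\<lambda>p. concat (map t (t p))) (t \<sigma>))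
            (\<lambda>i. i) (\<lambda>b. \<beta> r (t \<sigma> ! b)), concat (map (\<lambda>p. concat (map t (t p))) (t \<sigma>)))"
      using ts by (simp add: TX_PB[OF C typed] ext_trans_def)
    have ta: "PB ?X r (t \<sigma>) \<in> Arr (perm_cat ?E)" using mon_trans_ops(2)[OF c_PB, of "t \<sigma>"] ts by (simp add: hom_def)
    have m: "concat (map t (t (cell_face C (Suc r) \<sigma>))) = concat (map (\<lambda>p. t (cell_face C (Suc r) p)) (t \<sigma>))"
      using eq[OF s] by simp
    have r: "?R [\<sigma>] = (t (cell_face C (Suc r) (cell_face C (Suc r) \<sigma>)),
        blk_perm (lens (\<lambda>p. t (cell_face C (r + 1) p)) (t \<sigma>)) (lens (\<lambda>p. concat (map t (t p))) (t \<sigma>))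
            (\<lambda>i. i) (\<lambda>b. \<beta> r (t \<sigma> ! b))
          \<circ> \<beta> r (cell_face C (r + 1) \<sigma>), concat (map (\<lambda>p. concat (map t (t p))) (t \<sigma>)))"
      using s f beta_arr[OF f(2)] ta unfolding tr m by (simp add: c_simps m tr)
    have "concat (map t (concat (map t (t \<sigma>)))) = concat (map (\<lambda>p. concat (map t (t p))) (t \<sigma>))"
      by (simp add: concat_map_concat comp_def)
    then show ?thesis unfolding l r by simp
  qed
  have "(\<forall>x\<in>lists ?A. ?L x = ?R x) \<longleftrightarrow> (\<forall>a\<in>?A. ?L [a] = ?R [a])"
    using mon_trans_ball_generators[OF L R] .
  then show ?thesis using gen by (simp add: c_simps numeral_3_eq_3)
qed

text \<open>A lower face sends generators to generators, so whiskering with it works on blocks of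
  size one and leaves the permutation unchanged. The same holds for degeneracies in
  \<open>coherence_degen\<close>.\<close>

lemma coherence_face:
  assumes i: "i \<le> r"
  shows "(\<forall>x\<in>PObj (top_ps C t \<beta>) (r + 3).
      fa (mor (PD (top_ps C t \<beta>) (r + 1) i)) (PB (top_ps C t \<beta>) (r + 1) x)
      = PB (top_ps C t \<beta>) r (fo (mor (PD (top_ps C t \<beta>) (r + 3) i)) x))
   \<longleftrightarrow> (\<forall>\<sigma>\<in>cells (Base C) (r + 3). \<beta> (r + 1) \<sigma> = \<beta> r (cell_face C i \<sigma>))"
proof -
  let ?A = "cells (Base C) (Suc (Suc (Suc r)))" and ?E = "cells (Base C) r"
  let ?X = "top_ps C t \<beta>"
  let ?L = "\<lambda>x. fa (ext_fctr (cells (Base C) (Suc r)) (\<lambda>\<sigma>. [cell_face C i \<sigma>])) (PB ?X (Suc r) x)"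
  let ?R = "\<lambda>x. PB ?X r (fo (ext_fctr ?A (\<lambda>\<sigma>. [cell_face C i \<sigma>])) x)"
  note L = whisker_left_ext[OF c_f_mem[OF i] c_tf_mem[of "Suc (Suc r)" "Suc r"] c_tt_mem c_PB]
  note R = whisker_right_ext[OF c_f_mem[of i "Suc (Suc r)"] c_tf_mem c_tt_mem c_PB]
  have gen: "?L [\<sigma>] = ?R [\<sigma>] \<longleftrightarrow> \<beta> (Suc r) \<sigma> = \<beta> r (cell_face C i \<sigma>)" if s: "\<sigma> \<in> ?A" for \<sigma>
  proof -
    have f: "cell_face C (Suc (Suc r)) \<sigma> \<in> cells (Base C) (Suc (Suc r))" "cell_face C i \<sigma> \<in> cells (Base C) (Suc (Suc r))"
      using f_cells[OF s] i by simp_all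
    have ff: "cell_face C i (cell_face C (Suc (Suc r)) \<sigma>) = cell_face C (Suc r) (cell_face C i \<sigma>)"
      using cell_face_face[OF C s, of i "Suc (Suc r)"] i by simp
    have a: "\<beta> (Suc r) \<sigma> permutes {..<length (t (cell_face C (Suc (Suc r)) \<sigma>))}"
      "length (concat (map t (t \<sigma>))) = length (t (cell_face C (Suc (Suc r)) \<sigma>))"
      using beta_arr[OF s] by (simp_all add: perm_cat_Arr)
    have "?L [\<sigma>] = (map (cell_face C i) (t (cell_face C (Suc (Suc r)) \<sigma>)), \<beta> (Suc r) \<sigma>,
        map (cell_face C i) (concat (map t (t \<sigma>))))"
      using s beta_arr[OF s] blk_perm_singletons[OF a]
      by (simp add: c_simps del: length_concat map_concat)
    also have "map (cell_face C i) (t (cell_face C (Suc (Suc r)) \<sigma>)) = t (cell_face C (Suc r) (cell_face C i \<sigma>))"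
      using t_face[OF f(1) i] ff by simp
    also have "map (cell_face C i) (concat (map t (t \<sigma>))) = concat (map t (t (cell_face C i \<sigma>)))"
      using t_face[OF t_cells[OF s] i] t_face[OF s, of i] i by (simp add: map_concat comp_def cong: map_cong)
    finally show ?thesis using s f(2) i by (auto simp: c_simps)
  qed
  have "(\<forall>x\<in>lists ?A. ?L x = ?R x) \<longleftrightarrow> (\<forall>a\<in>?A. ?L [a] = ?R [a])"
    using mon_trans_ball_generators[OF L R] i by simp
  then show ?thesis using gen i by (simp add: c_simps numeral_3_eq_3)
qed

lemma coherence_degen_top:
  "(\<forall>x\<in>PObj (top_ps C t \<beta>) (r + 1).
      PB (top_ps C t \<beta>) r (fo (mor (PS (top_ps C t \<beta>) (r + 1) (r + 1))) x)
      = Ident (Gpd (PLev (top_ps C t \<beta>) r)) (fo (mor (PD (top_ps C t \<beta>) (r + 1) (r + 1))) x))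
   \<longleftrightarrow> (\<forall>\<sigma>\<in>cells (Base C) (r + 1). \<beta> r (cell_degen C (r + 1) \<sigma>) = (\<lambda>i. i))"
proof -
  let ?A = "cells (Base C) (Suc r)" and ?E = "cells (Base C) r"
  let ?X = "top_ps C t \<beta>"
  let ?L = "\<lambda>x. PB ?X r (fo (ext_fctr ?A (\<lambda>\<sigma>. [cell_degen C (Suc r) \<sigma>])) x)"
  let ?R = "\<lambda>x. Ident (perm_cat ?E) (fo (ext_fctr ?A t) x)"
  note L = whisker_right_ext[OF c_d_mem[of "Suc r" "Suc r"] c_tf_mem c_tt_mem c_PB]
  note R = mon_trans_ident[OF is_smg_SS is_smg_SS mon_fctr_ext[OF c_t_mem[of r]], unfolded SS_simps(1) perm_cat_Obj]
  have gen: "?L [\<sigma>] = ?R [\<sigma>] \<longleftrightarrow> \<beta> r (cell_degen C (Suc r) \<sigma>) = (\<lambda>i. i)" if s: "\<sigma> \<in> ?A" for \<sigma>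
  proof -
    have d: "cell_degen C (Suc r) \<sigma> \<in> cells (Base C) (Suc (Suc r))" using d_cells[OF s] by simp
    have ts: "t \<sigma> \<in> lists (cells (Base C) r)" using c_t_mem s by blast
    have "cell_face C (Suc r) (cell_degen C (Suc r) \<sigma>) = \<sigma>" using cell_face_degen_same[OF C s] by simp
    then show ?thesis using s d ts t_degen_top[OF s] by (simp add: c_simps)
  qed
  have "(\<forall>x\<in>lists ?A. ?L x = ?R x) \<longleftrightarrow> (\<forall>a\<in>?A. ?L [a] = ?R [a])"
    using mon_trans_ball_generators[OF L R] by simp
  then show ?thesis using gen by (simp add: c_simps)
qed

lemma coherence_degen:
  assumes i: "i \<le> r"
  shows "(\<forall>x\<in>PObj (top_ps C t \<beta>) (r + 2).
      PB (top_ps C t \<beta>) (r + 1) (fo (mor (PS (top_ps C t \<beta>) (r + 2) i)) x)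
      = fa (mor (PS (top_ps C t \<beta>) r i)) (PB (top_ps C t \<beta>) r x))
   \<longleftrightarrow> (\<forall>\<sigma>\<in>cells (Base C) (r + 2). \<beta> (r + 1) (cell_degen C i \<sigma>) = \<beta> r \<sigma>)"
proof -
  let ?A = "cells (Base C) (Suc (Suc r))" and ?E = "cells (Base C) r"
  let ?X = "top_ps C t \<beta>"
  let ?L = "\<lambda>x. PB ?X (Suc r) (fo (ext_fctr ?A (\<lambda>\<sigma>. [cell_degen C i \<sigma>])) x)"
  let ?R = "\<lambda>x. fa (ext_fctr ?E (\<lambda>\<sigma>. [cell_degen C i \<sigma>])) (PB ?X r x)"
  note L = whisker_right_ext[OF c_d_mem[of i "Suc (Suc r)"] c_tf_mem c_tt_mem c_PB]
  note R = whisker_left_ext[OF c_d_mem[OF i] c_tf_mem[of "Suc r" r] c_tt_mem c_PB]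
  have gen: "?L [\<sigma>] = ?R [\<sigma>] \<longleftrightarrow> \<beta> (Suc r) (cell_degen C i \<sigma>) = \<beta> r \<sigma>" if s: "\<sigma> \<in> ?A" for \<sigma>
  proof -
    have d: "cell_degen C i \<sigma> \<in> cells (Base C) (Suc (Suc (Suc r)))" using d_cells[OF s] i by simp
    have f: "cell_face C (Suc r) \<sigma> \<in> cells (Base C) (Suc r)" using f_cells[OF s] by simp
    have fd: "cell_face C (Suc (Suc r)) (cell_degen C i \<sigma>) = cell_degen C i (cell_face C (Suc r) \<sigma>)"
      using cell_face_degen_greater[OF C s, of i "Suc (Suc r)"] i by simp
    have a: "\<beta> r \<sigma> permutes {..<length (t (cell_face C (Suc r) \<sigma>))}"
      "length (concat (map t (t \<sigma>))) = length (t (cell_face C (Suc r) \<sigma>))"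
      using beta_arr[OF s] by (simp_all add: perm_cat_Arr)
    have "?R [\<sigma>] = (map (cell_degen C i) (t (cell_face C (Suc r) \<sigma>)), \<beta> r \<sigma>,
        map (cell_degen C i) (concat (map t (t \<sigma>))))"
      using s beta_arr[OF s] blk_perm_singletons[OF a]
      by (simp add: c_simps del: length_concat map_concat)
    also have "map (cell_degen C i) (t (cell_face C (Suc r) \<sigma>)) = t (cell_face C (Suc (Suc r)) (cell_degen C i \<sigma>))"
      using t_degen[OF f, of i] fd i by simp
    also have "map (cell_degen C i) (concat (map t (t \<sigma>))) = concat (map t (t (cell_degen C i \<sigma>)))"
      using t_degen[OF t_cells[OF s], of _ i] t_degen[OF s, of i] i by (simp add: map_concat comp_def cong: map_cong)
    finally show ?thesis using s d i by (auto simp: c_simps)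
  qed
  have "(\<forall>x\<in>lists ?A. ?L x = ?R x) \<longleftrightarrow> (\<forall>a\<in>?A. ?L [a] = ?R [a])"
    using mon_trans_ball_generators[OF L R] i by simp
  then show ?thesis using gen i by (simp add: c_simps)
qed

end

text \<open>The simplicial identities have to be extracted first, because the translations of the
  coherence laws assume them.\<close>

lemma is_topps_top_ps:
  assumes C: "is_ltcat C" and typed: "top_typed C t \<beta>"
  shows "is_topps (top_ps C t \<beta>) \<longleftrightarrow> top_simplicial C t \<and> top_coherent C t \<beta>"
proof
  assume X: "is_topps (top_ps C t \<beta>)"
  have s: "top_simplicial C t"
    using X unfolding is_topps_def top_simplicial_def TX_face_face[OF C typed]
      TX_face_degen_same[OF C typed] TX_face_degen_greater[OF C typed]
    by (elim conjE) (intro conjI, assumption+)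
  then have "top_coherent C t \<beta>"
    using X unfolding is_topps_def top_coherent_def
      coherence_cocycle[OF C typed s] coherence_degen_top[OF C typed s]
    by (elim conjE) (intro conjI, assumption,
      simp add: coherence_face[OF C typed s, simplified] , assumption,
      simp add: coherence_degen[OF C typed s, simplified])
  with s show "top_simplicial C t \<and> top_coherent C t \<beta>" by blast
next
  assume "top_simplicial C t \<and> top_coherent C t \<beta>"
  then have s: "top_simplicial C t" and c: "top_coherent C t \<beta>" by auto
  show "is_topps (top_ps C t \<beta>)"
    unfolding is_topps_def TX_face_face[OF C typed] TX_face_degen_same[OF C typed]
      TX_face_degen_greater[OF C typed] coherence_cocycle[OF C typed s] coherence_degen_top[OF C typed s]
  proof (intro conjI, goal_cases)
    case 1 show ?case using TX_hom(1)[OF C typed] by blast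
  next
    case 2 show ?case using TX_hom(2)[OF C typed] by blast
  next
    case 3 show ?case using TX_hom(3)[OF C typed] by blast
  next
    case 4 show ?case using s unfolding top_simplicial_def by blast
  next
    case 5 show ?case using TX_degen_degen[OF C typed] by blast
  next
    case 6 show ?case using TX_face_degen_less[OF C typed] by blast
  next
    case 7 show ?case using s unfolding top_simplicial_def by blast
  next
    case 8 show ?case using s unfolding top_simplicial_def by blast
  next
    case 9 show ?case using TX_mon_trans[OF C typed] by blast
  next
    case 10 show ?case using c unfolding top_coherent_def by blast
  next
    case 11
    have "\<forall>\<sigma>\<in>cells (Base C) (r + 3). \<beta> (r + 1) \<sigma> = \<beta> r (cell_face C i \<sigma>)" if "i \<le> r" for r i
      using c that unfolding top_coherent_def by blast
    then show ?case using coherence_face[OF C typed s] by blast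
  next
    case 12 show ?case using c unfolding top_coherent_def by blast
  next
    case 13
    have "\<forall>\<sigma>\<in>cells (Base C) (r + 2). \<beta> (r + 1) (cell_degen C i \<sigma>) = \<beta> r \<sigma>" if "i \<le> r" for r i
      using c that unfolding top_coherent_def by blast
    then show ?case using coherence_degen[OF C typed s] by blast
  qed
qed

text \<open>Since \<open>t\<close> is one function on cells of all levels, the level is recovered
  from the cell in order to choose the top face that is evaluated at it.\<close>

primrec cell_level :: "('o, 'm) cell \<Rightarrow> nat" where
  "cell_level (Cpt c) = 0"
| "cell_level (Chain x fs) = Suc (length fs)"

lemma cell_level: "\<sigma> \<in> cells C n \<Longrightarrow> cell_level \<sigma> = n"
  by (cases \<sigma>) simp_all

text \<open>\<open>top_ps\<close> looks at \<open>t\<close> on cells of positive level and at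
  \<open>\<beta> r\<close> on level \<open>r + 2\<close>; all other values are defaults. This lets
  the nerve of the reconstructed operadic category be compared with the given data.\<close>

lemma top_ps_cong:
  assumes C: "is_ltcat C" and typed: "top_typed C t \<beta>"
    and t: "\<And>n \<sigma>. \<sigma> \<in> cells (Base C) (Suc n) \<Longrightarrow> t' \<sigma> = t \<sigma>"
    and b: "\<And>r \<sigma>. \<sigma> \<in> cells (Base C) (Suc (Suc r)) \<Longrightarrow> \<beta>' r \<sigma> = \<beta> r \<sigma>"
  shows "top_ps C t' \<beta>' = top_ps C t \<beta>"
proof -
  have "ext_arr (cells (Base C) n) t' (cells (Base C) (n - 1)) = ext_arr (cells (Base C) n) t (cells (Base C) (n - 1))"
    if "1 \<le> n" for n
    using t[of _ "n - 1"] that by (intro ext_arr_cong) simp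
  moreover have "ext_trans (cells (Base C) (r + 2)) (\<lambda>\<sigma>. t' (cell_face C (r + 1) \<sigma>)) (\<lambda>\<sigma>. concat (map t' (t' \<sigma>))) (\<beta>' r)
      = ext_trans (cells (Base C) (r + 2)) (\<lambda>\<sigma>. t (cell_face C (r + 1) \<sigma>)) (\<lambda>\<sigma>. concat (map t (t \<sigma>))) (\<beta> r)" for r
  proof (rule ext_trans_cong)
    fix \<sigma> assume "\<sigma> \<in> cells (Base C) (r + 2)"
    then have s: "\<sigma> \<in> cells (Base C) (Suc (Suc r))" by simp
    have "cell_face C (r + 1) \<sigma> \<in> cells (Base C) (Suc r)" using cell_face_cells[OF C s, of "Suc r"] by simp
    moreover have "set (t \<sigma>) \<subseteq> cells (Base C) (Suc r)" using t_mem[OF C typed, of "Suc r"] s by blast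
    then have "map t' (t \<sigma>) = map t (t \<sigma>)" using t by (intro map_cong) auto
    ultimately show "t' (cell_face C (r + 1) \<sigma>) = t (cell_face C (r + 1) \<sigma>) \<and>
        concat (map t' (t' \<sigma>)) = concat (map t (t \<sigma>)) \<and> \<beta>' r \<sigma> = \<beta> r \<sigma>"
      using t[OF s] t[of _ r] b[OF s] by (simp del: map_eq_conv)
  qed
  ultimately show ?thesis by (simp add: top_ps_def fun_eq_iff)
qed

text \<open>\<open>u_star\<close> forgets just the top faces and the 2-cells, and freeness reduces
  both to their values on one-letter lists.\<close>

lemma topps_over_SNlt:
  assumes C: "is_ltcat C" and X: "is_topps X" and u: "u_star X = fo SNlt C"
  obtains t \<beta> where "X = top_ps C t \<beta>" "top_typed C t \<beta>"
proof -
  let ?A = "cells (Base C)"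
  have L: "PLev X = (\<lambda>n. SS (?A n))" and S: "PS X = TS (fo SNlt C)"
    and Dl: "(if i < n then PD X n i else undefined) = TD (fo SNlt C) n i" for n i
    using arg_cong[OF u, of TLev] arg_cong[OF u, of TS] fun_cong[OF fun_cong[OF arg_cong[OF u, of TD]], of n i]
    by (simp_all add: u_star_def SNlt_obj[OF C])
  have D: "\<forall>n i. if 1 \<le> n \<and> i \<le> n then PD X n i \<in> hom SMGp (PLev X n) (PLev X (n - 1)) else PD X n i = undefined"
    and B: "\<forall>r. mon_trans (PLev X (r + 2)) (PLev X r)
        (mor (Comp SMGp (PD X (r + 1) (r + 1)) (PD X (r + 2) (r + 1))))
        (mor (Comp SMGp (PD X (r + 1) (r + 1)) (PD X (r + 2) (r + 2))))
        (PB X r)"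
    using X unfolding is_topps_def by - (elim conjE, assumption)+
  define t where "t \<sigma> = fo (mor (PD X (cell_level \<sigma>) (cell_level \<sigma>))) [\<sigma>]" for \<sigma>
  define \<beta> where "\<beta> r \<sigma> = mor (PB X r [\<sigma>])" for r \<sigma>
  have top: "PD X (Suc n) (Suc n) = ext_arr (?A (Suc n)) t (?A n)" and t_mem: "t \<in> ?A (Suc n) \<rightarrow> lists (?A n)" for n
  proof -
    have "PD X (Suc n) (Suc n) \<in> hom SMGp (SS (?A (Suc n))) (SS (?A n))"
      using D[rule_format, of "Suc n" "Suc n"] by (simp add: L)
    then obtain F where F: "PD X (Suc n) (Suc n) = (SS (?A (Suc n)), F, SS (?A n))" "mon_fctr (SS (?A (Suc n))) (SS (?A n)) F"
      by (auto simp: SMGp_hom)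
    have "fo F [\<sigma>] = t \<sigma>" if "\<sigma> \<in> ?A (Suc n)" for \<sigma>
      using cell_level[OF that] by (simp add: t_def F)
    then have "ext_fctr (?A (Suc n)) (\<lambda>\<sigma>. fo F [\<sigma>]) = ext_fctr (?A (Suc n)) t" "t \<in> ?A (Suc n) \<rightarrow> lists (?A n)"
      using mon_fctr_SS(2)[OF F(2)] by (simp_all cong: ext_fctr_cong Pi_cong)
    then show "PD X (Suc n) (Suc n) = ext_arr (?A (Suc n)) t (?A n)" "t \<in> ?A (Suc n) \<rightarrow> lists (?A n)"
      using mon_fctr_SS(1)[OF F(2)] F(1) by (simp_all add: ext_arr_def)
  qed
  have low: "PD X (Suc n) i = ext_arr (?A (Suc n)) (\<lambda>\<sigma>. [cell_face C i \<sigma>]) (?A n)" if "i \<le> n" for n i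
    using Dl[of i "Suc n"] that by (simp add: SNlt_obj[OF C])
  have f_mem: "(\<lambda>\<sigma>. [cell_face C i \<sigma>]) \<in> ?A (Suc n) \<rightarrow> lists (?A n)" if "i \<le> n" for i n
    using cell_face_cells[OF C, of _ "Suc n" i] that by auto
  have tf_mem: "(\<lambda>\<sigma>. t (cell_face C (Suc r) \<sigma>)) \<in> ?A (Suc (Suc r)) \<rightarrow> lists (?A r)" for r
    using t_mem[of r] cell_face_cells[OF C, of _ "Suc (Suc r)" "Suc r"] by fastforce
  have b: "mon_trans (SS (?A (Suc (Suc r)))) (SS (?A r)) (ext_fctr (?A (Suc (Suc r))) (\<lambda>\<sigma>. t (cell_face C (Suc r) \<sigma>)))
      (ext_fctr (?A (Suc (Suc r))) (\<lambda>\<sigma>. concat (map t (t \<sigma>)))) (PB X r)" for r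
    using B[rule_format, of r] by (simp add: L top low ext_arr_comp[OF f_mem t_mem] ext_arr_comp[OF t_mem t_mem])
  note b' = mon_trans_SS[OF b tf_mem concat_map_funcset[OF t_mem t_mem]]
  have typed: "top_typed C t \<beta>"
    unfolding top_typed_def
  proof (intro conjI allI ballI)
    show "t \<sigma> \<in> lists (?A n)" if "\<sigma> \<in> ?A (Suc n)" for n \<sigma> using t_mem that by blast
    show "(t (cell_face C (r + 1) \<sigma>), \<beta> r \<sigma>, concat (map t (t \<sigma>))) \<in> Arr (perm_cat (?A r))"
      if "\<sigma> \<in> ?A (r + 2)" for r \<sigma>
      using b'(1)[of \<sigma> r] that by (simp add: \<beta>_def)
  qed
  have "PB X r = ext_trans (?A (r + 2)) (\<lambda>\<sigma>. t (cell_face C (r + 1) \<sigma>)) (\<lambda>\<sigma>. concat (map t (t \<sigma>))) (\<beta> r)" for r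
    using b'(2)[of r] by (simp add: \<beta>_def[abs_def])
  moreover have "PD X n i = (if i < n then TD (fo SNlt C) n i
              else if 1 \<le> n \<and> i = n then ext_arr (?A n) t (?A (n - 1)) else undefined)" for n i
  proof (cases n)
    case 0
    then show ?thesis using D[rule_format, of n i] by simp
  next
    case (Suc m)
    then show ?thesis using D[rule_format, of n i] Dl[of i n] top[of m] by (cases "i < n"; cases "i = n") simp_all
  qed
  ultimately have "X = top_ps C t \<beta>"
    using L S by (cases X) (simp add: top_ps_def fun_eq_iff)
  then show ?thesis using typed that by blast
qed

lemma u_star_top_ps:
  "is_ltcat C \<Longrightarrow> u_star (top_ps C t \<beta>) = fo SNlt C"
  by (simp add: u_star_def top_ps_def SNlt_obj fun_eq_iff)

lemma shuffle_top_ps: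
  assumes C: "is_ltcat C" and typed: "top_typed C t \<beta>"
  shows "shuffle (top_ps C t \<beta>) \<longleftrightarrow>
    (\<forall>r. \<forall>\<sigma>\<in>cells (Base C) (r + 2). \<forall>i < length (t \<sigma>).
       mono_on {pos (lens t (t \<sigma>)) i 0 ..< pos (lens t (t \<sigma>)) (Suc i) 0} (inv (\<beta> r \<sigma>)))"
proof -
  have "(let ps = fo (mor (PD (top_ps C t \<beta>) (r + 2) (r + 2))) [\<sigma>];
             ns = map (\<lambda>p. length (fo (mor (PD (top_ps C t \<beta>) (r + 1) (r + 1))) [p])) ps
         in \<forall>i < length ps.
              mono_on {sum_list (take i ns) ..< sum_list (take (i + 1) ns)} (inv (mor (PB (top_ps C t \<beta>) r [\<sigma>]))))
      \<longleftrightarrow> (\<forall>i < length (t \<sigma>).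
       mono_on {pos (lens t (t \<sigma>)) i 0 ..< pos (lens t (t \<sigma>)) (Suc i) 0} (inv (\<beta> r \<sigma>)))"
    if s: "\<sigma> \<in> cells (Base C) (Suc (Suc r))" for r \<sigma>
  proof -
    have "set (t \<sigma>) \<subseteq> cells (Base C) (Suc r)" using t_mem[OF C typed, of "Suc r"] s by blast
    then have "map (\<lambda>p. length (fo (ext_fctr (cells (Base C) (Suc r)) t) [p])) (t \<sigma>) = lens t (t \<sigma>)"
      by (intro map_cong) auto
    then show ?thesis
      using s by (simp add: TX_PD[OF C typed] TX_PB_generator[OF C typed] Let_def pos_def del: map_eq_conv)
  qed
  then show ?thesis unfolding shuffle_def by (simp add: TX_PLev[OF C typed] Ball_def)
qed

text \<open>For maps induced by a functor, compatibility with lower faces and degeneracies is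
  inherited from the nerve; the top face and \<beta> are all that remain.\<close>

lemma topps_map_top_ps:
  assumes C: "is_ltcat C" and typed: "top_typed C t \<beta>" and C': "is_ltcat C'" and typed': "top_typed C' t' \<beta>'"
    and F: "lt_fctr C C' F"
  shows "topps_map (top_ps C t \<beta>) (top_ps C' t' \<beta>')
      (\<lambda>n. ext_arr (cells (Base C) n) (\<lambda>\<sigma>. [cell_map (Base C') F \<sigma>]) (cells (Base C') n)) \<longleftrightarrow>
    (\<forall>n. \<forall>\<sigma>\<in>cells (Base C) (Suc n). t' (cell_map (Base C') F \<sigma>) = map (cell_map (Base C') F) (t \<sigma>)) \<and>
    (\<forall>r. \<forall>\<sigma>\<in>cells (Base C) (Suc (Suc r)). \<beta>' r (cell_map (Base C') F \<sigma>) = \<beta> r \<sigma>)"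
  (is "topps_map ?X ?X' ?h \<longleftrightarrow> ?T \<and> ?B")
proof -
  let ?A = "cells (Base C)" and ?A' = "cells (Base C')" and ?F = "cell_map (Base C') F"
  have m: "(\<lambda>\<sigma>. [?F \<sigma>]) \<in> ?A n \<rightarrow> lists (?A' n)" for n using cell_map_cells[OF C C' F] by auto
  have Fc: "?F \<sigma> \<in> ?A' n" if "\<sigma> \<in> ?A n" for \<sigma> n using cell_map_cells[OF C C' F that] .
  note mem = t_mem[OF C typed] t_mem[OF C' typed'] f_mem[OF C typed] f_mem[OF C' typed'] d_mem[OF C typed] d_mem[OF C' typed']
  have hom: "\<forall>n. ?h n \<in> hom SMGp (PLev ?X n) (PLev ?X' n)"
    using ext_arr_hom[OF m] by (simp add: TX_PLev[OF C typed] TX_PLev[OF C' typed'])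
  have deg: "\<forall>n i. i \<le> n \<longrightarrow> Comp SMGp (?h (n + 1)) (PS ?X n i) = Comp SMGp (PS ?X' n i) (?h n)"
    using cell_map_degen[OF C C' F] d_mem[OF C typed]
    by (auto simp: TX_PS[OF C typed] TX_PS[OF C' typed'] ext_arr_comp[OF d_mem[OF C typed] m]
        ext_arr_comp[OF m d_mem[OF C' typed']] intro!: ext_arr_cong)
  have low: "Comp SMGp (?h n) (PD ?X (Suc n) i) = Comp SMGp (PD ?X' (Suc n) i) (?h (Suc n))" if "i \<le> n" for n i
    using that cell_map_face[OF C C' F, of _ "Suc n" i]
    by (auto simp: TX_PD[OF C typed] TX_PD[OF C' typed'] ext_arr_comp[OF f_mem[OF C typed] m]
        ext_arr_comp[OF m f_mem[OF C' typed']] intro!: ext_arr_cong)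
  have top: "Comp SMGp (?h n) (PD ?X (Suc n) (Suc n)) = Comp SMGp (PD ?X' (Suc n) (Suc n)) (?h (Suc n))
      \<longleftrightarrow> (\<forall>\<sigma>\<in>?A (Suc n). t' (?F \<sigma>) = map ?F (t \<sigma>))" for n
    using concat_map_funcset[OF mem(1) m, of n] concat_map_funcset[OF m mem(2), of n]
    by (auto simp: TX_PD[OF C typed] TX_PD[OF C' typed'] ext_arr_comp[OF mem(1) m]
        ext_arr_comp[OF m mem(2)] ext_arr_eq_iff)
  have faces: "(\<forall>n i. 1 \<le> n \<and> i \<le> n \<longrightarrow> Comp SMGp (?h (n - 1)) (PD ?X n i) = Comp SMGp (PD ?X' n i) (?h n)) \<longleftrightarrow> ?T"
    (is "?L \<longleftrightarrow> ?T")
  proof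
    assume L: ?L
    show ?T using L[rule_format, of "Suc n" "Suc n" for n] top by simp
  next
    assume T: ?T
    show ?L
    proof (intro allI impI)
      fix n i :: nat assume "1 \<le> n \<and> i \<le> n"
      then obtain k where k: "n = Suc k" "i \<le> Suc k" by (cases n) auto
      show "Comp SMGp (?h (n - 1)) (PD ?X n i) = Comp SMGp (PD ?X' n i) (?h n)"
        using k T top[of k] low[of i k] by (cases "i = Suc k") simp_all
    qed
  qed
  \<comment> \<open>Only when the top faces are preserved do the end points of the two sides agree,
    so this equivalence is proved under \<open>?T\<close>.\<close>
  have betas: "(\<forall>x\<in>PObj ?X (r + 2). fa (mor (?h r)) (PB ?X r x) = PB ?X' r (fo (mor (?h (r + 2))) x))
      \<longleftrightarrow> (\<forall>\<sigma>\<in>?A (Suc (Suc r)). \<beta>' r (?F \<sigma>) = \<beta> r \<sigma>)" if T: ?T for r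
  proof -
    let ?L = "\<lambda>x. fa (ext_fctr (?A r) (\<lambda>\<sigma>. [?F \<sigma>])) (PB ?X r x)"
    let ?R = "\<lambda>x. PB ?X' r (fo (ext_fctr (?A (Suc (Suc r))) (\<lambda>\<sigma>. [?F \<sigma>])) x)"
    note L = whisker_left_ext[OF m tf_mem[OF C typed] tt_mem[OF C typed] TX_PB_trans[OF C typed, of r]]
    note R = whisker_right_ext[OF m tf_mem[OF C' typed'] tt_mem[OF C' typed'] TX_PB_trans[OF C' typed', of r]]
    have gen: "?L [\<sigma>] = ?R [\<sigma>] \<longleftrightarrow> \<beta>' r (?F \<sigma>) = \<beta> r \<sigma>" if s: "\<sigma> \<in> ?A (Suc (Suc r))" for \<sigma>
    proof -
      have b: "(t (cell_face C (Suc r) \<sigma>), \<beta> r \<sigma>, concat (map t (t \<sigma>))) \<in> Arr (perm_cat (?A r))"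
        using beta_Arr[OF C typed, of \<sigma> r] s by simp
      then have a: "\<beta> r \<sigma> permutes {..<length (t (cell_face C (Suc r) \<sigma>))}"
        "length (concat (map t (t \<sigma>))) = length (t (cell_face C (Suc r) \<sigma>))"
        by (simp_all add: perm_cat_Arr)
      have f: "cell_face C (Suc r) \<sigma> \<in> ?A (Suc r)" using cell_face_cells[OF C s, of "Suc r"] by simp
      have "?L [\<sigma>] = (map ?F (t (cell_face C (Suc r) \<sigma>)), \<beta> r \<sigma>, map ?F (concat (map t (t \<sigma>))))"
        using s b blk_perm_singletons[OF a]
        by (simp add: TX_PB_generator[OF C typed] del: length_concat map_concat)
      also have "map ?F (t (cell_face C (Suc r) \<sigma>)) = t' (cell_face C' (Suc r) (?F \<sigma>))"
        using T[rule_format, OF f] cell_map_face[OF C C' F s, of "Suc r"] by simp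
      also have "map ?F (concat (map t (t \<sigma>))) = concat (map t' (t' (?F \<sigma>)))"
      proof -
        have "set (t \<sigma>) \<subseteq> ?A (Suc r)" using mem(1)[of "Suc r"] s by blast
        then have "map (\<lambda>p. map ?F (t p)) (t \<sigma>) = map (\<lambda>p. t' (?F p)) (t \<sigma>)" using T by (intro map_cong) auto
        then show ?thesis using T s by (simp add: map_concat comp_def del: map_eq_conv)
      qed
      finally show ?thesis using s Fc[OF s] by (auto simp: TX_PB_generator[OF C' typed'])
    qed
    have "(\<forall>x\<in>lists (?A (Suc (Suc r))). ?L x = ?R x) \<longleftrightarrow> (\<forall>a\<in>?A (Suc (Suc r)). ?L [a] = ?R [a])"
      using mon_trans_ball_generators[OF L R] by simp
    then show ?thesis using gen by (simp add: TX_PLev[OF C typed])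
  qed
  show ?thesis
  proof
    assume "topps_map ?X ?X' ?h"
    then have T: ?T and B: "\<forall>r. \<forall>x\<in>PObj ?X (r + 2). fa (mor (?h r)) (PB ?X r x) = PB ?X' r (fo (mor (?h (r + 2))) x)"
      unfolding topps_map_def faces by - (elim conjE, assumption)+
    show "?T \<and> ?B" using T B unfolding betas[OF T] by (intro conjI)
  next
    assume TB: "?T \<and> ?B"
    show "topps_map ?X ?X' ?h"
      unfolding topps_map_def faces betas[OF conjunct1[OF TB]] using TB by (intro conjI hom deg) (elim conjE, assumption)+
  qed
qed

section \<open>Fibres of maps of finite ordinals\<close>

lemma FinOrd_Arr: "(m, g, n) \<in> Arr FinOrd \<longleftrightarrow> g \<in> {..<m} \<rightarrow>\<^sub>E {..<n}"
  by (simp add: FinOrd_def)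

lemma FinOrd_ArrE:
  assumes "u \<in> Arr FinOrd"
  obtains m g n where "u = (m, g, n)" "g \<in> {..<m} \<rightarrow>\<^sub>E {..<n}"
  using assms unfolding FinOrd_def by (auto elim: mk_cat_ArrE)

lemma FinOrd_ops [simp]:
  "(m, g, n) \<in> Arr FinOrd \<Longrightarrow> Dom FinOrd (m, g, n) = m"
  "(m, g, n) \<in> Arr FinOrd \<Longrightarrow> Cod FinOrd (m, g, n) = n"
  "Ident FinOrd n = (n, \<lambda>j\<in>{..<n}. j, n)"
  "(l, f, m) \<in> Arr FinOrd \<Longrightarrow> (m, g, n) \<in> Arr FinOrd \<Longrightarrow>
     Comp FinOrd (m, g, n) (l, f, m) = (l, compose {..<l} g f, n)"
  unfolding FinOrd_def by (simp_all only: mk_cat_ops UNIV_I)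

lemma FinOrd_Obj [simp]: "Obj FinOrd = UNIV"
  by (simp add: FinOrd_def)

lemma FinOrd_mor: "g \<in> Arr FinOrd \<Longrightarrow> j < Dom FinOrd g \<Longrightarrow> mor g j < Cod FinOrd g"
  by (erule FinOrd_ArrE) (auto simp: FinOrd_Arr)

lemma FinOrd_eqI:
  assumes "f \<in> Arr FinOrd" "g \<in> Arr FinOrd" "Dom FinOrd f = Dom FinOrd g" "Cod FinOrd f = Cod FinOrd g"
    and "\<And>j. j < Dom FinOrd f \<Longrightarrow> mor f j = mor g j"
  shows "f = g"
  using assms
  by (elim FinOrd_ArrE) (auto simp: FinOrd_Arr intro: PiE_ext)

lemma FinOrd_Comp_mor:
  assumes "g \<in> Arr FinOrd" "f \<in> Arr FinOrd" "Dom FinOrd g = Cod FinOrd f" "j < Dom FinOrd f"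
  shows "mor (Comp FinOrd g f) j = mor g (mor f j)"
  using assms by (elim FinOrd_ArrE) (auto simp: FinOrd_Arr compose_def)

lemma finite_fin_preimage [simp]: "finite (fin_preimage g i)"
  by (simp add: fin_preimage_def)

lemma fin_eps_nth:
  "a < fin_fib g i \<Longrightarrow> fin_eps g i a \<in> fin_preimage g i"
  using nth_mem[of a "sorted_list_of_set (fin_preimage g i)"] by (simp add: fin_eps_def fin_fib_def)

lemma fin_eps_mem:
  assumes "a < fin_fib g i"
  shows "fin_eps g i a < Dom FinOrd g" "mor g (fin_eps g i a) = i"
  using fin_eps_nth[OF assms] by (simp_all add: fin_preimage_def)

lemma fin_eps_less: "a < b \<Longrightarrow> b < fin_fib g i \<Longrightarrow> fin_eps g i a < fin_eps g i b"
  unfolding fin_eps_def fin_fib_def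
  using sorted_wrt_nth_less[OF strict_sorted_list_of_set[of "fin_preimage g i"], of a b] by simp

lemma fin_eps_inject: "a < fin_fib g i \<Longrightarrow> b < fin_fib g i \<Longrightarrow> fin_eps g i a = fin_eps g i b \<longleftrightarrow> a = b"
  by (metis fin_eps_less less_irrefl linorder_neqE_nat)

lemma fin_eps_surj:
  assumes "j < Dom FinOrd g"
  obtains a where "a < fin_fib g (mor g j)" "fin_eps g (mor g j) a = j"
proof -
  have "j \<in> set (sorted_list_of_set (fin_preimage g (mor g j)))" using assms by (simp add: fin_preimage_def)
  then obtain a where "a < length (sorted_list_of_set (fin_preimage g (mor g j)))"
    "sorted_list_of_set (fin_preimage g (mor g j)) ! a = j"
    unfolding in_set_conv_nth by blast
  then show ?thesis using that by (simp add: fin_eps_def fin_fib_def)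
qed

text \<open>A finite set of numbers has just one increasing enumeration. Exhibiting one therefore
  computes both the size of a fibre and its inclusion.\<close>

lemma fin_eps_unique:
  assumes e: "\<And>a b. a < b \<Longrightarrow> b < k \<Longrightarrow> e a < e b" and img: "e ` {..<k} = fin_preimage g i"
  shows "fin_fib g i = k" "\<And>a. a < k \<Longrightarrow> fin_eps g i a = e a"
proof -
  have "sorted_wrt (<) (map e [0..<k])" using e by (simp add: sorted_wrt_iff_nth_less)
  moreover have "set (map e [0..<k]) = fin_preimage g i" using img by (simp add: lessThan_atLeast0)
  ultimately have *: "map e [0..<k] = sorted_list_of_set (fin_preimage g i)"
    using strict_sorted_list_of_set[of "fin_preimage g i"]
    by (intro strict_sorted_equal) simp_all
  show "fin_fib g i = k"
    unfolding fin_fib_def using arg_cong[OF *, of length] by simp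
  show "fin_eps g i a = e a" if "a < k" for a
    unfolding fin_eps_def using that by (simp flip: *)
qed

text \<open>The block sizes of the ordinal sum into which \<open>fin_pi g\<close> maps.\<close>

definition fibs :: "fmap \<Rightarrow> nat list" where
  "fibs g = map (fin_fib g) [0..<Cod FinOrd g]"

lemma fibs_simps [simp]:
  "length (fibs g) = Cod FinOrd g" "i < Cod FinOrd g \<Longrightarrow> fibs g ! i = fin_fib g i"
  by (simp_all add: fibs_def)

lemma sum_fibs:
  assumes "g \<in> Arr FinOrd"
  shows "sum_list (fibs g) = Dom FinOrd g"
proof -
  have "(\<Union>i<Cod FinOrd g. fin_preimage g i) = {..<Dom FinOrd g}"
    using FinOrd_mor[OF assms] by (auto simp: fin_preimage_def)
  then have "Dom FinOrd g = card (\<Union>i<Cod FinOrd g. fin_preimage g i)" by simp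
  also have "\<dots> = (\<Sum>i<Cod FinOrd g. card (fin_preimage g i))"
    by (rule card_UN_disjoint) (auto simp: fin_preimage_def)
  finally show ?thesis
    by (simp add: fibs_def fin_fib_def interv_sum_list_conv_sum_set_nat lessThan_atLeast0)
qed

lemma pos_fibs: "i \<le> Cod FinOrd g \<Longrightarrow> pos (fibs g) i a = (\<Sum>i'<i. fin_fib g i') + a"
  by (simp add: pos_def fibs_def take_map interv_sum_list_conv_sum_set_nat lessThan_atLeast0 min_def)

text \<open>Makes the description in \<open>fin_pi\<close> meaningful. The inverse permutation is
  written down block by block; it is injective because distinct fibres are disjoint and each is
  enumerated injectively.\<close>

lemma fin_pi_aux:
  assumes g: "g \<in> Arr FinOrd"
  shows "\<exists>!p. p permutes {..<Dom FinOrd g} \<and>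
     (\<forall>i < Cod FinOrd g. \<forall>a < fin_fib g i. inv p ((\<Sum>i'<i. fin_fib g i') + a) = fin_eps g i a)"
proof (rule ex_ex1I)
  define q where "q k = (if k < Dom FinOrd g then case unpos (fibs g) k of (i, a) \<Rightarrow> fin_eps g i a else k)" for k
  have qp: "q (pos (fibs g) i a) = fin_eps g i a" if "i < Cod FinOrd g" "a < fin_fib g i" for i a
    using that pos_less[of i "fibs g" a] unpos_pos[of i "fibs g" a] by (simp add: q_def sum_fibs[OF g])
  have ex: "\<exists>i a. k = pos (fibs g) i a \<and> i < Cod FinOrd g \<and> a < fin_fib g i" if "k < Dom FinOrd g" for k
  proof -
    have "k < sum_list (fibs g)" using that by (simp add: sum_fibs[OF g])
    from pos_exhaust[OF this] obtain i a where "k = pos (fibs g) i a" "i < length (fibs g)" "a < fibs g ! i"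
      by (elim exE conjE)
    then show ?thesis by (intro exI[of _ i] exI[of _ a]) simp
  qed
  have q: "q permutes {..<Dom FinOrd g}"
  proof (rule permutes_lessThanI)
    show "q k < Dom FinOrd g" if "k < Dom FinOrd g" for k
      using ex[OF that] by (auto simp: qp intro!: fin_eps_mem(1))
    show "k = l" if kl: "k < Dom FinOrd g" "l < Dom FinOrd g" "q k = q l" for k l
    proof -
      obtain i a j b where *: "k = pos (fibs g) i a" "i < Cod FinOrd g" "a < fin_fib g i"
        "l = pos (fibs g) j b" "j < Cod FinOrd g" "b < fin_fib g j"
        using ex[OF kl(1)] ex[OF kl(2)] by auto
      then have e: "fin_eps g i a = fin_eps g j b" using kl(3) by (simp add: qp)
      then have "i = j" using fin_eps_mem(2)[OF *(3)] fin_eps_mem(2)[OF *(6)] by simp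
      then show ?thesis using e * fin_eps_inject[of a g i b] by simp
    qed
    show "q k = k" if "\<not> k < Dom FinOrd g" for k using that by (simp add: q_def)
  qed
  then show "\<exists>p. p permutes {..<Dom FinOrd g} \<and>
     (\<forall>i < Cod FinOrd g. \<forall>a < fin_fib g i. inv p ((\<Sum>i'<i. fin_fib g i') + a) = fin_eps g i a)"
    using qp by (intro exI[of _ "inv q"]) (simp add: permutes_inv permutes_inv_inv pos_fibs)
  fix p p'
  assume p: "p permutes {..<Dom FinOrd g} \<and>
     (\<forall>i < Cod FinOrd g. \<forall>a < fin_fib g i. inv p ((\<Sum>i'<i. fin_fib g i') + a) = fin_eps g i a)"
    and p': "p' permutes {..<Dom FinOrd g} \<and>
     (\<forall>i < Cod FinOrd g. \<forall>a < fin_fib g i. inv p' ((\<Sum>i'<i. fin_fib g i') + a) = fin_eps g i a)"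
  have "inv p k = inv p' k" for k
  proof (cases "k < Dom FinOrd g")
    case True
    then show ?thesis using ex[OF True] p p' by (auto simp: pos_fibs)
  next
    case False
    then show ?thesis
      using permutes_lessThanD(3)[OF permutes_inv[of p "{..<Dom FinOrd g}"]]
        permutes_lessThanD(3)[OF permutes_inv[of p' "{..<Dom FinOrd g}"]] p p' by simp
  qed
  then have "inv p = inv p'" by blast
  then show "p = p'" using p p' permutes_inv_inv by metis
qed

lemma fin_pi:
  assumes "g \<in> Arr FinOrd"
  shows "fin_pi g permutes {..<Dom FinOrd g}"
    "i < Cod FinOrd g \<Longrightarrow> a < fin_fib g i \<Longrightarrow> inv (fin_pi g) (pos (fibs g) i a) = fin_eps g i a"
    "i < Cod FinOrd g \<Longrightarrow> a < fin_fib g i \<Longrightarrow> fin_pi g (fin_eps g i a) = pos (fibs g) i a"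
proof -
  note * = theI'[OF fin_pi_aux[OF assms], folded fin_pi_def]
  show p: "fin_pi g permutes {..<Dom FinOrd g}" using * by blast
  show i: "inv (fin_pi g) (pos (fibs g) i a) = fin_eps g i a" if "i < Cod FinOrd g" "a < fin_fib g i"
    using * that by (simp add: pos_fibs)
  show "fin_pi g (fin_eps g i a) = pos (fibs g) i a" if "i < Cod FinOrd g" "a < fin_fib g i"
    using i[OF that] permutes_inverses(1)[OF p] by metis
qed

lemma fin_pi_unique:
  assumes g: "g \<in> Arr FinOrd" and p: "p permutes {..<Dom FinOrd g}"
    and "\<And>i a. i < Cod FinOrd g \<Longrightarrow> a < fin_fib g i \<Longrightarrow> p (fin_eps g i a) = pos (fibs g) i a"
  shows "fin_pi g = p"
  unfolding fin_pi_def
proof (rule the1_equality[OF fin_pi_aux[OF g]], intro conjI allI impI p)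
  fix i a assume "i < Cod FinOrd g" "a < fin_fib g i"
  then show "inv p ((\<Sum>i'<i. fin_fib g i') + a) = fin_eps g i a"
    using assms(3)[of i a] permutes_inverses(2)[OF p] by (metis pos_fibs less_imp_le)
qed

lemma FinOrd_cases:
  assumes "g \<in> Arr FinOrd" "j < Dom FinOrd g"
  obtains i a where "i < Cod FinOrd g" "a < fin_fib g i" "j = fin_eps g i a" "mor g j = i"
  using fin_eps_surj[OF assms(2)] FinOrd_mor[OF assms] by metis

section \<open>Fibre maps of finite ordinals and the cocycle identity\<close>

context
  fixes f g :: fmap
  assumes f: "f \<in> Arr FinOrd" and g: "g \<in> Arr FinOrd" and fg: "Dom FinOrd g = Cod FinOrd f"
begin

lemma gf: "Comp FinOrd g f \<in> Arr FinOrd" "Dom FinOrd (Comp FinOrd g f) = Dom FinOrd f"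
  "Cod FinOrd (Comp FinOrd g f) = Cod FinOrd g"
  using category_ops(6-8)[OF category_FinOrd g f fg] by auto

lemma fin_fibmap_mor:
  assumes "a < fin_fib (Comp FinOrd g f) i"
  shows "mor (fin_fibmap f g i) a < fin_fib g i"
    "fin_eps g i (mor (fin_fibmap f g i) a) = mor f (fin_eps (Comp FinOrd g f) i a)"
proof -
  let ?j = "fin_eps (Comp FinOrd g f) i a"
  have j: "?j < Dom FinOrd f" "mor g (mor f ?j) = i"
    using fin_eps_mem[OF assms] FinOrd_Comp_mor[OF g f fg, of ?j] by (simp_all add: gf)
  then obtain b where b: "b < fin_fib g i" "fin_eps g i b = mor f ?j"
    using fin_eps_surj[of "mor f ?j" g] FinOrd_mor[OF f j(1)] fg by metis
  then have "\<exists>!b. b < fin_fib g i \<and> fin_eps g i b = mor f ?j"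
    using fin_eps_inject by metis
  from theI'[OF this] show "mor (fin_fibmap f g i) a < fin_fib g i"
    "fin_eps g i (mor (fin_fibmap f g i) a) = mor f (fin_eps (Comp FinOrd g f) i a)"
    using assms by (simp_all add: fin_fibmap_def)
qed

lemma fin_fibmap:
  "fin_fibmap f g i \<in> Arr FinOrd" "Dom FinOrd (fin_fibmap f g i) = fin_fib (Comp FinOrd g f) i"
  "Cod FinOrd (fin_fibmap f g i) = fin_fib g i"
proof -
  have "mor (fin_fibmap f g i) \<in> {..<fin_fib (Comp FinOrd g f) i} \<rightarrow>\<^sub>E {..<fin_fib g i}"
    using fin_fibmap_mor(1) by (auto simp: PiE_iff) (simp add: fin_fibmap_def)
  then show *: "fin_fibmap f g i \<in> Arr FinOrd" by (simp add: fin_fibmap_def FinOrd_Arr)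
  then show "Dom FinOrd (fin_fibmap f g i) = fin_fib (Comp FinOrd g f) i"
    "Cod FinOrd (fin_fibmap f g i) = fin_fib g i"
    unfolding fin_fibmap_def by simp_all
qed

lemma fin_fibmap_unique:
  assumes q: "q \<in> Arr FinOrd" "Dom FinOrd q = fin_fib (Comp FinOrd g f) i" "Cod FinOrd q = fin_fib g i"
    and "\<And>a. a < fin_fib (Comp FinOrd g f) i \<Longrightarrow> fin_eps g i (mor q a) = mor f (fin_eps (Comp FinOrd g f) i a)"
  shows "q = fin_fibmap f g i"
proof (rule FinOrd_eqI[OF q(1) fin_fibmap(1)])
  fix a assume a: "a < Dom FinOrd q"
  then show "mor q a = mor (fin_fibmap f g i) a"
    using assms(4)[of a] fin_fibmap_mor[of a i] FinOrd_mor[OF q(1) a] fin_eps_inject[of _ g i] q by metis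
qed (simp_all add: q fin_fibmap)

text \<open>(A5) for finite ordinals. The composite of the two fibre inclusions is increasing and
  has the fibre of \<open>f\<close> over \<open>fin_eps g i b\<close> as image, so uniqueness of
  enumerations identifies it.\<close>

lemma fin_eps_fibmap:
  assumes b: "b < fin_fib g i"
  shows "fin_fib (fin_fibmap f g i) b = fin_fib f (fin_eps g i b)"
    "a < fin_fib f (fin_eps g i b) \<Longrightarrow>
     fin_eps (Comp FinOrd g f) i (fin_eps (fin_fibmap f g i) b a) = fin_eps f (fin_eps g i b) a"
proof -
  let ?h = "fin_fibmap f g i"
  let ?e = "\<lambda>a. fin_eps (Comp FinOrd g f) i (fin_eps ?h b a)"
  have h: "fin_eps ?h b a < fin_fib (Comp FinOrd g f) i" "mor ?h (fin_eps ?h b a) = b" if "a < fin_fib ?h b" for a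
    using fin_eps_mem[OF that] by (simp_all add: fin_fibmap)
  have "?e ` {..<fin_fib ?h b} = fin_preimage f (fin_eps g i b)"
  proof (intro equalityI subsetI)
    fix j assume "j \<in> ?e ` {..<fin_fib ?h b}"
    then obtain a where a: "a < fin_fib ?h b" "j = ?e a" by auto
    then show "j \<in> fin_preimage f (fin_eps g i b)"
      using fin_eps_mem(1)[OF h(1)[OF a(1)]] fin_fibmap_mor(2)[OF h(1)[OF a(1)]] h(2)[OF a(1)]
      by (simp add: fin_preimage_def gf)
  next
    fix j assume "j \<in> fin_preimage f (fin_eps g i b)"
    then have j: "j < Dom FinOrd f" "mor f j = fin_eps g i b" by (auto simp: fin_preimage_def)
    then have "mor (Comp FinOrd g f) j = i" using fin_eps_mem(2)[OF b] FinOrd_Comp_mor[OF g f fg] by simp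
    then obtain a where a: "a < fin_fib (Comp FinOrd g f) i" "fin_eps (Comp FinOrd g f) i a = j"
      using fin_eps_surj[of j "Comp FinOrd g f"] j(1) by (auto simp: gf)
    then have "mor ?h a = b"
      using fin_fibmap_mor[OF a(1)] j(2) fin_eps_inject[OF _ b] by simp
    then obtain c where "c < fin_fib ?h b" "fin_eps ?h b c = a"
      using fin_eps_surj[of a ?h] a(1) by (auto simp: fin_fibmap)
    then show "j \<in> ?e ` {..<fin_fib ?h b}" using a(2) by auto
  qed
  moreover have "?e a < ?e c" if "a < c" "c < fin_fib ?h b" for a c
    using fin_eps_less[OF fin_eps_less[OF that]] h(1)[of c] that by simp
  ultimately show "fin_fib ?h b = fin_fib f (fin_eps g i b)"
    "a < fin_fib f (fin_eps g i b) \<Longrightarrow> ?e a = fin_eps f (fin_eps g i b) a"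
    using fin_eps_unique[of "fin_fib ?h b" ?e f "fin_eps g i b"] by auto
qed

text \<open>A position \<open>j\<close> is coded by three indices: the value \<open>i\<close> of the
  composite at \<open>j\<close>, the place \<open>b\<close> of its image under \<open>f\<close> in
  the fibre of \<open>g\<close>, and its place \<open>a'\<close> in the fibre of \<open>f\<close>.
  The left side merges \<open>i\<close> with \<open>b\<close> first, the right side \<open>b\<close>
  with \<open>a'\<close>, and \<open>pos_concat\<close> says that the results agree.\<close>

lemma fin_cocycle:
  assumes nss: "nss = map (\<lambda>i. fibs (fin_fibmap f g i)) [0..<Cod FinOrd g]"
  shows "blk_perm (fibs f) (concat nss) (fin_pi g) (\<lambda>_ i. i) \<circ> fin_pi f
    = blk_perm (fibs (Comp FinOrd g f)) (map sum_list nss) (\<lambda>i. i) (\<lambda>i. fin_pi (fin_fibmap f g i)) \<circ> fin_pi (Comp FinOrd g f)"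
proof
  fix j
  show "(blk_perm (fibs f) (concat nss) (fin_pi g) (\<lambda>_ i. i) \<circ> fin_pi f) j
    = (blk_perm (fibs (Comp FinOrd g f)) (map sum_list nss) (\<lambda>i. i) (\<lambda>i. fin_pi (fin_fibmap f g i)) \<circ> fin_pi (Comp FinOrd g f)) j"
  proof (cases "j < Dom FinOrd f")
    case False
    then show ?thesis
      using permutes_lessThanD(3)[OF fin_pi(1)[OF f]] permutes_lessThanD(3)[OF fin_pi(1)[OF gf(1)]]
      by (simp add: gf blk_perm_outside sum_fibs[OF f] sum_fibs[OF gf(1)])
  next
    case True
    obtain i a where i: "i < Cod FinOrd g" "a < fin_fib (Comp FinOrd g f) i" "j = fin_eps (Comp FinOrd g f) i a"
      using FinOrd_cases[OF gf(1), of j] True gf(2,3) by metis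
    let ?h = "fin_fibmap f g i"
    obtain b a' where b: "b < fin_fib g i" "a' < fin_fib ?h b" "a = fin_eps ?h b a'"
      using FinOrd_cases[OF fin_fibmap(1), of a i] i(2) fin_fibmap(2,3) by metis
    have a': "a' < fin_fib f (fin_eps g i b)" using b fin_eps_fibmap(1)[OF b(1)] by simp
    have j: "j = fin_eps f (fin_eps g i b) a'" using i(3) b(3) fin_eps_fibmap(2)[OF b(1) a'] by simp
    have c: "fin_eps g i b < Cod FinOrd f" using fin_eps_mem(1)[OF b(1)] fg by simp
    have n: "nss ! i = fibs ?h" "i < length nss" "map length nss = fibs g"
      using i(1) by (simp_all add: nss fin_fibmap fibs_def)
    have "(blk_perm (fibs f) (concat nss) (fin_pi g) (\<lambda>_ i. i) \<circ> fin_pi f) j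
        = pos (concat nss) (pos (map length nss) i b) a'"
      using fin_pi(3)[OF f c a'] fin_pi(3)[OF g i(1) b(1)] c a' by (simp add: j n)
    also have "\<dots> = pos (map sum_list nss) i (pos (fibs ?h) b a')"
      using pos_concat[of i nss b a'] n b(1) by (simp add: fin_fibmap)
    also have "\<dots> = (blk_perm (fibs (Comp FinOrd g f)) (map sum_list nss) (\<lambda>i. i) (\<lambda>i. fin_pi (fin_fibmap f g i)) \<circ> fin_pi (Comp FinOrd g f)) j"
      using fin_pi(3)[OF gf(1), of i a] fin_pi(3)[OF fin_fibmap(1), of b i a'] i b by (simp add: gf fin_fibmap)
    finally show ?thesis .
  qed
qed

text \<open>The computation of \<open>fin_cocycle\<close> read backwards: a flattened position
  determines its indices, so the equation forces \<open>h\<close> and \<open>q i\<close> to have the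
  values of the composite and of the fibre maps. The sizes required in \<open>lens\<close> are
  supplied later by the object part of (A5).\<close>

lemma fin_cocycle_converse:
  assumes h: "h \<in> Arr FinOrd" "Dom FinOrd h = Dom FinOrd f" "Cod FinOrd h = Cod FinOrd g"
    and q: "\<And>i. i < Cod FinOrd g \<Longrightarrow> q i \<in> Arr FinOrd \<and> Dom FinOrd (q i) = fin_fib h i \<and> Cod FinOrd (q i) = fin_fib g i"
    and nss: "nss = map (\<lambda>i. fibs (q i)) [0..<Cod FinOrd g]"
    and lens: "\<And>i b. i < Cod FinOrd g \<Longrightarrow> b < fin_fib g i \<Longrightarrow> fin_fib (q i) b = fin_fib f (fin_eps g i b)"
    and eq: "blk_perm (fibs f) (concat nss) (fin_pi g) (\<lambda>_ i. i) \<circ> fin_pi f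
      = blk_perm (fibs h) (map sum_list nss) (\<lambda>i. i) (\<lambda>i. fin_pi (q i)) \<circ> fin_pi h"
  shows "h = Comp FinOrd g f" "\<And>i. i < Cod FinOrd g \<Longrightarrow> q i = fin_fibmap f g i"
proof -
  have n: "length nss = Cod FinOrd g" "map length nss = fibs g" "\<And>i. i < Cod FinOrd g \<Longrightarrow> nss ! i = fibs (q i)"
    using q by (auto simp: nss fibs_def)
  have ms: "map sum_list nss = fibs h"
    unfolding nss fibs_def[of h] h(3) map_map comp_def using q by (intro map_cong) (auto simp: sum_fibs)
  \<comment> \<open>Evaluates both sides of \<open>eq\<close> at the \<open>a\<close>-th element of
    the fibre of \<open>h\<close> over \<open>i\<close>; all that is needed about \<open>h\<close>
    and \<open>q\<close> is obtained at this one position.\<close>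
  have key: "mor g (mor f j) = i \<and> mor (q i) a < fin_fib g i \<and> fin_eps g i (mor (q i) a) = mor f j"
    if i: "i < Cod FinOrd g" and a: "a < fin_fib h i" and j: "j = fin_eps h i a" for i a j
  proof -
    have "j < Dom FinOrd f" using fin_eps_mem(1)[OF a] h j by simp
    then obtain c a' where c: "c < Cod FinOrd f" "a' < fin_fib f c" "j = fin_eps f c a'" "mor f j = c"
      using FinOrd_cases[OF f] by metis
    obtain k b where b: "k < Cod FinOrd g" "b < fin_fib g k" "c = fin_eps g k b" "mor g c = k"
      using FinOrd_cases[OF g, of c] c(1) fg by auto
    have a'': "a' < fin_fib (q k) b" using lens[OF b(1,2)] b(3) c(2) by simp
    obtain b' e where e: "b' < fin_fib g i" "e < fin_fib (q i) b'" "a = fin_eps (q i) b' e" "mor (q i) a = b'"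
      using FinOrd_cases[of "q i" a] q[OF i] a by auto
    have "(blk_perm (fibs f) (concat nss) (fin_pi g) (\<lambda>_ i. i) \<circ> fin_pi f) j = pos (concat nss) (pos (map length nss) k b) a'"
      using fin_pi(3)[OF f c(1,2)] fin_pi(3)[OF g b(1,2)] c b(3) by (simp add: n)
    also have "\<dots> = pos (fibs h) k (pos (fibs (q k)) b a')"
      using pos_concat[of k nss b a'] n b(1,2) q[OF b(1)] by (simp add: ms)
    finally have "pos (fibs h) k (pos (fibs (q k)) b a') = (blk_perm (fibs h) (map sum_list nss) (\<lambda>i. i) (\<lambda>i. fin_pi (q i)) \<circ> fin_pi h) j"
      by (simp add: eq)
    also have "\<dots> = pos (fibs h) i (pos (fibs (q i)) b' e)"
      using fin_pi(3)[OF h(1), of i a] fin_pi(3)[of "q i" b' e] q[OF i] i h(3) a j e by (simp add: ms)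
    finally have p: "pos (fibs h) k (pos (fibs (q k)) b a') = pos (fibs h) i (pos (fibs (q i)) b' e)" .
    \<comment> \<open>Both inner positions lie within their outer blocks, so
      \<open>pos_inject\<close> may be used twice: first for the outer block, giving
      \<open>k = i\<close>, then for the inner one, giving \<open>b = b'\<close>.\<close>
    have l: "pos (fibs (q k)) b a' < fin_fib h k" "pos (fibs (q i)) b' e < fin_fib h i"
      using pos_less[of b "fibs (q k)" a'] pos_less[of b' "fibs (q i)" e] q[OF b(1)] q[OF i] a'' b(2) e
      by (simp_all add: sum_fibs)
    have ki: "k = i" and p': "pos (fibs (q k)) b a' = pos (fibs (q i)) b' e"
      using pos_inject[OF p] l b(1) i h(3) by auto
    have "b = b'" using pos_inject[of "fibs (q i)" b a' b' e] p' ki a'' b(2) e q[OF i] by simp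
    then show ?thesis using b c e ki by simp
  qed
  show hc: "h = Comp FinOrd g f"
  proof (rule FinOrd_eqI[OF h(1) gf(1)])
    fix j assume j: "j < Dom FinOrd h"
    then obtain i a where "i < Cod FinOrd g" "a < fin_fib h i" "j = fin_eps h i a" "mor h j = i"
      using FinOrd_cases[OF h(1)] h(3) by metis
    then show "mor h j = mor (Comp FinOrd g f) j"
      using key FinOrd_Comp_mor[OF g f fg] j h(2) by simp
  qed (simp_all add: gf h)
  show "q i = fin_fibmap f g i" if i: "i < Cod FinOrd g" for i
    using q[OF i] key[OF i] unfolding hc by (intro fin_fibmap_unique) auto
qed

end

text \<open>The map recovered from a shuffle: its fibres are the blocks of sizes \<open>ns\<close>.\<close>

definition blk_map :: "nat list \<Rightarrow> (nat \<Rightarrow> nat) \<Rightarrow> fmap" where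
  "blk_map ns p = (sum_list ns, (\<lambda>j\<in>{..<sum_list ns}. fst (unpos ns (p j))), length ns)"

text \<open>The shuffle condition says that \<open>inv p\<close> enumerates each block increasingly,
  and this makes it the inclusion of the corresponding fibre. Without monotonicity the map would
  have the right fibres but possibly another \<open>fin_pi\<close>.\<close>

lemma blk_map:
  assumes p: "p permutes {..<sum_list ns}"
    and mono: "\<And>i. i < length ns \<Longrightarrow> mono_on {pos ns i 0 ..< pos ns (Suc i) 0} (inv p)"
  shows "blk_map ns p \<in> Arr FinOrd" "Dom FinOrd (blk_map ns p) = sum_list ns" "Cod FinOrd (blk_map ns p) = length ns"
    "fibs (blk_map ns p) = ns" "fin_pi (blk_map ns p) = p"
proof -
  let ?g = "blk_map ns p"
  have un: "fst (unpos ns k) < length ns \<and> snd (unpos ns k) < ns ! fst (unpos ns k)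
      \<and> pos ns (fst (unpos ns k)) (snd (unpos ns k)) = k" if "k < sum_list ns" for k
    using pos_exhaust[OF that] by (auto simp: unpos_pos)
  have pl: "p j < sum_list ns \<longleftrightarrow> j < sum_list ns" for j using permutes_lessThanD(1)[OF p] .
  show g: "?g \<in> Arr FinOrd" using un pl by (auto simp: blk_map_def FinOrd_Arr)
  then show dom: "Dom FinOrd ?g = sum_list ns" and cod: "Cod FinOrd ?g = length ns"
    unfolding blk_map_def by simp_all
  have ipl: "inv p k < sum_list ns \<longleftrightarrow> k < sum_list ns" for k using permutes_lessThanD(1)[OF permutes_inv[OF p]] .
  have fe: "fin_fib ?g i = ns ! i" "\<And>a. a < ns ! i \<Longrightarrow> fin_eps ?g i a = inv p (pos ns i a)" if i: "i < length ns" for i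
  proof -
    let ?e = "\<lambda>a. inv p (pos ns i a)"
    have "?e a < ?e b" if ab: "a < b" "b < ns ! i" for a b
    proof -
      have S: "pos ns (Suc i) 0 = pos ns i (ns ! i)" using i by (simp add: pos_def take_Suc_conv_app_nth)
      have "pos ns i a \<in> {pos ns i 0 ..< pos ns (Suc i) 0}" "pos ns i b \<in> {pos ns i 0 ..< pos ns (Suc i) 0}"
        "pos ns i a \<le> pos ns i b"
        unfolding S using ab by (simp_all add: pos_def)
      then have "?e a \<le> ?e b" by (rule mono_onD[OF mono[OF i]])
      moreover have "?e a \<noteq> ?e b"
        using ab permutes_lessThanD(2)[OF permutes_inv[OF p]] by (simp add: pos_def)
      ultimately show ?thesis by simp
    qed
    moreover have "?e ` {..<ns ! i} = fin_preimage ?g i"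
    proof (intro equalityI subsetI)
      fix j assume "j \<in> ?e ` {..<ns ! i}"
      then obtain a where a: "a < ns ! i" "j = ?e a" by auto
      then show "j \<in> fin_preimage ?g i"
        using pos_less[OF i a(1)] unpos_pos[OF i a(1)] permutes_inverses(1)[OF p]
        by (simp add: fin_preimage_def dom ipl) (simp add: blk_map_def ipl)
    next
      fix j assume "j \<in> fin_preimage ?g i"
      then have j: "j < sum_list ns" "fst (unpos ns (p j)) = i"
        by (auto simp: fin_preimage_def dom) (auto simp: blk_map_def)
      then have "pos ns i (snd (unpos ns (p j))) = p j" "snd (unpos ns (p j)) < ns ! i"
        using un[of "p j"] pl by auto
      then show "j \<in> ?e ` {..<ns ! i}"
        using permutes_inverses(2)[OF p] by (intro image_eqI[of _ _ "snd (unpos ns (p j))"]) simp_all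
    qed
    ultimately show "fin_fib ?g i = ns ! i" "\<And>a. a < ns ! i \<Longrightarrow> fin_eps ?g i a = inv p (pos ns i a)"
      using fin_eps_unique[of "ns ! i" ?e ?g i] by auto
  qed
  show fibs: "fibs ?g = ns" by (rule nth_equalityI) (simp_all add: cod fe)
  show "fin_pi ?g = p"
    by (rule fin_pi_unique[OF g]) (use p fe permutes_inverses(1)[OF p] in \<open>simp_all add: dom cod fibs\<close>)
qed

lemma fin_pi_mono_on:
  assumes g: "g \<in> Arr FinOrd" and i: "i < Cod FinOrd g"
  shows "mono_on {pos (fibs g) i 0 ..< pos (fibs g) (Suc i) 0} (inv (fin_pi g))"
proof (rule mono_onI)
  fix k l assume kl: "k \<in> {pos (fibs g) i 0 ..< pos (fibs g) (Suc i) 0}" "l \<in> {pos (fibs g) i 0 ..< pos (fibs g) (Suc i) 0}" "k \<le> l"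
  have S: "pos (fibs g) (Suc i) 0 = pos (fibs g) i (fin_fib g i)" using i by (simp add: pos_def take_Suc_conv_app_nth)
  define a b where "a = k - pos (fibs g) i 0" and "b = l - pos (fibs g) i 0"
  have "k = pos (fibs g) i a" "l = pos (fibs g) i b" "a < fin_fib g i" "b < fin_fib g i" "a \<le> b"
    using kl unfolding S by (auto simp: pos_def a_def b_def)
  then show "inv (fin_pi g) k \<le> inv (fin_pi g) l"
    using fin_pi(2)[OF g i] fin_eps_less[of a b g i] by (cases "a = b") auto
qed

text \<open>The block containing the image of \<open>j\<close> under the permutation tells the value
  at \<open>j\<close>. Both hypotheses matter: all monotone maps have the identity as
  \<open>fin_pi\<close>, and fibre sizes do not see the order of the values.\<close>

lemma fin_eq_if_pi_eq:
  assumes g: "g \<in> Arr FinOrd" and h: "h \<in> Arr FinOrd" and e: "fibs g = fibs h" "fin_pi g = fin_pi h"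
  shows "g = h"
proof (rule FinOrd_eqI[OF g h])
  show d: "Dom FinOrd g = Dom FinOrd h" using sum_fibs[OF g] sum_fibs[OF h] e by simp
  show c: "Cod FinOrd g = Cod FinOrd h" using arg_cong[OF e(1), of length] by simp
  fix j assume j: "j < Dom FinOrd g"
  then obtain i a where i: "i < Cod FinOrd g" "a < fin_fib g i" "j = fin_eps g i a" "mor g j = i"
    using FinOrd_cases[OF g] by metis
  have f: "fin_fib h i = fin_fib g i" using fibs_simps(2)[OF i(1)] fibs_simps(2)[of i h] i(1) c e by simp
  have "j = inv (fin_pi h) (pos (fibs h) i a)" using fin_pi(2)[OF g i(1,2)] i(3) e by simp
  also have "\<dots> = fin_eps h i a" using fin_pi(2)[OF h, of i a] i c f by simp
  finally show "mor g j = mor h j" using fin_eps_mem(2)[of a h i] i f by simp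
qed

section \<open>The operadic nerve as generator data\<close>

lemma slice_simps [simp]:
  "g \<in> Obj (slice C R) \<longleftrightarrow> g \<in> Arr C \<and> Cod C g = R"
  "(f, g) \<in> Arr (slice C R) \<longleftrightarrow> g \<in> Arr C \<and> f \<in> Arr C \<and> Dom C g = Cod C f \<and> Cod C g = R"
  "(f, g) \<in> Arr (slice C R) \<Longrightarrow> Dom (slice C R) (f, g) = Comp C g f"
  "(f, g) \<in> Arr (slice C R) \<Longrightarrow> Cod (slice C R) (f, g) = g"
  "g \<in> Arr C \<Longrightarrow> Cod C g = R \<Longrightarrow> Ident (slice C R) g = (Ident C (Dom C g), g)"
  by (auto simp: slice_def composable_def)

lemma slice_Comp:
  "(f, g) \<in> Arr (slice C R) \<Longrightarrow> (f', g') \<in> Arr (slice C R) \<Longrightarrow> g = Comp C g' f' \<Longrightarrow>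
     Comp (slice C R) (f', g') (f, g) = (Comp C f' f, g')"
  by (auto simp: slice_def composable_def)

lemma composable_hom: "f \<in> hom C x y \<Longrightarrow> g \<in> hom C y z \<Longrightarrow> composable C g f"
  by (auto simp: hom_def composable_def)

lemma path_comp_drop:
  assumes C: "category C" and p: "is_path C x gs" and a: "a < length gs"
  shows "path_comp C (drop a gs) = seg C x gs a (length gs)"
proof -
  obtain m where m: "length gs = Suc m" using a by (cases gs) auto
  have "a \<le> m" using a m by simp
  then show ?thesis
  proof (induction a rule: inc_induct)
    case base
    then have "drop m gs = [gs ! m]" using m by (simp add: Cons_nth_drop_Suc[symmetric])
    then show ?case using seg_Suc[OF C p, of m] m by simp
  next
    case (step a)
    then have "drop a gs = gs ! a # drop (Suc a) gs" "drop (Suc a) gs \<noteq> []"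
      using m by (simp_all add: Cons_nth_drop_Suc)
    then have "path_comp C (drop a gs) = Comp C (path_comp C (drop (Suc a) gs)) (gs ! a)"
      by (cases "drop (Suc a) gs") simp_all
    then show ?case
      using step seg_Comp[OF C p, of a "Suc a" "length gs"] seg_Suc[OF C p, of a] m by (simp del: seg.simps)
  qed
qed

text \<open>Together with \<open>fib_edges\<close> this restates \<open>fib_chain\<close> through
  \<open>seg\<close>, to make the calculus of \<open>pull\<close> available. The last vertex of the
  path is the base of the fibres, so the chain of fibres has one arrow fewer than
  \<open>gs\<close>.\<close>

definition fib_source :: "('o, 'm) opcat \<Rightarrow> 'o \<Rightarrow> 'm list \<Rightarrow> nat \<Rightarrow> 'o" where
  "fib_source P x gs i = fib_obj P (seg (OBase P) x gs 0 (length gs)) i"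

definition fib_edges :: "('o, 'm) opcat \<Rightarrow> 'o \<Rightarrow> 'm list \<Rightarrow> nat \<Rightarrow> 'm list" where
  "fib_edges P x gs i =
     map (\<lambda>a. fib_map P (gs ! a) (seg (OBase P) x gs (Suc a) (length gs)) i) [0..<length gs - 1]"

lemma fib_edges_nth:
  "Suc a < length gs \<Longrightarrow> fib_edges P x gs i ! a = fib_map P (gs ! a) (seg (OBase P) x gs (Suc a) (length gs)) i"
proof -
  assume "Suc a < length gs"
  then have "a < length gs - 1" by simp
  then show ?thesis by (simp add: fib_edges_def del: seg.simps)
qed

lemma fib_length: "length (fib_edges P x gs i) = length gs - 1"
  by (simp add: fib_edges_def)

section \<open>Fibres of chains in an operadic category\<close>

context
  fixes P :: "('o, 'm) opcat"
  assumes P: "is_opcat P"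
begin

lemma opcat_ltcat: "is_ltcat (Und P)"
  using P unfolding is_opcat_def by - (elim conjE, assumption)

lemma opcat_category: "category (OBase P)"
  using opcat_ltcat by blast

lemma opcat_Crd: "is_fctr (OBase P) FinOrd (Crd P)"
  using P unfolding is_opcat_def by - (elim conjE, assumption)

lemma opcat_Fib:
  "R \<in> Obj (OBase P) \<Longrightarrow> i < fo (Crd P) R \<Longrightarrow> is_fctr (slice (OBase P) R) (OBase P) (Fib P R i)"
  "\<not> (R \<in> Obj (OBase P) \<and> i < fo (Crd P) R) \<Longrightarrow> Fib P R i = undefined"
proof -
  have "\<forall>R i. if R \<in> Obj (OBase P) \<and> i < fo (Crd P) R
            then is_fctr (slice (OBase P) R) (OBase P) (Fib P R i)
            else Fib P R i = undefined"
    using P unfolding is_opcat_def by - (elim conjE, assumption)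
  then show "R \<in> Obj (OBase P) \<Longrightarrow> i < fo (Crd P) R \<Longrightarrow> is_fctr (slice (OBase P) R) (OBase P) (Fib P R i)"
    "\<not> (R \<in> Obj (OBase P) \<and> i < fo (Crd P) R) \<Longrightarrow> Fib P R i = undefined"
    by presburger+
qed

lemma opcat_axioms:
  "local_terminal (OBase P) R \<Longrightarrow> fo (Crd P) R = 1"
  "R \<in> Obj (OBase P) \<Longrightarrow> i < fo (Crd P) R \<Longrightarrow> fib_obj P (Ident (OBase P) R) i \<in> chosen (Und P)"
  "g \<in> Arr (OBase P) \<Longrightarrow> i < fo (Crd P) (Cod (OBase P) g) \<Longrightarrow>
     fo (Crd P) (fib_obj P g i) = fin_fib (fa (Crd P) g) i"
  "composable (OBase P) g f \<Longrightarrow> i < fo (Crd P) (Cod (OBase P) g) \<Longrightarrow>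
     fa (Crd P) (fib_map P f g i) = fin_fibmap (fa (Crd P) f) (fa (Crd P) g) i"
  "R \<in> Obj (OBase P) \<Longrightarrow> fib_obj P (tau (Und P) R) 0 = R"
  "g \<in> Arr (OBase P) \<Longrightarrow> fib_map P g (tau (Und P) (Cod (OBase P) g)) 0 = g"
  "composable (OBase P) g f \<Longrightarrow> i < fo (Crd P) (Cod (OBase P) g) \<Longrightarrow> j < fin_fib (fa (Crd P) g) i \<Longrightarrow>
     fib_obj P (fib_map P f g i) j = fib_obj P f (fin_eps (fa (Crd P) g) i j)"
  "composable (OBase P) g f \<Longrightarrow> i < fo (Crd P) (Cod (OBase P) g) \<Longrightarrow> j < fin_fib (fa (Crd P) g) i \<Longrightarrow>
     composable (OBase P) f h \<Longrightarrow>
     fib_map P (fib_map P h (Comp (OBase P) g f) i) (fib_map P f g i) j = fib_map P h f (fin_eps (fa (Crd P) g) i j)"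
proof -
  have
    "\<forall>R. local_terminal (OBase P) R \<longrightarrow> fo (Crd P) R = 1"
    "\<forall>R \<in> Obj (OBase P). \<forall>i < fo (Crd P) R. fib_obj P (Ident (OBase P) R) i \<in> chosen (Und P)"
    "\<forall>g \<in> Arr (OBase P). \<forall>i < fo (Crd P) (Cod (OBase P) g).
        fo (Crd P) (fib_obj P g i) = fin_fib (fa (Crd P) g) i"
    "\<forall>g f. composable (OBase P) g f \<longrightarrow> (\<forall>i < fo (Crd P) (Cod (OBase P) g).
        fa (Crd P) (fib_map P f g i) = fin_fibmap (fa (Crd P) f) (fa (Crd P) g) i)"
    "\<forall>R \<in> Obj (OBase P). fib_obj P (tau (Und P) R) 0 = R"
    "\<forall>g \<in> Arr (OBase P). fib_map P g (tau (Und P) (Cod (OBase P) g)) 0 = g"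
    "\<forall>g f. composable (OBase P) g f \<longrightarrow>
        (\<forall>i < fo (Crd P) (Cod (OBase P) g). \<forall>j < fin_fib (fa (Crd P) g) i.
           fib_obj P (fib_map P f g i) j = fib_obj P f (fin_eps (fa (Crd P) g) i j) \<and>
           (\<forall>h. composable (OBase P) f h \<longrightarrow>
              fib_map P (fib_map P h (Comp (OBase P) g f) i) (fib_map P f g i) j
              = fib_map P h f (fin_eps (fa (Crd P) g) i j)))"
    using P unfolding is_opcat_def by - (elim conjE, assumption)+
  note * = this
  show "local_terminal (OBase P) R \<Longrightarrow> fo (Crd P) R = 1" using *(1) by blast
  show "R \<in> Obj (OBase P) \<Longrightarrow> i < fo (Crd P) R \<Longrightarrow> fib_obj P (Ident (OBase P) R) i \<in> chosen (Und P)"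
    using *(2) by blast
  show "g \<in> Arr (OBase P) \<Longrightarrow> i < fo (Crd P) (Cod (OBase P) g) \<Longrightarrow>
     fo (Crd P) (fib_obj P g i) = fin_fib (fa (Crd P) g) i" using *(3) by blast
  show "composable (OBase P) g f \<Longrightarrow> i < fo (Crd P) (Cod (OBase P) g) \<Longrightarrow>
     fa (Crd P) (fib_map P f g i) = fin_fibmap (fa (Crd P) f) (fa (Crd P) g) i" using *(4) by blast
  show "R \<in> Obj (OBase P) \<Longrightarrow> fib_obj P (tau (Und P) R) 0 = R" using *(5) by blast
  show "g \<in> Arr (OBase P) \<Longrightarrow> fib_map P g (tau (Und P) (Cod (OBase P) g)) 0 = g" using *(6) by blast
  show "composable (OBase P) g f \<Longrightarrow> i < fo (Crd P) (Cod (OBase P) g) \<Longrightarrow> j < fin_fib (fa (Crd P) g) i \<Longrightarrow>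
     fib_obj P (fib_map P f g i) j = fib_obj P f (fin_eps (fa (Crd P) g) i j)" using *(7) by blast
  show "composable (OBase P) g f \<Longrightarrow> i < fo (Crd P) (Cod (OBase P) g) \<Longrightarrow> j < fin_fib (fa (Crd P) g) i \<Longrightarrow>
     composable (OBase P) f h \<Longrightarrow>
     fib_map P (fib_map P h (Comp (OBase P) g f) i) (fib_map P f g i) j = fib_map P h f (fin_eps (fa (Crd P) g) i j)"
    using *(7) by blast
qed

lemma crd_Arr:
  assumes "g \<in> Arr (OBase P)"
  shows "fa (Crd P) g \<in> Arr FinOrd" "Dom FinOrd (fa (Crd P) g) = fo (Crd P) (Dom (OBase P) g)"
    "Cod FinOrd (fa (Crd P) g) = fo (Crd P) (Cod (OBase P) g)"
  using is_fctr_ops[OF opcat_Crd] assms by simp_all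

lemma fib_obj_Obj:
  assumes "g \<in> Arr (OBase P)" "i < fo (Crd P) (Cod (OBase P) g)"
  shows "fib_obj P g i \<in> Obj (OBase P)"
  using is_fctr_ops(1)[OF opcat_Fib(1), of "Cod (OBase P) g" i g] assms
  by (simp add: fib_obj_def category_ops[OF opcat_category])

lemma fib_map_hom:
  assumes f: "f \<in> hom (OBase P) x y" and g: "g \<in> hom (OBase P) y z" and i: "i < fo (Crd P) z"
  shows "fib_map P f g i \<in> hom (OBase P) (fib_obj P (Comp (OBase P) g f) i) (fib_obj P g i)"
proof -
  have z: "z \<in> Obj (OBase P)" using g by (auto simp: hom_def category_ops[OF opcat_category])
  have a: "(f, g) \<in> Arr (slice (OBase P) z)" using f g by (simp add: hom_def)
  have c: "Cod (OBase P) (Comp (OBase P) g f) = z" "Cod (OBase P) g = z"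
    using hom_comp[OF opcat_category f g] g by (auto simp: hom_def)
  show ?thesis
    using is_fctr_ops(2-4)[OF opcat_Fib(1)[OF z i] a] a unfolding fib_map_def fib_obj_def c
    by (simp add: hom_def del: slice_simps(2))
qed

lemma fib_map_Ident:
  assumes "g \<in> hom (OBase P) y z" "i < fo (Crd P) z"
  shows "fib_map P (Ident (OBase P) y) g i = Ident (OBase P) (fib_obj P g i)"
proof -
  have z: "z \<in> Obj (OBase P)" using assms by (auto simp: hom_def category_ops[OF opcat_category])
  show ?thesis
    using is_fctr_ops(5)[OF opcat_Fib(1)[OF z assms(2)], of g] assms(1)
    by (auto simp: fib_map_def fib_obj_def hom_def)
qed

lemma fib_map_Comp:
  assumes f: "f \<in> hom (OBase P) x y" and f': "f' \<in> hom (OBase P) y z" and g: "g \<in> hom (OBase P) z w" and i: "i < fo (Crd P) w"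
  shows "fib_map P (Comp (OBase P) f' f) g i = Comp (OBase P) (fib_map P f' g i) (fib_map P f (Comp (OBase P) g f') i)"
proof -
  note C = opcat_category
  have w: "w \<in> Obj (OBase P)" using g by (auto simp: hom_def category_ops[OF C])
  have gf: "Comp (OBase P) g f' \<in> hom (OBase P) y w" by (rule hom_comp[OF C f' g])
  have a: "(f', g) \<in> Arr (slice (OBase P) w)" "(f, Comp (OBase P) g f') \<in> Arr (slice (OBase P) w)"
    using f f' g gf by (simp_all add: hom_def)
  have "Comp (slice (OBase P) w) (f', g) (f, Comp (OBase P) g f') = (Comp (OBase P) f' f, g)"
    using slice_Comp[OF a(2,1)] by simp
  then show ?thesis
    using is_fctr_ops(6)[OF opcat_Fib(1)[OF w i] a] a gf g
    by (simp add: fib_map_def hom_def del: slice_simps(2))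
qed

context
  fixes x :: 'o and gs :: "'m list" and i :: nat
  assumes p: "is_path (OBase P) x gs" and ne: "gs \<noteq> []" and i: "i < fo (Crd P) (vertex (OBase P) x gs (length gs))"
begin

lemma seg_top_hom: "a \<le> length gs \<Longrightarrow>
  seg (OBase P) x gs a (length gs) \<in> hom (OBase P) (vertex (OBase P) x gs a) (vertex (OBase P) x gs (length gs))"
  by (rule seg_hom[OF opcat_category p]) simp_all

lemma fib_chain_eq: "fib_chain P gs i = Chain (fib_source P x gs i) (fib_edges P x gs i)"
proof -
  have "path_comp (OBase P) gs = seg (OBase P) x gs 0 (length gs)"
    using path_comp_drop[OF opcat_category p, of 0] ne by simp
  moreover have "path_comp (OBase P) (drop (a + 1) gs) = seg (OBase P) x gs (Suc a) (length gs)" if "a < length gs - 1" for a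
    using path_comp_drop[OF opcat_category p, of "a + 1"] that by (simp del: seg.simps)
  ultimately show ?thesis by (simp add: fib_chain_def fib_edges_def fib_source_def del: seg.simps)
qed

lemma fib_edge_hom:
  assumes "Suc a < length gs"
  shows "fib_map P (gs ! a) (seg (OBase P) x gs (Suc a) (length gs)) i
    \<in> hom (OBase P) (fib_obj P (seg (OBase P) x gs a (length gs)) i) (fib_obj P (seg (OBase P) x gs (Suc a) (length gs)) i)"
  using fib_map_hom[OF path_nth[OF opcat_category p, of a] seg_top_hom[of "Suc a"] i]
    seg_Comp[OF opcat_category p, of a "Suc a" "length gs"] seg_Suc[OF opcat_category p, of a] assms
  by (simp del: seg.simps)

lemma fib_vertex:
  assumes "a < length gs"
  shows "vertex (OBase P) (fib_source P x gs i) (fib_edges P x gs i) a = fib_obj P (seg (OBase P) x gs a (length gs)) i"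
proof (cases a)
  case 0
  then show ?thesis by (simp add: fib_source_def del: seg.simps)
next
  case (Suc b)
  then show ?thesis using fib_edge_hom[of b] assms by (simp add: fib_edges_nth hom_def del: seg.simps)
qed

lemma fib_path: "is_path (OBase P) (fib_source P x gs i) (fib_edges P x gs i)"
  unfolding is_path_iff[OF opcat_category]
proof (intro conjI allI impI)
  show "(fib_source P x gs i) \<in> Obj (OBase P)"
    using fib_obj_Obj seg_top_hom[of 0] i by (simp add: fib_source_def hom_def del: seg.simps)
  fix a assume "a < length (fib_edges P x gs i)"
  then have a: "Suc a < length gs" by (auto simp: fib_length)
  then show "(fib_edges P x gs i) ! a \<in> Arr (OBase P)"
    "Dom (OBase P) ((fib_edges P x gs i) ! a) = vertex (OBase P) (fib_source P x gs i) (fib_edges P x gs i) a"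
    using fib_edge_hom[OF a] fib_vertex[of a] by (simp_all add: fib_edges_nth hom_def del: seg.simps)
qed

text \<open>Functoriality of the fibre functor, iterated along the path. The bound on
  \<open>b\<close> is strict because the last vertex is the base and has no counterpart among the
  fibres.\<close>

lemma fib_seg:
  assumes "a \<le> b" "b < length gs"
  shows "seg (OBase P) (fib_source P x gs i) (fib_edges P x gs i) a b = fib_map P (seg (OBase P) x gs a b) (seg (OBase P) x gs b (length gs)) i"
  using assms
proof (induction b rule: dec_induct)
  case base
  then show ?case
    using fib_map_Ident[OF seg_top_hom[of a] i] fib_vertex[of a]
    by (simp add: seg_self[OF opcat_category p] seg_self[OF opcat_category fib_path] del: seg.simps vertex_simps)
next
  case (step b)
  have "fib_map P (Comp (OBase P) (gs ! b) (seg (OBase P) x gs a b)) (seg (OBase P) x gs (Suc b) (length gs)) i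
    = Comp (OBase P) (fib_map P (gs ! b) (seg (OBase P) x gs (Suc b) (length gs)) i)
        (fib_map P (seg (OBase P) x gs a b) (Comp (OBase P) (seg (OBase P) x gs (Suc b) (length gs)) (gs ! b)) i)"
    using step by (intro fib_map_Comp[OF seg_hom[OF opcat_category p] path_nth[OF opcat_category p, of b] seg_top_hom i]) simp_all
  moreover have "Comp (OBase P) (seg (OBase P) x gs (Suc b) (length gs)) (gs ! b) = seg (OBase P) x gs b (length gs)"
    using seg_Comp[OF opcat_category p, of b "Suc b" "length gs"] seg_Suc[OF opcat_category p, of b] step by (simp del: seg.simps)
  moreover have "(fib_edges P x gs i) ! b = fib_map P (gs ! b) (seg (OBase P) x gs (Suc b) (length gs)) i"
    using step by (simp add: fib_edges_nth del: seg.simps)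
  ultimately show ?case using step by (simp add: seg.simps(2)[of _ _ _ a b] del: seg.simps)
qed

lemma fib_chain_cells: "fib_chain P gs i \<in> cells (OBase P) (length gs)"
  using fib_path ne unfolding fib_chain_eq by (cases gs) (simp_all add: fib_length)

end

text \<open>Fibres commute with every operator for which just the last vertex of the new chain goes
  to the base, which is what the two conditions on \<open>\<theta>\<close> express. This settles all
  lower faces, and all degeneracies that do not repeat the base, in one stroke.\<close>

lemma fib_chain_pull:
  assumes p: "is_path (OBase P) x gs" and i: "i < fo (Crd P) (vertex (OBase P) x gs (length gs))"
    and \<theta>: "mono \<theta>" "\<theta> (Suc k) = length gs" "\<theta> k < length gs"
  shows "fib_chain P (map (\<lambda>j. seg (OBase P) x gs (\<theta> j) (\<theta> (Suc j))) [0..<Suc k]) i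
    = pull (OBase P) (fib_source P x gs i) (fib_edges P x gs i) k \<theta>"
proof -
  note C = opcat_category
  have ne: "gs \<noteq> []" using \<theta> by auto
  let ?gs = "map (\<lambda>j. seg (OBase P) x gs (\<theta> j) (\<theta> (Suc j))) [0..<Suc k]"
  let ?x = "vertex (OBase P) x gs (\<theta> 0)"
  have t: "\<theta> (Suc k) \<le> length gs" using \<theta> by simp
  note p' = is_path_pull[OF C p \<theta>(1) t]
  have i': "i < fo (Crd P) (vertex (OBase P) ?x ?gs (length ?gs))"
    using i vertex_pull[OF C p \<theta>(1) t, of "Suc k"] \<theta>(2) by (simp del: upt_Suc vertex_simps)
  have b: "\<theta> j < length gs" if "j \<le> k" for j using monoD[OF \<theta>(1) that] \<theta>(3) by simp
  have s: "seg (OBase P) ?x ?gs j (Suc k) = seg (OBase P) x gs (\<theta> j) (length gs)" if "j \<le> Suc k" for j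
    using seg_pull[OF C p \<theta>(1) t, of j "Suc k"] \<theta>(2) that by (simp del: upt_Suc seg.simps)
  have e: "?gs ! a = seg (OBase P) x gs (\<theta> a) (\<theta> (Suc a))" if "a < Suc k" for a
    using that by (simp del: upt_Suc seg.simps)
  have "fib_chain P ?gs i = Chain (fib_source P ?x ?gs i) (fib_edges P ?x ?gs i)"
    by (rule fib_chain_eq[OF p' _ i']) simp
  also have "fib_source P ?x ?gs i = vertex (OBase P) (fib_source P x gs i) (fib_edges P x gs i) (\<theta> 0)"
    using fib_vertex[OF p ne i b[of 0]] s[of 0] by (simp add: fib_source_def del: upt_Suc seg.simps)
  also have "fib_edges P ?x ?gs i = map (\<lambda>j. seg (OBase P) (fib_source P x gs i) (fib_edges P x gs i) (\<theta> j) (\<theta> (Suc j))) [0..<k]"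
    using fib_seg[OF p ne i monoD[OF \<theta>(1)] b] s e
    by (auto simp: fib_edges_def simp del: upt_Suc seg.simps)
  finally show ?thesis by (simp add: pull_def del: upt_Suc seg.simps)
qed

lemma top_face_Chain:
  "gs \<noteq> [] \<Longrightarrow> top_face P (Chain x gs) = map (fib_chain P gs) [0..<fo (Crd P) (vertex (OBase P) x gs (length gs))]"
  by (cases gs rule: rev_cases) (simp_all add: nth_append)

lemma top_face_length: "length (top_face P (Chain x gs)) = fo (Crd P) (vertex (OBase P) x gs (length gs))"
  by (cases gs rule: rev_cases) (simp_all add: nth_append)

lemma top_face_cells:
  assumes "\<sigma> \<in> cells (OBase P) (Suc n)"
  shows "top_face P \<sigma> \<in> lists (cells (OBase P) n)"
  using assms
proof (cases rule: cellsE)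
  case (Chain x gs)
  show ?thesis
  proof (cases "gs = []")
    case True
    then have x: "x \<in> Obj (OBase P)" using Chain by simp
    then have "cpt (OBase P) (fib_obj P (Ident (OBase P) x) i) \<in> pi0 (OBase P)" if "i < fo (Crd P) x" for i
      using that by (intro cpt_pi0 fib_obj_Obj) (simp_all add: category_ops[OF opcat_category])
    then show ?thesis using True Chain by (auto simp: in_lists_conv_set)
  next
    case False
    then show ?thesis
      using fib_chain_cells[OF Chain(3) False] Chain unfolding Chain(1) top_face_Chain[OF False]
      by (auto simp: in_lists_conv_set simp del: vertex_simps)
  qed
qed auto

end

lemma last_arrow_eq: "length gs = Suc m \<Longrightarrow> last_arrow (Chain x gs) = gs ! m"
  by (cases gs rule: rev_cases) (auto simp: nth_append)

section \<open>Compatibility of the top face with faces and degeneracies\<close>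

context
  fixes P :: "('o, 'm) opcat"
  assumes P: "is_opcat P"
begin

lemmas p_C = opcat_category[OF P] and p_lt = opcat_ltcat[OF P]

lemma crd_chosen: "u \<in> chosen (Und P) \<Longrightarrow> fo (Crd P) u = 1"
  using is_ltcat_Lt(3)[OF p_lt] opcat_axioms(1)[OF P] by (auto simp: chosen_def)

lemma cell_face_fib:
  assumes p: "is_path (OBase P) x gs" and l: "length gs = Suc (Suc k)" and j: "j \<le> Suc k"
    and i: "i < fo (Crd P) (vertex (OBase P) x gs (length gs))"
  shows "cell_face (Und P) j (fib_chain P gs i) = pull (OBase P) (fib_source P x gs i) (fib_edges P x gs i) k (face_map j)"
proof -
  have ne: "gs \<noteq> []" using l by auto
  note pf = fib_path[OF P p ne i]
  show ?thesis
    using face_pull[OF p_lt pf mono_ops(1), of k j] j l Chain_pull[OF p_lt pf]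
    by (simp add: fib_chain_eq[OF P p ne i] fib_length)
qed

lemma cell_degen_fib:
  assumes p: "is_path (OBase P) x gs" and l: "length gs = Suc m" and j: "j \<le> m"
    and i: "i < fo (Crd P) (vertex (OBase P) x gs (length gs))"
  shows "cell_degen (Und P) j (fib_chain P gs i) = pull (OBase P) (fib_source P x gs i) (fib_edges P x gs i) (Suc m) (degen_map j)"
proof -
  have ne: "gs \<noteq> []" using l by auto
  note pf = fib_path[OF P p ne i]
  show ?thesis
    using degen_pull[OF p_lt pf mono_ops(1), of m j] j l Chain_pull[OF p_lt pf]
    by (simp add: fib_chain_eq[OF P p ne i] fib_length)
qed

lemma top_face_face:
  assumes s: "\<sigma> \<in> cells (OBase P) (Suc (Suc r))" and j: "j \<le> r"
  shows "map (cell_face (Und P) j) (top_face P \<sigma>) = top_face P (cell_face (Und P) j \<sigma>)"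
proof -
  from s obtain x gs where \<sigma>: "\<sigma> = Chain x gs" and p: "is_path (OBase P) x gs" and l: "length gs = Suc r"
    by (cases rule: cellsE) auto
  have ne: "gs \<noteq> []" using l by auto
  show ?thesis
  proof (cases r)
    case 0
    then obtain g where gs: "gs = [g]" using l by (auto simp: length_Suc_conv)
    have g: "g \<in> hom (OBase P) x (Cod (OBase P) g)" using p by (simp add: gs hom_def)
    then have y: "Cod (OBase P) g \<in> Obj (OBase P)" by (auto simp: hom_def category_ops[OF p_C])
    \<comment> \<open>The fibre map of \<open>g\<close> over the identity is an arrow between the
      two fibres, so they lie in one component.\<close>
    have "cpt (OBase P) (fib_obj P g i) = cpt (OBase P) (fib_obj P (Ident (OBase P) (Cod (OBase P) g)) i)"
      if "i < fo (Crd P) (Cod (OBase P) g)" for i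
      using cpt_hom[OF fib_map_hom[OF P g hom_ident[OF p_C y] that]] g
      by (simp add: hom_def category_ops[OF p_C])
    then show ?thesis using j 0 by (simp add: \<sigma> gs fib_chain_def)
  next
    case (Suc k)
    then have l': "length gs = Suc (Suc k)" using l by simp
    let ?gs = "map (\<lambda>a. seg (OBase P) x gs (face_map j a) (face_map j (Suc a))) [0..<Suc k]"
    let ?x = "vertex (OBase P) x gs (face_map j 0)"
    have t: "face_map j (Suc k) = length gs" "face_map j k < length gs" using l' j Suc by (auto simp: face_map_def)
    then have t': "face_map j (Suc k) \<le> length gs" by simp
    have f: "cell_face (Und P) j \<sigma> = Chain ?x ?gs"
      using face_pull[OF p_lt p mono_ops(1), of "Suc k" j] l' j Suc
      unfolding \<sigma> Chain_pull[OF p_lt p l'] by (simp add: pull_def[of _ _ _ "Suc k" "face_map j"] del: upt_Suc seg.simps)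
    have v: "vertex (OBase P) ?x ?gs (length ?gs) = vertex (OBase P) x gs (length gs)"
      using vertex_pull[OF p_C p mono_face_map t', of "Suc k"] t(1) by (simp del: upt_Suc seg.simps vertex_simps)
    have "cell_face (Und P) j (fib_chain P gs i) = fib_chain P ?gs i"
      if i: "i < fo (Crd P) (vertex (OBase P) x gs (length gs))" for i
      using cell_face_fib[OF p l' _ i, of j] fib_chain_pull[OF P p i mono_face_map t] j Suc by simp
    then have "map (cell_face (Und P) j) (top_face P \<sigma>)
        = map (fib_chain P ?gs) [0..<fo (Crd P) (vertex (OBase P) x gs (length gs))]"
      unfolding \<sigma> top_face_Chain[OF P ne] by simp
    also have "\<dots> = top_face P (Chain ?x ?gs)"
      using top_face_Chain[OF P, of ?gs ?x] v by simp
    finally show ?thesis using f by simp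
  qed
qed

lemma top_face_degen:
  assumes s: "\<sigma> \<in> cells (OBase P) n" and j: "j < n"
  shows "top_face P (cell_degen (Und P) j \<sigma>) = map (cell_degen (Und P) j) (top_face P \<sigma>)"
proof -
  from s j obtain x gs where \<sigma>: "\<sigma> = Chain x gs" and p: "is_path (OBase P) x gs" and n: "n = Suc (length gs)"
    by (cases rule: cellsE) auto
  let ?v = "vertex (OBase P) x gs (length gs)"
  have v: "?v \<in> Obj (OBase P)" using vertex_Obj[OF p_C p, of "length gs"] by simp
  show ?thesis
  proof (cases "j < length gs")
    case True
    then obtain m where l: "length gs = Suc m" by (cases "length gs") auto
    have ne: "gs \<noteq> []" using l by auto
    let ?gs = "map (\<lambda>a. seg (OBase P) x gs (degen_map j a) (degen_map j (Suc a))) [0..<Suc (Suc m)]"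
    let ?x = "vertex (OBase P) x gs (degen_map j 0)"
    have t: "degen_map j (Suc (Suc m)) = length gs" "degen_map j (Suc m) < length gs"
      using l True by (auto simp: degen_map_def)
    then have t': "degen_map j (Suc (Suc m)) \<le> length gs" by simp
    have f: "cell_degen (Und P) j \<sigma> = Chain ?x ?gs"
      using degen_pull[OF p_lt p mono_ops(1), of "Suc m" j] Chain_pull[OF p_lt p l] l True
      by (simp add: \<sigma> pull_def del: upt_Suc seg.simps cell_degen.simps)
    have v: "vertex (OBase P) ?x ?gs (length ?gs) = ?v"
      using vertex_pull[OF p_C p mono_degen_map t', of "Suc (Suc m)"] t(1) by (simp del: upt_Suc seg.simps vertex_simps)
    have "cell_degen (Und P) j (fib_chain P gs i) = fib_chain P ?gs i" if i: "i < fo (Crd P) ?v" for i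
      using cell_degen_fib[OF p l _ i, of j] fib_chain_pull[OF P p i mono_degen_map t] True l by simp
    then have "map (cell_degen (Und P) j) (top_face P \<sigma>) = map (fib_chain P ?gs) [0..<fo (Crd P) ?v]"
      unfolding \<sigma> top_face_Chain[OF P ne] by (simp del: cell_degen.simps)
    also have "\<dots> = top_face P (Chain ?x ?gs)"
      using top_face_Chain[OF P, of ?gs ?x] v by simp
    finally show ?thesis using f by simp
  next
    case False
    \<comment> \<open>Repeating the base lies outside the scope of \<open>fib_chain_pull\<close>. By
      (A2) the fibres of the identity are chosen, so each fibre chain acquires a final
      \<open>tau\<close>: it undergoes its top degeneracy.\<close>
    then have j': "j = length gs" using j n by simp
    define I where "I = Ident (OBase P) ?v"
    have I: "I \<in> hom (OBase P) ?v ?v" unfolding I_def by (rule hom_ident[OF p_C v])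
    have d: "cell_degen (Und P) j \<sigma> = Chain x (gs @ [I])" by (simp add: \<sigma> j' I_def)
    have p': "is_path (OBase P) x (gs @ [I])"
      using cell_degen_cells[OF p_lt s, of j] j unfolding d by simp
    have v': "vertex (OBase P) x (gs @ [I]) (length (gs @ [I])) = ?v" using I by (simp add: hom_def)
    have ch: "fib_obj P I i \<in> chosen (Und P)" if "i < fo (Crd P) ?v" for i
      using opcat_axioms(2)[OF P v that] by (simp add: I_def)
    have "fib_chain P (gs @ [I]) i = cell_degen (Und P) j (if gs = [] then Cpt (cpt (OBase P) (fib_obj P I i)) else fib_chain P gs i)"
      if i: "i < fo (Crd P) ?v" for i
    proof (cases "gs = []")
      case True
      then show ?thesis using ch[OF i] by (simp add: fib_chain_def chosen_iff[OF p_lt])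
    next
      case ne: False
      then obtain m where l: "length gs = Suc m" by (cases gs) auto
      have i': "i < fo (Crd P) (vertex (OBase P) x (gs @ [I]) (length (gs @ [I])))" using i v' by simp
      have s: "seg (OBase P) x (gs @ [I]) a (Suc (length gs)) = seg (OBase P) x gs a (length gs)" if "a \<le> length gs" for a
        using seg_snoc[OF that, of "OBase P" x I] seg_hom[OF p_C p that] by (simp add: I_def hom_def category_ops[OF p_C])
      have sI: "seg (OBase P) x gs (Suc m) (length gs) = I" by (simp add: seg_self[OF p_C p] l I_def del: vertex_simps)
      have "fib_source P x (gs @ [I]) i = fib_source P x gs i" using s[of 0] by (simp add: fib_source_def del: seg.simps)
      moreover have "fib_edges P x (gs @ [I]) i = fib_edges P x gs i @ [tau (Und P) (vertex (OBase P) (fib_source P x gs i) (fib_edges P x gs i) m)]"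
      proof (rule nth_equalityI)
        show "length (fib_edges P x (gs @ [I]) i) = length (fib_edges P x gs i @ [tau (Und P) (vertex (OBase P) (fib_source P x gs i) (fib_edges P x gs i) m)])"
          using l by (simp add: fib_length)
        fix a assume "a < length (fib_edges P x (gs @ [I]) i)"
        then have a: "a \<le> m" using l by (simp add: fib_length)
        have e: "fib_edges P x (gs @ [I]) i ! a = fib_map P (gs ! a) (seg (OBase P) x gs (Suc a) (length gs)) i"
          using fib_edges_nth[of a "gs @ [I]" P x i] a l s[of "Suc a"] by (simp add: nth_append del: seg.simps)
        show "fib_edges P x (gs @ [I]) i ! a = (fib_edges P x gs i @ [tau (Und P) (vertex (OBase P) (fib_source P x gs i) (fib_edges P x gs i) m)]) ! a"
        proof (cases "a < m")
          case True
          then show ?thesis using e l fib_edges_nth[of a gs P x i] by (simp add: nth_append fib_length del: seg.simps)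
        next
          case False
          then have am: "a = m" using a by simp
          have g: "gs ! m \<in> hom (OBase P) (vertex (OBase P) x gs m) ?v"
            using path_nth[OF p_C p, of m] l by (simp del: vertex_simps)
          have sm: "seg (OBase P) x gs m (length gs) = gs ! m" using seg_Suc[OF p_C p, of m] l by (simp del: seg.simps)
          have "fib_map P (gs ! m) I i \<in> hom (OBase P) (fib_obj P (gs ! m) i) (fib_obj P I i)"
            using fib_map_hom[OF P g I i] g by (simp add: I_def hom_def category_ops[OF p_C] del: vertex_simps)
          from tau_unique[OF p_lt this ch[OF i]]
          have "tau (Und P) (vertex (OBase P) (fib_source P x gs i) (fib_edges P x gs i) m) = fib_map P (gs ! m) I i"
            using fib_vertex[OF P p ne i, of m] l sm by (simp del: seg.simps vertex_simps)
          then show ?thesis using e am l sI by (simp add: nth_append fib_length del: seg.simps vertex_simps)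
        qed
      qed
      ultimately show ?thesis
        using l j' ne by (simp add: fib_chain_eq[OF P p' _ i'] fib_chain_eq[OF P p ne i] fib_length)
    qed
    then have "map (fib_chain P (gs @ [I])) [0..<fo (Crd P) ?v]
        = map (\<lambda>i. cell_degen (Und P) j (if gs = [] then Cpt (cpt (OBase P) (fib_obj P I i)) else fib_chain P gs i)) [0..<fo (Crd P) ?v]"
      by (simp del: cell_degen.simps)
    then show ?thesis
      unfolding d using top_face_Chain[OF P, of "gs @ [I]" x] v' top_face_Chain[OF P, of gs x]
      by (cases "gs = []") (simp_all add: \<sigma> I_def comp_def del: cell_degen.simps vertex_simps, simp_all)
  qed
qed

text \<open>Axiom (A4), applied to the source and to every arrow of the chain; (A1) guarantees that
  there is just one fibre over the appended terminal.\<close>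

lemma top_face_degen_top:
  assumes s: "\<sigma> \<in> cells (OBase P) n"
  shows "top_face P (cell_degen (Und P) n \<sigma>) = [\<sigma>]"
  using s
proof (cases rule: cellsE)
  case (Cpt c)
  note L = is_ltcat_Lt[OF p_lt Cpt(3)]
  have "fib_obj P (Ident (OBase P) (Lt (Und P) c)) 0 = Lt (Und P) c"
    using opcat_axioms(5)[OF P L(1)] tau_chosen[OF p_lt L(4)] by simp
  then show ?thesis using Cpt L crd_chosen[OF L(4)] by simp
next
  case (Chain x gs)
  let ?v = "vertex (OBase P) x gs (length gs)"
  define T where "T = tau (Und P) ?v"
  note p = Chain(3)
  have v: "?v \<in> Obj (OBase P)" using vertex_Obj[OF p_C p, of "length gs"] by simp
  have T: "T \<in> hom (OBase P) ?v (Lt (Und P) (cpt (OBase P) ?v))" unfolding T_def by (rule tau_hom[OF p_lt v])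
  have ch: "Lt (Und P) (cpt (OBase P) ?v) \<in> chosen (Und P)" by (rule is_ltcat_Lt(4)[OF p_lt cpt_pi0[OF v]])
  have p': "is_path (OBase P) x (gs @ [T])" unfolding T_def by (rule is_path_tau[OF p_lt p])
  have v': "vertex (OBase P) x (gs @ [T]) (length (gs @ [T])) = Lt (Und P) (cpt (OBase P) ?v)" using T by (simp add: hom_def)
  have one: "fo (Crd P) (vertex (OBase P) x (gs @ [T]) (length (gs @ [T]))) = 1" unfolding v' by (rule crd_chosen[OF ch])
  \<comment> \<open>Each composite into the appended chosen terminal is the \<open>tau\<close> of
    its source, which brings the fibres into the form of (A4).\<close>
  have s: "seg (OBase P) x (gs @ [T]) a (Suc (length gs)) = tau (Und P) (vertex (OBase P) x gs a)" if "a \<le> length gs" for a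
    using tau_unique[OF p_lt hom_comp[OF p_C seg_hom[OF p_C p that order_refl] T] ch] seg_snoc[OF that, of "OBase P" x T] by simp
  have i: "0 < fo (Crd P) (vertex (OBase P) x (gs @ [T]) (length (gs @ [T])))" using one by simp
  have "fib_source P x (gs @ [T]) 0 = x"
    using s[of 0] opcat_axioms(5)[OF P, of x] p is_path_iff[OF p_C, of x gs] by (simp add: fib_source_def del: seg.simps)
  moreover have "fib_edges P x (gs @ [T]) 0 = gs"
  proof (rule nth_equalityI)
    fix a assume "a < length (fib_edges P x (gs @ [T]) 0)"
    then have a: "a < length gs" by (simp add: fib_length)
    then show "fib_edges P x (gs @ [T]) 0 ! a = gs ! a"
      using fib_edges_nth[of a "gs @ [T]" P x 0] s[of "Suc a"] opcat_axioms(6)[OF P, of "gs ! a"] path_nth[OF p_C p a]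
      by (simp add: nth_append hom_def del: seg.simps)
  qed (simp add: fib_length)
  ultimately have "fib_chain P (gs @ [T]) 0 = \<sigma>"
    using fib_chain_eq[OF P p' _ i] Chain by simp
  then show ?thesis
    using top_face_Chain[OF P, of "gs @ [T]" x] one Chain by (simp add: T_def del: vertex_simps)
qed

lemma top_simplicial_opcat: "top_simplicial (Und P) (top_face P)"
  unfolding top_simplicial_def using top_face_face top_face_degen top_face_degen_top by simp

text \<open>The fibre chain over \<open>i\<close> ends in the fibre of the last arrow, whose
  cardinality is given by the object part of (A3).\<close>

lemma lens_top_face:
  assumes p: "is_path (OBase P) x gs" and l: "length gs = Suc m"
  shows "lens (top_face P) (top_face P (Chain x gs)) = fibs (fa (Crd P) (gs ! m))"
proof -
  have ne: "gs \<noteq> []" using l by auto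
  have g: "gs ! m \<in> hom (OBase P) (vertex (OBase P) x gs m) (vertex (OBase P) x gs (length gs))"
    using path_nth[OF p_C p, of m] l by (simp del: vertex_simps)
  have sm: "seg (OBase P) x gs m (length gs) = gs ! m" using seg_Suc[OF p_C p, of m] l by (simp del: seg.simps)
  have c: "Cod FinOrd (fa (Crd P) (gs ! m)) = fo (Crd P) (vertex (OBase P) x gs (length gs))"
    using crd_Arr(3)[OF P, of "gs ! m"] g by (simp add: hom_def)
  have "length (top_face P (fib_chain P gs i)) = fin_fib (fa (Crd P) (gs ! m)) i"
    if i: "i < fo (Crd P) (vertex (OBase P) x gs (length gs))" for i
    using fib_vertex[OF P p ne i, of m] opcat_axioms(3)[OF P, of "gs ! m" i] g i l sm
    unfolding fib_chain_eq[OF P p ne i] top_face_length[OF P]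
    by (simp add: fib_length hom_def del: seg.simps vertex_simps)
  then show ?thesis unfolding top_face_Chain[OF P ne] fibs_def c by simp
qed

end

definition opd_beta :: "('o, 'm) opcat \<Rightarrow> nat \<Rightarrow> ('o, 'm) cell \<Rightarrow> nat \<Rightarrow> nat" where
  "opd_beta P r \<sigma> = fin_pi (fa (Crd P) (last_arrow \<sigma>))"

lemma is_path_butlast: "category C \<Longrightarrow> is_path C x fs \<Longrightarrow> is_path C x (butlast fs)"
  by (induction fs arbitrary: x) (auto simp: category_ops)

section \<open>Iterated top faces and coherence in the operadic nerve\<close>

context
  fixes P :: "('o, 'm) opcat"
  assumes P: "is_opcat P"
begin

lemmas q_C = opcat_category[OF P] and q_lt = opcat_ltcat[OF P]

text \<open>Axiom (A5) used along an entire chain: its object part for the source, its morphism part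
  for every edge.\<close>

lemma top_face_fib_chain:
  assumes p: "is_path (OBase P) x gs" and l: "length gs = Suc m"
    and i: "i < fo (Crd P) (vertex (OBase P) x gs (length gs))" and b: "b < fin_fib (fa (Crd P) (gs ! m)) i"
  shows "top_face P (fib_chain P gs i) ! b = top_face P (Chain x (butlast gs)) ! fin_eps (fa (Crd P) (gs ! m)) i b"
proof -
  define g where "g = gs ! m"
  define e where "e = fin_eps (fa (Crd P) g) i b"
  have ne: "gs \<noteq> []" using l by auto
  have g: "g \<in> hom (OBase P) (vertex (OBase P) x gs m) (vertex (OBase P) x gs (length gs))"
    using path_nth[OF q_C p, of m] l by (simp add: g_def del: vertex_simps)
  have sm: "seg (OBase P) x gs m (Suc m) = g" using seg_Suc[OF q_C p, of m] l by (simp add: g_def del: seg.simps)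
  have i': "i < fo (Crd P) (Cod (OBase P) g)" using i g by (simp add: hom_def)
  have b': "b < fin_fib (fa (Crd P) g) i" using b by (simp add: g_def)
  have e: "e < fo (Crd P) (vertex (OBase P) x gs m)"
    using fin_eps_mem(1)[OF b'] crd_Arr[OF P, of g] g by (simp add: e_def hom_def)
  have fo: "fo (Crd P) (fib_obj P g i) = fin_fib (fa (Crd P) g) i"
    using opcat_axioms(3)[OF P _ i'] g by (simp add: hom_def)
  have gs: "gs = butlast gs @ [g]" using l by (cases gs rule: rev_cases) (auto simp: g_def nth_append)
  note p' = is_path_butlast[OF q_C p]
  have lb: "length (butlast gs) = m" using l by simp
  have sb: "seg (OBase P) x (butlast gs) a m = seg (OBase P) x gs a m" if "a \<le> m" for a
    using seg_append[of m "butlast gs" a "OBase P" x "[g]"] that lb gs by (simp del: seg.simps)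
  have vb: "vertex (OBase P) x (butlast gs) m = vertex (OBase P) x gs m"
    using vertex_append[of m "butlast gs" "OBase P" x "[g]"] lb gs by (simp del: vertex_simps)
  have sC: "seg (OBase P) x gs a (Suc m) = Comp (OBase P) g (seg (OBase P) x gs a m)" if "a \<le> m" for a
    using seg_Comp[OF q_C p that, of "Suc m"] l sm by (simp del: seg.simps)
  have sh: "seg (OBase P) x gs a m \<in> hom (OBase P) (vertex (OBase P) x gs a) (vertex (OBase P) x gs m)" if "a \<le> m" for a
    using seg_hom[OF q_C p that] l by (simp del: seg.simps vertex_simps)
  show ?thesis
  proof (cases m)
    case 0
    then have gs0: "gs = [g]" using l by (auto simp: length_Suc_conv g_def)
    have gx: "g \<in> hom (OBase P) x (Cod (OBase P) g)" using g by (simp add: gs0 hom_def 0)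
    have x: "x \<in> Obj (OBase P)" using gx by (auto simp: hom_def category_ops[OF q_C])
    \<comment> \<open>Here the entries are components of fibres of identities. (A5) for the identity
      of \<open>x\<close> followed by \<open>g\<close> relates them, since the fibre map of an
      identity is again an identity.\<close>
    have "fib_obj P (Ident (OBase P) (fib_obj P g i)) b = fib_obj P (Ident (OBase P) x) e"
      using opcat_axioms(7)[OF P composable_hom[OF hom_ident[OF q_C x] gx] i' b']
      unfolding e_def fib_map_Ident[OF P gx i'] .
    moreover have "fib_chain P gs i = Chain (fib_obj P g i) []" by (simp add: gs0 fib_chain_def)
    ultimately show ?thesis using b' fo e by (simp add: gs0 0 e_def[symmetric] g_def[symmetric])
  next
    case (Suc k)
    let ?w = "fib_source P x gs i" and ?es = "fib_edges P x gs i"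
    have le: "length ?es = m" using l by (simp add: fib_length)
    have ne': "?es \<noteq> []" "butlast gs \<noteq> []" using le lb Suc by (metis length_0_conv nat.distinct(1))+
    note pe = fib_path[OF P p ne i]
    have vm: "vertex (OBase P) ?w ?es m = fib_obj P g i"
      using fib_vertex[OF P p ne i, of m] l sm by (simp del: seg.simps vertex_simps)
    have bb: "b < fo (Crd P) (vertex (OBase P) ?w ?es (length ?es))" using b' fo le vm by simp
    have ee: "e < fo (Crd P) (vertex (OBase P) x (butlast gs) (length (butlast gs)))" using e lb vb by simp
    have fs: "seg (OBase P) ?w ?es a m = fib_map P (seg (OBase P) x gs a m) g i" if "a \<le> m" for a
      using fib_seg[OF P p ne i that] l sm by (simp del: seg.simps)
    have "fib_chain P ?es b = fib_chain P (butlast gs) e"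
      unfolding fib_chain_eq[OF P pe ne'(1) bb] fib_chain_eq[OF P p' ne'(2) ee] cell.inject
    proof
      show "fib_source P ?w ?es b = fib_source P x (butlast gs) e"
        using fs[of 0] sb[of 0] opcat_axioms(7)[OF P composable_hom[OF sh[of 0] g] i' b'] l
        by (simp add: fib_source_def le lb e_def del: seg.simps)
      show "fib_edges P ?w ?es b = fib_edges P x (butlast gs) e"
      proof (rule nth_equalityI)
        fix a assume "a < length (fib_edges P ?w ?es b)"
        then have a: "Suc a < m" using l by (simp add: fib_length)
        have ga: "gs ! a \<in> hom (OBase P) (vertex (OBase P) x gs a) (vertex (OBase P) x gs (Suc a))"
          using path_nth[OF q_C p, of a] a l by (simp del: vertex_simps)
        have "fib_edges P ?w ?es b ! a = fib_map P (fib_map P (gs ! a) (Comp (OBase P) g (seg (OBase P) x gs (Suc a) m)) i)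
            (fib_map P (seg (OBase P) x gs (Suc a) m) g i) b"
          using a l le fs[of "Suc a"] sC[of "Suc a"]
          by (simp add: fib_edges_nth fib_length del: seg.simps)
        also have "\<dots> = fib_map P (gs ! a) (seg (OBase P) x gs (Suc a) m) e"
          using opcat_axioms(8)[OF P composable_hom[OF sh[of "Suc a"] g] i' b' composable_hom[OF ga sh[of "Suc a"]]] a
          by (simp add: e_def del: seg.simps)
        also have "\<dots> = fib_edges P x (butlast gs) e ! a"
          using a lb sb[of "Suc a"] by (simp add: fib_edges_nth nth_butlast del: seg.simps)
        finally show "fib_edges P ?w ?es b ! a = fib_edges P x (butlast gs) e ! a" .
      qed (simp add: fib_length)
    qed
    moreover have "top_face P (fib_chain P gs i) ! b = fib_chain P ?es b"
      using bb unfolding fib_chain_eq[OF P p ne i] top_face_Chain[OF P ne'(1)] by (simp del: vertex_simps)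
    moreover have "top_face P (Chain x (butlast gs)) ! e = fib_chain P (butlast gs) e"
      using ee unfolding top_face_Chain[OF P ne'(2)] by (simp del: vertex_simps)
    ultimately show ?thesis by (simp add: e_def g_def)
  qed
qed

lemma last_crd:
  assumes p: "is_path (OBase P) x gs" and l: "length gs = Suc m"
  shows "fa (Crd P) (gs ! m) \<in> Arr FinOrd" "Dom FinOrd (fa (Crd P) (gs ! m)) = fo (Crd P) (vertex (OBase P) x gs m)"
    "Cod FinOrd (fa (Crd P) (gs ! m)) = fo (Crd P) (vertex (OBase P) x gs (length gs))"
  using path_nth[OF q_C p, of m] l crd_Arr[OF P, of "gs ! m"] by (simp_all add: hom_def)

text \<open>\<open>top_face_fib_chain\<close> supplies equal entries, and \<open>fin_pi\<close>
  carries the index \<open>fin_eps\<close> of the one list to the flattened index of the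
  other.\<close>

lemma top_face_Arr:
  assumes s: "\<sigma> \<in> cells (OBase P) (Suc (Suc r))"
  shows "(top_face P (cell_face (Und P) (Suc r) \<sigma>), opd_beta P r \<sigma>, concat (map (top_face P) (top_face P \<sigma>)))
    \<in> Arr (perm_cat (cells (OBase P) r))"
proof -
  from s obtain x gs where \<sigma>: "\<sigma> = Chain x gs" and p: "is_path (OBase P) x gs" and l: "length gs = Suc r"
    by (cases rule: cellsE) auto
  let ?g = "fa (Crd P) (gs ! r)"
  note G = last_crd[OF p l]
  have ne: "gs \<noteq> []" using l by auto
  have f: "cell_face (Und P) (Suc r) \<sigma> = Chain x (butlast gs)" using l by (auto simp: \<sigma>)
  have vb: "vertex (OBase P) x (butlast gs) r = vertex (OBase P) x gs r"
    using l by (cases r) (simp_all add: nth_butlast)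
  have "cell_face (Und P) (Suc r) \<sigma> \<in> cells (OBase P) (Suc r)" using cell_face_cells[OF q_lt s, of "Suc r"] by simp
  from top_face_cells[OF P this] have xs: "top_face P (cell_face (Und P) (Suc r) \<sigma>) \<in> lists (cells (OBase P) r)" .
  have ys: "concat (map (top_face P) (top_face P \<sigma>)) \<in> lists (cells (OBase P) r)"
    using top_face_cells[OF P] top_face_cells[OF P s] by (intro concat_map_lists) auto
  have lx: "length (top_face P (cell_face (Und P) (Suc r) \<sigma>)) = Dom FinOrd ?g"
    using top_face_length[OF P, of x "butlast gs"] l vb by (simp add: f G del: vertex_simps)
  have lens: "lens (top_face P) (top_face P \<sigma>) = fibs ?g" using lens_top_face[OF P p l] by (simp add: \<sigma>)
  have ly: "length (concat (map (top_face P) (top_face P \<sigma>))) = Dom FinOrd ?g"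
    using sum_fibs[OF G(1)] lens by (simp add: length_concat comp_def)
  have b: "opd_beta P r \<sigma> = fin_pi ?g" using last_arrow_eq[OF l, of x] by (simp add: opd_beta_def \<sigma>)
  have "top_face P (cell_face (Und P) (Suc r) \<sigma>) ! j = concat (map (top_face P) (top_face P \<sigma>)) ! fin_pi ?g j"
    if j: "j < Dom FinOrd ?g" for j
  proof -
    obtain i a where i: "i < Cod FinOrd ?g" "a < fin_fib ?g i" "j = fin_eps ?g i a"
      using FinOrd_cases[OF G(1) j] by metis
    have t: "i < length (top_face P \<sigma>)" "top_face P \<sigma> ! i = fib_chain P gs i"
      using i(1) unfolding \<sigma> top_face_Chain[OF P ne] G(3) by simp_all
    have "a < length (top_face P (top_face P \<sigma> ! i))"
      using arg_cong[OF lens, of "\<lambda>xs. xs ! i"] i t by simp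
    then have "concat (map (top_face P) (top_face P \<sigma>)) ! pos (fibs ?g) i a = top_face P (fib_chain P gs i) ! a"
      using nth_concat_pos[of i "map (top_face P) (top_face P \<sigma>)" a] t lens by (simp add: comp_def)
    then show ?thesis
      using top_face_fib_chain[OF p l _ i(2)] i(1) fin_pi(3)[OF G(1) i(1,2)] G(3) by (simp add: i(3) f)
  qed
  then show ?thesis
    using xs ys lx ly fin_pi(1)[OF G(1)] by (simp add: perm_cat_Arr b)
qed

lemma top_typed_opcat: "top_typed (Und P) (top_face P) (opd_beta P)"
  unfolding top_typed_def using top_face_cells[OF P] top_face_Arr by simp

lemma last_arrow_face:
  assumes p: "is_path (OBase P) x gs" and l: "length gs = Suc m" and i: "i < m"
  shows "last_arrow (cell_face (Und P) i (Chain x gs)) = gs ! m"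
proof -
  obtain k where k: "m = Suc k" using i by (cases m) auto
  have "gs \<noteq> []" using l by auto
  then show ?thesis
    using cell_face_Chain[OF q_C p refl, of i] l i k seg_Suc[OF q_C p, of m]
    by (simp add: pull_def face_map_def del: seg.simps cell_face.simps)
qed

lemma last_arrow_degen:
  assumes p: "is_path (OBase P) x gs" and l: "length gs = Suc m" and i: "i \<le> m"
  shows "last_arrow (cell_degen (Und P) i (Chain x gs)) = gs ! m"
  using cell_degen_Chain[OF q_C p refl, of i] l i seg_Suc[OF q_C p, of m]
  by (simp add: pull_def degen_map_def del: seg.simps cell_degen.simps)

text \<open>There is a single fibre, the whole source in its own order. This gives law (c), because
  the arrow appended by the top degeneracy ends in an object of cardinality one.\<close>

lemma fin_pi_constant:
  assumes g: "g \<in> Arr FinOrd" and c: "Cod FinOrd g = 1"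
  shows "fin_pi g = (\<lambda>i. i)"
proof (rule fin_pi_unique[OF g permutes_ident])
  fix i a assume i: "i < Cod FinOrd g" "a < fin_fib g i"
  have "(\<lambda>a. a) ` {..<Dom FinOrd g} = fin_preimage g 0"
    using FinOrd_mor[OF g] c by (auto simp: fin_preimage_def)
  then have "fin_fib g 0 = Dom FinOrd g" "\<And>a. a < Dom FinOrd g \<Longrightarrow> fin_eps g 0 a = a"
    using fin_eps_unique[of "Dom FinOrd g" "\<lambda>a. a" g 0] by auto
  then show "fin_eps g i a = pos (fibs g) i a" using i c by (simp add: pos_def)
qed

text \<open>This is \<open>fin_cocycle\<close> for the cardinalities of the last two arrows. The
  work lies in identifying the block sizes, where the morphism part of (A3) enters.\<close>

lemma opd_beta_cocycle:
  assumes s: "\<sigma> \<in> cells (OBase P) (Suc (Suc (Suc r)))"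
  shows "blk_perm (lens (top_face P) (top_face P (cell_face (Und P) (Suc (Suc r)) \<sigma>)))
      (lens (top_face P) (concat (map (top_face P) (top_face P \<sigma>)))) (opd_beta P (Suc r) \<sigma>) (\<lambda>_ i. i)
      \<circ> opd_beta P r (cell_face (Und P) (Suc (Suc r)) \<sigma>)
    = blk_perm (lens (\<lambda>p. top_face P (cell_face (Und P) (Suc r) p)) (top_face P \<sigma>))
        (lens (\<lambda>p. concat (map (top_face P) (top_face P p))) (top_face P \<sigma>))
        (\<lambda>i. i) (\<lambda>b. opd_beta P r (top_face P \<sigma> ! b))
      \<circ> opd_beta P r (cell_face (Und P) (Suc r) \<sigma>)"
proof -
  from s obtain x gs where \<sigma>: "\<sigma> = Chain x gs" and p: "is_path (OBase P) x gs" and l: "length gs = Suc (Suc r)"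
    by (cases rule: cellsE) auto
  let ?t = "top_face P"
  define f g where "f = gs ! r" and "g = gs ! Suc r"
  let ?f = "fa (Crd P) f" and ?g = "fa (Crd P) g"
  have f: "f \<in> hom (OBase P) (vertex (OBase P) x gs r) (vertex (OBase P) x gs (Suc r))"
    and g: "g \<in> hom (OBase P) (vertex (OBase P) x gs (Suc r)) (vertex (OBase P) x gs (length gs))"
    using path_nth[OF q_C p, of r] path_nth[OF q_C p, of "Suc r"] l
    by (simp_all add: f_def g_def del: vertex_simps)
  have A: "?f \<in> Arr FinOrd" "?g \<in> Arr FinOrd" "Dom FinOrd ?g = Cod FinOrd ?f"
    and gf: "fa (Crd P) (Comp (OBase P) g f) = Comp FinOrd ?g ?f"
    and n: "Cod FinOrd ?g = fo (Crd P) (vertex (OBase P) x gs (length gs))"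
    using f g is_fctr_ops[OF opcat_Crd[OF P]] by (simp_all add: hom_def)
  have ne: "gs \<noteq> []" using l by auto
  note p' = is_path_butlast[OF q_C p]
  have lb: "length (butlast gs) = Suc r" using l by simp
  have fb: "butlast gs ! r = f" using l by (simp add: f_def nth_butlast)
  have t: "?t \<sigma> = map (fib_chain P gs) [0..<Cod FinOrd ?g]" unfolding \<sigma> top_face_Chain[OF P ne] n ..
  have d2: "cell_face (Und P) (Suc (Suc r)) \<sigma> = Chain x (butlast gs)" using l by (auto simp: \<sigma>)
  have d1: "last_arrow (cell_face (Und P) (Suc r) \<sigma>) = Comp (OBase P) g f"
    using l ne by (simp add: \<sigma> f_def g_def)
  define nss where "nss = map (\<lambda>i. fibs (fin_fibmap ?f ?g i)) [0..<Cod FinOrd ?g]"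
  have sg: "seg (OBase P) x gs (Suc r) (length gs) = g" using seg_Suc[OF q_C p, of "Suc r"] l by (simp add: g_def del: seg.simps)
  have chain: "fib_chain P gs i \<in> cells (OBase P) (Suc (Suc r))" "last_arrow (fib_chain P gs i) = fib_map P f g i"
    "lens ?t (?t (fib_chain P gs i)) = fibs (fin_fibmap ?f ?g i)" "fa (Crd P) (fib_map P f g i) = fin_fibmap ?f ?g i"
    if i: "i < Cod FinOrd ?g" for i
  proof -
    have i': "i < fo (Crd P) (vertex (OBase P) x gs (length gs))" using i n by simp
    have le: "length (fib_edges P x gs i) = Suc r" using l by (simp add: fib_length)
    show "fib_chain P gs i \<in> cells (OBase P) (Suc (Suc r))" using fib_chain_cells[OF P p ne i'] l by simp
    have e: "fib_edges P x gs i ! r = fib_map P f g i" using fib_edges_nth[of r gs P x i] l sg by (simp add: f_def)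
    then show "last_arrow (fib_chain P gs i) = fib_map P f g i"
      unfolding fib_chain_eq[OF P p ne i'] last_arrow_eq[OF le] by simp
    have "i < fo (Crd P) (Cod (OBase P) g)" using i' g by (simp add: hom_def)
    then show c: "fa (Crd P) (fib_map P f g i) = fin_fibmap ?f ?g i"
      using opcat_axioms(4)[OF P composable_hom[OF f g]] by simp
    show "lens ?t (?t (fib_chain P gs i)) = fibs (fin_fibmap ?f ?g i)"
      unfolding fib_chain_eq[OF P p ne i'] lens_top_face[OF P fib_path[OF P p ne i'] le] e c ..
  qed
  have L1: "lens ?t (?t (cell_face (Und P) (Suc (Suc r)) \<sigma>)) = fibs ?f"
    unfolding d2 lens_top_face[OF P p' lb] fb ..
  have "map (\<lambda>i. lens ?t (?t (fib_chain P gs i))) [0..<Cod FinOrd ?g] = nss"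
    unfolding nss_def using chain(3) by (intro map_cong) auto
  then have L2: "lens ?t (concat (map ?t (?t \<sigma>))) = concat nss"
    by (simp add: t map_concat comp_def del: map_eq_conv)
  have L4: "lens (\<lambda>p. concat (map ?t (?t p))) (?t \<sigma>) = map sum_list nss"
    using chain(3) by (simp add: t nss_def length_concat comp_def)
  have L3: "lens (\<lambda>p. ?t (cell_face (Und P) (Suc r) p)) (?t \<sigma>) = lens (\<lambda>p. concat (map ?t (?t p))) (?t \<sigma>)"
  proof (rule map_cong[OF refl])
    fix q assume "q \<in> set (?t \<sigma>)"
    then have "q \<in> cells (OBase P) (Suc (Suc r))" using chain(1) by (auto simp: t)
    from top_face_Arr[OF this] show "length (?t (cell_face (Und P) (Suc r) q)) = length (concat (map ?t (?t q)))"
      by (simp add: perm_cat_Arr)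
  qed
  have L5: "map sum_list nss = fibs (Comp FinOrd ?g ?f)"
  proof -
    have "sum_list (fibs (fin_fibmap ?f ?g i)) = fin_fib (Comp FinOrd ?g ?f) i" for i
      using sum_fibs[OF fin_fibmap(1)[OF A]] fin_fibmap(2)[OF A] by simp
    then show ?thesis using category_ops(8)[OF category_FinOrd A(2,1,3)] by (simp add: nss_def fibs_def[of "Comp FinOrd ?g ?f"] comp_def)
  qed
  have B: "opd_beta P (Suc r) \<sigma> = fin_pi ?g" "opd_beta P r (cell_face (Und P) (Suc (Suc r)) \<sigma>) = fin_pi ?f"
    "opd_beta P r (cell_face (Und P) (Suc r) \<sigma>) = fin_pi (Comp FinOrd ?g ?f)"
    using last_arrow_eq[OF l, of x] last_arrow_eq[OF lb, of x] fb gf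
    by (simp_all add: opd_beta_def \<sigma> d2[unfolded \<sigma>] d1[unfolded \<sigma>] g_def del: cell_face.simps last_arrow.simps)
  have "blk_perm (fibs (Comp FinOrd ?g ?f)) (map sum_list nss) (\<lambda>i. i) (\<lambda>b. opd_beta P r (?t \<sigma> ! b))
      = blk_perm (fibs (Comp FinOrd ?g ?f)) (map sum_list nss) (\<lambda>i. i) (\<lambda>i. fin_pi (fin_fibmap ?f ?g i))"
    using category_ops(8)[OF category_FinOrd A(2,1,3)] chain(2,4)
    by (intro blk_perm_cong) (simp_all add: t opd_beta_def)
  then show ?thesis
    unfolding L1 L2 L3 L4 B using fin_cocycle[OF A nss_def] L5 by simp
qed

lemma top_coherent_opcat: "top_coherent (Und P) (top_face P) (opd_beta P)"
  unfolding top_coherent_def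
proof (intro conjI allI ballI impI)
  show "blk_perm (lens (top_face P) (top_face P (cell_face (Und P) (r + 2) \<sigma>)))
      (lens (top_face P) (concat (map (top_face P) (top_face P \<sigma>)))) (opd_beta P (r + 1) \<sigma>) (\<lambda>_ i. i)
      \<circ> opd_beta P r (cell_face (Und P) (r + 2) \<sigma>)
    = blk_perm (lens (\<lambda>p. top_face P (cell_face (Und P) (r + 1) p)) (top_face P \<sigma>))
        (lens (\<lambda>p. concat (map (top_face P) (top_face P p))) (top_face P \<sigma>))
        (\<lambda>i. i) (\<lambda>b. opd_beta P r (top_face P \<sigma> ! b))
      \<circ> opd_beta P r (cell_face (Und P) (r + 1) \<sigma>)" if "\<sigma> \<in> cells (OBase P) (r + 3)" for r \<sigma>
    using opd_beta_cocycle[of \<sigma> r] that by (simp add: numeral_3_eq_3)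
  show "opd_beta P (r + 1) \<sigma> = opd_beta P r (cell_face (Und P) i \<sigma>)" if "i \<le> r" "\<sigma> \<in> cells (OBase P) (r + 3)" for r i \<sigma>
    using that(2)
  proof (cases rule: cellsE)
    case (Chain x gs)
    then have "length gs = Suc (Suc r)" by simp
    then show ?thesis
      using last_arrow_face[OF Chain(3), of "Suc r" i] last_arrow_eq[of gs "Suc r" x] that(1)
      by (simp add: Chain(1) opd_beta_def del: cell_face.simps last_arrow.simps)
  qed simp
  show "opd_beta P r (cell_degen (Und P) (r + 1) \<sigma>) = (\<lambda>i. i)" if "\<sigma> \<in> cells (OBase P) (r + 1)" for r \<sigma>
    using that
  proof (cases rule: cellsE)
    case (Chain x gs)
    have v: "vertex (OBase P) x gs (length gs) \<in> Obj (OBase P)" using vertex_Obj[OF q_C Chain(3), of "length gs"] by simp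
    have "fa (Crd P) (tau (Und P) (vertex (OBase P) x gs (length gs))) \<in> Arr FinOrd"
      "Cod FinOrd (fa (Crd P) (tau (Und P) (vertex (OBase P) x gs (length gs)))) = 1"
      using crd_Arr[OF P, of "tau (Und P) (vertex (OBase P) x gs (length gs))"] tau_hom[OF q_lt v]
        crd_chosen[OF P is_ltcat_Lt(4)[OF q_lt cpt_pi0[OF v]]] by (simp_all add: hom_def)
    then show ?thesis using fin_pi_constant Chain by (simp add: opd_beta_def)
  qed simp
  show "opd_beta P (r + 1) (cell_degen (Und P) i \<sigma>) = opd_beta P r \<sigma>" if "i \<le> r" "\<sigma> \<in> cells (OBase P) (r + 2)" for r i \<sigma>
    using that(2)
  proof (cases rule: cellsE)
    case (Chain x gs)
    then have "length gs = Suc r" by simp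
    then show ?thesis
      using last_arrow_degen[OF Chain(3), of r i] last_arrow_eq[of gs r x] that(1)
      by (simp add: Chain(1) opd_beta_def del: cell_degen.simps last_arrow.simps)
  qed simp
qed

lemma is_topps_opcat: "is_topps (top_ps (Und P) (top_face P) (opd_beta P))"
  using is_topps_top_ps[OF q_lt top_typed_opcat] top_simplicial_opcat[OF P] top_coherent_opcat by simp

lemma shuffle_opcat: "shuffle (top_ps (Und P) (top_face P) (opd_beta P))"
  unfolding shuffle_top_ps[OF q_lt top_typed_opcat]
proof (intro allI ballI impI)
  fix r \<sigma> i assume "\<sigma> \<in> cells (OBase P) (r + 2)" and i: "i < length (top_face P \<sigma>)"
  then obtain x gs where \<sigma>: "\<sigma> = Chain x gs" and p: "is_path (OBase P) x gs" and l: "length gs = Suc r"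
    by (cases \<sigma>) auto
  have "i < Cod FinOrd (fa (Crd P) (gs ! r))"
    using i top_face_length[OF P, of x gs] last_crd(3)[OF p l] by (simp add: \<sigma>)
  then show "mono_on {pos (lens (top_face P) (top_face P \<sigma>)) i 0..<pos (lens (top_face P) (top_face P \<sigma>)) (Suc i) 0}
      (inv (opd_beta P r \<sigma>))"
    using fin_pi_mono_on[OF last_crd(1)[OF p l]] last_arrow_eq[OF l, of x]
    by (simp add: \<sigma> lens_top_face[OF P p l] opd_beta_def del: last_arrow.simps top_face.simps)
qed

text \<open>Removes the two definite descriptions from the nerve: \<open>free_ext\<close> equals the
  explicit extension, and the 2-cells are the unique transformations with the prescribed
  permutations.\<close>

lemma nopd_obj_eq: "nopd_obj P = top_ps (Und P) (top_face P) (opd_beta P)"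
proof -
  let ?X = "top_ps (Und P) (top_face P) (opd_beta P)"
  note T = top_typed_opcat
  have d: "nopd_d P n i = PD ?X n i" for n i
    using free_ext_SS[OF t_mem[OF q_lt T, of "n - 1"]]
    by (cases n) (auto simp: nopd_d_def top_ps_def nopd_lev_def ext_arr_def)
  have b: "nopd_beta P r = PB ?X r" for r
    unfolding nopd_beta_def
  proof (rule the_equality)
    have m: "mon_trans (nopd_lev P (r + 2)) (nopd_lev P r)
           (mor (Comp SMGp (nopd_d P (r + 1) (r + 1)) (nopd_d P (r + 2) (r + 1))))
           (mor (Comp SMGp (nopd_d P (r + 1) (r + 1)) (nopd_d P (r + 2) (r + 2)))) (PB ?X r)"
      using TX_mon_trans[OF q_lt T, of r] unfolding d by (simp add: nopd_lev_def TX_PLev[OF q_lt T])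
    moreover have gen: "mor (PB ?X r [\<sigma>]) = fin_pi (fa (Crd P) (last_arrow \<sigma>))" if "\<sigma> \<in> cells (OBase P) (r + 2)" for \<sigma>
      using TX_PB_generator[OF q_lt T, of \<sigma> r] that by (simp add: opd_beta_def)
    ultimately show "mon_trans (nopd_lev P (r + 2)) (nopd_lev P r)
           (mor (Comp SMGp (nopd_d P (r + 1) (r + 1)) (nopd_d P (r + 2) (r + 1))))
           (mor (Comp SMGp (nopd_d P (r + 1) (r + 1)) (nopd_d P (r + 2) (r + 2)))) (PB ?X r) \<and>
        (\<forall>\<sigma> \<in> cells (OBase P) (r + 2). mor (PB ?X r [\<sigma>]) = fin_pi (fa (Crd P) (last_arrow \<sigma>)))" by blast
    fix b
    assume b: "mon_trans (nopd_lev P (r + 2)) (nopd_lev P r)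
           (mor (Comp SMGp (nopd_d P (r + 1) (r + 1)) (nopd_d P (r + 2) (r + 1))))
           (mor (Comp SMGp (nopd_d P (r + 1) (r + 1)) (nopd_d P (r + 2) (r + 2)))) b \<and>
        (\<forall>\<sigma> \<in> cells (OBase P) (r + 2). mor (b [\<sigma>]) = fin_pi (fa (Crd P) (last_arrow \<sigma>)))"
    show "b = PB ?X r"
    proof (rule mon_trans_eq_on_generators[OF conjunct1[OF b, unfolded nopd_lev_def] m[unfolded nopd_lev_def]])
      fix \<sigma> assume s: "\<sigma> \<in> cells (OBase P) (r + 2)"
      \<comment> \<open>An arrow of a free groupoid is fixed by its end points and its permutation,
        so prescribing the permutations on generators leaves no freedom.\<close>
      have "u = v" if "u \<in> hom (perm_cat A) xs ys" "v \<in> hom (perm_cat A) xs ys" "mor u = mor v"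
        for u v :: "('o, 'm) cell sarr" and A xs ys
        using that by (cases u; cases v) (auto simp: hom_def)
      then show "b [\<sigma>] = PB ?X r [\<sigma>]"
        using mon_trans_ops(2)[OF conjunct1[OF b], of "[\<sigma>]"] mon_trans_ops(2)[OF m, of "[\<sigma>]"] s gen[OF s] b
        by (simp add: nopd_lev_def)
    qed
  qed
  show ?thesis
    using d b by (simp add: nopd_obj_def fun_eq_iff) (simp add: top_ps_def nopd_lev_def fun_eq_iff)
qed

end

section \<open>The operadic category of generator data\<close>

primrec cell_source :: "('o, 'm) cell \<Rightarrow> 'o" where
  "cell_source (Cpt c) = undefined"
| "cell_source (Chain x fs) = x"

primrec cell_arrow :: "('o, 'm) cell \<Rightarrow> 'm" where
  "cell_arrow (Cpt c) = undefined"
| "cell_arrow (Chain x fs) = hd fs"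

definition crd_map ::
  "('o, 'm) ltcat \<Rightarrow> (('o, 'm) cell \<Rightarrow> ('o, 'm) cell list) \<Rightarrow> (nat \<Rightarrow> ('o, 'm) cell \<Rightarrow> nat \<Rightarrow> nat) \<Rightarrow> 'm \<Rightarrow> fmap" where
  "crd_map C t \<beta> f = blk_map (lens t (t (Chain (Dom (Base C) f) [f]))) (\<beta> 0 (Chain (Dom (Base C) f) [f]))"

definition fibre :: "('o, 'm) ltcat \<Rightarrow> (('o, 'm) cell \<Rightarrow> ('o, 'm) cell list) \<Rightarrow> 'm \<Rightarrow> nat \<Rightarrow> 'o" where
  "fibre C t g i = cell_source (t (Chain (Dom (Base C) g) [g]) ! i)"

text \<open>The fibre chain of a two-arrow chain has one arrow, which is the fibre map; hence the
  head of the list is the right reading.\<close>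

definition fibre_map :: "('o, 'm) ltcat \<Rightarrow> (('o, 'm) cell \<Rightarrow> ('o, 'm) cell list) \<Rightarrow> 'm \<Rightarrow> 'm \<Rightarrow> nat \<Rightarrow> 'm" where
  "fibre_map C t f g i = cell_arrow (t (Chain (Dom (Base C) f) [f, g]) ! i)"

text \<open>\<open>t\<close> of an object lists one component for each element of its cardinality,
  which is why \<open>length (t (Chain x []))\<close> is used. The values \<open>undefined\<close>
  are those that \<open>is_opcat\<close> prescribes.\<close>

definition opcat_of ::
  "('o, 'm) ltcat \<Rightarrow> (('o, 'm) cell \<Rightarrow> ('o, 'm) cell list) \<Rightarrow> (nat \<Rightarrow> ('o, 'm) cell \<Rightarrow> nat \<Rightarrow> nat) \<Rightarrow> ('o, 'm) opcat" where
  "opcat_of C t \<beta> =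
     \<lparr>Und = C, Crd = mk_fctr (Base C) (\<lambda>x. length (t (Chain x []))) (crd_map C t \<beta>),
      Fib = (\<lambda>R i. if R \<in> Obj (Base C) \<and> i < length (t (Chain R []))
              then mk_fctr (slice (Base C) R) (\<lambda>g. fibre C t g i) (\<lambda>(f, g). fibre_map C t f g i)
              else undefined)\<rparr>"

section \<open>Recovering the axioms of an operadic category\<close>

context
  fixes C :: "('o, 'm) ltcat" and t \<beta>
  assumes C: "is_ltcat C" and typed: "top_typed C t \<beta>" and simp: "top_simplicial C t" and coh: "top_coherent C t \<beta>"
    and shuf: "\<And>r \<sigma> i. \<sigma> \<in> cells (Base C) (r + 2) \<Longrightarrow> i < length (t \<sigma>) \<Longrightarrow>
       mono_on {pos (lens t (t \<sigma>)) i 0 ..< pos (lens t (t \<sigma>)) (Suc i) 0} (inv (\<beta> r \<sigma>))"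
begin

lemmas g_cat = is_ltcat_category[OF C]
lemmas g_face = t_face[OF C typed simp] and g_degen = t_degen[OF C typed simp]
  and g_degen_top = t_degen_top[OF C typed simp] and g_arr = beta_arr[OF C typed simp]

lemma g_mem: "\<sigma> \<in> cells (Base C) (Suc n) \<Longrightarrow> i < length (t \<sigma>) \<Longrightarrow> t \<sigma> ! i \<in> cells (Base C) n"
  using t_cells[OF C typed simp] by simp

lemma g_beta_face: "\<sigma> \<in> cells (Base C) (Suc (Suc (Suc r))) \<Longrightarrow> \<beta> (Suc r) \<sigma> = \<beta> r (cell_face C 0 \<sigma>)"
  using coh unfolding top_coherent_def by (simp add: numeral_3_eq_3)

lemma g_cocycle:
  assumes "\<sigma> \<in> cells (Base C) (r + 3)"
  shows "blk_perm (lens t (t (cell_face C (r + 2) \<sigma>))) (lens t (concat (map t (t \<sigma>)))) (\<beta> (r + 1) \<sigma>) (\<lambda>_ i. i)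
      \<circ> \<beta> r (cell_face C (r + 2) \<sigma>)
    = blk_perm (lens (\<lambda>p. t (cell_face C (r + 1) p)) (t \<sigma>)) (lens (\<lambda>p. concat (map t (t p))) (t \<sigma>))
        (\<lambda>i. i) (\<lambda>b. \<beta> r (t \<sigma> ! b))
      \<circ> \<beta> r (cell_face C (r + 1) \<sigma>)"
proof -
  note conjunct1[OF coh[unfolded top_coherent_def]]
  from bspec[OF spec[OF this] assms] show ?thesis .
qed

text \<open>The face \<open>d_0\<close> drops the source and commutes with the top face, so the
  number of entries survives until only the last object is left.\<close>

lemma t_length: "is_path (Base C) x gs \<Longrightarrow> length (t (Chain x gs)) = length (t (Chain (vertex (Base C) x gs (length gs)) []))"
proof (induction gs arbitrary: x)
  case (Cons g gs)
  then have p: "is_path (Base C) (Cod (Base C) g) gs" by simp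
  have "Chain x (g # gs) \<in> cells (Base C) (Suc (Suc (length gs)))" using Cons.prems by simp
  from g_face[OF this, of 0] have "t (Chain (Cod (Base C) g) gs) = map (cell_face C 0) (t (Chain x (g # gs)))" by simp
  then have "length (t (Chain x (g # gs))) = length (t (Chain (Cod (Base C) g) gs))" by (metis length_map)
  then show ?case using Cons.IH[OF p] vertex_Cons[of "Base C" x g gs "length gs"] by simp
qed simp

lemma arrow_cell: "f \<in> hom (Base C) x y \<Longrightarrow> Chain x [f] \<in> cells (Base C) (Suc (Suc 0))"
  by (auto simp: hom_def category_ops[OF g_cat])

lemma pair_cell: "f \<in> hom (Base C) x y \<Longrightarrow> g \<in> hom (Base C) y z \<Longrightarrow> Chain x [f, g] \<in> cells (Base C) (Suc (Suc (Suc 0)))"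
  by (auto simp: hom_def category_ops[OF g_cat])

lemma triple_cell: "h \<in> hom (Base C) u x \<Longrightarrow> f \<in> hom (Base C) x y \<Longrightarrow> g \<in> hom (Base C) y z \<Longrightarrow>
    Chain u [h, f, g] \<in> cells (Base C) (Suc (Suc (Suc (Suc 0))))"
  by (auto simp: hom_def category_ops[OF g_cat])

lemma hom_Obj: "f \<in> hom (Base C) x y \<Longrightarrow> x \<in> Obj (Base C) \<and> y \<in> Obj (Base C)"
  by (auto simp: hom_def category_ops[OF g_cat])

lemma crd_map:
  assumes f: "f \<in> hom (Base C) x y"
  shows "crd_map C t \<beta> f \<in> Arr FinOrd" "Dom FinOrd (crd_map C t \<beta> f) = length (t (Chain x []))"
    "Cod FinOrd (crd_map C t \<beta> f) = length (t (Chain y []))"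
    "fibs (crd_map C t \<beta> f) = lens t (t (Chain x [f]))" "fin_pi (crd_map C t \<beta> f) = \<beta> 0 (Chain x [f])"
proof -
  note s = arrow_cell[OF f]
  let ?ns = "lens t (t (Chain x [f]))"
  have d: "Dom (Base C) f = x" using f by (simp add: hom_def)
  have a: "(t (Chain x []), \<beta> 0 (Chain x [f]), concat (map t (t (Chain x [f])))) \<in> Arr (perm_cat (cells (Base C) 0))"
    using g_arr[OF s] by simp
  then have sum: "sum_list ?ns = length (t (Chain x []))" by (simp add: perm_cat_Arr length_concat comp_def)
  have p: "\<beta> 0 (Chain x [f]) permutes {..<sum_list ?ns}" using a unfolding sum by (simp add: perm_cat_Arr)
  have m: "\<And>i. i < length ?ns \<Longrightarrow> mono_on {pos ?ns i 0 ..< pos ?ns (Suc i) 0} (inv (\<beta> 0 (Chain x [f])))"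
    using shuf[of "Chain x [f]" 0] s by simp
  have l: "length (t (Chain x [f])) = length (t (Chain y []))"
    using t_length[of x "[f]"] s f by (simp add: hom_def)
  note b = blk_map[OF p m]
  show "crd_map C t \<beta> f \<in> Arr FinOrd" "Dom FinOrd (crd_map C t \<beta> f) = length (t (Chain x []))"
    "Cod FinOrd (crd_map C t \<beta> f) = length (t (Chain y []))"
    "fibs (crd_map C t \<beta> f) = lens t (t (Chain x [f]))" "fin_pi (crd_map C t \<beta> f) = \<beta> 0 (Chain x [f])"
    using b sum l by (simp_all add: crd_map_def d)
qed

lemma fibre_cell:
  assumes g: "g \<in> hom (Base C) y z" and i: "i < length (t (Chain z []))"
  shows "t (Chain y [g]) ! i = Chain (fibre C t g i) []" "fibre C t g i \<in> Obj (Base C)"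
    "length (t (Chain (fibre C t g i) [])) = fin_fib (crd_map C t \<beta> g) i"
proof -
  have d: "Dom (Base C) g = y" using g by (simp add: hom_def)
  have l: "length (t (Chain y [g])) = length (t (Chain z []))"
    using t_length[of y "[g]"] arrow_cell[OF g] g by (simp add: hom_def)
  then have "t (Chain y [g]) ! i \<in> cells (Base C) (Suc 0)" using g_mem[OF arrow_cell[OF g]] i by simp
  then obtain w where w: "t (Chain y [g]) ! i = Chain w []" "w \<in> Obj (Base C)"
    by (cases rule: cellsE) auto
  then show f: "t (Chain y [g]) ! i = Chain (fibre C t g i) []" and "fibre C t g i \<in> Obj (Base C)"
    by (simp_all add: fibre_def d)
  have "fibs (crd_map C t \<beta> g) ! i = length (t (Chain (fibre C t g i) []))"
    using crd_map(4)[OF g] l i f by simp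
  then show "length (t (Chain (fibre C t g i) [])) = fin_fib (crd_map C t \<beta> g) i"
    using crd_map(3)[OF g] i by simp
qed

text \<open>The faces \<open>d_0\<close> and \<open>d_1\<close> of the chain \<open>[f, g]\<close>
  keep \<open>g\<close> and the composite, and thereby fix target and source of the single arrow in
  each entry.\<close>

lemma fibre_map_cell:
  assumes f: "f \<in> hom (Base C) x y" and g: "g \<in> hom (Base C) y z" and i: "i < length (t (Chain z []))"
  shows "length (t (Chain x [f, g])) = length (t (Chain z []))"
    "t (Chain x [f, g]) ! i = Chain (fibre C t (Comp (Base C) g f) i) [fibre_map C t f g i]"
    "fibre_map C t f g i \<in> hom (Base C) (fibre C t (Comp (Base C) g f) i) (fibre C t g i)"
proof -
  note s = pair_cell[OF f g]
  have d: "Dom (Base C) f = x" "Cod (Base C) f = y" using f by (simp_all add: hom_def)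
  note gf = hom_comp[OF g_cat f g]
  show l: "length (t (Chain x [f, g])) = length (t (Chain z []))"
    using t_length[of x "[f, g]"] s g by (simp add: hom_def)
  then have "t (Chain x [f, g]) ! i \<in> cells (Base C) (Suc (Suc 0))" using g_mem[OF s] i by simp
  then obtain w es where es: "t (Chain x [f, g]) ! i = Chain w es" "length es = Suc 0" "is_path (Base C) w es"
    by (cases rule: cellsE) auto
  then obtain e where "es = [e]" by (auto simp: length_Suc_conv)
  with es have e: "t (Chain x [f, g]) ! i = Chain w [e]" "e \<in> Arr (Base C)" "Dom (Base C) e = w" by simp_all
  have "t (Chain y [g]) = map (cell_face C 0) (t (Chain x [f, g]))"
    "t (Chain x [Comp (Base C) g f]) = map (cell_face C 1) (t (Chain x [f, g]))"
    using g_face[OF s, of 0] g_face[OF s, of 1] d by simp_all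
  then have "t (Chain y [g]) ! i = Chain (Cod (Base C) e) []" "t (Chain x [Comp (Base C) g f]) ! i = Chain w []"
    using l i e by simp_all
  then have "Cod (Base C) e = fibre C t g i" "w = fibre C t (Comp (Base C) g f) i"
    using fibre_cell(1)[OF g i] fibre_cell(1)[OF gf i] by simp_all
  then show "t (Chain x [f, g]) ! i = Chain (fibre C t (Comp (Base C) g f) i) [fibre_map C t f g i]"
    "fibre_map C t f g i \<in> hom (Base C) (fibre C t (Comp (Base C) g f) i) (fibre C t g i)"
    using e by (simp_all add: fibre_map_def d hom_def)
qed

lemma fibre_map_Ident:
  assumes g: "g \<in> hom (Base C) y z" and i: "i < length (t (Chain z []))"
  shows "fibre_map C t (Ident (Base C) y) g i = Ident (Base C) (fibre C t g i)"
proof -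
  have y: "y \<in> Obj (Base C)" using hom_Obj[OF g] by simp
  have l: "length (t (Chain y [g])) = length (t (Chain z []))"
    using t_length[of y "[g]"] arrow_cell[OF g] g by (simp add: hom_def)
  have "t (Chain y [Ident (Base C) y, g]) = map (cell_degen C 0) (t (Chain y [g]))"
    using g_degen[OF arrow_cell[OF g], of 0] by simp
  then have "t (Chain y [Ident (Base C) y, g]) ! i = Chain (fibre C t g i) [Ident (Base C) (fibre C t g i)]"
    using fibre_cell(1)[OF g i] l i by simp
  then show ?thesis
    using fibre_map_cell(2)[OF hom_ident[OF g_cat y] g i] by (metis cell_arrow.simps(2) list.sel(1))
qed

text \<open>Functoriality of fibres from three faces of a three-arrow chain: \<open>d_0\<close> and
  \<open>d_2\<close> identify the two arrows of the entry, and \<open>d_1\<close> evaluates their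
  composite.\<close>

lemma fibre_map_triple:
  assumes h: "h \<in> hom (Base C) u x" and f: "f \<in> hom (Base C) x y" and g: "g \<in> hom (Base C) y z"
    and i: "i < length (t (Chain z []))"
  shows "length (t (Chain u [h, f, g])) = length (t (Chain z []))"
    "t (Chain u [h, f, g]) ! i = Chain (fibre C t (Comp (Base C) g (Comp (Base C) f h)) i)
       [fibre_map C t h (Comp (Base C) g f) i, fibre_map C t f g i]"
    "fibre_map C t (Comp (Base C) f h) g i = Comp (Base C) (fibre_map C t f g i) (fibre_map C t h (Comp (Base C) g f) i)"
proof -
  note s = triple_cell[OF h f g]
  have d: "Cod (Base C) h = x" "Cod (Base C) f = y" using h f by (simp_all add: hom_def)
  note fh = hom_comp[OF g_cat h f] and gf = hom_comp[OF g_cat f g]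
  show l: "length (t (Chain u [h, f, g])) = length (t (Chain z []))"
    using t_length[of u "[h, f, g]"] s g by (simp add: hom_def)
  then have "t (Chain u [h, f, g]) ! i \<in> cells (Base C) (Suc (Suc (Suc 0)))" using g_mem[OF s] i by simp
  then obtain w es where es: "t (Chain u [h, f, g]) ! i = Chain w es" "length es = Suc (Suc 0)"
    by (cases rule: cellsE) auto
  then obtain a b where e: "t (Chain u [h, f, g]) ! i = Chain w [a, b]" by (auto simp: length_Suc_conv)
  have "t (Chain x [f, g]) = map (cell_face C 0) (t (Chain u [h, f, g]))"
    "t (Chain u [Comp (Base C) f h, g]) = map (cell_face C 1) (t (Chain u [h, f, g]))"
    "t (Chain u [h, Comp (Base C) g f]) = map (cell_face C 2) (t (Chain u [h, f, g]))"
    using g_face[OF s, of 0] g_face[OF s, of 1] g_face[OF s, of 2] d by (simp_all add: numeral_2_eq_2)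
  then have "t (Chain x [f, g]) ! i = Chain (Cod (Base C) a) [b]"
    "t (Chain u [Comp (Base C) f h, g]) ! i = Chain w [Comp (Base C) b a]"
    "t (Chain u [h, Comp (Base C) g f]) ! i = Chain w [a]"
    using l i e by (simp_all add: numeral_2_eq_2)
  then have *: "b = fibre_map C t f g i" "a = fibre_map C t h (Comp (Base C) g f) i"
    "w = fibre C t (Comp (Base C) g (Comp (Base C) f h)) i" "Comp (Base C) b a = fibre_map C t (Comp (Base C) f h) g i"
    using fibre_map_cell(2)[OF f g i] fibre_map_cell(2)[OF fh g i] fibre_map_cell(2)[OF h gf i] by simp_all
  show "t (Chain u [h, f, g]) ! i = Chain (fibre C t (Comp (Base C) g (Comp (Base C) f h)) i)
       [fibre_map C t h (Comp (Base C) g f) i, fibre_map C t f g i]"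
    unfolding e * ..
  show "fibre_map C t (Comp (Base C) f h) g i = Comp (Base C) (fibre_map C t f g i) (fibre_map C t h (Comp (Base C) g f) i)"
    using * by simp
qed

text \<open>Law (b) for \<open>d_0\<close>, repeated until a single arrow remains.\<close>

lemma beta_last:
  "is_path (Base C) x gs \<Longrightarrow> length gs = Suc r \<Longrightarrow> \<beta> r (Chain x gs) = fin_pi (crd_map C t \<beta> (gs ! r))"
proof (induction r arbitrary: x gs)
  case 0
  then obtain g where gs: "gs = [g]" by (auto simp: length_Suc_conv)
  then have "g \<in> hom (Base C) x (Cod (Base C) g)" using 0 by (simp add: hom_def)
  then show ?case using crd_map(5) gs by simp
next
  case (Suc r)
  then obtain g gs' where gs: "gs = g # gs'" "length gs' = Suc r" by (auto simp: length_Suc_conv)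
  then have "gs' \<noteq> []" by auto
  have "Chain x gs \<in> cells (Base C) (Suc (Suc (Suc r)))" using Suc.prems by simp
  then show ?case using g_beta_face[of "Chain x gs" r] Suc gs by simp
qed

text \<open>Reads off the fibres of \<open>t \<sigma>\<close> over the last arrow \<open>g\<close> of \<open>\<sigma>\<close> from the permutation \<open>\<pi>\<^sub>g\<close>; this is
  the source of axiom (A5).\<close>

lemma t_fibre_nth:
  assumes p: "is_path (Base C) x gs" and l: "length gs = Suc r" and i: "i < length (t (Chain x gs))"
    and b: "b < fin_fib (crd_map C t \<beta> (gs ! r)) i"
  shows "t (t (Chain x gs) ! i) ! b = t (Chain x (butlast gs)) ! fin_eps (crd_map C t \<beta> (gs ! r)) i b"
proof -
  let ?g = "crd_map C t \<beta> (gs ! r)"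
  have g: "gs ! r \<in> hom (Base C) (vertex (Base C) x gs r) (vertex (Base C) x gs (length gs))"
    using path_nth[OF g_cat p, of r] l by (simp del: vertex_simps)
  have s: "Chain x gs \<in> cells (Base C) (Suc (Suc r))" using p l by simp
  have ne: "gs \<noteq> []" using l by auto
  have f: "cell_face C (Suc r) (Chain x gs) = Chain x (butlast gs)" using l ne by simp
  \<comment> \<open>The typing of \<beta> at this chain: the two iterated top faces have equal
    entries along the permutation of the last arrow.\<close>
  have a: "(t (Chain x (butlast gs)), fin_pi ?g, concat (map t (t (Chain x gs)))) \<in> Arr (perm_cat (cells (Base C) r))"
    using g_arr[OF s] beta_last[OF p l] unfolding f by simp
  have n: "i < Cod FinOrd ?g" using i t_length[OF p] crd_map(3)[OF g] by simp
  have j: "fin_eps ?g i b < length (t (Chain x (butlast gs)))"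
  proof -
    have "vertex (Base C) x (butlast gs) (length (butlast gs)) = vertex (Base C) x gs r"
      using l by (cases r) (simp_all add: nth_butlast)
    then show ?thesis
      using fin_eps_mem(1)[OF b] crd_map(2)[OF g] t_length[OF is_path_butlast[OF g_cat p]] by simp
  qed
  have lens: "lens t (t (Chain x gs)) = fibs ?g"
  proof (rule nth_equalityI)
    show "length (lens t (t (Chain x gs))) = length (fibs ?g)" using t_length[OF p] crd_map(3)[OF g] by simp
    fix k assume "k < length (lens t (t (Chain x gs)))"
    then have k: "k < length (t (Chain x gs))" by simp
    have "t (Chain (vertex (Base C) x gs r) [gs ! r]) ! k = Chain (fibre C t (gs ! r) k) []"
      using fibre_cell(1)[OF g] k t_length[OF p] by simp
    \<comment> \<open>Again by \<open>d_0\<close>: applied to the entries as well as to the chain,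
      it reduces the block sizes to those of the last arrow alone.\<close>
    moreover have "length (t (t (Chain x gs) ! k)) = length (t (Chain (fibre C t (gs ! r) k) []))"
      using p l k
    proof (induction r arbitrary: x gs)
      case 0
      then obtain g where gs: "gs = [g]" by (auto simp: length_Suc_conv)
      then have "g \<in> hom (Base C) x (Cod (Base C) g)" using 0 by (simp add: hom_def)
      then show ?case using fibre_cell(1) t_length[of x gs] 0 gs by simp
    next
      case (Suc r)
      then obtain g gs' where gs: "gs = g # gs'" "length gs' = Suc r" by (auto simp: length_Suc_conv)
      then have "gs' \<noteq> []" by auto
      have s: "Chain x gs \<in> cells (Base C) (Suc (Suc (Suc r)))" using Suc.prems by simp
      have f: "t (Chain (Cod (Base C) g) gs') = map (cell_face C 0) (t (Chain x gs))"
        using g_face[OF s, of 0] gs by simp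
      then have k: "k < length (t (Chain (Cod (Base C) g) gs'))" using Suc.prems by simp
      have "t (Chain x gs) ! k \<in> cells (Base C) (Suc (Suc r))" using g_mem[OF s] Suc.prems by simp
      from g_face[OF this, of 0] have "length (t (t (Chain x gs) ! k)) = length (t (cell_face C 0 (t (Chain x gs) ! k)))"
        by simp
      also have "\<dots> = length (t (t (Chain (Cod (Base C) g) gs') ! k))" using f Suc.prems by simp
      also have "\<dots> = length (t (Chain (fibre C t (gs' ! r) k) []))"
        using Suc.IH[of "Cod (Base C) g" gs'] Suc.prems gs k by simp
      finally show ?case using gs by simp
    qed
    ultimately show "lens t (t (Chain x gs)) ! k = fibs ?g ! k"
      using k fibre_cell(3)[OF g, of k] t_length[OF p] crd_map(3)[OF g] by simp
  qed
  have "b < length (t (t (Chain x gs) ! i))" using arg_cong[OF lens, of "\<lambda>xs. xs ! i"] i n b by simp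
  then have "concat (map t (t (Chain x gs))) ! pos (fibs ?g) i b = t (t (Chain x gs) ! i) ! b"
    using nth_concat_pos[of i "map t (t (Chain x gs))" b] i lens by (simp add: comp_def)
  then show ?thesis
    using a j fin_pi(3)[OF crd_map(1)[OF g] n b] by (simp add: perm_cat_Arr)
qed

text \<open>The object part of (A5) comes first, because it provides the fibre sizes that
  \<open>fin_cocycle_converse\<close> asks for. The cocycle law at \<open>[f, g]\<close> then yields
  functoriality of cardinality and the morphism part of (A3) together.\<close>

lemma crd_comp:
  assumes f: "f \<in> hom (Base C) x y" and g: "g \<in> hom (Base C) y z"
  shows "crd_map C t \<beta> (Comp (Base C) g f) = Comp FinOrd (crd_map C t \<beta> g) (crd_map C t \<beta> f)"
    "i < length (t (Chain z [])) \<Longrightarrow>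
     crd_map C t \<beta> (fibre_map C t f g i) = fin_fibmap (crd_map C t \<beta> f) (crd_map C t \<beta> g) i"
    "i < length (t (Chain z [])) \<Longrightarrow> b < fin_fib (crd_map C t \<beta> g) i \<Longrightarrow>
     fibre C t (fibre_map C t f g i) b = fibre C t f (fin_eps (crd_map C t \<beta> g) i b)"
proof -
  let ?f = "crd_map C t \<beta> f" and ?g = "crd_map C t \<beta> g" and ?h = "crd_map C t \<beta> (Comp (Base C) g f)"
  let ?e = "\<lambda>i. fibre_map C t f g i" and ?\<sigma> = "Chain x [f, g]"
  let ?q = "\<lambda>i. crd_map C t \<beta> (?e i)"
  note gf = hom_comp[OF g_cat f g] and s = pair_cell[OF f g]
  note F = crd_map[OF f] and G = crd_map[OF g] and H = crd_map[OF gf]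
  note cell = fibre_map_cell[OF f g]
  note Q = crd_map[OF cell(3)]
  have p: "is_path (Base C) x [f, g]" using s by simp
  have d: "Cod (Base C) f = y" "Dom (Base C) f = x" using f by (simp_all add: hom_def)
  have eps: "fin_eps ?g i b < length (t (Chain y []))" if "b < fin_fib ?g i" for i b
    using fin_eps_mem(1)[OF that] G by simp
  show A5: "fibre C t (?e i) b = fibre C t f (fin_eps ?g i b)" if i: "i < length (t (Chain z []))" and b: "b < fin_fib ?g i" for i b
  proof -
    have "t (t ?\<sigma> ! i) ! b = t (Chain x [f]) ! fin_eps ?g i b"
      using t_fibre_nth[OF p, of 1 i b] cell(1)[OF i] i b by simp
    moreover have "b < length (t (Chain (fibre C t g i) []))" using fibre_cell(3)[OF g i] b by simp
    ultimately show ?thesis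
      using fibre_cell(1)[OF cell(3)[OF i]] fibre_cell(1)[OF f eps[OF b]] cell(2)[OF i] by simp
  qed
  have lt: "length (t ?\<sigma>) = Cod FinOrd ?g"
    using t_length[OF p] G(3) g by (simp add: hom_def)
  then have tmap: "t ?\<sigma> = map (\<lambda>i. Chain (fibre C t (Comp (Base C) g f) i) [?e i]) [0..<Cod FinOrd ?g]"
    using cell(2) G(3) by (intro nth_equalityI) simp_all
  define nss where "nss = map (\<lambda>i. fibs (?q i)) [0..<Cod FinOrd ?g]"
  have nss: "map (\<lambda>i. lens t (t (Chain (fibre C t (Comp (Base C) g f) i) [?e i]))) [0..<Cod FinOrd ?g] = nss"
    unfolding nss_def using Q(4) G(3) by (intro map_cong) auto
  have L2: "lens t (concat (map t (t ?\<sigma>))) = concat nss"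
    using nss by (simp add: tmap map_concat comp_def del: map_eq_conv)
  have L4: "lens (\<lambda>p. concat (map t (t p))) (t ?\<sigma>) = map sum_list nss"
    using arg_cong[OF nss, of "map sum_list"] by (simp add: tmap length_concat comp_def del: map_eq_conv)
  have L3: "lens (\<lambda>p. t (cell_face C (Suc 0) p)) (t ?\<sigma>) = fibs ?h"
    using fibre_cell(3)[OF gf] H(3) G(3) by (simp add: tmap fibs_def)
  have "blk_perm (lens t (t (cell_face C 2 ?\<sigma>))) (lens t (concat (map t (t ?\<sigma>)))) (\<beta> 1 ?\<sigma>) (\<lambda>_ i. i) \<circ> \<beta> 0 (cell_face C 2 ?\<sigma>)
     = blk_perm (lens (\<lambda>p. t (cell_face C 1 p)) (t ?\<sigma>)) (lens (\<lambda>p. concat (map t (t p))) (t ?\<sigma>))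
            (\<lambda>i. i) (\<lambda>b. \<beta> 0 (t ?\<sigma> ! b)) \<circ> \<beta> 0 (cell_face C 1 ?\<sigma>)"
    using g_cocycle[of ?\<sigma> 0] s by (simp add: numeral_3_eq_3 numeral_2_eq_2)
  moreover have "cell_face C 2 ?\<sigma> = Chain x [f]" "cell_face C 1 ?\<sigma> = Chain x [Comp (Base C) g f]"
    by (simp_all add: numeral_2_eq_2)
  moreover have "\<beta> 1 ?\<sigma> = fin_pi ?g" using beta_last[OF p, of 1] by simp
  moreover have "blk_perm (fibs ?h) (map sum_list nss) (\<lambda>i. i) (\<lambda>b. \<beta> 0 (t ?\<sigma> ! b))
      = blk_perm (fibs ?h) (map sum_list nss) (\<lambda>i. i) (\<lambda>i. fin_pi (?q i))"
    using H(3) G(3) Q(5) by (intro blk_perm_cong) (simp_all add: tmap)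
  ultimately have eq: "blk_perm (fibs ?f) (concat nss) (fin_pi ?g) (\<lambda>_ i. i) \<circ> fin_pi ?f
      = blk_perm (fibs ?h) (map sum_list nss) (\<lambda>i. i) (\<lambda>i. fin_pi (?q i)) \<circ> fin_pi ?h"
    using L2 L3 L4 F H by simp
  have q: "?q i \<in> Arr FinOrd \<and> Dom FinOrd (?q i) = fin_fib ?h i \<and> Cod FinOrd (?q i) = fin_fib ?g i" if "i < Cod FinOrd ?g" for i
    using Q(1-3)[of i] that fibre_cell(3)[OF gf, of i] fibre_cell(3)[OF g, of i] G(3) by simp
  have lens: "fin_fib (?q i) b = fin_fib ?f (fin_eps ?g i b)" if i: "i < Cod FinOrd ?g" and b: "b < fin_fib ?g i" for i b
  proof -
    have i': "i < length (t (Chain z []))" using i G(3) by simp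
    have b': "b < length (t (Chain (fibre C t g i) []))" using fibre_cell(3)[OF g i'] b by simp
    show ?thesis
      using fibre_cell(3)[OF cell(3)[OF i'] b'] fibre_cell(3)[OF f eps[OF b]] A5[OF i' b] by simp
  qed
  have dom: "Dom FinOrd ?g = Cod FinOrd ?f" "Dom FinOrd ?h = Dom FinOrd ?f" "Cod FinOrd ?h = Cod FinOrd ?g"
    using F G H by simp_all
  note conv = fin_cocycle_converse[OF F(1) G(1) dom(1) H(1) dom(2,3) q nss_def lens eq]
  show "?h = Comp FinOrd ?g ?f" using conv(1) by simp
  show "?q i = fin_fibmap ?f ?g i" if "i < length (t (Chain z []))" for i using conv(2)[of i] that G(3) by simp
qed

text \<open>The morphism part of (A5) is \<open>t_fibre_nth\<close> at a chain of three arrows,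
  whose fibre chain over \<open>i\<close> consists of the two fibre maps on the left.\<close>

lemma fibre_map_fibre_map:
  assumes h: "h \<in> hom (Base C) u x" and f: "f \<in> hom (Base C) x y" and g: "g \<in> hom (Base C) y z"
    and i: "i < length (t (Chain z []))" and b: "b < fin_fib (crd_map C t \<beta> g) i"
  shows "fibre_map C t (fibre_map C t h (Comp (Base C) g f) i) (fibre_map C t f g i) b
    = fibre_map C t h f (fin_eps (crd_map C t \<beta> g) i b)"
proof -
  note T = fibre_map_triple[OF h f g i] and gf = hom_comp[OF g_cat f g]
  have p: "is_path (Base C) u [h, f, g]" using triple_cell[OF h f g] by simp
  have e: "fin_eps (crd_map C t \<beta> g) i b < length (t (Chain y []))"
    using fin_eps_mem(1)[OF b] crd_map[OF g] by simp
  have b': "b < length (t (Chain (fibre C t g i) []))" using fibre_cell(3)[OF g i] b by simp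
  have as: "Comp (Base C) g (Comp (Base C) f h) = Comp (Base C) (Comp (Base C) g f) h" by (rule hom_assoc[OF g_cat h f g])
  have e1: "fibre_map C t h (Comp (Base C) g f) i \<in> hom (Base C) (fibre C t (Comp (Base C) g (Comp (Base C) f h)) i) (fibre C t (Comp (Base C) g f) i)"
    unfolding as by (rule fibre_map_cell(3)[OF h gf i])
  have "t (t (Chain u [h, f, g]) ! i) ! b = t (Chain u [h, f]) ! fin_eps (crd_map C t \<beta> g) i b"
    using t_fibre_nth[OF p, of 2 i b] T(1) i b by (simp add: numeral_2_eq_2)
  then show ?thesis
    using fibre_map_cell(2)[OF e1 fibre_map_cell(3)[OF f g i] b'] fibre_map_cell(2)[OF h f e] T(2) by simp
qed

text \<open>All fibres have one element, by the degeneracies \<open>s_0\<close> at an object and at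
  a component. By functoriality the map is also idempotent, so \<open>j\<close> and its image lie in
  the same one-element fibre and coincide.\<close>

lemma crd_ident:
  assumes x: "x \<in> Obj (Base C)"
  shows "crd_map C t \<beta> (Ident (Base C) x) = Ident FinOrd (length (t (Chain x [])))"
proof -
  let ?I = "Ident (Base C) x" and ?n = "length (t (Chain x []))"
  let ?g = "crd_map C t \<beta> ?I"
  note I = hom_ident[OF g_cat x]
  note G = crd_map[OF I]
  have xc: "Chain x [] \<in> cells (Base C) (Suc 0)" using x by simp
  have "t (Chain x [?I]) = map (cell_degen C 0) (t (Chain x []))" using g_degen[OF xc, of 0] by simp
  moreover have "length (t (cell_degen C 0 p)) = 1" if "p \<in> set (t (Chain x []))" for p
    using g_degen_top[of p 0] t_cells[OF C typed simp xc that] by simp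
  ultimately have one: "fin_fib ?g i = 1" if "i < ?n" for i
    using arg_cong[OF G(4), of "\<lambda>xs. xs ! i"] that G(3) by simp
  have idem: "Comp FinOrd ?g ?g = ?g" using crd_comp(1)[OF I I] I by (simp add: hom_def category_ops[OF g_cat])
  have id: "mor ?g j = j" if j: "j < ?n" for j
  proof -
    have k: "mor ?g j < ?n" using FinOrd_mor[OF G(1), of j] j G by simp
    have "mor ?g (mor ?g j) = mor ?g j" using FinOrd_Comp_mor[OF G(1) G(1), of j] j G idem by simp
    moreover obtain a where "a < fin_fib ?g (mor ?g j)" "fin_eps ?g (mor ?g j) a = j"
      using fin_eps_surj[of j ?g] j G(2) by metis
    moreover obtain b where "b < fin_fib ?g (mor ?g (mor ?g j))" "fin_eps ?g (mor ?g (mor ?g j)) b = mor ?g j"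
      using fin_eps_surj[of "mor ?g j" ?g] k G(2) by metis
    ultimately show ?thesis using one[OF k] by simp
  qed
  have J: "Ident FinOrd ?n \<in> Arr FinOrd" using category_ops(3)[OF category_FinOrd] by simp
  then have "Dom FinOrd (Ident FinOrd ?n) = ?n" "Cod FinOrd (Ident FinOrd ?n) = ?n" by simp_all
  then show ?thesis using id G by (intro FinOrd_eqI[OF G(1) J]) simp_all
qed

lemma opcat_of_simps [simp]:
  "Und (opcat_of C t \<beta>) = C"
  "x \<in> Obj (Base C) \<Longrightarrow> fo (Crd (opcat_of C t \<beta>)) x = length (t (Chain x []))"
  "f \<in> Arr (Base C) \<Longrightarrow> fa (Crd (opcat_of C t \<beta>)) f = crd_map C t \<beta> f"
  by (simp_all add: opcat_of_def)

lemma opcat_of_fib_obj: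
  "g \<in> hom (Base C) y z \<Longrightarrow> i < length (t (Chain z [])) \<Longrightarrow> fib_obj (opcat_of C t \<beta>) g i = fibre C t g i"
  using hom_Obj[of g y z] by (auto simp: fib_obj_def opcat_of_def hom_def)

lemma opcat_of_fib_map:
  "f \<in> hom (Base C) x y \<Longrightarrow> g \<in> hom (Base C) y z \<Longrightarrow> i < length (t (Chain z [])) \<Longrightarrow>
     fib_map (opcat_of C t \<beta>) f g i = fibre_map C t f g i"
  using hom_Obj[of g y z] by (auto simp: fib_map_def opcat_of_def hom_def)

text \<open>A chosen terminal is \<open>s_0\<close> of its component, and the top face retracts that
  degeneracy, leaving a list with the component as sole entry.\<close>

lemma crd_chosen_of:
  assumes "u \<in> chosen C"
  shows "length (t (Chain u [])) = 1"
proof -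
  have u: "u \<in> Obj (Base C)" "Lt C (cpt (Base C) u) = u" using assms by (simp_all add: chosen_iff[OF C])
  then have "Cpt (cpt (Base C) u) \<in> cells (Base C) 0" by (simp add: cpt_pi0)
  from g_degen_top[OF this] show ?thesis using u by simp
qed

lemma is_fctr_crd_of: "is_fctr (Base C) FinOrd (Crd (opcat_of C t \<beta>))"
  unfolding opcat_of_def opcat.simps
proof (rule is_fctrI[OF _ _ _ _ g_cat])
  fix f assume "f \<in> Arr (Base C)"
  then have "f \<in> hom (Base C) (Dom (Base C) f) (Cod (Base C) f)" by (simp add: hom_def)
  from crd_map[OF this] show "crd_map C t \<beta> f \<in> Arr FinOrd \<and>
      Dom FinOrd (crd_map C t \<beta> f) = length (t (Chain (Dom (Base C) f) [])) \<and>
      Cod FinOrd (crd_map C t \<beta> f) = length (t (Chain (Cod (Base C) f) []))" by simp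
  fix g assume "g \<in> Arr (Base C)" "Dom (Base C) g = Cod (Base C) f"
  then show "crd_map C t \<beta> (Comp (Base C) g f) = Comp FinOrd (crd_map C t \<beta> g) (crd_map C t \<beta> f)"
    using \<open>f \<in> hom (Base C) _ _\<close> by (intro crd_comp(1)) (simp_all add: hom_def)
qed (simp_all add: crd_ident)

lemma is_fctr_fib_of:
  assumes R: "R \<in> Obj (Base C)" and i: "i < length (t (Chain R []))"
  shows "is_fctr (slice (Base C) R) (Base C) (Fib (opcat_of C t \<beta>) R i)"
proof -
  have F: "Fib (opcat_of C t \<beta>) R i = mk_fctr (slice (Base C) R) (\<lambda>g. fibre C t g i) (\<lambda>(f, g). fibre_map C t f g i)"
    using assms by (simp add: opcat_of_def)
  show ?thesis
    unfolding F
  proof (rule is_fctrI[OF _ _ _ _ category_slice[OF g_cat]])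
    have h: "g \<in> hom (Base C) (Dom (Base C) g) R" if "g \<in> Arr (Base C)" "Cod (Base C) g = R" for g
      using that by (simp add: hom_def)
    show "fibre C t g i \<in> Obj (Base C)" if "g \<in> Obj (slice (Base C) R)" for g
      using fibre_cell(2)[OF h i] that by simp
    show "(case Ident (slice (Base C) R) g of (f, g) \<Rightarrow> fibre_map C t f g i) = Ident (Base C) (fibre C t g i)"
      if "g \<in> Obj (slice (Base C) R)" for g
      using fibre_map_Ident[OF h i] that by simp
    fix u assume u: "u \<in> Arr (slice (Base C) R)"
    then obtain f g where ug: "u = (f, g)" by (cases u)
    have g: "g \<in> hom (Base C) (Dom (Base C) g) R" and f: "f \<in> hom (Base C) (Dom (Base C) f) (Dom (Base C) g)"
      using u unfolding ug by (simp_all add: hom_def)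
    show "(case u of (f, g) \<Rightarrow> fibre_map C t f g i) \<in> Arr (Base C) \<and>
        Dom (Base C) (case u of (f, g) \<Rightarrow> fibre_map C t f g i) = fibre C t (Dom (slice (Base C) R) u) i \<and>
        Cod (Base C) (case u of (f, g) \<Rightarrow> fibre_map C t f g i) = fibre C t (Cod (slice (Base C) R) u) i"
      using fibre_map_cell(3)[OF f g i] u unfolding ug by (simp add: hom_def del: slice_simps(2))
    fix v assume v: "v \<in> Arr (slice (Base C) R)" and d: "Dom (slice (Base C) R) v = Cod (slice (Base C) R) u"
    then obtain f' g' where vg: "v = (f', g')" by (cases v)
    have g': "g' \<in> hom (Base C) (Dom (Base C) g') R" and f': "f' \<in> hom (Base C) (Dom (Base C) f') (Dom (Base C) g')"
      using v unfolding vg by (simp_all add: hom_def)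
    have gg: "g = Comp (Base C) g' f'" using d u v unfolding ug vg by (simp del: slice_simps(2))
    have f2: "f \<in> hom (Base C) (Dom (Base C) f) (Dom (Base C) f')"
      using f hom_comp[OF g_cat f' g'] by (simp add: gg hom_def)
    have "Comp (slice (Base C) R) v u = (Comp (Base C) f' f, g')"
      using slice_Comp[of f g "Base C" R f' g'] u v gg unfolding ug vg by (simp del: slice_simps(2))
    then show "(case Comp (slice (Base C) R) v u of (f, g) \<Rightarrow> fibre_map C t f g i)
        = Comp (Base C) (case v of (f, g) \<Rightarrow> fibre_map C t f g i) (case u of (f, g) \<Rightarrow> fibre_map C t f g i)"
      using fibre_map_triple(3)[OF f2 f' g' i] gg by (simp add: ug vg)
  qed
qed

text \<open>(A1) concerns every local terminal, chosen or not. \<open>R\<close> is a retract of the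
  chosen terminal of its component, hence its cardinality is a retract of a one-element
  ordinal.\<close>

lemma crd_local_terminal:
  assumes R: "local_terminal (Base C) R"
  shows "length (t (Chain R [])) = 1"
proof -
  have RO: "R \<in> Obj (Base C)" using R by (simp add: local_terminal_def)
  let ?U = "Lt C (cpt (Base C) R)"
  note U = is_ltcat_Lt[OF C cpt_pi0[OF RO]]
  have "?U \<in> cpt (Base C) R" using U(2) cpt_self[of ?U "Base C"] by simp
  then obtain f where f: "f \<in> hom (Base C) ?U R" using R unfolding local_terminal_def by blast
  note \<tau> = tau_hom[OF C RO]
  have "Comp (Base C) f (tau C R) = Ident (Base C) R"
    using local_terminal_unique[OF R hom_comp[OF g_cat \<tau> f] hom_ident[OF g_cat RO]] .
  then have e: "Comp FinOrd (crd_map C t \<beta> f) (crd_map C t \<beta> (tau C R)) = Ident FinOrd (length (t (Chain R [])))"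
    using crd_comp(1)[OF \<tau> f] crd_ident[OF RO] by simp
  note F = crd_map[OF f] and T = crd_map[OF \<tau>] and one = crd_chosen_of[OF U(4)]
  have "j = mor (crd_map C t \<beta> f) 0" if j: "j < length (t (Chain R []))" for j
  proof -
    have "mor (crd_map C t \<beta> (tau C R)) j = 0" using FinOrd_mor[OF T(1), of j] T j one by simp
    then show ?thesis using FinOrd_Comp_mor[OF F(1) T(1), of j] F T j e by simp
  qed
  then have "\<not> 1 < length (t (Chain R []))" by (metis less_trans zero_less_one zero_neq_one)
  moreover have "0 < length (t (Chain R []))" using FinOrd_mor[OF F(1), of 0] F one by auto
  ultimately show ?thesis by linarith
qed

lemma is_opcat_of: "is_opcat (opcat_of C t \<beta>)"
  unfolding is_opcat_def opcat_of_simps(1)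
proof (intro conjI allI ballI impI, goal_cases)
  case 1 show ?case by (rule C)
next
  case 2 show ?case by (rule is_fctr_crd_of)
next
  case (3 R i)
  show ?case using is_fctr_fib_of[of R i] by (auto simp: opcat_of_def)
next
  case (4 R)
  then show ?case using crd_local_terminal[of R] by (simp add: local_terminal_def)
next
  case (5 R i)
  then have i: "i < length (t (Chain R []))" and R: "Chain R [] \<in> cells (Base C) (Suc 0)" by simp_all
  note I = hom_ident[OF g_cat 5(1)]
  obtain c where c: "t (Chain R []) ! i = Cpt c" "c \<in> pi0 (Base C)"
    using g_mem[OF R i] by (cases rule: cellsE) auto
  \<comment> \<open>(A2): the fibres of the identity arise by \<open>s_0\<close> from components, so
    they are chosen terminals.\<close>
  have "t (Chain R [Ident (Base C) R]) = map (cell_degen C 0) (t (Chain R []))" using g_degen[OF R, of 0] by simp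
  then have "fibre C t (Ident (Base C) R) i = Lt C c" using fibre_cell(1)[OF I i] i c by simp
  then show ?case using opcat_of_fib_obj[OF I i] is_ltcat_Lt(4)[OF C c(2)] by simp
next
  case (6 g i)
  then have g: "g \<in> hom (Base C) (Dom (Base C) g) (Cod (Base C) g)" by (simp add: hom_def)
  then have i: "i < length (t (Chain (Cod (Base C) g) []))" using 6 hom_Obj[OF g] by simp
  show ?case using opcat_of_fib_obj[OF g i] fibre_cell(2,3)[OF g i] 6 by simp
next
  case (7 g f i)
  then have f: "f \<in> hom (Base C) (Dom (Base C) f) (Dom (Base C) g)" and g: "g \<in> hom (Base C) (Dom (Base C) g) (Cod (Base C) g)"
    by (simp_all add: composable_def hom_def)
  then have i: "i < length (t (Chain (Cod (Base C) g) []))" using 7 hom_Obj[OF g] by simp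
  show ?case
    using opcat_of_fib_map[OF f g i] crd_comp(2)[OF f g i] fibre_map_cell(3)[OF f g i] f g by (simp add: hom_def)
next
  case (8 R)
  note \<tau> = tau_hom[OF C 8] and one = crd_chosen_of[OF is_ltcat_Lt(4)[OF C cpt_pi0[OF 8]]]
  \<comment> \<open>(A4) is the statement that the top face retracts the top degeneracy, here at an
    object; the next case uses it at an arrow.\<close>
  have "t (Chain R [tau C R]) = [Chain R []]" using g_degen_top[of "Chain R []" "Suc 0"] 8 by simp
  then show ?case using opcat_of_fib_obj[OF \<tau>, of 0] fibre_cell(1)[OF \<tau>, of 0] one by simp
next
  case (9 g)
  let ?y = "Cod (Base C) g"
  have g: "g \<in> hom (Base C) (Dom (Base C) g) ?y" using 9 by (simp add: hom_def)
  then have y: "?y \<in> Obj (Base C)" using hom_Obj by blast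
  note \<tau> = tau_hom[OF C y] and one = crd_chosen_of[OF is_ltcat_Lt(4)[OF C cpt_pi0[OF y]]]
  have "t (Chain (Dom (Base C) g) [g, tau C ?y]) = [Chain (Dom (Base C) g) [g]]"
    using g_degen_top[of "Chain (Dom (Base C) g) [g]" "Suc (Suc 0)"] arrow_cell[OF g] by simp
  then show ?case using opcat_of_fib_map[OF g \<tau>, of 0] fibre_map_cell(2)[OF g \<tau>, of 0] one by simp
next
  case (10 g f i j)
  then have f: "f \<in> hom (Base C) (Dom (Base C) f) (Dom (Base C) g)" and g: "g \<in> hom (Base C) (Dom (Base C) g) (Cod (Base C) g)"
    by (simp_all add: composable_def hom_def)
  then have i: "i < length (t (Chain (Cod (Base C) g) []))" using 10 hom_Obj[OF g] by simp
  have j: "j < fin_fib (crd_map C t \<beta> g) i" using 10 g by (simp add: hom_def)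
  have e: "fin_eps (crd_map C t \<beta> g) i j < length (t (Chain (Dom (Base C) g) []))"
    using fin_eps_mem(1)[OF j] crd_map[OF g] by simp
  have j': "j < length (t (Chain (fibre C t g i) []))" using fibre_cell(3)[OF g i] j by simp
  show ?case
    using opcat_of_fib_map[OF f g i] opcat_of_fib_obj[OF fibre_map_cell(3)[OF f g i] j'] opcat_of_fib_obj[OF f e]
      crd_comp(3)[OF f g i j] g by (simp add: hom_def)
next
  case (11 g f i j h)
  then have f: "f \<in> hom (Base C) (Dom (Base C) f) (Dom (Base C) g)" and g: "g \<in> hom (Base C) (Dom (Base C) g) (Cod (Base C) g)"
    and h: "h \<in> hom (Base C) (Dom (Base C) h) (Dom (Base C) f)"
    by (simp_all add: composable_def hom_def)
  then have i: "i < length (t (Chain (Cod (Base C) g) []))" using 11 hom_Obj[OF g] by simp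
  have j: "j < fin_fib (crd_map C t \<beta> g) i" using 11 g by (simp add: hom_def)
  have e: "fin_eps (crd_map C t \<beta> g) i j < length (t (Chain (Dom (Base C) g) []))"
    using fin_eps_mem(1)[OF j] crd_map[OF g] by simp
  have j': "j < length (t (Chain (fibre C t g i) []))" using fibre_cell(3)[OF g i] j by simp
  note gf = hom_comp[OF g_cat f g]
  show ?case
    using opcat_of_fib_map[OF f g i] opcat_of_fib_map[OF h gf i]
      opcat_of_fib_map[OF fibre_map_cell(3)[OF h gf i] fibre_map_cell(3)[OF f g i] j'] opcat_of_fib_map[OF h f e]
      fibre_map_fibre_map[OF h f g i j] g by (simp add: hom_def)
qed

text \<open>With at least two arrows, the chain without its last arrow and the chain without its
  first together still contain the source and every arrow.\<close>

lemma cell_eq_if_faces_eq: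
  assumes "p \<in> cells K (Suc (Suc (Suc r)))" "q \<in> cells K (Suc (Suc (Suc r)))"
    and "cell_face C 0 p = cell_face C 0 q" "cell_face C (Suc (Suc r)) p = cell_face C (Suc (Suc r)) q"
  shows "p = q"
proof -
  obtain x gs where p: "p = Chain x gs" "length gs = Suc (Suc r)" using assms(1) by (cases rule: cellsE) auto
  obtain y hs where q: "q = Chain y hs" "length hs = Suc (Suc r)" using assms(2) by (cases rule: cellsE) auto
  obtain a b gs' where g: "gs = a # b # gs'" using p(2) by (auto simp: length_Suc_conv)
  obtain c d hs' where h: "hs = c # d # hs'" using q(2) by (auto simp: length_Suc_conv)
  show ?thesis using assms(3,4) p q by (simp add: g h)
qed

text \<open>Up to two arrows the claim holds by construction. Beyond that, both top faces commute
  with \<open>d_0\<close> and with the last of the lower faces, and the entries are long enough to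
  be determined by these faces.\<close>

lemma top_face_opcat_of:
  "\<sigma> \<in> cells (Base C) (Suc n) \<Longrightarrow> top_face (opcat_of C t \<beta>) \<sigma> = t \<sigma>"
proof (induction n arbitrary: \<sigma> rule: less_induct)
  case (less n)
  let ?P = "opcat_of C t \<beta>"
  note P = is_opcat_of
  from less.prems obtain x gs where \<sigma>: "\<sigma> = Chain x gs" and p: "is_path (Base C) x gs" and l: "length gs = n"
    by (cases rule: cellsE) auto
  have v: "vertex (Base C) x gs (length gs) \<in> Obj (Base C)" using vertex_Obj[OF g_cat p, of "length gs"] by simp
  have len: "length (top_face ?P \<sigma>) = length (t \<sigma>)"
    using top_face_length[OF P, of x gs] t_length[OF p] v by (simp add: \<sigma> del: vertex_simps top_face.simps)
  show ?case
  proof (rule nth_equalityI[OF len])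
    fix i assume "i < length (top_face ?P \<sigma>)"
    then have i: "i < length (t \<sigma>)" using len by simp
    consider "n = 0" | "n = 1" | "n = 2" | r where "n = Suc (Suc (Suc r))"
      by (metis One_nat_def numeral_2_eq_2 old.nat.exhaust)
    then show "top_face ?P \<sigma> ! i = t \<sigma> ! i"
    proof cases
      case 1
      then have gs: "gs = []" and x: "x \<in> Obj (Base C)" using l p by auto
      have R: "Chain x [] \<in> cells (Base C) (Suc 0)" using x by simp
      have i': "i < length (t (Chain x []))" using i by (simp add: \<sigma> gs)
      obtain c where c: "t (Chain x []) ! i = Cpt c" "c \<in> pi0 (Base C)"
        using g_mem[OF R i'] by (cases rule: cellsE) auto
      note I = hom_ident[OF g_cat x]
      have "t (Chain x [Ident (Base C) x]) = map (cell_degen C 0) (t (Chain x []))" using g_degen[OF R, of 0] by simp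
      \<comment> \<open>The nerve lists components of fibres of the identity. The fibre is the
        chosen terminal of the component \<open>c\<close>, so passing to its component returns
        \<open>c\<close>.\<close>
      then have "fibre C t (Ident (Base C) x) i = Lt C c" using fibre_cell(1)[OF I i'] i' c by simp
      then show ?thesis
        using opcat_of_fib_obj[OF I i'] is_ltcat_Lt(2)[OF C c(2)] i' c x by (simp add: \<sigma> gs)
    next
      case 2
      then obtain g where gs: "gs = [g]" using l by (auto simp: length_Suc_conv)
      then have g: "g \<in> hom (Base C) x (Cod (Base C) g)" using p by (simp add: hom_def)
      have i': "i < length (t (Chain (Cod (Base C) g) []))" using i t_length[OF p] by (simp add: \<sigma> gs)
      then show ?thesis
        using opcat_of_fib_obj[OF g i'] fibre_cell(1)[OF g i'] hom_Obj[OF g] by (simp add: \<sigma> gs fib_chain_def)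
    next
      case 3
      then obtain f g where gs: "gs = [f, g]" using l by (auto simp: length_Suc_conv numeral_2_eq_2)
      then have f: "f \<in> hom (Base C) x (Cod (Base C) f)" and g: "g \<in> hom (Base C) (Cod (Base C) f) (Cod (Base C) g)"
        using p by (simp_all add: hom_def)
      have i': "i < length (t (Chain (Cod (Base C) g) []))" using i t_length[OF p] by (simp add: \<sigma> gs)
      then show ?thesis
        using opcat_of_fib_obj[OF hom_comp[OF g_cat f g] i'] opcat_of_fib_map[OF f g i'] fibre_map_cell(2)[OF f g i'] hom_Obj[OF g]
        by (simp add: \<sigma> gs fib_chain_def)
    next
      case 4
      have s: "\<sigma> \<in> cells (Base C) (Suc (Suc (Suc (Suc r))))" using less.prems 4 by simp
      show ?thesis
      proof (rule cell_eq_if_faces_eq)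
        show "t \<sigma> ! i \<in> cells (Base C) (Suc (Suc (Suc r)))" by (rule g_mem[OF s i])
        have "top_face ?P \<sigma> \<in> lists (cells (Base C) (Suc (Suc (Suc r))))" using top_face_cells[OF P, of \<sigma>] s by simp
        then show "top_face ?P \<sigma> ! i \<in> cells (Base C) (Suc (Suc (Suc r)))"
          using nth_mem[of i "top_face ?P \<sigma>"] i len by (auto simp del: top_face.simps)
        \<comment> \<open>The induction hypothesis applies to the face, which has one arrow
          fewer.\<close>
        have "cell_face C j (top_face ?P \<sigma> ! i) = cell_face C j (t \<sigma> ! i)" if j: "j \<le> Suc (Suc r)" for j
        proof -
          have "cell_face C j \<sigma> \<in> cells (Base C) (Suc (Suc (Suc r)))" using cell_face_cells[OF C s, of j] j by simp
          then have "top_face ?P (cell_face C j \<sigma>) = t (cell_face C j \<sigma>)" using less.IH[of "Suc (Suc r)"] 4 by simp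
          then have "map (cell_face C j) (top_face ?P \<sigma>) = map (cell_face C j) (t \<sigma>)"
            using top_face_face[OF P, of \<sigma> "Suc (Suc r)" j] g_face[OF s j] s j by simp
          then show ?thesis using i len by (metis nth_map)
        qed
        then show "cell_face C 0 (top_face ?P \<sigma> ! i) = cell_face C 0 (t \<sigma> ! i)"
          "cell_face C (Suc (Suc r)) (top_face ?P \<sigma> ! i) = cell_face C (Suc (Suc r)) (t \<sigma> ! i)" by simp_all
      qed
    qed
  qed
qed

lemma opd_beta_opcat_of:
  assumes "\<sigma> \<in> cells (Base C) (Suc (Suc r))"
  shows "opd_beta (opcat_of C t \<beta>) r \<sigma> = \<beta> r \<sigma>"
  using assms
proof (cases rule: cellsE)
  case (Chain x gs)
  then have l: "length gs = Suc r" by simp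
  then have "gs ! r \<in> Arr (Base C)" using path_nth[OF g_cat Chain(3), of r] by (simp add: hom_def)
  then show ?thesis
    using beta_last[OF Chain(3) l] last_arrow_eq[OF l, of x] by (simp add: opd_beta_def Chain(1) del: last_arrow.simps)
qed simp

lemma nopd_obj_opcat_of: "nopd_obj (opcat_of C t \<beta>) = top_ps C t \<beta>"
  using nopd_obj_eq[OF is_opcat_of] top_ps_cong[OF C typed top_face_opcat_of opd_beta_opcat_of] by simp

end

text \<open>Everything in the record can be read off the nerve: cardinalities of objects from
  lengths, of arrows by \<open>fin_eq_if_pi_eq\<close>, fibres and fibre maps from chains with one
  and two arrows. Outside the domain both records hold \<open>undefined\<close>.\<close>

lemma opcat_eqI:
  assumes P: "is_opcat P" and Q: "is_opcat Q" and u: "Und P = Und Q" and n: "nopd_obj P = nopd_obj Q"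
  shows "P = Q"
proof -
  let ?C = "Und Q"
  note C = opcat_ltcat[OF Q] and cat = opcat_category[OF Q]
  note TP = top_typed_opcat[OF P, unfolded u] and TQ = top_typed_opcat[OF Q]
  have X: "top_ps ?C (top_face P) (opd_beta P) = top_ps ?C (top_face Q) (opd_beta Q)"
    using n nopd_obj_eq[OF P] nopd_obj_eq[OF Q] u by simp
  have t: "top_face P \<sigma> = top_face Q \<sigma>" if "\<sigma> \<in> cells (Base ?C) (Suc n)" for \<sigma> n
  proof -
    have "PD (top_ps ?C (top_face P) (opd_beta P)) (Suc n) (Suc n) = PD (top_ps ?C (top_face Q) (opd_beta Q)) (Suc n) (Suc n)"
      by (simp only: X)
    then show ?thesis
      using that ext_arr_eq_iff[OF t_mem[OF C TP] t_mem[OF C TQ], of n] by (simp add: TX_PD[OF C TP] TX_PD[OF C TQ])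
  qed
  have b: "opd_beta P r \<sigma> = opd_beta Q r \<sigma>" if "\<sigma> \<in> cells (Base ?C) (Suc (Suc r))" for \<sigma> r
  proof -
    have "PB (top_ps ?C (top_face P) (opd_beta P)) r [\<sigma>] = PB (top_ps ?C (top_face Q) (opd_beta Q)) r [\<sigma>]"
      by (simp only: X)
    then show ?thesis by (simp add: TX_PB_generator[OF C TP that] TX_PB_generator[OF C TQ that])
  qed
  have co: "fo (Crd P) x = fo (Crd Q) x" if "x \<in> Obj (Base ?C)" for x
    using arg_cong[OF t[of "Chain x []" 0], of length] that by simp
  have ca: "fa (Crd P) g = fa (Crd Q) g" if g: "g \<in> Arr (Base ?C)" for g
  proof (rule fin_eq_if_pi_eq)
    have s: "Chain (Dom (Base ?C) g) [g] \<in> cells (Base ?C) (Suc (Suc 0))"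
      using g by (simp add: category_ops[OF cat])
    show "fa (Crd P) g \<in> Arr FinOrd" "fa (Crd Q) g \<in> Arr FinOrd" using crd_Arr(1)[OF P] crd_Arr(1)[OF Q] g u by simp_all
    show "fin_pi (fa (Crd P) g) = fin_pi (fa (Crd Q) g)" using b[OF s] by (simp add: opd_beta_def)
    have "map (\<lambda>p. length (top_face P p)) (top_face Q (Chain (Dom (Base ?C) g) [g]))
        = map (\<lambda>p. length (top_face Q p)) (top_face Q (Chain (Dom (Base ?C) g) [g]))"
      using t[of _ 0] top_face_cells[OF Q s] by (intro map_cong) (auto simp del: top_face.simps)
    then show "fibs (fa (Crd P) g) = fibs (fa (Crd Q) g)"
      using lens_top_face[OF P, of "Dom (Base ?C) g" "[g]" 0] lens_top_face[OF Q, of "Dom (Base ?C) g" "[g]" 0] s u t[OF s]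
      by (simp del: top_face.simps map_eq_conv)
  qed
  have c: "Crd P = Crd Q"
    by (rule fctr_eqI[OF opcat_Crd[OF P, unfolded u] opcat_Crd[OF Q]]) (simp_all add: co ca)
  have "Fib P R i = Fib Q R i" for R i
  proof (cases "R \<in> Obj (Base ?C) \<and> i < fo (Crd Q) R")
    case False
    then show ?thesis using opcat_Fib(2)[OF P, of R i] opcat_Fib(2)[OF Q, of R i] u c by simp
  next
    case True
    then have R: "R \<in> Obj (Base ?C)" and i: "i < fo (Crd Q) R" by auto
    have FP: "is_fctr (slice (Base ?C) R) (Base ?C) (Fib P R i)" and FQ: "is_fctr (slice (Base ?C) R) (Base ?C) (Fib Q R i)"
      using opcat_Fib(1)[OF P, of R i] opcat_Fib(1)[OF Q, of R i] u c True by simp_all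
    show ?thesis
    proof (rule fctr_eqI[OF FP FQ])
      fix g assume "g \<in> Obj (slice (Base ?C) R)"
      then have g: "g \<in> Arr (Base ?C)" "Cod (Base ?C) g = R" by simp_all
      have s: "Chain (Dom (Base ?C) g) [g] \<in> cells (Base ?C) (Suc (Suc 0))"
        using g R by (simp add: category_ops[OF cat])
      show "fo (Fib P R i) g = fo (Fib Q R i) g"
        using arg_cong[OF t[OF s], of "\<lambda>xs. xs ! i"] i g u c by (simp add: fib_chain_def fib_obj_def)
    next
      fix a assume "a \<in> Arr (slice (Base ?C) R)"
      then obtain f g where a: "a = (f, g)" "g \<in> Arr (Base ?C)" "Cod (Base ?C) g = R" "f \<in> Arr (Base ?C)" "Dom (Base ?C) g = Cod (Base ?C) f"
        by (cases a) simp
      have s: "Chain (Dom (Base ?C) f) [f, g] \<in> cells (Base ?C) (Suc (Suc (Suc 0)))"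
        using a R by (simp add: category_ops[OF cat])
      show "fa (Fib P R i) a = fa (Fib Q R i) a"
        using arg_cong[OF t[OF s], of "\<lambda>xs. xs ! i"] i a u c by (simp add: fib_chain_def fib_map_def)
    qed
  qed
  then have "Fib P = Fib Q" by (intro ext)
  then show ?thesis using u c by (cases P; cases Q) simp
qed

section \<open>Operadic functors\<close>

lemma op_fctr_ops:
  assumes "op_fctr P Q F"
  shows "lt_fctr (Und P) (Und Q) F" "fcomp (OBase P) (Crd Q) F = Crd P"
    "g \<in> Arr (OBase P) \<Longrightarrow> i < fo (Crd P) (Cod (OBase P) g) \<Longrightarrow> fo F (fib_obj P g i) = fib_obj Q (fa F g) i"
    "composable (OBase P) g f \<Longrightarrow> i < fo (Crd P) (Cod (OBase P) g) \<Longrightarrow>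
       fa F (fib_map P f g i) = fib_map Q (fa F f) (fa F g) i"
    "x \<in> Obj (OBase P) \<Longrightarrow> fo (Crd Q) (fo F x) = fo (Crd P) x"
    "g \<in> Arr (OBase P) \<Longrightarrow> fa (Crd Q) (fa F g) = fa (Crd P) g"
proof -
  show c: "fcomp (OBase P) (Crd Q) F = Crd P" and "lt_fctr (Und P) (Und Q) F"
    using assms by (simp_all add: op_fctr_def)
  show "x \<in> Obj (OBase P) \<Longrightarrow> fo (Crd Q) (fo F x) = fo (Crd P) x"
    "g \<in> Arr (OBase P) \<Longrightarrow> fa (Crd Q) (fa F g) = fa (Crd P) g"
    by (simp_all flip: c)
qed (use assms in \<open>simp_all add: op_fctr_def\<close>)

context
  fixes P Q :: "('o, 'm) opcat" and F
  assumes P: "is_opcat P" and Q: "is_opcat Q" and F: "lt_fctr (Und P) (Und Q) F"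
begin

lemmas o_C = opcat_category[OF P] and o_D = opcat_category[OF Q] and o_F = ltF[OF opcat_ltcat[OF P] opcat_ltcat[OF Q] F]

lemma op_fctr_fib_chain:
  assumes O: "op_fctr P Q F" and p: "is_path (OBase P) x gs" and ne: "gs \<noteq> []"
    and i: "i < fo (Crd P) (vertex (OBase P) x gs (length gs))"
  shows "fib_chain Q (map (fa F) gs) i = cell_map (OBase Q) F (fib_chain P gs i)"
proof -
  note p' = is_path_map[OF o_F o_C o_D p]
  have v: "vertex (OBase P) x gs (length gs) \<in> Obj (OBase P)" using vertex_Obj[OF o_C p, of "length gs"] by simp
  have i': "i < fo (Crd Q) (vertex (OBase Q) (fo F x) (map (fa F) gs) (length (map (fa F) gs)))"
    using i vertex_map[OF o_F o_C p, of "length gs"] op_fctr_ops(5)[OF O v] by (simp del: vertex_simps)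
  have ne': "map (fa F) gs \<noteq> []" using ne by simp
  have s: "seg (OBase P) x gs a (length gs) \<in> hom (OBase P) (vertex (OBase P) x gs a) (vertex (OBase P) x gs (length gs))"
    if "a \<le> length gs" for a
    by (rule seg_top_hom[OF P p ne i that])
  have sm: "seg (OBase Q) (fo F x) (map (fa F) gs) a (length gs) = fa F (seg (OBase P) x gs a (length gs))"
    if "a \<le> length gs" for a
    using seg_map[OF o_F o_C p that] by simp
  have "fib_source Q (fo F x) (map (fa F) gs) i = fo F (fib_source P x gs i)"
    using sm[of 0] op_fctr_ops(3)[OF O, of "seg (OBase P) x gs 0 (length gs)" i] s[of 0] i
    by (simp add: fib_source_def hom_def del: seg.simps)
  moreover have "fib_edges Q (fo F x) (map (fa F) gs) i = map (fa F) (fib_edges P x gs i)"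
  proof (rule nth_equalityI)
    fix a assume "a < length (fib_edges Q (fo F x) (map (fa F) gs) i)"
    then have a: "Suc a < length gs" by (simp add: fib_length)
    have g: "gs ! a \<in> hom (OBase P) (vertex (OBase P) x gs a) (vertex (OBase P) x gs (Suc a))"
      using path_nth[OF o_C p, of a] a by (simp del: vertex_simps)
    have "Cod (OBase P) (seg (OBase P) x gs (Suc a) (length gs)) = vertex (OBase P) x gs (length gs)"
      using s[of "Suc a"] a by (simp add: hom_def del: seg.simps vertex_simps)
    then show "fib_edges Q (fo F x) (map (fa F) gs) i ! a = map (fa F) (fib_edges P x gs i) ! a"
      using a sm[of "Suc a"] op_fctr_ops(4)[OF O composable_hom[OF g s[of "Suc a"]], of i] i
      by (simp add: fib_edges_nth fib_length del: seg.simps vertex_simps)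
  qed (simp add: fib_length)
  ultimately show ?thesis
    by (simp add: fib_chain_eq[OF P p ne i] fib_chain_eq[OF Q p' ne' i'])
qed

lemma op_fctr_top_face:
  assumes O: "op_fctr P Q F" and s: "\<sigma> \<in> cells (OBase P) (Suc n)"
  shows "top_face Q (cell_map (OBase Q) F \<sigma>) = map (cell_map (OBase Q) F) (top_face P \<sigma>)"
  using s
proof (cases rule: cellsE)
  case (Chain x gs)
  have v: "vertex (OBase P) x gs (length gs) \<in> Obj (OBase P)" using vertex_Obj[OF o_C Chain(3), of "length gs"] by simp
  have n: "fo (Crd Q) (vertex (OBase Q) (fo F x) (map (fa F) gs) (length gs)) = fo (Crd P) (vertex (OBase P) x gs (length gs))"
    using vertex_map[OF o_F o_C Chain(3), of "length gs"] op_fctr_ops(5)[OF O v] by (simp del: vertex_simps)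
  show ?thesis
  proof (cases "gs = []")
    case True
    then have x: "x \<in> Obj (OBase P)" using v by simp
    have I: "Ident (OBase P) x \<in> Arr (OBase P)" "Cod (OBase P) (Ident (OBase P) x) = x" using category_ops[OF o_C] x by simp_all
    have "cpt (OBase Q) (fib_obj Q (Ident (OBase Q) (fo F x)) i) = pi0_map (OBase Q) F (cpt (OBase P) (fib_obj P (Ident (OBase P) x) i))"
      if i: "i < fo (Crd P) x" for i
      using pi0_map_cpt[OF o_F o_C o_D fib_obj_Obj[OF P I(1), of i]] op_fctr_ops(3)[OF O I(1), of i] is_fctr_ops(5)[OF o_F x] i I(2)
      by simp
    then show ?thesis using Chain True n by simp
  next
    case False
    have "map (fib_chain Q (map (fa F) gs)) [0..<fo (Crd P) (vertex (OBase P) x gs (length gs))]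
        = map (\<lambda>i. cell_map (OBase Q) F (fib_chain P gs i)) [0..<fo (Crd P) (vertex (OBase P) x gs (length gs))]"
      using op_fctr_fib_chain[OF O Chain(3) False] by simp
    then show ?thesis
      using top_face_Chain[OF P False, of x] top_face_Chain[OF Q, of "map (fa F) gs" "fo F x"] n False
      by (simp add: Chain(1) comp_def del: top_face.simps vertex_simps map_eq_conv)
  qed
qed simp

lemma op_fctr_opd_beta:
  assumes O: "op_fctr P Q F" and s: "\<sigma> \<in> cells (OBase P) (Suc (Suc r))"
  shows "opd_beta Q r (cell_map (OBase Q) F \<sigma>) = opd_beta P r \<sigma>"
  using s
proof (cases rule: cellsE)
  case (Chain x gs)
  then have l: "length gs = Suc r" by simp
  then have "gs ! r \<in> Arr (OBase P)" using path_nth[OF o_C Chain(3), of r] by (simp add: hom_def)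
  then show ?thesis
    using op_fctr_ops(6)[OF O] last_arrow_eq[OF l, of x] last_arrow_eq[of "map (fa F) gs" r "fo F x"] l
    by (simp add: opd_beta_def Chain(1) del: last_arrow.simps)
qed simp

text \<open>Only objects, single arrows and composable pairs are inspected; the cardinality of an
  arrow is compared through its block sizes and its \<open>fin_pi\<close>.\<close>

lemma op_fctrI:
  assumes T: "\<And>n \<sigma>. \<sigma> \<in> cells (OBase P) (Suc n) \<Longrightarrow>
      top_face Q (cell_map (OBase Q) F \<sigma>) = map (cell_map (OBase Q) F) (top_face P \<sigma>)"
    and B: "\<And>r \<sigma>. \<sigma> \<in> cells (OBase P) (Suc (Suc r)) \<Longrightarrow> opd_beta Q r (cell_map (OBase Q) F \<sigma>) = opd_beta P r \<sigma>"
  shows "op_fctr P Q F"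
proof -
  have co: "fo (Crd Q) (fo F x) = fo (Crd P) x" if "x \<in> Obj (OBase P)" for x
    using arg_cong[OF T[of "Chain x []" 0], of length] that by simp
  have s: "Chain (Dom (OBase P) g) [g] \<in> cells (OBase P) (Suc (Suc 0))" if "g \<in> Arr (OBase P)" for g
    using that by (simp add: category_ops[OF o_C])
  have ca: "fa (Crd Q) (fa F g) = fa (Crd P) g" if g: "g \<in> Arr (OBase P)" for g
  proof (rule fin_eq_if_pi_eq)
    let ?x = "Dom (OBase P) g"
    have p: "is_path (OBase P) ?x [g]" using s[OF g] by simp
    note p' = is_path_map[OF o_F o_C o_D p]
    show "fa (Crd Q) (fa F g) \<in> Arr FinOrd" "fa (Crd P) g \<in> Arr FinOrd"
      using crd_Arr(1)[OF P g] crd_Arr(1)[OF Q is_fctr_ops(2)[OF o_F g]] by simp_all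
    show "fin_pi (fa (Crd Q) (fa F g)) = fin_pi (fa (Crd P) g)" using B[OF s[OF g]] by (simp add: opd_beta_def)
    have "fibs (fa (Crd Q) (fa F g)) = lens (top_face Q) (top_face Q (cell_map (OBase Q) F (Chain ?x [g])))"
      using lens_top_face[OF Q p', of 0] by (simp del: top_face.simps)
    also have "\<dots> = map (\<lambda>p. length (top_face Q (cell_map (OBase Q) F p))) (top_face P (Chain ?x [g]))"
      unfolding T[OF s[OF g]] by (simp add: comp_def del: top_face.simps)
    also have "\<dots> = lens (top_face P) (top_face P (Chain ?x [g]))"
      using T[of _ 0] top_face_cells[OF P s[OF g]] by (intro map_cong) (auto simp del: top_face.simps)
    also have "\<dots> = fibs (fa (Crd P) g)" using lens_top_face[OF P p, of 0] by (simp del: top_face.simps)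
    finally show "fibs (fa (Crd Q) (fa F g)) = fibs (fa (Crd P) g)" .
  qed
  have "fcomp (OBase P) (Crd Q) F = Crd P"
    by (rule fctr_eqI[OF is_fctr_fcomp[OF o_C o_F opcat_Crd[OF Q]] opcat_Crd[OF P]]) (simp_all add: co ca)
  moreover have "fo F (fib_obj P g i) = fib_obj Q (fa F g) i"
    if g: "g \<in> Arr (OBase P)" and i: "i < fo (Crd P) (Cod (OBase P) g)" for g i
    using arg_cong[OF T[OF s[OF g]], of "\<lambda>xs. xs ! i"] i co[of "Cod (OBase P) g"] g
      is_fctr_ops(4)[OF o_F g] category_ops(2)[OF o_C g]
    by (simp add: fib_chain_def)
  moreover have "fa F (fib_map P f g i) = fib_map Q (fa F f) (fa F g) i"
    if gf: "composable (OBase P) g f" and i: "i < fo (Crd P) (Cod (OBase P) g)" for f g i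
  proof -
    have g: "g \<in> Arr (OBase P)" and "f \<in> Arr (OBase P)" "Dom (OBase P) g = Cod (OBase P) f"
      using gf by (auto simp: composable_def)
    then have "Chain (Dom (OBase P) f) [f, g] \<in> cells (OBase P) (Suc (Suc (Suc 0)))"
      by (simp add: category_ops[OF o_C])
    from arg_cong[OF T[OF this], of "\<lambda>xs. xs ! i"] show ?thesis
      using i co[of "Cod (OBase P) g"] is_fctr_ops(4)[OF o_F g] category_ops(2)[OF o_C g]
      by (simp add: fib_chain_def)
  qed
  ultimately show ?thesis using F unfolding op_fctr_def by blast
qed

text \<open>One direction makes the nerve well defined on arrows; the other gives joint surjectivity
  on arrows in the pullback.\<close>

lemma topps_map_opcat_iff:
  "topps_map (nopd_obj P) (nopd_obj Q)
     (\<lambda>n. ext_arr (cells (OBase P) n) (\<lambda>\<sigma>. [cell_map (OBase Q) F \<sigma>]) (cells (OBase Q) n)) \<longleftrightarrow> op_fctr P Q F"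
  unfolding nopd_obj_eq[OF P] nopd_obj_eq[OF Q]
    topps_map_top_ps[OF opcat_ltcat[OF P] top_typed_opcat[OF P] opcat_ltcat[OF Q] top_typed_opcat[OF Q] F]
  using op_fctrI op_fctr_top_face op_fctr_opd_beta by blast

end

section \<open>The square of functors\<close>

lemma category_OpCat: "category OpCat"
  unfolding OpCat_def
proof (rule category_mk_cat)
  fix P :: "('o, 'm) opcat" assume "P \<in> {P. is_opcat P}"
  then have P: "is_opcat P" by simp
  note C = opcat_category[OF P]
  have "lt_fctr (Und P) (Und P) (fid (OBase P))"
    using category_ops(3)[OF category_CatLt, of "Und P"] opcat_ltcat[OF P] by (simp add: CatLt_Arr)
  then show "fid (OBase P) \<in> {F. op_fctr P P F}"
    using fcomp_fid[OF C opcat_Crd[OF P]] fib_obj_Obj[OF P] fib_map_hom[OF P]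
    by (auto simp: op_fctr_def composable_def hom_def)
next
  fix P Q R :: "('o, 'm) opcat" and F G
  assume "P \<in> {P. is_opcat P}" "Q \<in> {P. is_opcat P}" "R \<in> {P. is_opcat P}"
    and "F \<in> {F. op_fctr P Q F}" "G \<in> {F. op_fctr Q R F}"
  then have P: "is_opcat P" and Q: "is_opcat Q" and R: "is_opcat R" and F: "op_fctr P Q F" and G: "op_fctr Q R G"
    by auto
  note C = opcat_category[OF P] and O = op_fctr_ops[OF F] and O' = op_fctr_ops[OF G]
  note f = ltF[OF opcat_ltcat[OF P] opcat_ltcat[OF Q] O(1)]
  have "lt_fctr (Und P) (Und R) (fcomp (OBase P) G F)"
    using category_ops(6)[OF category_CatLt, of "(Und Q, G, Und R)" "(Und P, F, Und Q)"]
      opcat_ltcat[OF P] opcat_ltcat[OF Q] opcat_ltcat[OF R] O(1) O'(1) by (simp add: CatLt_Arr)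
  moreover have "fcomp (OBase P) (Crd R) (fcomp (OBase P) G F) = Crd P"
    using fcomp_assoc[OF f] O(2) O'(2) by metis
  moreover have "fo (fcomp (OBase P) G F) (fib_obj P h i) = fib_obj R (fa (fcomp (OBase P) G F) h) i"
    if h: "h \<in> Arr (OBase P)" and i: "i < fo (Crd P) (Cod (OBase P) h)" for h i
    using fib_obj_Obj[OF P h i] O(3)[OF h i] O'(3)[of "fa F h" i] O(5)[of "Cod (OBase P) h"] h i
    by (simp add: is_fctr_ops[OF f] category_ops[OF C])
  moreover have "fa (fcomp (OBase P) G F) (fib_map P k h i) = fib_map R (fa (fcomp (OBase P) G F) k) (fa (fcomp (OBase P) G F) h) i"
    if hk: "composable (OBase P) h k" and i: "i < fo (Crd P) (Cod (OBase P) h)" for h k i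
  proof -
    have h: "h \<in> Arr (OBase P)" "k \<in> Arr (OBase P)" "Dom (OBase P) h = Cod (OBase P) k" using hk by (auto simp: composable_def)
    then have "fib_map P k h i \<in> Arr (OBase P)"
      using fib_map_hom[OF P, of k "Dom (OBase P) k" "Dom (OBase P) h" h "Cod (OBase P) h" i] i by (simp add: hom_def)
    moreover have "composable (OBase Q) (fa F h) (fa F k)" using h by (simp add: composable_def is_fctr_ops[OF f])
    ultimately show ?thesis
      using O(4)[OF hk i] O'(4)[of "fa F h" "fa F k" i] O(5)[of "Cod (OBase P) h"] h i
      by (simp add: is_fctr_ops[OF f] category_ops[OF C])
  qed
  ultimately show "fcomp (OBase P) G F \<in> {F. op_fctr P R F}" by (simp add: op_fctr_def)
next
  fix P Q :: "('o, 'm) opcat" and F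
  assume "P \<in> {P. is_opcat P}" "Q \<in> {P. is_opcat P}" "F \<in> {F. op_fctr P Q F}"
  then have "is_opcat P" "is_opcat Q" "is_fctr (OBase P) (OBase Q) F"
    by (auto simp: op_fctr_def lt_fctr_def)
  then show "fcomp (OBase P) F (fid (OBase P)) = F \<and> fcomp (OBase P) (fid (OBase Q)) F = F"
    using fcomp_fid fid_fcomp opcat_category by metis
next
  fix P Q R S :: "('o, 'm) opcat" and F G H
  assume "F \<in> {F. op_fctr P Q F}"
  then have "is_fctr (OBase P) (OBase Q) F" by (auto simp: op_fctr_def lt_fctr_def)
  then show "fcomp (OBase P) H (fcomp (OBase P) G F) = fcomp (OBase P) (fcomp (OBase Q) H G) F"
    by (rule fcomp_assoc)
qed

lemma OpCat_Obj [simp]: "Obj OpCat = {P. is_opcat P}"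
  by (simp add: OpCat_def)

lemma OpCat_Arr: "(P, F, Q) \<in> Arr OpCat \<longleftrightarrow> is_opcat P \<and> is_opcat Q \<and> op_fctr P Q F"
  by (simp add: OpCat_def)

lemma OpCat_ops [simp]:
  "(P, F, Q) \<in> Arr OpCat \<Longrightarrow> Dom OpCat (P, F, Q) = P"
  "(P, F, Q) \<in> Arr OpCat \<Longrightarrow> Cod OpCat (P, F, Q) = Q"
  "is_opcat P \<Longrightarrow> Ident OpCat P = (P, fid (OBase P), P)"
  "(P, F, Q) \<in> Arr OpCat \<Longrightarrow> (Q, G, R) \<in> Arr OpCat \<Longrightarrow>
     Comp OpCat (Q, G, R) (P, F, Q) = (P, fcomp (OBase P) G F, R)"
  unfolding OpCat_def by (simp_all only: mk_cat_ops mem_Collect_eq)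

lemma OpCat_ArrE:
  assumes "u \<in> Arr OpCat"
  obtains P F Q where "u = (P, F, Q)" "is_opcat P" "is_opcat Q" "op_fctr P Q F"
  using assms unfolding OpCat_def by (auto elim: mk_cat_ArrE)

section \<open>The category of top-pseudo-simplicial objects and the functor
  \<open>UStar\<close>\<close>

lemma topps_ops:
  assumes "is_topps X"
  shows "PLev X n \<in> Obj SMGp" "1 \<le> n \<Longrightarrow> i \<le> n \<Longrightarrow> PD X n i \<in> hom SMGp (PLev X n) (PLev X (n - 1))"
    "i \<le> n \<Longrightarrow> PS X n i \<in> hom SMGp (PLev X n) (PLev X (n + 1))" "\<not> i \<le> n \<Longrightarrow> PS X n i = undefined"
    "x \<in> PObj X (r + 2) \<Longrightarrow> PB X r x \<in> Arr (Gpd (PLev X r))"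
    "i < j \<Longrightarrow> j \<le> r + 2 \<Longrightarrow> \<not> (i = r + 1 \<and> j = r + 2) \<Longrightarrow>
        Comp SMGp (PD X (r + 1) i) (PD X (r + 2) j) = Comp SMGp (PD X (r + 1) (j - 1)) (PD X (r + 2) i)"
    "i \<le> j \<Longrightarrow> j \<le> n \<Longrightarrow> Comp SMGp (PS X (n + 1) i) (PS X n j) = Comp SMGp (PS X (n + 1) (j + 1)) (PS X n i)"
    "i < j \<Longrightarrow> j \<le> n \<Longrightarrow> Comp SMGp (PD X (n + 1) i) (PS X n j) = Comp SMGp (PS X (n - 1) (j - 1)) (PD X n i)"
    "i = j \<or> i = j + 1 \<Longrightarrow> j \<le> n \<Longrightarrow> Comp SMGp (PD X (n + 1) i) (PS X n j) = Ident SMGp (PLev X n)"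
    "j + 1 < i \<Longrightarrow> i \<le> n + 1 \<Longrightarrow> Comp SMGp (PD X (n + 1) i) (PS X n j) = Comp SMGp (PS X (n - 1) j) (PD X n (i - 1))"
proof -
  have *: "\<forall>n. PLev X n \<in> Obj SMGp"
    "\<forall>n i. if 1 \<le> n \<and> i \<le> n then PD X n i \<in> hom SMGp (PLev X n) (PLev X (n - 1)) else PD X n i = undefined"
    "\<forall>n i. if i \<le> n then PS X n i \<in> hom SMGp (PLev X n) (PLev X (n + 1)) else PS X n i = undefined"
    "\<forall>r i j. i < j \<and> j \<le> r + 2 \<and> \<not> (i = r + 1 \<and> j = r + 2) \<longrightarrow>
        Comp SMGp (PD X (r + 1) i) (PD X (r + 2) j) = Comp SMGp (PD X (r + 1) (j - 1)) (PD X (r + 2) i)"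
    "\<forall>n i j. i \<le> j \<and> j \<le> n \<longrightarrow>
        Comp SMGp (PS X (n + 1) i) (PS X n j) = Comp SMGp (PS X (n + 1) (j + 1)) (PS X n i)"
    "\<forall>n i j. i < j \<and> j \<le> n \<longrightarrow>
        Comp SMGp (PD X (n + 1) i) (PS X n j) = Comp SMGp (PS X (n - 1) (j - 1)) (PD X n i)"
    "\<forall>n i j. (i = j \<or> i = j + 1) \<and> j \<le> n \<longrightarrow>
        Comp SMGp (PD X (n + 1) i) (PS X n j) = Ident SMGp (PLev X n)"
    "\<forall>n i j. j + 1 < i \<and> i \<le> n + 1 \<longrightarrow>
        Comp SMGp (PD X (n + 1) i) (PS X n j) = Comp SMGp (PS X (n - 1) j) (PD X n (i - 1))"
    and B: "\<forall>r. mon_trans (PLev X (r + 2)) (PLev X r)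
        (mor (Comp SMGp (PD X (r + 1) (r + 1)) (PD X (r + 2) (r + 1))))
        (mor (Comp SMGp (PD X (r + 1) (r + 1)) (PD X (r + 2) (r + 2)))) (PB X r)"
    using assms unfolding is_topps_def by - (elim conjE, assumption)+
  show "PLev X n \<in> Obj SMGp" using *(1) by blast
  show "1 \<le> n \<Longrightarrow> i \<le> n \<Longrightarrow> PD X n i \<in> hom SMGp (PLev X n) (PLev X (n - 1))" using *(2) by presburger
  show "i \<le> n \<Longrightarrow> PS X n i \<in> hom SMGp (PLev X n) (PLev X (n + 1))" using *(3) by presburger
  show "\<not> i \<le> n \<Longrightarrow> PS X n i = undefined" using *(3) by presburger
  show "x \<in> PObj X (r + 2) \<Longrightarrow> PB X r x \<in> Arr (Gpd (PLev X r))"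
    using mon_trans_ops(2)[OF spec[OF B], of x r] by (simp add: hom_def)
  show "i < j \<Longrightarrow> j \<le> r + 2 \<Longrightarrow> \<not> (i = r + 1 \<and> j = r + 2) \<Longrightarrow>
        Comp SMGp (PD X (r + 1) i) (PD X (r + 2) j) = Comp SMGp (PD X (r + 1) (j - 1)) (PD X (r + 2) i)"
    using *(4) by blast
  show "i \<le> j \<Longrightarrow> j \<le> n \<Longrightarrow> Comp SMGp (PS X (n + 1) i) (PS X n j) = Comp SMGp (PS X (n + 1) (j + 1)) (PS X n i)"
    using *(5) by blast
  show "i < j \<Longrightarrow> j \<le> n \<Longrightarrow> Comp SMGp (PD X (n + 1) i) (PS X n j) = Comp SMGp (PS X (n - 1) (j - 1)) (PD X n i)"
    using *(6) by blast
  show "i = j \<or> i = j + 1 \<Longrightarrow> j \<le> n \<Longrightarrow> Comp SMGp (PD X (n + 1) i) (PS X n j) = Ident SMGp (PLev X n)"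
    using *(7) by blast
  show "j + 1 < i \<Longrightarrow> i \<le> n + 1 \<Longrightarrow> Comp SMGp (PD X (n + 1) i) (PS X n j) = Comp SMGp (PS X (n - 1) j) (PD X n (i - 1))"
    using *(8) by blast
qed

lemma topps_map_ops:
  assumes "topps_map X Y h"
  shows "h n \<in> hom SMGp (PLev X n) (PLev Y n)"
    "1 \<le> n \<Longrightarrow> i \<le> n \<Longrightarrow> Comp SMGp (h (n - 1)) (PD X n i) = Comp SMGp (PD Y n i) (h n)"
    "i \<le> n \<Longrightarrow> Comp SMGp (h (n + 1)) (PS X n i) = Comp SMGp (PS Y n i) (h n)"
    "x \<in> PObj X (r + 2) \<Longrightarrow> fa (mor (h r)) (PB X r x) = PB Y r (fo (mor (h (r + 2))) x)"
proof -
  have *: "\<forall>n. h n \<in> hom SMGp (PLev X n) (PLev Y n)"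
    "\<forall>n i. 1 \<le> n \<and> i \<le> n \<longrightarrow> Comp SMGp (h (n - 1)) (PD X n i) = Comp SMGp (PD Y n i) (h n)"
    "\<forall>n i. i \<le> n \<longrightarrow> Comp SMGp (h (n + 1)) (PS X n i) = Comp SMGp (PS Y n i) (h n)"
    "\<forall>r. \<forall>x \<in> PObj X (r + 2). fa (mor (h r)) (PB X r x) = PB Y r (fo (mor (h (r + 2))) x)"
    using assms unfolding topps_map_def by - (elim conjE, assumption)+
  show "h n \<in> hom SMGp (PLev X n) (PLev Y n)" using *(1) by blast
  show "1 \<le> n \<Longrightarrow> i \<le> n \<Longrightarrow> Comp SMGp (h (n - 1)) (PD X n i) = Comp SMGp (PD Y n i) (h n)" using *(2) by blast
  show "i \<le> n \<Longrightarrow> Comp SMGp (h (n + 1)) (PS X n i) = Comp SMGp (PS Y n i) (h n)" using *(3) by blast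
  show "x \<in> PObj X (r + 2) \<Longrightarrow> fa (mor (h r)) (PB X r x) = PB Y r (fo (mor (h (r + 2))) x)" using *(4) by blast
qed

lemma SMGp_mor:
  assumes "f \<in> hom SMGp M N" "g \<in> hom SMGp N E"
  shows "x \<in> Obj (Gpd M) \<Longrightarrow> fo (mor (Comp SMGp g f)) x = fo (mor g) (fo (mor f) x)"
    "a \<in> Arr (Gpd M) \<Longrightarrow> fa (mor (Comp SMGp g f)) a = fa (mor g) (fa (mor f) a)"
    "x \<in> Obj (Gpd M) \<Longrightarrow> fo (mor f) x \<in> Obj (Gpd N)"
proof -
  obtain F G where *: "f = (M, F, N)" "g = (N, G, E)" "mon_fctr M N F" using assms by (auto simp: SMGp_hom)
  then show "x \<in> Obj (Gpd M) \<Longrightarrow> fo (mor (Comp SMGp g f)) x = fo (mor g) (fo (mor f) x)"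
    "a \<in> Arr (Gpd M) \<Longrightarrow> fa (mor (Comp SMGp g f)) a = fa (mor g) (fa (mor f) a)"
    "x \<in> Obj (Gpd M) \<Longrightarrow> fo (mor f) x \<in> Obj (Gpd N)"
    using assms is_fctr_ops(1)[OF mon_fctr_ops(1)[OF *(3)]] by simp_all
qed

lemma category_TopPs: "category TopPs"
  unfolding TopPs_def
proof (rule category_mk_cat)
  note S = category_SMGp
  fix X :: "('x, 'y) topps" assume "X \<in> {X. is_topps X}"
  then have X: "is_topps X" by simp
  have "topps_map X X (\<lambda>n. Ident SMGp (PLev X n))"
    unfolding topps_map_def
  proof (intro conjI allI impI ballI)
    show "Ident SMGp (PLev X n) \<in> hom SMGp (PLev X n) (PLev X n)" for n
      by (rule hom_ident[OF S topps_ops(1)[OF X]])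
    show "Comp SMGp (Ident SMGp (PLev X (n - 1))) (PD X n i) = Comp SMGp (PD X n i) (Ident SMGp (PLev X n))"
      if "1 \<le> n \<and> i \<le> n" for n i
      using topps_ops(2)[OF X, of n i] that by (simp add: hom_def category_ops(9,10)[OF S])
    show "Comp SMGp (Ident SMGp (PLev X (n + 1))) (PS X n i) = Comp SMGp (PS X n i) (Ident SMGp (PLev X n))"
      if "i \<le> n" for n i
      using topps_ops(3)[OF X, of i n] that by (simp add: hom_def category_ops(9,10)[OF S])
    show "fa (mor (Ident SMGp (PLev X r))) (PB X r x) = PB X r (fo (mor (Ident SMGp (PLev X (r + 2)))) x)"
      if "x \<in> PObj X (r + 2)" for r x
      using topps_ops(1)[OF X] topps_ops(5)[OF X that] that by simp
  qed
  then show "(\<lambda>n. Ident SMGp (PLev X n)) \<in> {h. topps_map X X h}" by simp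
next
  note S = category_SMGp
  fix X Y Z :: "('x, 'y) topps" and f g
  assume "X \<in> {X. is_topps X}" "Y \<in> {X. is_topps X}" "Z \<in> {X. is_topps X}"
    "f \<in> {h. topps_map X Y h}" "g \<in> {h. topps_map Y Z h}"
  then have X: "is_topps X" and Y: "is_topps Y" and Z: "is_topps Z" and f: "topps_map X Y f" and g: "topps_map Y Z g"
    by auto
  note F = topps_map_ops[OF f] and G = topps_map_ops[OF g]
  have "topps_map X Z (\<lambda>n. Comp SMGp (g n) (f n))"
    unfolding topps_map_def
  proof (intro conjI allI impI ballI)
    show "Comp SMGp (g n) (f n) \<in> hom SMGp (PLev X n) (PLev Z n)" for n
      by (rule hom_comp[OF S F(1) G(1)])
    show "Comp SMGp (Comp SMGp (g (n - 1)) (f (n - 1))) (PD X n i) = Comp SMGp (PD Z n i) (Comp SMGp (g n) (f n))"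
      if "1 \<le> n \<and> i \<le> n" for n i
    proof -
      have *: "1 \<le> n" "i \<le> n" using that by auto
      show ?thesis
        by (rule square_comp[OF S F(1) F(1) G(1) G(1) topps_ops(2)[OF X *] topps_ops(2)[OF Y *] topps_ops(2)[OF Z *] F(2)[OF *] G(2)[OF *]])
    qed
    show "Comp SMGp (Comp SMGp (g (n + 1)) (f (n + 1))) (PS X n i) = Comp SMGp (PS Z n i) (Comp SMGp (g n) (f n))"
      if *: "i \<le> n" for n i
      by (rule square_comp[OF S F(1) F(1) G(1) G(1) topps_ops(3)[OF X *] topps_ops(3)[OF Y *] topps_ops(3)[OF Z *] F(3)[OF *] G(3)[OF *]])
    show "fa (mor (Comp SMGp (g r) (f r))) (PB X r x) = PB Z r (fo (mor (Comp SMGp (g (r + 2)) (f (r + 2)))) x)"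
      if x: "x \<in> PObj X (r + 2)" for r x
      using SMGp_mor(2)[OF F(1) G(1) topps_ops(5)[OF X x]] SMGp_mor(1,3)[OF F(1) G(1) x] F(4)[OF x]
        G(4)[of "fo (mor (f (r + 2))) x" r] by simp
  qed
  then show "(\<lambda>n. Comp SMGp (g n) (f n)) \<in> {h. topps_map X Z h}" by simp
next
  fix X Y :: "('x, 'y) topps" and f
  assume "f \<in> {h. topps_map X Y h}"
  then have "f n \<in> hom SMGp (PLev X n) (PLev Y n)" for n by (simp add: topps_map_ops)
  then show "(\<lambda>n. Comp SMGp (f n) (Ident SMGp (PLev X n))) = f \<and> (\<lambda>n. Comp SMGp (Ident SMGp (PLev Y n)) (f n)) = f"
    by (auto simp: hom_def category_ops(9,10)[OF category_SMGp])
next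
  fix X Y Z W :: "('x, 'y) topps" and f g h
  assume "f \<in> {h. topps_map X Y h}" "g \<in> {h. topps_map Y Z h}" "h \<in> {h. topps_map Z W h}"
  then show "(\<lambda>n. Comp SMGp (h n) (Comp SMGp (g n) (f n))) = (\<lambda>n. Comp SMGp (Comp SMGp (h n) (g n)) (f n))"
    using hom_assoc[OF category_SMGp] topps_map_ops(1) by (intro ext) blast
qed

lemma TopPs_Obj [simp]: "Obj TopPs = {X. is_topps X}"
  by (simp add: TopPs_def)

lemma TopPs_Arr: "(X, h, Y) \<in> Arr TopPs \<longleftrightarrow> is_topps X \<and> is_topps Y \<and> topps_map X Y h"
  by (simp add: TopPs_def)

lemma TopPs_ops [simp]:
  "(X, h, Y) \<in> Arr TopPs \<Longrightarrow> Dom TopPs (X, h, Y) = X"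
  "(X, h, Y) \<in> Arr TopPs \<Longrightarrow> Cod TopPs (X, h, Y) = Y"
  "is_topps X \<Longrightarrow> Ident TopPs X = (X, \<lambda>n. Ident SMGp (PLev X n), X)"
  "(X, h, Y) \<in> Arr TopPs \<Longrightarrow> (Y, k, Z) \<in> Arr TopPs \<Longrightarrow>
     Comp TopPs (Y, k, Z) (X, h, Y) = (X, \<lambda>n. Comp SMGp (k n) (h n), Z)"
  unfolding TopPs_def by (simp_all only: mk_cat_ops mem_Collect_eq)

lemma TopPs_ArrE:
  assumes "u \<in> Arr TopPs"
  obtains X h Y where "u = (X, h, Y)" "is_topps X" "is_topps Y" "topps_map X Y h"
  using assms unfolding TopPs_def by (auto elim: mk_cat_ArrE)

text \<open>Level \<open>n\<close> is degree \<open>n\<close> in \<open>PLev\<close> but degree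
  \<open>n - 1\<close> in \<open>TLev\<close>, so the faces with \<open>i < n\<close> are just those
  below the top one. The only simplicial identity that is weakened involves top faces, and these are
  gone.\<close>

lemma is_tsplit_u_star:
  assumes X: "is_topps X"
  shows "is_tsplit SMGp (u_star X)"
  unfolding u_star_def
proof (rule is_tsplitI, goal_cases)
  case (1 n) show ?case using topps_ops(1)[OF X, of n] by simp
next
  case (2 n i) then show ?case using topps_ops(2)[OF X, of n i] by simp
next
  case (4 n i) then show ?case using topps_ops(3)[OF X, of i n] by simp
next
  case (5 n i) then show ?case using topps_ops(4)[OF X, of i n] by simp
next
  case (6 n i j)
  then obtain r where r: "n = r + 2" by (intro that[of "n - 2"]) simp
  show ?case using topps_ops(6)[OF X, of i j r] 6 by (auto simp: r)
next
  case (7 n i j) then show ?case using topps_ops(7)[OF X, of i j n] by simp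
next
  case (8 n i j) then show ?case using topps_ops(8)[OF X, of i j n] by simp
next
  case (9 n i j) then show ?case using topps_ops(9)[OF X, of i j n] by auto
next
  case (10 n i j) then show ?case using topps_ops(10)[OF X, of j i n] by auto
qed simp_all

lemma tsplit_map_u_star:
  assumes "topps_map X Y h"
  shows "tsplit_map SMGp (u_star X) (u_star Y) h"
  using topps_map_ops[OF assms] by (simp add: tsplit_map_def u_star_def)

lemma is_fctr_UStar: "is_fctr TopPs (TSplit SMGp) UStar"
  unfolding UStar_def
proof (rule is_fctrI[OF _ _ _ _ category_TopPs])
  show "u_star X \<in> Obj (TSplit SMGp)" if "X \<in> Obj TopPs" for X :: "('x, 'y) topps"
    using that by (simp add: is_tsplit_u_star)
  show "(case Ident TopPs X of (X, h, Y) \<Rightarrow> (u_star X, h, u_star Y)) = Ident (TSplit SMGp) (u_star X)"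
    if "X \<in> Obj TopPs" for X :: "('x, 'y) topps"
    using that by (simp add: is_tsplit_u_star del: SMGp_ops) (simp add: u_star_def)
  fix u :: "('x, 'y) topps_arr" assume "u \<in> Arr TopPs"
  then obtain X h Y where u: "u = (X, h, Y)" and *: "is_topps X" "is_topps Y" "topps_map X Y h" by (rule TopPs_ArrE)
  have a: "(u_star X, h, u_star Y) \<in> Arr (TSplit SMGp)"
    using * by (simp add: TSplit_Arr is_tsplit_u_star tsplit_map_u_star)
  show "(case u of (X, h, Y) \<Rightarrow> (u_star X, h, u_star Y)) \<in> Arr (TSplit SMGp) \<and>
      Dom (TSplit SMGp) (case u of (X, h, Y) \<Rightarrow> (u_star X, h, u_star Y)) = u_star (Dom TopPs u) \<and>
      Cod (TSplit SMGp) (case u of (X, h, Y) \<Rightarrow> (u_star X, h, u_star Y)) = u_star (Cod TopPs u)"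
    using a * by (simp add: u TopPs_Arr)
  fix v :: "('x, 'y) topps_arr" assume v': "v \<in> Arr TopPs" and d: "Dom TopPs v = Cod TopPs u"
  from v' obtain Y' k Z where "v = (Y', k, Z)" and **: "is_topps Y'" "is_topps Z" "topps_map Y' Z k" by (rule TopPs_ArrE)
  then have v: "v = (Y, k, Z)" and **: "is_topps Z" "topps_map Y Z k" using d v' * by (simp_all add: u TopPs_Arr)
  have b: "(u_star Y, k, u_star Z) \<in> Arr (TSplit SMGp)"
    using * ** by (simp add: TSplit_Arr is_tsplit_u_star tsplit_map_u_star)
  show "(case Comp TopPs v u of (X, h, Y) \<Rightarrow> (u_star X, h, u_star Y))
      = Comp (TSplit SMGp) (case v of (X, h, Y) \<Rightarrow> (u_star X, h, u_star Y)) (case u of (X, h, Y) \<Rightarrow> (u_star X, h, u_star Y))"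
    using a b * ** by (simp add: u v TopPs_Arr)
qed

section \<open>The nerve and forgetful functors\<close>

lemma nopd_map_eq:
  "nopd_map P Q F = (\<lambda>n. ext_arr (cells (OBase P) n) (\<lambda>\<sigma>. [cell_map (OBase Q) F \<sigma>]) (cells (OBase Q) n))"
  by (simp add: nopd_map_def nopd_lev_def ext_arr_def SS_map_ext fun_eq_iff)

lemma nopd_arr:
  assumes "is_opcat P" "is_opcat Q" "op_fctr P Q F"
  shows "(nopd_obj P, nopd_map P Q F, nopd_obj Q) \<in> Arr TopPs"
  using assms topps_map_opcat_iff[OF assms(1,2) op_fctr_ops(1)[OF assms(3)]]
  by (simp add: TopPs_Arr nopd_map_eq nopd_obj_eq is_topps_opcat)

lemma nopd_FrSh:
  assumes P: "is_opcat P"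
  shows "levelwise_free (nopd_obj P)" "shuffle (nopd_obj P)"
  using shuffle_opcat[OF P] by (auto simp: nopd_obj_eq[OF P] levelwise_free_def top_ps_def)

lemma is_fctr_Nopd: "is_fctr OpCat TopPs Nopd"
  unfolding Nopd_def
proof (rule is_fctrI[OF _ _ _ _ category_OpCat])
  show "nopd_obj P \<in> Obj TopPs" if "P \<in> Obj OpCat" for P :: "('o, 'm) opcat"
    using that is_topps_opcat[of P] by (simp add: nopd_obj_eq)
  show "(case Ident OpCat P of (P, F, Q) \<Rightarrow> (nopd_obj P, nopd_map P Q F, nopd_obj Q)) = Ident TopPs (nopd_obj P)"
    if "P \<in> Obj OpCat" for P :: "('o, 'm) opcat"
  proof -
    have P: "is_opcat P" using that by simp
    have "nopd_map P P (fid (OBase P)) n = Ident SMGp (PLev (nopd_obj P) n)" for n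
      using cell_map_fid[OF opcat_category[OF P], of _ n]
      by (auto simp: nopd_map_eq nopd_obj_eq[OF P] top_ps_def ext_arr_ident simp del: SMGp_ops intro: ext_arr_cong)
    then show ?thesis using is_topps_opcat[OF P] P by (simp add: nopd_obj_eq[OF P] fun_eq_iff del: SMGp_ops)
  qed
  fix u :: "('o, 'm) opcat \<times> ('o, 'm, 'o, 'm) fctr \<times> ('o, 'm) opcat"
  assume "u \<in> Arr OpCat"
  then obtain P F Q where u: "u = (P, F, Q)" and *: "is_opcat P" "is_opcat Q" "op_fctr P Q F" by (rule OpCat_ArrE)
  show "(case u of (P, F, Q) \<Rightarrow> (nopd_obj P, nopd_map P Q F, nopd_obj Q)) \<in> Arr TopPs \<and>
      Dom TopPs (case u of (P, F, Q) \<Rightarrow> (nopd_obj P, nopd_map P Q F, nopd_obj Q)) = nopd_obj (Dom OpCat u) \<and>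
      Cod TopPs (case u of (P, F, Q) \<Rightarrow> (nopd_obj P, nopd_map P Q F, nopd_obj Q)) = nopd_obj (Cod OpCat u)"
    using nopd_arr[OF *] * by (simp add: u OpCat_Arr)
  fix v :: "('o, 'm) opcat \<times> ('o, 'm, 'o, 'm) fctr \<times> ('o, 'm) opcat"
  assume v': "v \<in> Arr OpCat" and d: "Dom OpCat v = Cod OpCat u"
  from v' obtain Q' G R where "v = (Q', G, R)" "is_opcat Q'" "is_opcat R" "op_fctr Q' R G" by (rule OpCat_ArrE)
  then have v: "v = (Q, G, R)" and **: "is_opcat R" "op_fctr Q R G" using d v' * by (simp_all add: u OpCat_Arr)
  note f = op_fctr_ops(1)[OF *(3)] and g = op_fctr_ops(1)[OF **(2)]
  note lP = opcat_ltcat[OF *(1)] and lQ = opcat_ltcat[OF *(2)] and lR = opcat_ltcat[OF **(1)]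
  have "nopd_map P R (fcomp (OBase P) G F) n = Comp SMGp (nopd_map Q R G n) (nopd_map P Q F n)" for n
  proof -
    have m: "(\<lambda>\<sigma>. [cell_map (OBase Q) F \<sigma>]) \<in> cells (OBase P) n \<rightarrow> lists (cells (OBase Q) n)"
      "(\<lambda>\<sigma>. [cell_map (OBase R) G \<sigma>]) \<in> cells (OBase Q) n \<rightarrow> lists (cells (OBase R) n)"
      using cell_map_cells[OF lP lQ f] cell_map_cells[OF lQ lR g] by auto
    show ?thesis
      using cell_map_fcomp[OF is_ltcat_category[OF lP] is_ltcat_category[OF lQ] is_ltcat_category[OF lR]
          ltF[OF lP lQ f] ltF[OF lQ lR g], of _ n]
      by (auto simp: nopd_map_eq ext_arr_comp[OF m] intro: ext_arr_cong)
  qed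
  then show "(case Comp OpCat v u of (P, F, Q) \<Rightarrow> (nopd_obj P, nopd_map P Q F, nopd_obj Q))
      = Comp TopPs (case v of (P, F, Q) \<Rightarrow> (nopd_obj P, nopd_map P Q F, nopd_obj Q))
          (case u of (P, F, Q) \<Rightarrow> (nopd_obj P, nopd_map P Q F, nopd_obj Q))"
    using nopd_arr[OF *] nopd_arr[OF *(2) **] * ** by (simp add: u v OpCat_Arr fun_eq_iff)
qed

lemma is_fctr_Forget: "is_fctr OpCat CatLt Forget"
  unfolding Forget_def
proof (rule is_fctrI[OF _ _ _ _ category_OpCat])
  show "Und P \<in> Obj CatLt" if "P \<in> Obj OpCat" for P :: "('o, 'm) opcat"
    using that by (simp add: opcat_ltcat)
  show "(case Ident OpCat P of (P, F, Q) \<Rightarrow> (Und P, F, Und Q)) = Ident CatLt (Und P)"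
    if "P \<in> Obj OpCat" for P :: "('o, 'm) opcat"
    using that by (simp add: opcat_ltcat)
  fix u :: "('o, 'm) opcat \<times> ('o, 'm, 'o, 'm) fctr \<times> ('o, 'm) opcat"
  assume "u \<in> Arr OpCat"
  then obtain P F Q where u: "u = (P, F, Q)" and *: "is_opcat P" "is_opcat Q" "op_fctr P Q F" by (rule OpCat_ArrE)
  have a: "(Und P, F, Und Q) \<in> Arr CatLt" using * op_fctr_ops(1)[OF *(3)] by (simp add: CatLt_Arr opcat_ltcat)
  then show "(case u of (P, F, Q) \<Rightarrow> (Und P, F, Und Q)) \<in> Arr CatLt \<and>
      Dom CatLt (case u of (P, F, Q) \<Rightarrow> (Und P, F, Und Q)) = Und (Dom OpCat u) \<and>
      Cod CatLt (case u of (P, F, Q) \<Rightarrow> (Und P, F, Und Q)) = Und (Cod OpCat u)"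
    using * by (simp add: u OpCat_Arr)
  fix v :: "('o, 'm) opcat \<times> ('o, 'm, 'o, 'm) fctr \<times> ('o, 'm) opcat"
  assume v': "v \<in> Arr OpCat" and d: "Dom OpCat v = Cod OpCat u"
  from v' obtain Q' G R where "v = (Q', G, R)" "is_opcat Q'" "is_opcat R" "op_fctr Q' R G" by (rule OpCat_ArrE)
  then have v: "v = (Q, G, R)" and **: "is_opcat R" "op_fctr Q R G" using d v' * by (simp_all add: u OpCat_Arr)
  have b: "(Und Q, G, Und R) \<in> Arr CatLt" using * ** op_fctr_ops(1)[OF **(2)] by (simp add: CatLt_Arr opcat_ltcat)
  show "(case Comp OpCat v u of (P, F, Q) \<Rightarrow> (Und P, F, Und Q))
      = Comp CatLt (case v of (P, F, Q) \<Rightarrow> (Und P, F, Und Q)) (case u of (P, F, Q) \<Rightarrow> (Und P, F, Und Q))"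
    using a b * ** by (simp add: u v OpCat_Arr)
qed

text \<open>Joint surjectivity on objects. The shuffle condition enters here, as it allows the
  cardinality of an arrow to be recovered from its permutation.\<close>

lemma opcat_over_ltcat:
  assumes C: "is_ltcat C" and X: "is_topps X" "shuffle X" and u: "u_star X = fo SNlt C"
  obtains P where "is_opcat P" "nopd_obj P = X" "Und P = C"
proof -
  obtain t \<beta> where t: "X = top_ps C t \<beta>" "top_typed C t \<beta>" by (rule topps_over_SNlt[OF C X(1) u])
  then have s: "top_simplicial C t" "top_coherent C t \<beta>" using X(1) is_topps_top_ps[OF C t(2)] by auto
  have sh: "mono_on {pos (lens t (t \<sigma>)) i 0 ..< pos (lens t (t \<sigma>)) (Suc i) 0} (inv (\<beta> r \<sigma>))"
    if "\<sigma> \<in> cells (Base C) (r + 2)" "i < length (t \<sigma>)" for r \<sigma> i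
    using X(2) that unfolding t(1) shuffle_top_ps[OF C t(2)] by blast
  show ?thesis
    using is_opcat_of[OF C t(2) s sh] nopd_obj_opcat_of[OF C t(2) s sh] opcat_of_simps(1)[OF C t(2) s sh]
    by (intro that[of "opcat_of C t \<beta>"]) (simp_all add: t(1))
qed

lemma full_subcat_simps [simp]:
  "x \<in> Obj (full_subcat A S) \<longleftrightarrow> x \<in> Obj A \<and> x \<in> S"
  "f \<in> Arr (full_subcat A S) \<longleftrightarrow> f \<in> Arr A \<and> Dom A f \<in> S \<and> Cod A f \<in> S"
  by (simp_all add: full_subcat_def)

lemma restr_fctr_simps:
  "x \<in> Obj C \<Longrightarrow> fo (restr_fctr C F) x = fo F x" "f \<in> Arr C \<Longrightarrow> fa (restr_fctr C F) f = fa F f"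
  by (simp_all add: restr_fctr_def)

theorem theorem6p11:
  shows "strict_pullback
           (OpCat :: (('o, 'm) opcat, ('o, 'm) opcat \<times> ('o, 'm, 'o, 'm) fctr \<times> ('o, 'm) opcat) cat)
           TopPsFrSh CatLt (TSplit SMGp)
           Nopd Forget (restr_fctr TopPsFrSh UStar) SNlt"
proof -
  have N: "is_fctr (OpCat :: (('o, 'm) opcat, ('o, 'm) opcat \<times> ('o, 'm, 'o, 'm) fctr \<times> ('o, 'm) opcat) cat) TopPsFrSh Nopd"
    unfolding TopPsFrSh_def
    by (rule is_fctr_into_full_subcat[OF is_fctr_Nopd _ category_OpCat]) (auto simp: Nopd_def nopd_FrSh)
  have U: "is_fctr TopPsFrSh (TSplit SMGp) (restr_fctr TopPsFrSh UStar)"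
    unfolding TopPsFrSh_def by (rule is_fctr_full_subcat[OF category_TopPs is_fctr_UStar])
  have T: "category TopPsFrSh" unfolding TopPsFrSh_def by (rule category_full_subcat[OF category_TopPs])
  have uo: "u_star (nopd_obj P) = fo SNlt (Und P)" if "is_opcat P" for P :: "('o, 'm) opcat"
    using that by (simp add: nopd_obj_eq u_star_top_ps opcat_ltcat)
  have Ux: "fo (restr_fctr TopPsFrSh UStar) X = u_star X" if "X \<in> Obj TopPsFrSh"
    for X :: "(('o, 'm) cell list, ('o, 'm) cell sarr) topps"
    using that by (simp add: restr_fctr_simps UStar_def) (simp add: TopPsFrSh_def)
  have Ua: "fa (restr_fctr TopPsFrSh UStar) (X, h, Y) = (u_star X, h, u_star Y)" if "(X, h, Y) \<in> Arr TopPsFrSh"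
    for X Y :: "(('o, 'm) cell list, ('o, 'm) cell sarr) topps" and h
    using that by (simp add: restr_fctr_simps UStar_def) (simp add: TopPsFrSh_def)
  have No: "fo Nopd P = nopd_obj P" "fo Forget P = Und P" if "is_opcat P" for P :: "('o, 'm) opcat"
    using that by (simp_all add: Nopd_def Forget_def)
  have Na: "fa Nopd (P, F, Q) = (nopd_obj P, nopd_map P Q F, nopd_obj Q)" "fa Forget (P, F, Q) = (Und P, F, Und Q)"
    if "is_opcat P" "is_opcat Q" "op_fctr P Q F" for P Q :: "('o, 'm) opcat" and F
    using that by (simp_all add: Nopd_def Forget_def OpCat_Arr)
  have comm: "fcomp OpCat (restr_fctr TopPsFrSh UStar) Nopd
      = fcomp (OpCat :: (('o, 'm) opcat, ('o, 'm) opcat \<times> ('o, 'm, 'o, 'm) fctr \<times> ('o, 'm) opcat) cat) SNlt Forget"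
  proof (rule fctr_eqI[OF is_fctr_fcomp[OF category_OpCat N U] is_fctr_fcomp[OF category_OpCat is_fctr_Forget is_fctr_SNlt]])
    fix P :: "('o, 'm) opcat" assume P: "P \<in> Obj OpCat"
    then show "fo (fcomp OpCat (restr_fctr TopPsFrSh UStar) Nopd) P = fo (fcomp OpCat SNlt Forget) P"
      using is_fctr_ops(1)[OF N P] by (simp add: No Ux uo)
  next
    fix u :: "('o, 'm) opcat \<times> ('o, 'm, 'o, 'm) fctr \<times> ('o, 'm) opcat" assume u': "u \<in> Arr OpCat"
    then obtain P F Q where u: "u = (P, F, Q)" and *: "is_opcat P" "is_opcat Q" "op_fctr P Q F" by (rule OpCat_ArrE)
    show "fa (fcomp OpCat (restr_fctr TopPsFrSh UStar) Nopd) u = fa (fcomp OpCat SNlt Forget) u"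
      using is_fctr_ops(2)[OF N u'] u' SNlt_map[OF opcat_ltcat[OF *(1)] opcat_ltcat[OF *(2)] op_fctr_ops(1)[OF *(3)]]
      by (simp add: u Na[OF *] Ua uo[OF *(1)] uo[OF *(2)] nopd_map_eq)
  qed
  show ?thesis
  proof (rule strict_pullbackI[OF category_OpCat T category_CatLt category_TSplit[OF category_SMGp] N is_fctr_Forget U is_fctr_SNlt comm])
    fix P Q :: "('o, 'm) opcat"
    assume "P \<in> Obj OpCat" "Q \<in> Obj OpCat" "fo Nopd P = fo Nopd Q" "fo Forget P = fo Forget Q"
    then show "P = Q" by (auto simp: No intro: opcat_eqI)
  next
    fix u v :: "('o, 'm) opcat \<times> ('o, 'm, 'o, 'm) fctr \<times> ('o, 'm) opcat"
    assume "u \<in> Arr OpCat" "v \<in> Arr OpCat" and eq: "fa Nopd u = fa Nopd v" "fa Forget u = fa Forget v"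
    then obtain P F Q P' F' Q' where u: "u = (P, F, Q)" and *: "is_opcat P" "is_opcat Q" "op_fctr P Q F"
      and v: "v = (P', F', Q')" and **: "is_opcat P'" "is_opcat Q'" "op_fctr P' Q' F'"
      by (elim OpCat_ArrE)
    show "u = v"
      using eq opcat_eqI[OF *(1) **(1)] opcat_eqI[OF *(2) **(2)] by (simp add: u v Na[OF *] Na[OF **])
  next
    fix X :: "(('o, 'm) cell list, ('o, 'm) cell sarr) topps" and C :: "('o, 'm) ltcat"
    assume X: "X \<in> Obj TopPsFrSh" and C: "C \<in> Obj CatLt" and "fo (restr_fctr TopPsFrSh UStar) X = fo SNlt C"
    then have "is_ltcat C" "is_topps X" "shuffle X" "u_star X = fo SNlt C" by (simp_all add: Ux) (simp_all add: TopPsFrSh_def)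
    then obtain P where "is_opcat P" "nopd_obj P = X" "Und P = C" by (rule opcat_over_ltcat)
    then show "\<exists>P\<in>Obj OpCat. fo Nopd P = X \<and> fo Forget P = C" by (auto simp: No)
  next
    fix a :: "(('o, 'm) cell list, ('o, 'm) cell sarr) topps_arr" and b :: "('o, 'm) ltcat \<times> ('o, 'm, 'o, 'm) fctr \<times> ('o, 'm) ltcat"
    assume a': "a \<in> Arr TopPsFrSh" and b': "b \<in> Arr CatLt" and eq: "fa (restr_fctr TopPsFrSh UStar) a = fa SNlt b"
    obtain C F D where b: "b = (C, F, D)" and CD: "is_ltcat C" "is_ltcat D" "lt_fctr C D F"
      using b' by (rule CatLt_ArrE)
    have "a \<in> Arr TopPs" using a' by (simp add: TopPsFrSh_def)
    then obtain X h Y where a: "a = (X, h, Y)" and XY: "is_topps X" "is_topps Y" "topps_map X Y h" by (rule TopPs_ArrE)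
    have sh: "shuffle X" "shuffle Y" using a' XY by (simp_all add: a TopPsFrSh_def TopPs_Arr)
    \<comment> \<open>Equality of the two images fixes the end points and shows that
      \<open>h\<close> is the family induced by \<open>F\<close>, so only its compatibility with the
      top structure carries new information.\<close>
    have e: "u_star X = fo SNlt C" "u_star Y = fo SNlt D"
      "h = (\<lambda>n. ext_arr (cells (Base C) n) (\<lambda>\<sigma>. [cell_map (Base D) F \<sigma>]) (cells (Base D) n))"
      using eq a' Ua[of X h Y] by (simp_all add: a b SNlt_map[OF CD])
    obtain P where P: "is_opcat P" "nopd_obj P = X" "Und P = C" by (rule opcat_over_ltcat[OF CD(1) XY(1) sh(1) e(1)])
    obtain Q where Q: "is_opcat Q" "nopd_obj Q = Y" "Und Q = D" by (rule opcat_over_ltcat[OF CD(2) XY(2) sh(2) e(2)])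
    have "op_fctr P Q F"
      using topps_map_opcat_iff[OF P(1) Q(1), of F] XY(3) CD(3) by (simp add: P Q e(3))
    then show "\<exists>z\<in>Arr OpCat. fa Nopd z = a \<and> fa Forget z = b"
      using P Q e(3) by (intro bexI[of _ "(P, F, Q)"]) (simp_all add: Na a b nopd_map_eq OpCat_Arr)
  qed
qed

end
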